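(* Let $(c_0,\rho_0,\theta_0,u_0)\in L^\infty(\mathbb T)^3\times H^1(\mathbb T)$ and suppose there exist positive constants $\underline{\rho_0},\overline{\rho_0},\underline{\theta_0},\overline{\theta_0}$ such that for a.e. $x\in\mathbb T$, $\underline{\rho_0}\le\rho_0(x)\le\overline{\rho_0}$, $\underline{\theta_0}\le\theta_0(x)\le\overline{\theta_0}$ and $0\le c_0(x)\le1$. Then for every $T>0$ there exists at most one solution à la Hoff on $[0,T]$ of (NS) with initial data $(c_0,\rho_0,\theta_0,u_0)$.
   Context: $\mathbb T=\mathbb R/\mathbb Z$ is identified with $[0,1)$. Fix constants $\mu_\pm>0$, $\gamma_\pm>1$, $c_{v,\pm}>0$, and for $c\in[0,1]$ set $\mu(c)=c\mu_++(1-c)\mu_-$, $\gamma(c)=c\gamma_++(1-c)\gamma_-$, $c_v(c)=c\,c_{v,+}+(1-c)c_{v,-}$. For unknowns $c,\rho,\theta,u$ on $[0,T]\times\mathbb T$, write $p=(\gamma(c)-1)\rho\theta$, $\sigma=\mu(c)\partial_xu-p$, $E=u^2/2+c_v(c)\theta$. The mesoscopic system (NS) is $\partial_t\rho+\partial_x(\rho u)=0$, $\partial_t(\rho c)+\partial_x(\rho c u)=0$, $\partial_t(\rho u)+\partial_x(\rho u^2)=\partial_x\sigma$, $\partial_t(\rho E)+\partial_x(\rho E u)=\partial_x(\sigma u)$, with initial data $\rho|_{t=0}=\rho_0$, $(\rho c)|_{t=0}=\rho_0c_0$, $(\rho u)|_{t=0}=\rho_0u_0$, $(\rho E)|_{t=0}=\rho_0E_0$,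 $E_0=u_0^2/2+c_v(c_0)\theta_0$. A weak solution on $[0,T]$ is $(c,\rho,\theta,u)\in L^\infty(0,T;L^\infty(\mathbb T))\times L^\infty(0,T;L^1(\mathbb T))^2\times L^1(0,T;W^{1,1}(\mathbb T))$ satisfying these equations in distributions and the initial data weakly. Write $\dot f=\partial_tf+u\partial_xf$, $\kappa(t)=\min(1,t)$. A solution à la Hoff on $[0,T]$ is a weak solution for which there exist positive constants $\underline\rho,\overline\rho,\underline\theta,\overline\theta,C_5,C_6,C_8,C_9,C_{11}$ such that: $\underline\rho\le\rho\le\overline\rho$, $\underline\theta\le\theta\le\overline\theta$ a.e.; for a.e. $t$, $\int_0^1\sigma^2+\int_0^t\int_0^1(\partial_x\sigma)^2\le C_5$ and $\int_0^1(\partial_xu)^2\le C_8$; $\int_0^T\|\sigma\|_{L^\infty}^2\le C_6$, $\int_0^T\|\partial_xu\|_{L^\infty}^2\le C_9$; for a.e. $t$, $\kappa(t)\int_0^1(\partial_x\sigma)^2+\int_0^t\kappa(s)\int_0^1\dot\sigma^2\le C_{11}$. *)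

theory Defs
  imports "HOL-Analysis.Analysis" "HOL-Probability.Essential_Supremum"
begin

text \<open>The torus R/Z is identified with [0,1); functions on the torus are real functions
 whose values on [0,1) matter.  Space-time points are pairs z = (t,x).\<close>

definition torus :: "real set" where "torus = {0..<1}"

definition cyl :: "real \<Rightarrow> (real \<times> real) set" where
  "cyl T = {0<..<T} \<times> torus"

primrec Ck :: "nat \<Rightarrow> ('a::real_normed_vector \<Rightarrow> real) \<Rightarrow> bool" where
  "Ck 0 f = continuous_on UNIV f"
| "Ck (Suc k) f = ((\<forall>z. f differentiable (at z)) \<and>
                    (\<forall>v. Ck k (\<lambda>z. frechet_derivative f (at z) v)))"

definition smooth_fun :: "('a::real_normed_vector \<Rightarrow> real) \<Rightarrow> bool" where
  "smooth_fun f \<longleftrightarrow> (\<forall>k. Ck k f)"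

definition d1 :: "(real \<Rightarrow> real) \<Rightarrow> real \<Rightarrow> real" where
  "d1 f x = frechet_derivative f (at x) 1"

definition dt :: "(real \<times> real \<Rightarrow> real) \<Rightarrow> real \<times> real \<Rightarrow> real" where
  "dt f z = frechet_derivative f (at z) (1, 0)"

definition dx :: "(real \<times> real \<Rightarrow> real) \<Rightarrow> real \<times> real \<Rightarrow> real" where
  "dx f z = frechet_derivative f (at z) (0, 1)"

definition test_torus :: "(real \<Rightarrow> real) \<Rightarrow> bool" where
  "test_torus \<phi> \<longleftrightarrow> smooth_fun \<phi> \<and> (\<forall>x. \<phi> (x + 1) = \<phi> x)"

definition test_init :: "real \<Rightarrow> (real \<times> real \<Rightarrow> real) \<Rightarrow> bool" where
  "test_init T \<phi> \<longleftrightarrow> smooth_fun \<phi> \<and> (\<forall>t x. \<phi> (t, x + 1) = \<phi> (t, x)) \<and>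
     (\<exists>T'<T. \<forall>t x. T' \<le> t \<longrightarrow> \<phi> (t, x) = 0)"

definition test_int :: "real \<Rightarrow> (real \<times> real \<Rightarrow> real) \<Rightarrow> bool" where
  "test_int T \<phi> \<longleftrightarrow> smooth_fun \<phi> \<and> (\<forall>t x. \<phi> (t, x + 1) = \<phi> (t, x)) \<and>
     (\<exists>a b. 0 < a \<and> b < T \<and> (\<forall>t x. (t \<le> a \<or> b \<le> t) \<longrightarrow> \<phi> (t, x) = 0))"

definition H1_torus :: "(real \<Rightarrow> real) \<Rightarrow> bool" where
  "H1_torus f \<longleftrightarrow> f \<in> borel_measurable (lebesgue_on torus) \<and>
     set_integrable lebesgue torus (\<lambda>x. (f x)\<^sup>2) \<and>
     (\<exists>g. g \<in> borel_measurable (lebesgue_on torus) \<and>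
        set_integrable lebesgue torus (\<lambda>x. (g x)\<^sup>2) \<and>
        (\<forall>\<phi>. test_torus \<phi> \<longrightarrow>
           (LINT x:torus|lebesgue. f x * d1 \<phi> x) = - (LINT x:torus|lebesgue. g x * \<phi> x)))"

definition weak_dx :: "real \<Rightarrow> (real \<times> real \<Rightarrow> real) \<Rightarrow> (real \<times> real \<Rightarrow> real) \<Rightarrow> bool" where
  "weak_dx T f g \<longleftrightarrow> (\<forall>\<phi>. test_int T \<phi> \<longrightarrow>
      set_integrable lebesgue (cyl T) (\<lambda>z. f z * dx \<phi> z) \<and>
      set_integrable lebesgue (cyl T) (\<lambda>z. g z * \<phi> z) \<and>
      (LINT z:cyl T|lebesgue. f z * dx \<phi> z) = - (LINT z:cyl T|lebesgue. g z * \<phi> z))"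

definition weak_dt :: "real \<Rightarrow> (real \<times> real \<Rightarrow> real) \<Rightarrow> (real \<times> real \<Rightarrow> real) \<Rightarrow> bool" where
  "weak_dt T f g \<longleftrightarrow> (\<forall>\<phi>. test_int T \<phi> \<longrightarrow>
      set_integrable lebesgue (cyl T) (\<lambda>z. f z * dt \<phi> z) \<and>
      set_integrable lebesgue (cyl T) (\<lambda>z. g z * \<phi> z) \<and>
      (LINT z:cyl T|lebesgue. f z * dt \<phi> z) = - (LINT z:cyl T|lebesgue. g z * \<phi> z))"

text \<open>Weak form of  d_t q + d_x F = 0  on [0,T) x torus with  q|_{t=0} = q0 (weakly):
 for every test function phi,
 int int (q d_t phi + F d_x phi) + int q0 phi(0,.) = 0.\<close>
definition weak_cons :: "real \<Rightarrow> (real \<times> real \<Rightarrow> real) \<Rightarrow> (real \<times> real \<Rightarrow> real) \<Rightarrow> (real \<Rightarrow> real) \<Rightarrow> bool" where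
  "weak_cons T q F q0 \<longleftrightarrow> (\<forall>\<phi>. test_init T \<phi> \<longrightarrow>
      set_integrable lebesgue (cyl T) (\<lambda>z. q z * dt \<phi> z + F z * dx \<phi> z) \<and>
      set_integrable lebesgue torus (\<lambda>x. q0 x * \<phi> (0, x)) \<and>
      (LINT z:cyl T|lebesgue. q z * dt \<phi> z + F z * dx \<phi> z)
        + (LINT x:torus|lebesgue. q0 x * \<phi> (0, x)) = 0)"

definition Linf_Linf :: "real \<Rightarrow> (real \<times> real \<Rightarrow> real) \<Rightarrow> bool" where
  "Linf_Linf T f \<longleftrightarrow> set_borel_measurable lebesgue (cyl T) f \<and>
     (\<exists>M. AE z in lebesgue. z \<in> cyl T \<longrightarrow> \<bar>f z\<bar> \<le> M)"

definition Linf_L1 :: "real \<Rightarrow> (real \<times> real \<Rightarrow> real) \<Rightarrow> bool" where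
  "Linf_L1 T f \<longleftrightarrow> set_borel_measurable lebesgue (cyl T) f \<and>
     (\<exists>M. AE t in lebesgue. t \<in> {0<..<T} \<longrightarrow>
        (\<integral>\<^sup>+x \<in> torus. ennreal \<bar>f (t, x)\<bar> \<partial>lebesgue) \<le> ennreal M)"

definition L1_W11 :: "real \<Rightarrow> (real \<times> real \<Rightarrow> real) \<Rightarrow> (real \<times> real \<Rightarrow> real) \<Rightarrow> bool" where
  "L1_W11 T u ux \<longleftrightarrow> set_integrable lebesgue (cyl T) u \<and>
     set_integrable lebesgue (cyl T) ux \<and> weak_dx T u ux"

definition mix :: "real \<Rightarrow> real \<Rightarrow> real \<Rightarrow> real" where
  "mix ap am c = c * ap + (1 - c) * am"

definition Linf_norm_slice :: "(real \<times> real \<Rightarrow> real) \<Rightarrow> real \<Rightarrow> ennreal" where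
  "Linf_norm_slice f t = esssup (lebesgue_on torus) (\<lambda>x. ennreal \<bar>f (t, x)\<bar>)"

definition weak_solution_ux ::
  "real \<Rightarrow> real \<Rightarrow> real \<Rightarrow> real \<Rightarrow> real \<Rightarrow> real \<Rightarrow> real \<Rightarrow>
   (real \<Rightarrow> real) \<Rightarrow> (real \<Rightarrow> real) \<Rightarrow> (real \<Rightarrow> real) \<Rightarrow> (real \<Rightarrow> real) \<Rightarrow>
   (real \<times> real \<Rightarrow> real) \<Rightarrow> (real \<times> real \<Rightarrow> real) \<Rightarrow> (real \<times> real \<Rightarrow> real) \<Rightarrow>
   (real \<times> real \<Rightarrow> real) \<Rightarrow> (real \<times> real \<Rightarrow> real) \<Rightarrow> bool" where
  "weak_solution_ux mup mum gp gm cvp cvm T c0 rho0 theta0 u0 c rho theta u ux \<longleftrightarrow>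
     (let sigma = (\<lambda>z. mix mup mum (c z) * ux z - (mix gp gm (c z) - 1) * rho z * theta z);
          E = (\<lambda>z. (u z)\<^sup>2 / 2 + mix cvp cvm (c z) * theta z);
          E0 = (\<lambda>x. (u0 x)\<^sup>2 / 2 + mix cvp cvm (c0 x) * theta0 x)
      in Linf_Linf T c \<and> Linf_L1 T rho \<and> Linf_L1 T theta \<and> L1_W11 T u ux \<and>
         weak_cons T rho (\<lambda>z. rho z * u z) rho0 \<and>
         weak_cons T (\<lambda>z. rho z * c z) (\<lambda>z. rho z * c z * u z) (\<lambda>x. rho0 x * c0 x) \<and>
         weak_cons T (\<lambda>z. rho z * u z) (\<lambda>z. rho z * (u z)\<^sup>2 - sigma z) (\<lambda>x. rho0 x * u0 x) \<and>
         weak_cons T (\<lambda>z. rho z * E z) (\<lambda>z. rho z * E z * u z - sigma z * u z)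
                     (\<lambda>x. rho0 x * E0 x))"

definition weak_solution ::
  "real \<Rightarrow> real \<Rightarrow> real \<Rightarrow> real \<Rightarrow> real \<Rightarrow> real \<Rightarrow> real \<Rightarrow>
   (real \<Rightarrow> real) \<Rightarrow> (real \<Rightarrow> real) \<Rightarrow> (real \<Rightarrow> real) \<Rightarrow> (real \<Rightarrow> real) \<Rightarrow>
   (real \<times> real \<Rightarrow> real) \<Rightarrow> (real \<times> real \<Rightarrow> real) \<Rightarrow> (real \<times> real \<Rightarrow> real) \<Rightarrow>
   (real \<times> real \<Rightarrow> real) \<Rightarrow> bool" where
  "weak_solution mup mum gp gm cvp cvm T c0 rho0 theta0 u0 c rho theta u \<longleftrightarrow>
     (\<exists>ux. weak_solution_ux mup mum gp gm cvp cvm T c0 rho0 theta0 u0 c rho theta u ux)"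

text \<open>Solution a la Hoff on [0,T].  sx is d_x sigma and sd is the material derivative
 sigma-dot = d_t sigma + u d_x sigma (i.e. d_t sigma = sd - u sx in distributions).\<close>
definition hoff_solution ::
  "real \<Rightarrow> real \<Rightarrow> real \<Rightarrow> real \<Rightarrow> real \<Rightarrow> real \<Rightarrow> real \<Rightarrow>
   (real \<Rightarrow> real) \<Rightarrow> (real \<Rightarrow> real) \<Rightarrow> (real \<Rightarrow> real) \<Rightarrow> (real \<Rightarrow> real) \<Rightarrow>
   (real \<times> real \<Rightarrow> real) \<Rightarrow> (real \<times> real \<Rightarrow> real) \<Rightarrow> (real \<times> real \<Rightarrow> real) \<Rightarrow>
   (real \<times> real \<Rightarrow> real) \<Rightarrow> bool" where
  "hoff_solution mup mum gp gm cvp cvm T c0 rho0 theta0 u0 c rho theta u \<longleftrightarrow>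
     (\<exists>ux. weak_solution_ux mup mum gp gm cvp cvm T c0 rho0 theta0 u0 c rho theta u ux \<and>
       (let sigma = (\<lambda>z. mix mup mum (c z) * ux z - (mix gp gm (c z) - 1) * rho z * theta z)
        in \<exists>rl rh tl th C5 C6 C8 C9 C11 :: real. \<exists>sx sd.
          0 < rl \<and> 0 < rh \<and> 0 < tl \<and> 0 < th \<and> 0 < C5 \<and> 0 < C6 \<and> 0 < C8 \<and> 0 < C9 \<and> 0 < C11 \<and>
          (AE z in lebesgue. z \<in> cyl T \<longrightarrow> rl \<le> rho z \<and> rho z \<le> rh) \<and>
          (AE z in lebesgue. z \<in> cyl T \<longrightarrow> tl \<le> theta z \<and> theta z \<le> th) \<and>
          weak_dx T sigma sx \<and>
          weak_dt T sigma (\<lambda>z. sd z - u z * sx z) \<and>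
          (AE t in lebesgue. t \<in> {0<..<T} \<longrightarrow>
             (\<integral>\<^sup>+x \<in> torus. ennreal ((sigma (t, x))\<^sup>2) \<partial>lebesgue)
             + (\<integral>\<^sup>+z \<in> {0<..<t} \<times> torus. ennreal ((sx z)\<^sup>2) \<partial>lebesgue) \<le> ennreal C5) \<and>
          (AE t in lebesgue. t \<in> {0<..<T} \<longrightarrow>
             (\<integral>\<^sup>+x \<in> torus. ennreal ((ux (t, x))\<^sup>2) \<partial>lebesgue) \<le> ennreal C8) \<and>
          (\<integral>\<^sup>+t \<in> {0<..<T}. (Linf_norm_slice sigma t)\<^sup>2 \<partial>lebesgue) \<le> ennreal C6 \<and>
          (\<integral>\<^sup>+t \<in> {0<..<T}. (Linf_norm_slice ux t)\<^sup>2 \<partial>lebesgue) \<le> ennreal C9 \<and>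
          (AE t in lebesgue. t \<in> {0<..<T} \<longrightarrow>
             ennreal (min 1 t) * (\<integral>\<^sup>+x \<in> torus. ennreal ((sx (t, x))\<^sup>2) \<partial>lebesgue)
             + (\<integral>\<^sup>+z \<in> {0<..<t} \<times> torus. ennreal (min 1 (fst z) * (sd z)\<^sup>2) \<partial>lebesgue)
             \<le> ennreal C11)))"

end

theory Submission
  imports Defs
begin

text \<open>
  Two solutions are compared in Lagrangian coordinates. The velocity is Lipschitz in space with a
  constant that is square integrable in time, so it has a flow $X$, and testing the conservation
  laws with functions carried by the flow shows that along trajectories the concentration is
  constant and the specific volume, the velocity and the temperature are primitives in time of
  $\partial_a u/\rho_0$, $\partial_a \sigma/\rho_0$ and $\sigma\,\partial_a u/(\rho_0 c_v)$. In the mass variable the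
  momentum equation is linear in the pair $(u,\sigma)$; multiplying the equation for the difference of the
  velocities by that difference and integrating by parts, the viscous term controls the difference of
  the velocity gradients, and everything else is absorbed by Gronwall's lemma. Equal velocities along
  trajectories give equal flows, hence equality in the original variables.

  Every field is first replaced by a Borel measurable, periodic representative whose bounds hold at
  every point. The bound on the velocity comes from the conservation of the total momentum together
  with the bound on the spatial derivative of the velocity.
\<close>

section \<open>Lebesgue measure on bounded intervals\<close>

text \<open>Concentration, density and temperature are merely bounded, so comparing two solutions at
  the same point would require derivatives of discontinuous profiles. Following particles removes
  them: these unknowns solve ordinary differential equations in time with the label \<open>a\<close>
  as a parameter, and both solutions share the coefficients \<open>c0\<close> and
  \<open>rho0\<close>. The price is that fields are sampled along curves, which are null sets. Hence
  the sawtooth test functions attached to a trajectory: in the frame of the moving point the flux is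
  q (u - u(Z)) - s, and its first part vanishes at Z by continuity of u and boundedness of q,
  however rough q is. Times are delicate too, since every test function, label or translate brings
  its own null set of times; identities are therefore proved for countably many of them and extended
  by continuity. In the comparison, volume differences carry the coefficient \<open>L t\<close>,
  which Young's inequality squares; this is where the square integrability in time of the Lipschitz
  constant enters, as integrability of the Gronwall kernel.\<close>

definition lb :: "real \<Rightarrow> real \<Rightarrow> real measure" where
  "lb a b = density lborel (\<lambda>x. ennreal (indicator {a<..<b} x))"

text \<open>The measure is a density on the whole line, not a restricted space: the sigma-algebra is
  independent of the endpoints, so integrals whose endpoints vary with time or follow a trajectory
  share one notion of measurability.\<close>

lemma sets_lb [simp, measurable_cong]: "sets (lb a b) = sets borel"
  and space_lb [simp]: "space (lb a b) = UNIV"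
  by (simp_all add: lb_def)

lemma measurable_lb [simp]: "borel_measurable (lb a b) = borel_measurable borel"
  by (rule measurable_cong_sets) auto

lemma emeasure_lb: "A \<in> sets borel \<Longrightarrow> emeasure (lb a b) A = emeasure lborel ({a<..<b} \<inter> A)"
  proof -
  assume A: "A \<in> sets borel"
  have "emeasure (lb a b) A = (\<integral>\<^sup>+x. indicator ({a<..<b} \<inter> A) x \<partial>lborel)"
    unfolding lb_def
    by (subst emeasure_density) (use A in measurable, rule nn_integral_cong, auto split: split_indicator)
  also have "\<dots> = emeasure lborel ({a<..<b} \<inter> A)" using A by (intro nn_integral_indicator) auto
  finally show ?thesis .
qed

text \<open>\<open>ennreal\<close> truncates at 0, so reversed endpoints give the null measure:
  integrals are then 0, with no orientation sign. This default covers the boundary cases t = 0 and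
  \<open>frac x = 0\<close>.\<close>

lemma emeasure_lb_UNIV [simp]: "emeasure (lb a b) UNIV = ennreal (b - a)"
  by (cases "a \<le> b") (auto simp: emeasure_lb ennreal_neg)

interpretation lb: finite_measure "lb a b" for a b
  by (rule finite_measureI) (simp add: emeasure_lb_UNIV)

interpretation lb2: pair_sigma_finite "lb a b" "lb c d" for a b c d ..

lemma AE_lb: "(AE x in lb a b. P x) \<longleftrightarrow> (AE x in lborel. a < x \<and> x < b \<longrightarrow> P x)"
  unfolding lb_def by (subst AE_density) (auto simp: indicator_def)

lemma AE_lb_in: "AE x in lb a b. a < x \<and> x < b"
  by (simp add: AE_lb)

lemma AE_lbI: "(\<And>x. a < x \<Longrightarrow> x < b \<Longrightarrow> P x) \<Longrightarrow> AE x in lb a b. P x"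
  by (simp add: AE_lb)

lemma AE_lb_mono:
  assumes "AE x in lb a b. P x" "a \<le> a'" "b' \<le> b"
  shows "AE x in lb a' b'. P x"
  using assms unfolding AE_lb by auto

lemma integrable_lb_iff:
  fixes f :: "real \<Rightarrow> real"
  shows "f \<in> borel_measurable borel \<Longrightarrow> integrable (lb a b) f \<longleftrightarrow> set_integrable lborel {a<..<b} f"
  unfolding lb_def set_integrable_def
  by (subst integrable_density) auto

lemma integral_lb_eq:
  fixes f :: "real \<Rightarrow> real"
  shows "f \<in> borel_measurable borel \<Longrightarrow> integral\<^sup>L (lb a b) f = (LINT x:{a<..<b}|lborel. f x)"
  unfolding lb_def set_lebesgue_integral_def
  by (subst integral_density) auto

lemma integrable_lb_measurable: "integrable (lb a b) f \<Longrightarrow> (f::real\<Rightarrow>real) \<in> borel_measurable borel"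
  using borel_measurable_integrable by force

lemma integrable_lb_bounded:
  fixes f :: "real \<Rightarrow> real"
  assumes "f \<in> borel_measurable borel" "\<And>x. a < x \<Longrightarrow> x < b \<Longrightarrow> \<bar>f x\<bar> \<le> K"
  shows "integrable (lb a b) f"
  by (rule lb.integrable_const_bound[where B=K]) (use assms in \<open>auto simp: AE_lb\<close>)

lemma integrable_lb_subset:
  fixes f :: "real \<Rightarrow> real"
  assumes "integrable (lb a b) f" "a \<le> a'" "b' \<le> b"
  shows "integrable (lb a' b') f"
proof -
  have m: "f \<in> borel_measurable borel" by (rule integrable_lb_measurable[OF assms(1)])
  have "set_integrable lborel {a<..<b} f" using assms(1) m by (simp add: integrable_lb_iff)
  then have "set_integrable lborel {a'<..<b'} f"
    by (rule set_integrable_subset) (use assms in auto)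
  then show ?thesis using m by (simp add: integrable_lb_iff)
qed

lemma integral_lb_restrict:
  fixes f :: "real \<Rightarrow> real"
  assumes "f \<in> borel_measurable borel" "a \<le> a'" "b' \<le> b"
  shows "integral\<^sup>L (lb a' b') f = (\<integral>x. indicator {a'<..<b'} x * f x \<partial>lb a b)"
proof -
  have [measurable]: "f \<in> borel_measurable borel" by fact
  have "indicator {a'<..<b'} x * f x = indicator {a<..<b} x * (indicator {a'<..<b'} x * f x)" for x
    using assms by (auto simp: indicator_def)
  then have "(\<lambda>x. indicator {a'<..<b'} x *\<^sub>R f x) = (\<lambda>x. indicator {a<..<b} x *\<^sub>R (indicator {a'<..<b'} x * f x))"
    by (intro ext) (simp only: real_scaleR_def)
  then show ?thesis
    unfolding integral_lb_eq[OF assms(1)] by (subst integral_lb_eq) (simp_all only: set_lebesgue_integral_def, measurable)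
qed

lemma integral_lb_combine:
  fixes f :: "real \<Rightarrow> real"
  assumes "integrable (lb a c) f" "a \<le> b" "b \<le> c"
  shows "integral\<^sup>L (lb a c) f = integral\<^sup>L (lb a b) f + integral\<^sup>L (lb b c) f"
proof -
  have [measurable]: "f \<in> borel_measurable borel" by (rule integrable_lb_measurable[OF assms(1)])
  have 1: "integrable (lb a c) (\<lambda>x. indicator {a<..<b} x * f x)" "integrable (lb a c) (\<lambda>x. indicator {b<..<c} x * f x)"
    by (rule Bochner_Integration.integrable_bound[OF assms(1)]; auto simp: indicator_def)+
  have "integral\<^sup>L (lb a b) f + integral\<^sup>L (lb b c) f = 
     (\<integral>x. indicator {a<..<b} x * f x + indicator {b<..<c} x * f x \<partial>lb a c)"
    using assms unfolding Bochner_Integration.integral_add[OF 1]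
    by (subst (1 2) integral_lb_restrict[where a=a and b=c]) auto
  also have "\<dots> = integral\<^sup>L (lb a c) f"
  proof (rule integral_cong_AE)
    have "AE x in lborel. x \<noteq> b" by (rule AE_lborel_singleton)
    then show "AE x in lb a c. indicator {a<..<b} x * f x + indicator {b<..<c} x * f x = f x"
      unfolding AE_lb by eventually_elim (auto simp: indicator_def)
  qed auto
  finally show ?thesis by simp
qed

text \<open>Measurability is not assumed: a non-measurable integrand has Bochner integral 0 by
  convention, and \<open>K\<close> is nonnegative as soon as the interval contains a point.\<close>

lemma integral_lb_bound:
  fixes f :: "real \<Rightarrow> real"
  assumes "a \<le> b" "\<And>x. a < x \<Longrightarrow> x < b \<Longrightarrow> \<bar>f x\<bar> \<le> K"
  shows "\<bar>integral\<^sup>L (lb a b) f\<bar> \<le> K * (b - a)"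
proof (cases "f \<in> borel_measurable borel")
  case True
  have "\<bar>integral\<^sup>L (lb a b) f\<bar> \<le> (\<integral>x. \<bar>f x\<bar> \<partial>lb a b)" by (rule integral_abs_bound)
  also have "\<dots> \<le> (\<integral>x. K \<partial>lb a b)"
    by (rule integral_mono_AE) (use assms True in \<open>auto simp: AE_lb intro!: integrable_lb_bounded[where K=K]\<close>)
  also have "\<dots> = K * (b - a)" using assms by (simp add: measure_def)
  finally show ?thesis .
next
  case False
  then have "integral\<^sup>L (lb a b) f = 0"
    using integrable_lb_measurable not_integrable_integral_eq by blast
  moreover have "0 \<le> K * (b - a)"
  proof (cases "a < b")
    case True
    then obtain x where "a < x" "x < b" using dense by auto
    then have "0 \<le> K" using assms(2)[of x] by linarith
    then show ?thesis using assms(1) by simp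
  qed (use assms(1) in simp)
  ultimately show ?thesis by simp
qed

lemma integral_lb_const [simp]: "a \<le> b \<Longrightarrow> (\<integral>x. (c::real) \<partial>lb a b) = c * (b - a)"
  by (simp add: measure_def)

lemma integral_lb_empty [simp]: "b \<le> a \<Longrightarrow> integral\<^sup>L (lb a b) (f::real\<Rightarrow>real) = 0"
proof -
  assume "b \<le> a"
  then have "AE x in lb a b. f x = 0" by (simp add: AE_lb)
  then show ?thesis
    by (rule integral_eq_zero_AE)
qed

text \<open>The positive and negative parts of the integrand define finite measures with the same distribution function.\<close>
lemma AE_zero_if_primitive_zero:
  fixes f :: "real \<Rightarrow> real"
  assumes f: "integrable (lb a b) f" and z: "\<And>x. a \<le> x \<Longrightarrow> x \<le> b \<Longrightarrow> integral\<^sup>L (lb a x) f = 0"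
  shows "AE x in lb a b. f x = 0"
proof -
  have [measurable]: "f \<in> borel_measurable borel" by (rule integrable_lb_measurable[OF f])
  define P where "P = density (lb a b) (\<lambda>x. ennreal (max 0 (f x)))"
  define N where "N = density (lb a b) (\<lambda>x. ennreal (max 0 (- f x)))"
  have ip: "integrable (lb a b) (\<lambda>x. indicator S x * max 0 (f x))" "integrable (lb a b) (\<lambda>x. indicator S x * max 0 (- f x))"
    if [measurable]: "S \<in> sets borel" for S
    by (rule Bochner_Integration.integrable_bound[OF f]; auto simp: indicator_def)+
  have eP: "emeasure P S = ennreal (\<integral>x. indicator S x * max 0 (f x) \<partial>lb a b)" 
      and eN: "emeasure N S = ennreal (\<integral>x. indicator S x * max 0 (- f x) \<partial>lb a b)" 
    if [measurable]: "S \<in> sets borel" for S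
    using ip[OF that] by (simp_all add: P_def N_def emeasure_density nn_integral_eq_integral[symmetric] ennreal_mult' ennreal_indicator mult.commute)
  have diff: "(\<integral>x. indicator S x * max 0 (f x) \<partial>lb a b) - (\<integral>x. indicator S x * max 0 (- f x) \<partial>lb a b) = (\<integral>x. indicator S x * f x \<partial>lb a b)"
    if [measurable]: "S \<in> sets borel" for S
    by (subst Bochner_Integration.integral_diff[symmetric, OF ip[OF that]])
      (rule Bochner_Integration.integral_cong, auto simp: indicator_def)
  have ioc: "(\<integral>x. indicator {..y} x * f x \<partial>lb a b) = 0" for y
  proof -
    define y' where "y' = max a (min b y)"
    have "AE x in lborel. x \<noteq> y" by (rule AE_lborel_singleton)
    then have "AE x in lb a b. indicator {..y} x * f x = indicator {a<..<y'} x * f x"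
      unfolding AE_lb by eventually_elim (auto simp: indicator_def y'_def)
    then have "(\<integral>x. indicator {..y} x * f x \<partial>lb a b) = (\<integral>x. indicator {a<..<y'} x * f x \<partial>lb a b)"
      by (intro integral_cong_AE) auto
    also have "\<dots> = 0"
    proof (cases "a \<le> b")
      case True
      then have "integral\<^sup>L (lb a y') f = 0" by (intro z) (auto simp: y'_def)
      then show ?thesis using True by (subst integral_lb_restrict[symmetric]) (auto simp: y'_def)
    qed simp
    finally show ?thesis .
  qed
  have "P = N"
  proof (rule measure_eqI_generator_eq[where \<Omega>=UNIV and E="range atMost" and A="\<lambda>n. {..real n}"])
    show "Int_stable (range (atMost :: real \<Rightarrow> real set))" 
      by (auto simp: Int_stable_def min_def[symmetric])
    show "sets P = sigma_sets UNIV (range (atMost :: real \<Rightarrow> real set))"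
      "sets N = sigma_sets UNIV (range (atMost :: real \<Rightarrow> real set))"
      by (simp_all add: P_def N_def borel_eq_atMost)
    show "emeasure P X = emeasure N X" if X': "X \<in> range atMost" for X
    proof -
      obtain y where X: "X = {..y}" using X' by blast
      show ?thesis unfolding X using ioc[of y] diff[of "{..y}"] eP[of "{..y}"] eN[of "{..y}"] by simp
    qed
    show "(\<Union>i. {..real i}) = UNIV" by (auto intro: real_arch_simple)
    show "emeasure P {..real i} \<noteq> \<infinity>" for i using eP by simp
  qed auto
  then have eq: "emeasure P S = emeasure N S" for S by simp
  \<comment> \<open>\<open>P\<close> is carried by \<open>?S\<close> and \<open>N\<close> by
    \<open>?R\<close>; as the two measures agree and the carriers are disjoint, both vanish.\<close>
  let ?S = "{x. f x > 0}" let ?R = "{x. f x < 0}"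
  have "emeasure P ?S = emeasure N ?S" by (rule eq)
  moreover have "emeasure N ?S = 0" unfolding N_def
    by (subst emeasure_density) (auto simp: nn_integral_0_iff_AE indicator_def max_def)
  ultimately have "AE x in lb a b. ennreal (max 0 (f x)) * indicator ?S x = 0"
    unfolding P_def by (subst (asm) emeasure_density) (auto simp: nn_integral_0_iff_AE)
  moreover have "emeasure P ?R = 0" unfolding P_def
    by (subst emeasure_density) (auto simp: nn_integral_0_iff_AE indicator_def max_def)
  with eq have "emeasure N ?R = 0" by metis
  then have "AE x in lb a b. ennreal (max 0 (- f x)) * indicator ?R x = 0"
    unfolding N_def by (subst (asm) emeasure_density) (auto simp: nn_integral_0_iff_AE)
  ultimately show ?thesis by eventually_elim (auto simp: indicator_def max_def split: if_splits)
qed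

text \<open>Adding the endpoints, a null set, turns this into an indefinite Henstock-Kurzweil
  integral, which is continuous.\<close>

lemma integral_lb_zero_continuous:
  fixes f :: "real \<Rightarrow> real"
  assumes f: "integrable (lb a b) f" 
  shows "continuous_on {a..b} (\<lambda>t. integral\<^sup>L (lb a t) f)"
proof (cases "a \<le> b")
  case True
  have [measurable]: "f \<in> borel_measurable borel" by (rule integrable_lb_measurable[OF f])
  have "set_integrable lborel {a<..<b} f" using f by (simp add: integrable_lb_iff)
  then have i: "set_integrable lborel {a..b} f"
    unfolding set_integrable_def
    by (rule integrable_cong_AE_imp) (use AE_lborel_singleton[of a] AE_lborel_singleton[of b] in \<open>(auto, eventually_elim, auto simp: indicator_def)\<close>)
  then have hk: "f integrable_on {a..b}" using set_borel_integral_eq_integral by blast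
  have "integral\<^sup>L (lb a t) f = integral {a..t} f" if "t \<in> {a..b}" for t
  proof -
    have it: "set_integrable lborel {a..t} f" by (rule set_integrable_subset[OF i]) (use that in auto)
    have "integral\<^sup>L (lb a t) f = (LINT x:{a..t}|lborel. f x)"
      unfolding set_lebesgue_integral_def
      by (simp add: integral_lb_eq set_lebesgue_integral_def, rule integral_cong_AE)
         (use AE_lborel_singleton[of a] AE_lborel_singleton[of t] in \<open>(auto, eventually_elim, auto simp: indicator_def)\<close>)
    then show ?thesis using set_borel_integral_eq_integral(2)[OF it] by simp
  qed
  then show ?thesis using indefinite_integral_continuous_1[OF hk] by (subst continuous_on_cong[OF refl]) auto
qed simp

text \<open>Here the measure itself depends on the parameter. Moving the endpoints into the
  integrand leaves the fixed measure \<open>lborel\<close>, for which parameter integrals are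
  measurable.\<close>

lemma measurable_integral_lb [measurable]:
  fixes f :: "'a \<Rightarrow> real \<Rightarrow> real"
  assumes [measurable]: "case_prod f \<in> borel_measurable (N \<Otimes>\<^sub>M borel)" "g \<in> borel_measurable N" "h \<in> borel_measurable N"
  shows "(\<lambda>y. integral\<^sup>L (lb (g y) (h y)) (f y)) \<in> borel_measurable N"
proof -
  have "integral\<^sup>L (lb (g y) (h y)) (f y) = (\<integral>x. (if g y < x \<and> x < h y then 1 else 0) * f y x \<partial>lborel)" 
    if y: "y \<in> space N" for y
  proof -
    have "f y \<in> borel_measurable borel"
      using measurable_Pair2[OF assms(1) y] by simp
    then show ?thesis
      by (subst integral_lb_eq) (auto simp: set_lebesgue_integral_def indicator_def intro!: Bochner_Integration.integral_cong)
  qed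
  moreover have "(\<lambda>y. \<integral>x. (if g y < x \<and> x < h y then 1 else 0) * f y x \<partial>lborel) \<in> borel_measurable N"
    by measurable
  ultimately show ?thesis by (simp cong: measurable_cong)
qed

section \<open>Products and powers of primitives, and Gronwall's lemma\<close>

lemma integrable_pair_mult:
  fixes a b :: "real \<Rightarrow> real"
  assumes a: "integrable (lb p q) a" and b: "integrable (lb r s) b"
  shows "integrable (lb p q \<Otimes>\<^sub>M lb r s) (\<lambda>(x, y). a x * b y)"
proof -
  have [measurable]: "a \<in> borel_measurable borel" "b \<in> borel_measurable borel"
    using a b by (auto intro: integrable_lb_measurable)
  show ?thesis
  proof (rule lb2.Fubini_integrable)
    show "integrable (lb p q) (\<lambda>x. LINT y|lb r s. norm (case (x, y) of (x, y) \<Rightarrow> a x * b y))"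
      using a by (simp add: abs_mult)
    show "AE x in lb p q. integrable (lb r s) (\<lambda>y. case (x, y) of (x, y) \<Rightarrow> a x * b y)"
      using b by simp
  qed measurable
qed

lemma integrable_mult_bounded:
  fixes f g :: "'a \<Rightarrow> real"
  assumes "integrable M f" "g \<in> borel_measurable M" "AE x in M. \<bar>g x\<bar> \<le> K"
  shows "integrable M (\<lambda>x. f x * g x)"
proof (rule Bochner_Integration.integrable_bound)
  show "integrable M (\<lambda>x. \<bar>K\<bar> * f x)" using assms by simp
  show "AE x in M. norm (f x * g x) \<le> norm (\<bar>K\<bar> * f x)"
    using assms(3) by eventually_elim (auto simp: abs_mult mult.commute[of "\<bar>f _\<bar>"] intro!: mult_right_mono)
qed (use assms in auto)

lemma abs_integral_lb_le:
  fixes f :: "real \<Rightarrow> real"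
  assumes f: "integrable (lb p t) f" and "s \<le> t"
  shows "\<bar>integral\<^sup>L (lb p s) f\<bar> \<le> (\<integral>x. \<bar>f x\<bar> \<partial>lb p t)"
proof -
  have [measurable]: "f \<in> borel_measurable borel" using f by (rule integrable_lb_measurable)
  have "integral\<^sup>L (lb p s) f = (\<integral>x. indicator {p<..<s} x * f x \<partial>lb p t)"
    using assms by (intro integral_lb_restrict) auto
  also have "\<bar>\<dots>\<bar> \<le> (\<integral>x. \<bar>indicator {p<..<s} x * f x\<bar> \<partial>lb p t)" by (rule integral_abs_bound)
  also have "\<dots> \<le> (\<integral>x. \<bar>f x\<bar> \<partial>lb p t)"
    by (intro integral_mono) (auto intro!: Bochner_Integration.integrable_bound[OF f] simp: indicator_def f)
  finally show ?thesis .
qed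

text \<open>The product rule for absolutely continuous functions, in integrated form. The product
  \<open>a s * b r\<close> over the square splits into the triangles r < s and s < r, the diagonal
  being null, and Fubini turns each triangle into one of the two terms. It serves both as energy
  identity in time and as integration by parts in space.\<close>

lemma primitive_product:
  fixes a b :: "real \<Rightarrow> real"
  assumes a: "integrable (lb p t) a" and b: "integrable (lb p t) b" and "p \<le> t"
  shows "integrable (lb p t) (\<lambda>s. a s * (g0 + integral\<^sup>L (lb p s) b))"
    and "integrable (lb p t) (\<lambda>s. (f0 + integral\<^sup>L (lb p s) a) * b s)"
    and "(f0 + integral\<^sup>L (lb p t) a) * (g0 + integral\<^sup>L (lb p t) b)
      = f0 * g0 + (\<integral>s. a s * (g0 + integral\<^sup>L (lb p s) b) + (f0 + integral\<^sup>L (lb p s) a) * b s \<partial>lb p t)"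
proof -
  have [measurable]: "a \<in> borel_measurable borel" "b \<in> borel_measurable borel"
    using a b by (auto intro: integrable_lb_measurable)
  have bda: "\<bar>integral\<^sup>L (lb p s) a\<bar> \<le> (\<integral>x. \<bar>a x\<bar> \<partial>lb p t)" and bdb: "\<bar>integral\<^sup>L (lb p s) b\<bar> \<le> (\<integral>x. \<bar>b x\<bar> \<partial>lb p t)" 
    if "s \<le> t" for s
    using abs_integral_lb_le[OF a that] abs_integral_lb_le[OF b that] by auto
  have ia: "integrable (lb p t) (\<lambda>s. a s * integral\<^sup>L (lb p s) b)"
    by (rule integrable_mult_bounded[OF a, where K="\<integral>x. \<bar>b x\<bar> \<partial>lb p t"]) (auto simp: AE_lb intro!: bdb)
  have ib: "integrable (lb p t) (\<lambda>s. b s * integral\<^sup>L (lb p s) a)"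
    by (rule integrable_mult_bounded[OF b, where K="\<integral>x. \<bar>a x\<bar> \<partial>lb p t"]) (auto simp: AE_lb intro!: bda)
  show 1: "integrable (lb p t) (\<lambda>s. a s * (g0 + integral\<^sup>L (lb p s) b))"
    using Bochner_Integration.integrable_add[OF integrable_mult_left[OF a, of g0] ia] by (simp add: algebra_simps)
  show 2: "integrable (lb p t) (\<lambda>s. (f0 + integral\<^sup>L (lb p s) a) * b s)"
    using Bochner_Integration.integrable_add[OF integrable_mult_left[OF b, of f0] ib] by (simp add: algebra_simps)
  let ?N = "lb p t"
  have iab: "integrable (?N \<Otimes>\<^sub>M ?N) (\<lambda>(s, r). a s * b r)"
    by (rule integrable_pair_mult[OF a b])
  have i1: "integrable (?N \<Otimes>\<^sub>M ?N) (\<lambda>(s, r). (if r < s then 1 else 0) * (a s * b r))"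
    and i2: "integrable (?N \<Otimes>\<^sub>M ?N) (\<lambda>(s, r). (if s < r then 1 else 0) * (a s * b r))"
    by (rule Bochner_Integration.integrable_bound[OF iab]; auto)+
  have e1: "(\<integral>s. a s * integral\<^sup>L (lb p s) b \<partial>?N) = (\<integral>s. \<integral>r. (if r < s then 1 else 0) * (a s * b r) \<partial>?N \<partial>?N)"
  proof (rule integral_cong_AE)
    show "AE s in lb p t. a s * integral\<^sup>L (lb p s) b = (LINT r|lb p t. (if r < s then 1 else 0) * (a s * b r))"
    proof (rule AE_lbI)
      fix s assume s: "p < s" "s < t"
      have "integral\<^sup>L (lb p s) b = (\<integral>r. indicator {p<..<s} r * b r \<partial>?N)"
        using s by (intro integral_lb_restrict) auto
      also have "\<dots> = (\<integral>r. (if r < s then 1 else 0) * b r \<partial>?N)"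
        by (rule integral_cong_AE) (auto simp: AE_lb)
      finally have "a s * integral\<^sup>L (lb p s) b = (\<integral>r. a s * ((if r < s then 1 else 0) * b r) \<partial>?N)" by simp
      then show "a s * integral\<^sup>L (lb p s) b = (LINT r|lb p t. (if r < s then 1 else 0) * (a s * b r))"
        by (simp add: ac_simps)
    qed
  qed measurable
  have e2: "(\<integral>s. b s * integral\<^sup>L (lb p s) a \<partial>?N) = (\<integral>r. \<integral>s. (if s < r then 1 else 0) * (a s * b r) \<partial>?N \<partial>?N)"
  proof (rule integral_cong_AE)
    show "AE s in lb p t. b s * integral\<^sup>L (lb p s) a = (LINT r|lb p t. (if r < s then 1 else 0) * (a r * b s))"
    proof (rule AE_lbI)
      fix s assume s: "p < s" "s < t"
      have "integral\<^sup>L (lb p s) a = (\<integral>r. indicator {p<..<s} r * a r \<partial>?N)"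
        using s by (intro integral_lb_restrict) auto
      also have "\<dots> = (\<integral>r. (if r < s then 1 else 0) * a r \<partial>?N)"
        by (rule integral_cong_AE) (auto simp: AE_lb)
      finally have "b s * integral\<^sup>L (lb p s) a = (\<integral>r. b s * ((if r < s then 1 else 0) * a r) \<partial>?N)" by simp
      then show "b s * integral\<^sup>L (lb p s) a = (LINT r|lb p t. (if r < s then 1 else 0) * (a r * b s))"
        by (simp add: ac_simps)
    qed
  qed measurable
  have "(\<integral>s. a s * integral\<^sup>L (lb p s) b \<partial>?N) + (\<integral>s. b s * integral\<^sup>L (lb p s) a \<partial>?N)
    = (\<integral>s. \<integral>r. (if r < s then 1 else 0) * (a s * b r) \<partial>?N \<partial>?N) + (\<integral>s. \<integral>r. (if s < r then 1 else 0) * (a s * b r) \<partial>?N \<partial>?N)"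
    using lb2.Fubini_integral[OF i2] e1 e2 by simp
  also have "\<dots> = integral\<^sup>L (?N \<Otimes>\<^sub>M ?N) (\<lambda>(s, r). (if r < s then 1 else 0) * (a s * b r)) + integral\<^sup>L (?N \<Otimes>\<^sub>M ?N) (\<lambda>(s, r). (if s < r then 1 else 0) * (a s * b r))"
    using lb2.integral_fst[OF i1] lb2.integral_fst[OF i2] by simp
  also have "\<dots> = integral\<^sup>L (?N \<Otimes>\<^sub>M ?N) (\<lambda>(s, r). a s * b r)"
  proof -
    have "AE s in ?N. AE r in ?N. r \<noteq> s"
    proof (rule AE_I2)
      fix s show "AE r in ?N. r \<noteq> s" unfolding AE_lb using AE_lborel_singleton[of s] by eventually_elim auto
    qed
    then have "AE z in ?N \<Otimes>\<^sub>M ?N. snd z < fst z \<or> fst z < snd z"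
      by (intro lb2.AE_pair_measure) (measurable, auto simp: neq_iff)
    then have "AE z in ?N \<Otimes>\<^sub>M ?N. (case z of (s, r) \<Rightarrow> (if r < s then 1 else 0) * (a s * b r)) + (case z of (s, r) \<Rightarrow> (if s < r then 1 else 0) * (a s * b r)) = (case z of (s, r) \<Rightarrow> a s * b r)"
      by eventually_elim auto
    then show ?thesis
      unfolding Bochner_Integration.integral_add[OF i1 i2, symmetric] by (intro integral_cong_AE) auto
  qed
  also have "\<dots> = integral\<^sup>L ?N a * integral\<^sup>L ?N b"
    using lb2.integral_fst[OF iab] by simp
  finally have key: "(\<integral>s. a s * integral\<^sup>L (lb p s) b \<partial>?N) + (\<integral>s. b s * integral\<^sup>L (lb p s) a \<partial>?N) = integral\<^sup>L ?N a * integral\<^sup>L ?N b" .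
  have "(\<integral>s. a s * (g0 + integral\<^sup>L (lb p s) b) + (f0 + integral\<^sup>L (lb p s) a) * b s \<partial>?N)
     = (\<integral>s. a s * (g0 + integral\<^sup>L (lb p s) b) \<partial>?N) + (\<integral>s. (f0 + integral\<^sup>L (lb p s) a) * b s \<partial>?N)"
    by (rule Bochner_Integration.integral_add[OF 1 2])
  also have "(\<integral>s. a s * (g0 + integral\<^sup>L (lb p s) b) \<partial>?N) = integral\<^sup>L ?N a * g0 + (\<integral>s. a s * integral\<^sup>L (lb p s) b \<partial>?N)"
    using Bochner_Integration.integral_add[OF integrable_mult_left[OF a, of g0] ia] a by (simp add: algebra_simps)
  also have "(\<integral>s. (f0 + integral\<^sup>L (lb p s) a) * b s \<partial>?N) = f0 * integral\<^sup>L ?N b + (\<integral>s. b s * integral\<^sup>L (lb p s) a \<partial>?N)"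
    using Bochner_Integration.integral_add[OF integrable_mult_right[OF b, of f0] ib] b by (simp add: algebra_simps)
  finally show "(f0 + integral\<^sup>L (lb p t) a) * (g0 + integral\<^sup>L (lb p t) b)
      = f0 * g0 + (\<integral>s. a s * (g0 + integral\<^sup>L (lb p s) b) + (f0 + integral\<^sup>L (lb p s) a) * b s \<partial>lb p t)"
    using key by (simp add: algebra_simps)
qed

text \<open>Induction through \<open>primitive_product\<close> replaces the chain rule, since
  \<open>k\<close> is only integrable. Divided by factorials, these powers are the terms of the
  exponential series in Gronwall's lemma and in the Picard iteration.\<close>

lemma primitive_power:
  fixes k :: "real \<Rightarrow> real"
  assumes k: "integrable (lb p t) k" and "p \<le> t"
  shows "integrable (lb p t) (\<lambda>s. real (Suc n) * integral\<^sup>L (lb p s) k ^ n * k s) \<and>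
    integral\<^sup>L (lb p t) k ^ Suc n = (\<integral>s. real (Suc n) * integral\<^sup>L (lb p s) k ^ n * k s \<partial>lb p t)"
  using assms
proof (induction n arbitrary: t)
  case 0
  then show ?case by simp
next
  case (Suc n)
  let ?a = "\<lambda>s. real (Suc n) * integral\<^sup>L (lb p s) k ^ n * k s"
  have ia: "integrable (lb p t) ?a" using Suc by blast
  have e: "integral\<^sup>L (lb p s) ?a = integral\<^sup>L (lb p s) k ^ Suc n" if "p \<le> s" "s \<le> t" for s
    using Suc.IH[of s] integrable_lb_subset[OF Suc.prems(1), of p s] that by auto
  have [measurable]: "k \<in> borel_measurable borel" using k by (rule integrable_lb_measurable)
  note P = primitive_product(1)[OF ia Suc.prems(1,2), of 0] primitive_product(2)[OF ia Suc.prems(1,2), of 0]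
    primitive_product(3)[OF ia Suc.prems(1,2), of 0 0]
  have ae: "AE s in lb p t. ?a s * (0 + integral\<^sup>L (lb p s) k) + (0 + integral\<^sup>L (lb p s) ?a) * k s = real (Suc (Suc n)) * integral\<^sup>L (lb p s) k ^ Suc n * k s"
    by (rule AE_lbI) (use e in \<open>auto simp: algebra_simps\<close>)
  have "integrable (lb p t) (\<lambda>s. real (Suc (Suc n)) * integral\<^sup>L (lb p s) k ^ Suc n * k s)"
    by (rule integrable_cong_AE_imp[OF Bochner_Integration.integrable_add[OF P(1,2)]])
      (use ae in \<open>auto elim: AE_mp\<close>)
  moreover have "integral\<^sup>L (lb p t) k ^ Suc (Suc n) = integral\<^sup>L (lb p t) ?a * integral\<^sup>L (lb p t) k"
    using e[of t] Suc.prems by simp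
  moreover have "\<dots> = (\<integral>s. real (Suc (Suc n)) * integral\<^sup>L (lb p s) k ^ Suc n * k s \<partial>lb p t)"
    using P(3) integral_cong_AE[OF _ _ ae] by simp
  ultimately show ?case by (metis (no_types, lifting))
qed

text \<open>\<open>f\<close> is only measurable, so nothing can be differentiated; the inequality is
  iterated instead. After n rounds the bound is c times the n-th partial sum of exp(\<Lambda>) plus
  the remainder M \<Lambda>^n / n!, which tends to 0. The a priori bound \<open>M\<close> starts the
  iteration, and the countably many null sets are joined before n tends to infinity.\<close>

lemma gronwall_AE:
  fixes f k :: "real \<Rightarrow> real"
  assumes k: "integrable (lb 0 T) k" and k0: "\<And>t. 0 \<le> k t"
    and [measurable]: "f \<in> borel_measurable borel" and c: "0 \<le> c"
    and f0: "AE t in lb 0 T. 0 \<le> f t" and fM: "AE t in lb 0 T. f t \<le> M"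
    and ineq: "AE t in lb 0 T. f t \<le> c + (\<integral>s. k s * f s \<partial>lb 0 t)"
  shows "AE t in lb 0 T. f t \<le> c * exp (integral\<^sup>L (lb 0 T) k)"
proof -
  have [measurable]: "k \<in> borel_measurable borel" using k by (rule integrable_lb_measurable)
  define \<Lambda> where "\<Lambda> t = integral\<^sup>L (lb 0 t) k" for t
  have \<Lambda>0: "0 \<le> \<Lambda> t" for t unfolding \<Lambda>_def using k0 by (intro Bochner_Integration.integral_nonneg) auto
  have kt: "integrable (lb 0 t) k" if "t \<le> T" for t by (rule integrable_lb_subset[OF k]) (use that in auto)
  have [measurable]: "\<Lambda> \<in> borel_measurable borel" unfolding \<Lambda>_def by measurable
  have \<Lambda>mono: "\<Lambda> t \<le> \<Lambda> T" if "0 \<le> t" "t \<le> T" for t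
  proof -
    have "\<Lambda> T = \<Lambda> t + integral\<^sup>L (lb t T) k" unfolding \<Lambda>_def by (rule integral_lb_combine[OF k that])
    moreover have "0 \<le> integral\<^sup>L (lb t T) k" using k0 by (intro Bochner_Integration.integral_nonneg) auto
    ultimately show ?thesis by simp
  qed
  have ik: "integrable (lb 0 t) (\<lambda>s. k s * (\<Lambda> s ^ n / fact n))" and ek: "(\<integral>s. k s * (\<Lambda> s ^ n / fact n) \<partial>lb 0 t) = \<Lambda> t ^ Suc n / fact (Suc n)"
    if "0 \<le> t" "t \<le> T" for t n
  proof -
    note P = primitive_power[OF kt[OF that(2)] that(1), of n]
    have eq: "k s * (\<Lambda> s ^ n / fact n) = (real (Suc n) * integral\<^sup>L (lb 0 s) k ^ n * k s) / fact (Suc n)" for s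
      unfolding \<Lambda>_def fact_Suc by (simp del: of_nat_Suc)
    show "integrable (lb 0 t) (\<lambda>s. k s * (\<Lambda> s ^ n / fact n))"
      unfolding eq using P by (intro integrable_divide_zero) auto
    show "(\<integral>s. k s * (\<Lambda> s ^ n / fact n) \<partial>lb 0 t) = \<Lambda> t ^ Suc n / fact (Suc n)"
      unfolding eq unfolding integral_divide_zero conjunct2[OF P, symmetric] unfolding \<Lambda>_def ..
  qed
  have ind: "AE t in lb 0 T. f t \<le> c * (\<Sum>i<n. \<Lambda> t ^ i / fact i) + M * (\<Lambda> t ^ n / fact n)" for n
  proof (induction n)
    case 0
    then show ?case using fM by simp
  next
    case (Suc n)
    have "AE t in lb 0 T. 0 < t \<and> t < T" by (rule AE_lb_in)
    with ineq show ?case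
    proof eventually_elim
      case (elim t)
      have i1: "integrable (lb 0 t) (\<lambda>s. k s * f s)"
      proof (rule integrable_mult_bounded[OF kt])
        show "AE x in lb 0 t. \<bar>f x\<bar> \<le> M"
          using AE_lb_mono[OF f0, of 0 t] AE_lb_mono[OF fM, of 0 t] elim by auto
      qed (use elim in auto)
      have i2: "integrable (lb 0 t) (\<lambda>s. c * (\<Sum>i<n. k s * (\<Lambda> s ^ i / fact i)) + M * (k s * (\<Lambda> s ^ n / fact n)))"
        using ik elim by (intro Bochner_Integration.integrable_add integrable_mult_right Bochner_Integration.integrable_sum) auto
      have "(\<integral>s. k s * f s \<partial>lb 0 t) \<le> (\<integral>s. c * (\<Sum>i<n. k s * (\<Lambda> s ^ i / fact i)) + M * (k s * (\<Lambda> s ^ n / fact n)) \<partial>lb 0 t)"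
      proof (rule integral_mono_AE[OF i1 i2])
        have "AE s in lb 0 t. f s \<le> c * (\<Sum>i<n. \<Lambda> s ^ i / fact i) + M * (\<Lambda> s ^ n / fact n)"
          by (rule AE_lb_mono[OF Suc.IH]) (use elim in auto)
        then show "AE s in lb 0 t. k s * f s \<le> c * (\<Sum>i<n. k s * (\<Lambda> s ^ i / fact i)) + M * (k s * (\<Lambda> s ^ n / fact n))"
        proof eventually_elim
          case (elim s)
          have "k s * f s \<le> k s * (c * (\<Sum>i<n. \<Lambda> s ^ i / fact i) + M * (\<Lambda> s ^ n / fact n))"
            by (rule mult_left_mono[OF elim k0])
          then show ?case by (simp add: algebra_simps sum_distrib_left)
        qed
      qed
      also have "\<dots> = c * (\<Sum>i<n. \<Lambda> t ^ Suc i / fact (Suc i)) + M * (\<Lambda> t ^ Suc n / fact (Suc n))"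
      proof -
        have "(\<integral>s. c * (\<Sum>i<n. k s * (\<Lambda> s ^ i / fact i)) + M * (k s * (\<Lambda> s ^ n / fact n)) \<partial>lb 0 t)
          = c * (\<integral>s. (\<Sum>i<n. k s * (\<Lambda> s ^ i / fact i)) \<partial>lb 0 t) + M * (\<integral>s. (k s * (\<Lambda> s ^ n / fact n)) \<partial>lb 0 t)"
          using elim by (subst Bochner_Integration.integral_add)
            ((intro integrable_mult_right Bochner_Integration.integrable_sum ik; simp)+, simp)
        also have "(\<integral>s. (\<Sum>i<n. k s * (\<Lambda> s ^ i / fact i)) \<partial>lb 0 t) = (\<Sum>i<n. \<Lambda> t ^ Suc i / fact (Suc i))"
          using ik ek elim by (subst Bochner_Integration.integral_sum) (auto simp del: power_Suc fact_Suc)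
        also have "(\<integral>s. (k s * (\<Lambda> s ^ n / fact n)) \<partial>lb 0 t) = \<Lambda> t ^ Suc n / fact (Suc n)"
          using elim by (intro ek) auto
        finally show ?thesis .
      qed
      finally have "f t \<le> c + (c * (\<Sum>i<n. \<Lambda> t ^ Suc i / fact (Suc i)) + M * (\<Lambda> t ^ Suc n / fact (Suc n)))"
        using elim by linarith
      moreover have "(\<Sum>i<Suc n. \<Lambda> t ^ i / fact i) = 1 + (\<Sum>i<n. \<Lambda> t ^ Suc i / fact (Suc i))"
        by (subst sum.lessThan_Suc_shift) simp
      ultimately show ?case by (simp add: algebra_simps del: power_Suc fact_Suc)
    qed
  qed
  then have "AE t in lb 0 T. \<forall>n. f t \<le> c * (\<Sum>i<n. \<Lambda> t ^ i / fact i) + M * (\<Lambda> t ^ n / fact n)"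
    by (simp add: AE_all_countable)
  moreover have "AE t in lb 0 T. 0 < t \<and> t < T" by (rule AE_lb_in)
  ultimately show ?thesis
  proof eventually_elim
    case (elim t)
    have s: "(\<lambda>i. \<Lambda> t ^ i / fact i) sums exp (\<Lambda> t)" using exp_converges[of "\<Lambda> t"] by (simp add: divide_inverse mult.commute)
    have "(\<lambda>n. c * (\<Sum>i<n. \<Lambda> t ^ i / fact i) + M * (\<Lambda> t ^ n / fact n)) \<longlonglongrightarrow> c * exp (\<Lambda> t) + M * 0"
      using s summable_LIMSEQ_zero[OF sums_summable[OF s]] by (intro tendsto_intros) (auto simp: sums_def)
    then have "f t \<le> c * exp (\<Lambda> t) + M * 0"
      by (rule LIMSEQ_le_const) (use elim in auto)
    also have "\<dots> \<le> c * exp (integral\<^sup>L (lb 0 T) k)"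
      using \<Lambda>mono[of t] elim c by (auto simp: \<Lambda>_def intro!: mult_left_mono)
    finally show ?case .
  qed
qed

section \<open>Smooth cut-offs\<close>

text \<open>\<open>Ck (Suc k)\<close> speaks of derivatives only and does not contain
  \<open>Ck k\<close> literally; at the bottom of the induction continuity is recovered from
  differentiability.\<close>

lemma Ck_Suc_imp: "Ck (Suc k) f \<Longrightarrow> Ck k f"
proof (induction k arbitrary: f)
  case 0
  then show ?case
    by (auto intro!: differentiable_imp_continuous_on simp: differentiable_on_def differentiable_at_withinI)
next
  case (Suc k)
  from Suc.prems have "\<forall>z. f differentiable (at z)" "\<And>v. Ck (Suc k) (\<lambda>z. frechet_derivative f (at z) v)"
    by (simp_all only: Ck.simps(2)) auto
  with Suc.IH show ?case by (simp only: Ck.simps(2)) auto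
qed

lemma Ck_SucI:
  assumes "\<And>z. (f has_derivative f' z) (at z)" "\<And>v. Ck k (\<lambda>z. f' z v)"
  shows "Ck (Suc k) f"
proof -
  have "frechet_derivative f (at z) = f' z" for z
    using frechet_derivative_at[OF assms(1)[of z]] by simp
  then show ?thesis using assms by (auto simp: differentiable_def)
qed

lemma Ck_SucD:
  assumes "Ck (Suc k) f"
  shows "(f has_derivative frechet_derivative f (at z)) (at z)" "Ck k (\<lambda>z. frechet_derivative f (at z) v)"
  using assms by (auto simp: frechet_derivative_works[symmetric])

lemma Ck_const: "Ck k (\<lambda>z. c)"
proof (induction k arbitrary: c)
  case (Suc k)
  show ?case by (rule Ck_SucI[where f'="\<lambda>z v. 0"]) (auto intro: Suc)
qed auto

lemma Ck_linear: "bounded_linear f \<Longrightarrow> Ck k f"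
proof (cases k)
  case (Suc n)
  assume "bounded_linear f"
  then show ?thesis unfolding Suc
    by (intro Ck_SucI[where f'="\<lambda>z. f"]) (auto intro: Ck_const bounded_linear.has_derivative bounded_linear_imp_has_derivative)
qed (auto intro: linear_continuous_on)

lemma Ck_add: "Ck k f \<Longrightarrow> Ck k g \<Longrightarrow> Ck k (\<lambda>z. f z + g z)"
proof (induction k arbitrary: f g)
  case 0
  then show ?case by (auto intro: continuous_intros)
next
  case (Suc k)
  show ?case
    by (rule Ck_SucI[where f'="\<lambda>z v. frechet_derivative f (at z) v + frechet_derivative g (at z) v"])
      (auto intro!: has_derivative_add Ck_SucD[OF Suc.prems(1)] Ck_SucD[OF Suc.prems(2)] Suc.IH)
qed

lemma Ck_mult: "Ck k f \<Longrightarrow> Ck k g \<Longrightarrow> Ck k (\<lambda>z. f z * g z)"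
proof (induction k arbitrary: f g)
  case 0
  then show ?case by (auto intro: continuous_intros)
next
  case (Suc k)
  show ?case
  proof (rule Ck_SucI)
    show "((\<lambda>z. f z * g z) has_derivative (\<lambda>v. f z * frechet_derivative g (at z) v + frechet_derivative f (at z) v * g z)) (at z)" for z
      by (rule has_derivative_mult[OF Ck_SucD(1)[OF Suc.prems(1)] Ck_SucD(1)[OF Suc.prems(2)]])
    show "Ck k (\<lambda>z. f z * frechet_derivative g (at z) v + frechet_derivative f (at z) v * g z)" for v
      by (intro Ck_add Suc.IH Ck_SucD(2)[OF Suc.prems(1)] Ck_SucD(2)[OF Suc.prems(2)] Ck_Suc_imp[OF Suc.prems(1)] Ck_Suc_imp[OF Suc.prems(2)])
  qed
qed

lemma d1_works: "Ck (Suc k) f \<Longrightarrow> (f has_real_derivative d1 f x) (at x)"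
proof -
  assume "Ck (Suc k) f"
  then have h: "(f has_derivative frechet_derivative f (at x)) (at x)" by (rule Ck_SucD)
  have "frechet_derivative f (at x) v = d1 f x * v" for v
    using linear_scale[OF has_derivative_linear[OF h], of v 1] by (simp add: d1_def)
  then have "frechet_derivative f (at x) = (*) (d1 f x)" by auto
  then show ?thesis using h by (simp add: has_field_derivative_def)
qed

lemma Ck_d1: "Ck (Suc k) f \<Longrightarrow> Ck k (d1 f)"
  unfolding d1_def[abs_def] by (rule Ck_SucD)

lemma d1_eq: "(f has_real_derivative D) (at x) \<Longrightarrow> d1 f x = D"
proof -
  assume "(f has_real_derivative D) (at x)"
  then have "(f has_derivative (*) D) (at x)" by (simp add: has_field_derivative_def)
  then have "frechet_derivative f (at x) = (*) D" by (rule frechet_derivative_at[symmetric])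
  then show ?thesis by (simp add: d1_def)
qed

lemma Ck_SucI_real:
  assumes "\<And>x. (f has_real_derivative f' x) (at x)" "Ck k f'"
  shows "Ck (Suc k) f"
  by (rule Ck_SucI[where f'="\<lambda>z v. f' z * v"])
    (use assms in \<open>auto simp: has_field_derivative_def intro!: Ck_mult Ck_const\<close>)

lemma Ck_compose: "Ck k f \<Longrightarrow> Ck k g \<Longrightarrow> Ck k (\<lambda>z. f (g z))"
  for f :: "real \<Rightarrow> real"
proof (induction k arbitrary: f)
  case 0
  then show ?case by (auto intro: continuous_on_compose2)
next
  case (Suc k)
  show ?case
  proof (rule Ck_SucI)
    show "((\<lambda>z. f (g z)) has_derivative (\<lambda>v. frechet_derivative g (at z) v * d1 f (g z))) (at z)" for z
      using has_derivative_compose[OF Ck_SucD(1)[OF Suc.prems(2)] d1_works[OF Suc.prems(1), unfolded has_field_derivative_def], of z]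
      by (simp add: mult.commute)
    show "Ck k (\<lambda>z. frechet_derivative g (at z) v * d1 f (g z))" for v
      by (rule Ck_mult[OF Ck_SucD(2)[OF Suc.prems(2)] Suc.IH[OF Ck_d1[OF Suc.prems(1)] Ck_Suc_imp[OF Suc.prems(2)]]])
  qed
qed

lemma smooth_const: "smooth_fun (\<lambda>z. c)"
  and smooth_linear: "bounded_linear f \<Longrightarrow> smooth_fun f"
  and smooth_add: "smooth_fun f \<Longrightarrow> smooth_fun g \<Longrightarrow> smooth_fun (\<lambda>z. f z + g z)"
  and smooth_mult: "smooth_fun f \<Longrightarrow> smooth_fun g \<Longrightarrow> smooth_fun (\<lambda>z. f z * g z)"
  by (auto simp: smooth_fun_def intro: Ck_const Ck_linear Ck_add Ck_mult)

lemma smooth_diff: "smooth_fun f \<Longrightarrow> smooth_fun g \<Longrightarrow> smooth_fun (\<lambda>z. f z - g z)"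
  using smooth_add[of f "\<lambda>z. -1 * g z"] smooth_mult[OF smooth_const[of "-1"]] by auto

lemma smooth_compose: "smooth_fun f \<Longrightarrow> smooth_fun g \<Longrightarrow> smooth_fun (\<lambda>z. f (g z))"
  for f :: "real \<Rightarrow> real"
  unfolding smooth_fun_def by (rule allI, rule Ck_compose) (erule spec)+

lemma smooth_d1: "smooth_fun f \<Longrightarrow> smooth_fun (d1 f)"
  and smooth_d1_works: "smooth_fun f \<Longrightarrow> (f has_real_derivative d1 f x) (at x)"
  by (auto simp: smooth_fun_def intro: Ck_d1 d1_works)

lemma smooth_ident: "smooth_fun (\<lambda>x::real. x)"
  by (rule smooth_linear) simp

lemma smooth_primitive:
  assumes "\<And>x. (f has_real_derivative f' x) (at x)" "smooth_fun f'"
  shows "smooth_fun f"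
  unfolding smooth_fun_def
proof
  fix k show "Ck k f"
    using Ck_SucI_real[of f f' k] assms by (auto simp: smooth_fun_def intro: Ck_Suc_imp)
qed

lemma smooth_continuous: "smooth_fun f \<Longrightarrow> continuous_on UNIV f"
  unfolding smooth_fun_def by (metis Ck.simps(1))

lemma smooth_trig: "smooth_fun (\<lambda>x::real. sin x)" "smooth_fun (\<lambda>x::real. cos x)"
proof -
  have "Ck k (\<lambda>x::real. sin x) \<and> Ck k (\<lambda>x::real. cos x)" for k
  proof (induction k)
    case (Suc k)
    have "Ck (Suc k) (\<lambda>x::real. sin x)"
      by (rule Ck_SucI_real[where f'=cos]) (use Suc in \<open>auto intro!: derivative_eq_intros\<close>)
    moreover have "Ck (Suc k) (\<lambda>x::real. cos x)"
      by (rule Ck_SucI_real[where f'="\<lambda>x. -1 * sin x"]) ((auto intro!: derivative_eq_intros)[1], intro Ck_mult Ck_const conjunct1[OF Suc])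
    ultimately show ?case by blast
  qed (auto intro: continuous_intros)
  then show "smooth_fun (\<lambda>x::real. sin x)" "smooth_fun (\<lambda>x::real. cos x)" by (auto simp: smooth_fun_def)
qed

text \<open>The classical flat function exp(-1/x), multiplied by x^(-n) and extended by 0. The index
  makes the family closed under differentiation: the derivative of member n combines members n+2 and
  n+1, so one induction gives smoothness of all of them.\<close>

definition flatexp :: "nat \<Rightarrow> real \<Rightarrow> real" where
  "flatexp n x = (if 0 < x then (1/x)^n / exp (1/x) else 0)"

lemma flatexp_tendsto_0: "(flatexp n \<longlongrightarrow> 0) (at 0)"
proof -
  have "((\<lambda>x. (1/x)^n / exp (1/x) :: real) \<longlongrightarrow> 0) (at_right 0)"
  proof (rule filterlim_compose[OF tendsto_power_div_exp_0])
    show "filterlim (\<lambda>x::real. 1/x) at_top (at_right 0)"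
      using filterlim_inverse_at_top_right by (simp add: inverse_eq_divide)
  qed
  then have "(flatexp n \<longlongrightarrow> 0) (at_right 0)"
    by (rule Lim_transform_eventually) (auto simp: flatexp_def eventually_at_right_less eventually_at intro!: exI[of _ 1])
  moreover have "(flatexp n \<longlongrightarrow> 0) (at_left 0)"
    by (rule Lim_transform_eventually[OF tendsto_const]) (auto simp: flatexp_def eventually_at intro!: exI[of _ 1])
  ultimately show ?thesis by (simp add: filterlim_split_at)
qed

lemma flatexp_deriv: "(flatexp n has_real_derivative flatexp (n+2) x - n * flatexp (n+1) x) (at x)"
proof -
  consider "x > 0" | "x < 0" | "x = 0" by linarith
  then show ?thesis
  proof cases
    case 1
    have "((\<lambda>x. (1/x)^n / exp (1/x)) has_real_derivative flatexp (n+2) x - n * flatexp (n+1) x) (at x)"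
    proof (cases n)
      case 0
      then show ?thesis using 1 by (auto intro!: derivative_eq_intros simp: flatexp_def field_simps power2_eq_square)
    next
      case (Suc m)
      have p: "((\<lambda>x. 1/x) has_real_derivative - (1/x^2)) (at x)"
        using 1 by (auto intro!: derivative_eq_intros simp: power2_eq_square)
      have e: "((\<lambda>x. exp (1/x)) has_real_derivative exp (1/x) * (- (1/x^2))) (at x)"
        by (rule DERIV_chain2[OF DERIV_exp p])
      have alg: "((1 + real m) * (- (1/x^2) * Y) * F - (1/x * Y) * (F * (- (1/x^2)))) / (F * F) = (1/x * (1/x * (1/x * Y))) / F - (1 + real m) * ((1/x * (1/x * Y)) / F)"
        if "F > 0" for F Y using that 1 by (simp add: field_simps power2_eq_square)
      have "((\<lambda>x. (1/x)^Suc m / exp (1/x)) has_real_derivative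
          ((1 + real m) * (- (1/x^2) * (1/x)^m) * exp (1/x) - (1/x)^Suc m * (exp (1/x) * (- (1/x^2)))) / (exp (1/x) * exp (1/x))) (at x)"
        by (rule DERIV_divide[OF DERIV_power_Suc[OF p] e]) simp
      moreover have "((1 + real m) * (- (1/x^2) * (1/x)^m) * exp (1/x) - (1/x)^Suc m * (exp (1/x) * (- (1/x^2)))) / (exp (1/x) * exp (1/x))
         = flatexp (n+2) x - n * flatexp (n+1) x"
        using 1 alg[of "exp (1/x)" "(1/x)^m"] unfolding Suc flatexp_def by simp
      ultimately show ?thesis using Suc by simp
    qed
    then show ?thesis
      by (rule has_field_derivative_transform_within_open[where S="{0<..}"]) (use 1 in \<open>auto simp: flatexp_def\<close>)
  next
    case 2
    have "((\<lambda>x. 0) has_real_derivative flatexp (n+2) x - n * flatexp (n+1) x) (at x)"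
      using 2 by (auto simp: flatexp_def)
    then show ?thesis
      by (rule has_field_derivative_transform_within_open[where S="{..<0}"]) (use 2 in \<open>auto simp: flatexp_def\<close>)
  next
    case 3
    \<comment> \<open>At the origin the difference quotient of member n is member n+1, which tends
      to 0.\<close>
    have "((\<lambda>h. (flatexp n (0 + h) - flatexp n 0) / h) \<longlongrightarrow> 0) (at 0)"
    proof (rule Lim_transform_eventually[OF flatexp_tendsto_0[of "n+1"]])
      have "flatexp (n+1) h = (flatexp n (0 + h) - flatexp n 0) / h" if "h \<noteq> 0" for h
        using that by (auto simp: flatexp_def)
      then show "\<forall>\<^sub>F h in at 0. flatexp (n+1) h = (flatexp n (0 + h) - flatexp n 0) / h"
        by (auto simp: eventually_at intro!: exI[of _ 1])
    qed
    then show ?thesis unfolding 3 by (simp add: DERIV_def flatexp_def)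
  qed
qed

lemma smooth_flatexp: "smooth_fun (flatexp n)"
proof -
  have "Ck k (flatexp n)" for k n
  proof (induction k arbitrary: n)
    case 0
    show ?case using DERIV_isCont[OF flatexp_deriv] by (simp add: continuous_on_eq_continuous_at)
  next
    case (Suc k)
    have "Ck k (\<lambda>x. flatexp (n+2) x + (- real n) * flatexp (n+1) x)"
      by (intro Ck_add Ck_mult Ck_const Suc)
    then have "Ck k (\<lambda>x. flatexp (n+2) x - real n * flatexp (n+1) x)" by (simp only: mult_minus_left diff_conv_add_uminus)
    then show ?case by (rule Ck_SucI_real[OF flatexp_deriv])
  qed
  then show ?thesis by (simp add: smooth_fun_def)
qed

text \<open>As \<open>n\<close> grows, these increase to the indicator of the interval from \<open>a\<close> to \<open>b\<close>; the product of sines makes the second one 1-periodic.\<close>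
definition tbump :: "nat \<Rightarrow> real \<Rightarrow> real \<Rightarrow> real \<Rightarrow> real" where
  "tbump n a b t = flatexp 0 (real n * ((t - a) * (b - t)))"

definition xbump :: "nat \<Rightarrow> real \<Rightarrow> real \<Rightarrow> real \<Rightarrow> real" where
  "xbump n a b x = flatexp 0 (real n * (sin (pi * (x - a)) * sin (pi * (b - x))))"

lemma flatexp0_bounds: "0 \<le> flatexp 0 x" "flatexp 0 x \<le> 1"
  by (auto simp: flatexp_def)

lemma flatexp0_limit: "(\<lambda>n. flatexp 0 (real n * y)) \<longlonglongrightarrow> (if 0 < y then 1 else 0)"
proof (cases "0 < y")
  case True
  have "(\<lambda>n. 1 / exp (1 / (real n * y))) \<longlonglongrightarrow> 1 / exp 0"
  proof (intro tendsto_intros)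
    show "(\<lambda>n. 1 / (real n * y)) \<longlonglongrightarrow> 0"
      using tendsto_mult[OF lim_1_over_n tendsto_const[of "1/y"]] by (simp add: field_simps)
  qed simp
  then have "(\<lambda>n. flatexp 0 (real n * y)) \<longlonglongrightarrow> 1 / exp 0"
    by (rule Lim_transform_eventually)
      (use True in \<open>auto simp: flatexp_def eventually_sequentially intro!: exI[of _ 1]\<close>)
  then show ?thesis using True by simp
next
  case False
  then have "flatexp 0 (real n * y) = 0" for n by (auto simp: flatexp_def zero_less_mult_iff)
  then show ?thesis using False by simp
qed

lemma smooth_tbump: "smooth_fun (tbump n a b)"
  unfolding tbump_def[abs_def]
  by (intro smooth_compose[OF smooth_flatexp] smooth_mult smooth_diff smooth_const smooth_ident)

lemma smooth_xbump: "smooth_fun (xbump n a b)"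
  unfolding xbump_def[abs_def]
  by (intro smooth_compose[OF smooth_flatexp] smooth_mult smooth_diff smooth_const smooth_ident smooth_compose[OF smooth_trig(1)])

lemma xbump_periodic: "xbump n a b (x + 1) = xbump n a b x"
proof -
  have "sin (pi * (x + 1 - a)) = - sin (pi * (x - a))" 
    using sin_periodic_pi[of "pi * (x - a)"] by (simp add: algebra_simps)
  moreover have "sin (pi * (b - (x + 1))) = - sin (pi * (b - x))"
    using sin_periodic_pi[of "pi * (b - (x + 1))"] by (simp add: algebra_simps)
  ultimately show ?thesis by (simp add: xbump_def)
qed

lemma tbump_limit: "a < b \<Longrightarrow> (\<lambda>n. tbump n a b t) \<longlonglongrightarrow> indicator {a<..<b} t"
proof -
  assume "a < b"
  then have "0 < (t - a) * (b - t) \<longleftrightarrow> t \<in> {a<..<b}" by (auto simp: zero_less_mult_iff)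
  then show ?thesis unfolding tbump_def using flatexp0_limit[of "(t - a) * (b - t)"] by (auto simp: indicator_def split: if_splits)
qed

text \<open>Within one period both arguments, in units of pi, stay in [-1, 1], where a sine has the
  sign of its argument or vanishes; outside [a, b] one factor is negative and the other is
  not.\<close>

lemma sin_prod_pos_iff:
  assumes "0 \<le> a" "a < b" "b \<le> 1" "0 \<le> x" "x < 1"
  shows "0 < sin (pi * (x - a)) * sin (pi * (b - x)) \<longleftrightarrow> x \<in> {a<..<b}"
proof -
  have pos: "0 < sin (pi * y)" if "0 < y" "y < 1" for y using that by (intro sin_gt_zero) auto
  have neg: "sin (pi * y) < 0" if "-1 < y" "y < 0" for y using pos[of "-y"] that by simp
  consider "a < x" "x < b" | "x < a" | "x = a" | "x = b" | "b < x" by linarith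
  then show ?thesis
  proof cases
    case 1 then show ?thesis using pos[of "x - a"] pos[of "b - x"] assms by auto
  next
    case 2 
    have "sin (pi * (x - a)) < 0" using 2 assms by (intro neg) auto
    moreover have "0 \<le> sin (pi * (b - x))" using 2 assms by (intro sin_ge_zero) auto
    ultimately show ?thesis using 2 by (auto simp: zero_less_mult_iff)
  next
    case 5
    have "sin (pi * (b - x)) < 0" using 5 assms by (intro neg) auto
    moreover have "0 \<le> sin (pi * (x - a))" using 5 assms by (intro sin_ge_zero) auto
    ultimately show ?thesis using 5 by (auto simp: zero_less_mult_iff)
  qed auto
qed

lemma xbump_limit:
  assumes "0 \<le> a" "a < b" "b \<le> 1" "0 \<le> x" "x < 1"
  shows "(\<lambda>n. xbump n a b x) \<longlonglongrightarrow> indicator {a<..<b} x"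
  unfolding xbump_def using flatexp0_limit[of "sin (pi * (x - a)) * sin (pi * (b - x))"] sin_prod_pos_iff[OF assms]
  by (auto simp: indicator_def split: if_splits)

lemma ex_primitive:
  fixes f :: "real \<Rightarrow> real"
  assumes "continuous_on UNIV f"
  shows "\<exists>F. \<forall>x. (F has_real_derivative f x) (at x)"
proof -
  define F where "F x = (LBINT y=ereal 0..x. f y)" for x :: real
  have "(F has_real_derivative f x) (at x)" for x
  proof -
    \<comment> \<open>The interval contains the base point 0 and has x in its interior, so one
      application serves both signs of x.\<close>
    have "((\<lambda>u. LBINT y=ereal 0..u. f y) has_vector_derivative (f x)) (at x within {min 0 (x-1)..max 0 (x+1)})"
      by (rule interval_integral_FTC2) (use assms in \<open>auto intro: continuous_on_subset\<close>)
    moreover have "at x within {min 0 (x-1)..max 0 (x+1)} = at x"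
      by (rule at_within_interior) auto
    ultimately show ?thesis
      by (simp add: F_def[abs_def] has_real_derivative_iff_has_vector_derivative)
  qed
  then show ?thesis by blast
qed

section \<open>Space-time integrals and weak equations\<close>

abbreviation cylm :: "real \<Rightarrow> (real \<times> real) measure" where
  "cylm T \<equiv> lb 0 T \<Otimes>\<^sub>M lb 0 1"

lemma open_box_borel [measurable]: "{a<..<b} \<times> {c<..<d} \<in> sets (borel :: (real \<times> real) measure)"
  by (intro borel_open open_Times) auto

lemma cylm_density: "lb a b \<Otimes>\<^sub>M lb c d = density lborel (\<lambda>z. ennreal (indicator ({a<..<b} \<times> {c<..<d}) z))"
proof -
  have "lb a b \<Otimes>\<^sub>M lb c d = density (lborel \<Otimes>\<^sub>M lborel) (\<lambda>(x,y). ennreal (indicator {a<..<b} x) * ennreal (indicator {c<..<d} y))"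
    unfolding lb_def by (rule pair_measure_density) (auto intro!: sigma_finite_lborel lb.sigma_finite_measure_axioms[unfolded lb_def])
  also have "\<dots> = density lborel (\<lambda>z. ennreal (indicator ({a<..<b} \<times> {c<..<d}) z))"
  proof (subst lborel_prod, rule density_cong)
    show "(\<lambda>(x,y). ennreal (indicator {a<..<b} x) * ennreal (indicator {c<..<d} y)) \<in> borel_measurable lborel"
    proof -
      have "(\<lambda>(x,y). ennreal (indicator {a<..<b} x) * ennreal (indicator {c<..<d} y)) \<in> borel_measurable (borel \<Otimes>\<^sub>M borel)"
        by measurable
      then show ?thesis by (simp add: borel_prod)
    qed
  qed (auto simp: indicator_def)
  finally show ?thesis .
qed

lemma AE_cylm: "(AE z in lb a b \<Otimes>\<^sub>M lb c d. P z) \<longleftrightarrow> (AE z in lborel. z \<in> {a<..<b} \<times> {c<..<d} \<longrightarrow> P z)"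
  unfolding cylm_density by (subst AE_density) (auto split: split_indicator)

lemma AE_snd_neq: "AE z in (lborel::(real\<times>real) measure). snd z \<noteq> c"
proof -
  have "AE z in lborel \<Otimes>\<^sub>M lborel. snd z < (c::real) \<or> c < snd (z::real\<times>real)"
    by (rule lborel_pair.AE_pair_measure) (measurable, use AE_lborel_singleton[of c] in \<open>auto simp: neq_iff\<close>)
  then show ?thesis unfolding lborel_prod by eventually_elim auto
qed

text \<open>The line x = 0, which the half-open torus contains and the open interval does not, is
  null, and completion does not change almost-everywhere statements. All later work can thus use the
  Borel measure \<open>cylm T\<close>.\<close>

lemma AE_cyl_iff: "(AE z in lebesgue. z \<in> cyl T \<longrightarrow> P z) \<longleftrightarrow> (AE z in cylm T. P z)"
  unfolding AE_cylm AE_completion_iff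
proof
  assume "AE z in lborel. z \<in> {0<..<T} \<times> {0<..<1} \<longrightarrow> P z"
  with AE_snd_neq[of 0] show "AE z in lborel. z \<in> cyl T \<longrightarrow> P z"
    by eventually_elim (auto simp: cyl_def torus_def less_le)
next
  assume "AE z in lborel. z \<in> cyl T \<longrightarrow> P z"
  then show "AE z in lborel. z \<in> {0<..<T} \<times> {0<..<1} \<longrightarrow> P z"
    by eventually_elim (auto simp: cyl_def torus_def)
qed

lemma AE_torus_iff: "(AE x in lebesgue. x \<in> torus \<longrightarrow> P x) \<longleftrightarrow> (AE x in lb 0 1. P x)"
  unfolding AE_lb AE_completion_iff
proof
  assume "AE x in lborel. 0 < x \<and> x < 1 \<longrightarrow> P x"
  with AE_lborel_singleton[of 0] show "AE x in lborel. x \<in> torus \<longrightarrow> P x"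
    by eventually_elim (auto simp: torus_def less_le)
next
  assume "AE x in lborel. x \<in> torus \<longrightarrow> P x"
  then show "AE x in lborel. 0 < x \<and> x < 1 \<longrightarrow> P x"
    by eventually_elim (auto simp: torus_def)
qed

lemma AE_time_iff: "(AE t in lebesgue. t \<in> {0<..<T} \<longrightarrow> P t) \<longleftrightarrow> (AE t in lb 0 T. P t)"
  unfolding AE_lb AE_completion_iff by simp

text \<open>The exit from the completed measure: \<open>f\<close> is only Lebesgue measurable, but
  cut off to the cylinder it agrees almost everywhere with a Borel function, to which the density
  description of \<open>cylm T\<close> applies.\<close>

lemma cyl_transfer:
  fixes f f' :: "real \<times> real \<Rightarrow> real"
  assumes f: "set_integrable lebesgue (cyl T) f" and [measurable]: "f' \<in> borel_measurable (borel \<Otimes>\<^sub>M borel)"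
    and ae: "AE z in cylm T. f z = f' z"
  shows "integrable (cylm T) f'" "(LINT z:cyl T|lebesgue. f z) = integral\<^sup>L (cylm T) f'"
proof -
  let ?I = "\<lambda>z. indicator ({0<..<T} \<times> {0<..<1}) z * f' z"
  have m[measurable]: "?I \<in> borel_measurable borel" unfolding borel_prod[symmetric] by measurable
  have m': "f' \<in> borel_measurable lborel" using assms(2) unfolding borel_prod by simp
  have ae': "AE z in lebesgue. indicator (cyl T) z *\<^sub>R f z = ?I z"
    using ae AE_snd_neq[of 0] unfolding AE_cylm AE_completion_iff 
    by eventually_elim (auto simp: cyl_def torus_def indicator_def)
  have i: "integrable lebesgue ?I"
    by (rule integrable_cong_AE_imp[OF f[unfolded set_integrable_def]])
      (use ae' m in \<open>auto simp: measurable_completion eq_commute\<close>)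
  then have i2: "integrable lborel ?I" by (subst (asm) integrable_completion) auto
  then show "integrable (cylm T) f'" unfolding cylm_density using m' by (subst integrable_density) auto
  have "(LINT z:cyl T|lebesgue. f z) = integral\<^sup>L lebesgue ?I"
    unfolding set_lebesgue_integral_def
    by (rule integral_cong_AE) (use f ae' m in \<open>auto simp: set_integrable_def measurable_completion\<close>)
  also have "\<dots> = integral\<^sup>L lborel ?I" by (rule integral_completion) simp
  also have "\<dots> = integral\<^sup>L (cylm T) f'" unfolding cylm_density using m' by (subst integral_density) auto
  finally show "(LINT z:cyl T|lebesgue. f z) = integral\<^sup>L (cylm T) f'" .
qed

lemma torus_transfer:
  fixes f f' :: "real \<Rightarrow> real"
  assumes f: "set_integrable lebesgue torus f" and [measurable]: "f' \<in> borel_measurable borel"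
    and ae: "AE z in lb 0 1. f z = f' z"
  shows "integrable (lb 0 1) f'" "(LINT z:torus|lebesgue. f z) = integral\<^sup>L (lb 0 1) f'"
proof -
  let ?I = "\<lambda>z. indicator {0<..<1} z * f' z"
  have m: "?I \<in> borel_measurable borel" by measurable
  have ae': "AE z in lebesgue. indicator torus z *\<^sub>R f z = ?I z"
    using ae AE_lborel_singleton[of 0] unfolding AE_lb AE_completion_iff 
    by eventually_elim (auto simp: torus_def indicator_def)
  have i: "integrable lebesgue ?I"
    by (rule integrable_cong_AE_imp[OF f[unfolded set_integrable_def]])
      (use ae' m in \<open>auto simp: measurable_completion eq_commute\<close>)
  then have i2: "integrable lborel ?I" by (subst (asm) integrable_completion) auto
  then show "integrable (lb 0 1) f'" by (simp add: integrable_lb_iff set_integrable_def)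
  have "(LINT z:torus|lebesgue. f z) = integral\<^sup>L lebesgue ?I"
    unfolding set_lebesgue_integral_def
    by (rule integral_cong_AE) (use f ae' m in \<open>auto simp: set_integrable_def measurable_completion\<close>)
  also have "\<dots> = integral\<^sup>L lborel ?I" by (rule integral_completion) simp
  also have "\<dots> = integral\<^sup>L (lb 0 1) f'" by (simp add: integral_lb_eq set_lebesgue_integral_def)
  finally show "(LINT z:torus|lebesgue. f z) = integral\<^sup>L (lb 0 1) f'" .
qed

section \<open>Test functions of product form and scalar weak equations\<close>

lemma tensor_smooth: "smooth_fun \<eta> \<Longrightarrow> smooth_fun e \<Longrightarrow> smooth_fun (\<lambda>z::real\<times>real. \<eta> (fst z) * e (snd z))"
  by (rule smooth_mult[OF smooth_compose smooth_compose]) (auto intro!: smooth_linear bounded_linear_fst bounded_linear_snd)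

text \<open>Products of a function of time and a function of space are the only space-time test
  functions used. They reduce each weak equation to scalar equations in time, one for every spatial
  factor.\<close>

lemma tensor_derivs:
  assumes "smooth_fun \<eta>" "smooth_fun e"
  shows "dt (\<lambda>z. \<eta> (fst z) * e (snd z)) z = d1 \<eta> (fst z) * e (snd z)"
    "dx (\<lambda>z. \<eta> (fst z) * e (snd z)) z = \<eta> (fst z) * d1 e (snd z)"
proof -
  have 1: "((\<lambda>z::real\<times>real. \<eta> (fst z)) has_derivative (\<lambda>v. d1 \<eta> (fst z) * fst v)) (at z)"
    by (rule has_derivative_compose[OF has_derivative_fst[OF has_derivative_ident]  smooth_d1_works[OF assms(1), unfolded has_field_derivative_def]])
  have 2: "((\<lambda>z::real\<times>real. e (snd z)) has_derivative (\<lambda>v. d1 e (snd z) * snd v)) (at z)"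
    by (rule has_derivative_compose[OF has_derivative_snd[OF has_derivative_ident]  smooth_d1_works[OF assms(2), unfolded has_field_derivative_def]])
  have "frechet_derivative (\<lambda>z. \<eta> (fst z) * e (snd z)) (at z) = (\<lambda>v. \<eta> (fst z) * (d1 e (snd z) * snd v) + d1 \<eta> (fst z) * fst v * e (snd z))"
    by (rule frechet_derivative_at[symmetric, OF has_derivative_mult[OF 1 2]])
  then show "dt (\<lambda>z. \<eta> (fst z) * e (snd z)) z = d1 \<eta> (fst z) * e (snd z)"
    "dx (\<lambda>z. \<eta> (fst z) * e (snd z)) z = \<eta> (fst z) * d1 e (snd z)"
    by (simp_all add: dt_def dx_def)
qed

lemma smooth_measurable: "smooth_fun f \<Longrightarrow> f \<in> borel_measurable borel"
  by (rule borel_measurable_continuous_onI) (rule smooth_continuous)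

lemma smooth_integral:
  assumes f: "smooth_fun f" and "a \<le> b"
  shows "integrable (lb a b) (d1 f)" "f b - f a = integral\<^sup>L (lb a b) (d1 f)"
proof -
  have c: "continuous_on {a..b} (d1 f)" using smooth_continuous[OF smooth_d1[OF f]] by (rule continuous_on_subset) auto
  have [measurable]: "d1 f \<in> borel_measurable borel" by (rule smooth_measurable[OF smooth_d1[OF f]])
  obtain B where B: "\<And>x. x \<in> {a..b} \<Longrightarrow> norm (d1 f x) \<le> B"
    using compact_imp_bounded[OF compact_continuous_image[OF c compact_Icc]] unfolding bounded_iff by blast
  show i: "integrable (lb a b) (d1 f)" by (rule integrable_lb_bounded[where K=B]) (use B in auto)
  have "(d1 f has_integral (f b - f a)) {a..b}"
    by (rule fundamental_theorem_of_calculus[OF \<open>a \<le> b\<close>])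
      (auto intro!: has_field_derivative_at_within smooth_d1_works[OF f] simp: has_real_derivative_iff_has_vector_derivative[symmetric])
  then have hi: "(d1 f has_integral (f b - f a)) {a<..<b}"
    using has_integral_Icc_iff_Ioo by blast
  have "set_integrable lborel {a<..<b} (d1 f)" using i by (simp add: integrable_lb_iff)
  from set_borel_integral_eq_integral(2)[OF this] hi
  show "f b - f a = integral\<^sup>L (lb a b) (d1 f)"
    by (simp add: integral_lb_eq integral_unique)
qed

text \<open>Interior test functions only reach intervals away from 0 and T, so the conclusion is
  drawn on the intervals (\<open>d n\<close>, T - \<open>d n\<close>), which exhaust (0, T).\<close>

lemma AE_zero_if_intervals_zero:
  fixes f :: "real \<Rightarrow> real"
  assumes f: "integrable (lb 0 T) f" and z: "\<And>a b. 0 < a \<Longrightarrow> a < b \<Longrightarrow> b < T \<Longrightarrow> integral\<^sup>L (lb a b) f = 0"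
  shows "AE x in lb 0 T. f x = 0"
proof (cases "0 < T")
  case True
  \<comment> \<open>The summand 3 keeps \<open>d n\<close> below T / 2 already for n = 0.\<close>
  define d where "d n = T / (real n + 3)" for n :: nat
  have d: "0 < d n" "d n < T - d n" for n using True by (auto simp: d_def field_simps intro!: add_pos_nonneg)
  have "AE x in lb (d n) (T - d n). f x = 0" for n
  proof (rule AE_zero_if_primitive_zero)
    show "integrable (lb (d n) (T - d n)) f" by (rule integrable_lb_subset[OF f]) (use d[of n] in auto)
    show "integral\<^sup>L (lb (d n) x) f = 0" if "d n \<le> x" "x \<le> T - d n" for x
      using z[of "d n" x] d[of n] that by (cases "x = d n") auto
  qed
  then have "AE x in lborel. \<forall>n. d n < x \<and> x < T - d n \<longrightarrow> f x = 0"
    unfolding AE_lb AE_all_countable by blast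
  then show ?thesis unfolding AE_lb
  proof eventually_elim
    case (elim x)
    show ?case
    proof
      assume x: "0 < x \<and> x < T"
      define m where "m = min x (T - x)"
      have m: "0 < m" using x by (auto simp: m_def)
      obtain n where n: "T / m < real n" using reals_Archimedean2 by blast
      then have "T < real n * m" using m by (simp add: field_simps)
      then have "T < (real n + 3) * m" using m by (simp add: algebra_simps)
      then have "d n < m" unfolding d_def by (simp add: field_simps)
      then have "d n < x" "d n < T - x" by (auto simp: m_def)
      then show "f x = 0" using elim by (auto simp: algebra_simps)
    qed
  qed
qed (auto simp: AE_lb)

lemma weak_zero:
  fixes f :: "real \<Rightarrow> real"
  assumes f: "integrable (lb 0 T) f" 
    and z: "\<And>n a b. 0 < a \<Longrightarrow> a < b \<Longrightarrow> b < T \<Longrightarrow> (\<integral>t. f t * tbump n a b t \<partial>lb 0 T) = 0"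
  shows "AE x in lb 0 T. f x = 0"
proof (rule AE_zero_if_intervals_zero[OF f])
  fix a b :: real assume ab: "0 < a" "a < b" "b < T"
  have [measurable]: "f \<in> borel_measurable borel" by (rule integrable_lb_measurable[OF f])
  have [measurable]: "tbump n a b \<in> borel_measurable borel" for n by (rule smooth_measurable[OF smooth_tbump])
  have "(\<lambda>n. \<integral>t. f t * tbump n a b t \<partial>lb 0 T) \<longlonglongrightarrow> (\<integral>t. f t * indicator {a<..<b} t \<partial>lb 0 T)"
  proof (rule integral_dominated_convergence[where w="\<lambda>t. \<bar>f t\<bar>"])
    show "AE t in lb 0 T. (\<lambda>n. f t * tbump n a b t) \<longlonglongrightarrow> f t * indicator {a<..<b} t"
      using tbump_limit[OF ab(2)] by (auto intro!: tendsto_intros)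
    show "AE t in lb 0 T. norm (f t * tbump n a b t) \<le> \<bar>f t\<bar>" for n
      using flatexp0_bounds by (auto simp: abs_mult tbump_def intro!: mult_left_le)
  qed (use f in auto)
  moreover have "(\<integral>t. f t * tbump n a b t \<partial>lb 0 T) = 0" for n using z ab by auto
  ultimately have "(\<integral>t. f t * indicator {a<..<b} t \<partial>lb 0 T) = 0" by (simp add: LIMSEQ_const_iff)
  then show "integral\<^sup>L (lb a b) f = 0"
    using ab by (subst integral_lb_restrict[where a=0 and b=T]) (auto simp: mult.commute)
qed

text \<open>In distributions A' = B with A(0) = A0, so the defect A - A0 - (primitive of B) should
  annihilate every bump. Each bump is the derivative of an admissible test function, and integration
  by parts moves that derivative onto the primitive of B.\<close>

lemma weak_ode:
  fixes A B :: "real \<Rightarrow> real"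
  assumes A: "integrable (lb 0 T) A" and B: "integrable (lb 0 T) B"
    and w: "\<And>\<eta> T'. smooth_fun \<eta> \<Longrightarrow> T' < T \<Longrightarrow> (\<And>t. T' \<le> t \<Longrightarrow> \<eta> t = 0) \<Longrightarrow>
        (\<integral>t. A t * d1 \<eta> t + B t * \<eta> t \<partial>lb 0 T) + A0 * \<eta> 0 = 0"
  shows "AE t in lb 0 T. A t = A0 + integral\<^sup>L (lb 0 t) B"
proof -
  have [measurable]: "A \<in> borel_measurable borel" "B \<in> borel_measurable borel"
    using A B by (auto intro: integrable_lb_measurable)
  have ib: "integrable (lb 0 T) (\<lambda>t. integral\<^sup>L (lb 0 t) B)"
    by (rule integrable_lb_bounded[where K="\<integral>x. \<bar>B x\<bar> \<partial>lb 0 T"]) (auto intro!: abs_integral_lb_le[OF B])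
  have iD: "integrable (lb 0 T) (\<lambda>t. A t - A0 - integral\<^sup>L (lb 0 t) B)" using A ib by auto
  have "AE t in lb 0 T. A t - A0 - integral\<^sup>L (lb 0 t) B = 0"
  proof (rule weak_zero[OF iD])
    fix n and a b :: real assume ab: "0 < a" "a < b" "b < T"
    let ?e = "tbump n a b"
    obtain F where F: "\<And>x. (F has_real_derivative ?e x) (at x)"
      using ex_primitive[OF smooth_continuous[OF smooth_tbump]] by blast
    have sF: "smooth_fun F" by (rule smooth_primitive[OF F smooth_tbump])
    \<comment> \<open>F is constant beyond the support of the bump, so subtracting
      \<open>F T\<close> makes \<eta> vanish from b on, as admissibility demands. \<eta> need not
      vanish at 0: this is how \<open>A0\<close> enters.\<close>
    define \<eta> where "\<eta> t = F t - F T" for t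
    have s\<eta>: "smooth_fun \<eta>" unfolding \<eta>_def[abs_def] by (intro smooth_diff sF smooth_const)
    have D\<eta>: "d1 \<eta> = ?e"
    proof
      fix x show "d1 \<eta> x = ?e x" unfolding \<eta>_def[abs_def]
        by (rule d1_eq) (auto intro!: derivative_eq_intros F)
    qed
    have e0: "?e t = 0" if "b \<le> t" for t 
      using that ab by (auto simp: tbump_def flatexp_def zero_less_mult_iff)
    have \<eta>0: "\<eta> t = 0" if t: "b \<le> t" for t
    proof -
      have "F t = F b" if t: "b \<le> t" for t
      proof (cases "t = b")
        case False
        with t have "b < t" by simp
        obtain z where "b < z" "F t - F b = (t - b) * ?e z" using MVT2[OF \<open>b < t\<close>, of F ?e] F by auto
        then show ?thesis using e0[of z] by simp
      qed simp
      from this[OF t] this[of T] ab show ?thesis by (simp add: \<eta>_def)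
    qed
    have W: "(\<integral>t. A t * ?e t + B t * \<eta> t \<partial>lb 0 T) + A0 * \<eta> 0 = 0"
      using w[OF s\<eta> ab(3) \<eta>0] D\<eta> by simp
    have ebd: "\<bar>?e t\<bar> \<le> 1" for t using flatexp0_bounds by (simp add: tbump_def)
    have [measurable]: "?e \<in> borel_measurable borel" "\<eta> \<in> borel_measurable borel"
      using smooth_measurable s\<eta> smooth_tbump by auto
    have ie: "integrable (lb 0 T) ?e" by (rule integrable_lb_bounded[where K=1]) (use ebd in auto)
    have \<eta>rep: "\<eta> 0 + integral\<^sup>L (lb 0 t) ?e = \<eta> t" if "0 \<le> t" for t
      using smooth_integral(2)[OF s\<eta> that] by (simp add: D\<eta>)
    have T0: "0 \<le> T" using ab by simp
    note P = primitive_product(1)[OF B ie T0, of "\<eta> 0"] primitive_product(2)[OF B ie T0, of 0] primitive_product(3)[OF B ie T0, of 0 "\<eta> 0"]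
    have iA: "integrable (lb 0 T) (\<lambda>t. A t * ?e t)" by (rule integrable_mult_bounded[OF A, where K=1]) (use ebd in auto)
    have iB\<eta>: "integrable (lb 0 T) (\<lambda>t. B t * \<eta> t)"
      by (rule integrable_cong_AE_imp[OF P(1)]) (use \<eta>rep in \<open>auto simp: AE_lb\<close>)
    have "(\<integral>t. B t * \<eta> t \<partial>lb 0 T) + (\<integral>t. integral\<^sup>L (lb 0 t) B * ?e t \<partial>lb 0 T) = 
      (\<integral>t. B t * (\<eta> 0 + integral\<^sup>L (lb 0 t) ?e) \<partial>lb 0 T) + (\<integral>t. (0 + integral\<^sup>L (lb 0 t) B) * ?e t \<partial>lb 0 T)"
      by (intro arg_cong2[where f="(+)"] integral_cong_AE) (use \<eta>rep in \<open>auto simp: AE_lb\<close>)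
    also have "\<dots> = integral\<^sup>L (lb 0 T) B * \<eta> T"
      using P(3) \<eta>rep[OF T0] unfolding Bochner_Integration.integral_add[OF P(1,2)] by simp
    also have "\<dots> = 0" using \<eta>0[of T] ab by simp
    finally have 1: "(\<integral>t. B t * \<eta> t \<partial>lb 0 T) = - (\<integral>t. integral\<^sup>L (lb 0 t) B * ?e t \<partial>lb 0 T)" by simp
    have 2: "\<eta> 0 = - integral\<^sup>L (lb 0 T) ?e" using \<eta>rep[OF T0] \<eta>0[of T] ab by simp
    have iI: "integrable (lb 0 T) (\<lambda>t. integral\<^sup>L (lb 0 t) B * ?e t)" using P(2) by simp
    have "(\<integral>t. (A t - A0 - integral\<^sup>L (lb 0 t) B) * ?e t \<partial>lb 0 T) = (\<integral>t. A t * ?e t - A0 * ?e t - integral\<^sup>L (lb 0 t) B * ?e t \<partial>lb 0 T)"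
      by (simp add: algebra_simps)
    also have "\<dots> = (\<integral>t. A t * ?e t \<partial>lb 0 T) - A0 * integral\<^sup>L (lb 0 T) ?e - (\<integral>t. integral\<^sup>L (lb 0 t) B * ?e t \<partial>lb 0 T)"
      using iA ie iI by simp
    also have "\<dots> = 0" using W iA iB\<eta> 1 2 by simp
    finally show "(\<integral>t. (A t - A0 - integral\<^sup>L (lb 0 t) B) * ?e t \<partial>lb 0 T) = 0" .
  qed
  then show ?thesis by eventually_elim simp
qed

section \<open>Periodic functions and spatial primitives\<close>

lemma measure_lb_UNIV [simp]: "a \<le> b \<Longrightarrow> measure (lb a b) UNIV = b - a"
  by (simp add: measure_def)

text \<open>The device for exchanging quantifiers: rational labels, endpoints or translates share
  one null set of times, and continuity then supplies all the others.\<close>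

lemma continuous_zero_if_rat_zero:
  fixes g :: "real \<Rightarrow> real"
  assumes "continuous_on {a..b} g" "\<And>x. x \<in> \<rat> \<Longrightarrow> a < x \<Longrightarrow> x < b \<Longrightarrow> g x = 0" "a < b" "x \<in> {a..b}"
  shows "g x = 0"
proof -
  have "closure ({a<..<b} \<inter> \<rat>) = closure {a<..<b}"
    by (rule closure_open_Int_superset) (auto simp: Rats_closure_real)
  then have "closure ({a<..<b} \<inter> \<rat>) = {a..b}" using \<open>a < b\<close> by simp
  then show ?thesis
    using continuous_constant_on_closure[of "{a<..<b} \<inter> \<rat>" g 0 x] assms by auto
qed

lemma lb_shift:
  fixes f :: "real \<Rightarrow> real"
  assumes [measurable]: "f \<in> borel_measurable borel"
  shows "integrable (lb (a+c) (b+c)) f \<longleftrightarrow> integrable (lb a b) (\<lambda>x. f (x + c))"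
    "integral\<^sup>L (lb (a+c) (b+c)) f = integral\<^sup>L (lb a b) (\<lambda>x. f (x + c))"
proof -
  have e: "indicator {a+c<..<b+c} (c + 1 * x) *\<^sub>R f (c + 1 * x) = indicator {a<..<b} x *\<^sub>R f (x + c)" for x
    by (auto simp: indicator_def add.commute)
  show "integrable (lb (a+c) (b+c)) f \<longleftrightarrow> integrable (lb a b) (\<lambda>x. f (x + c))"
    using lborel_integrable_real_affine_iff[of 1 "\<lambda>x. indicator {a+c<..<b+c} x *\<^sub>R f x" c]
    unfolding e by (simp add: integrable_lb_iff set_integrable_def)
  show "integral\<^sup>L (lb (a+c) (b+c)) f = integral\<^sup>L (lb a b) (\<lambda>x. f (x + c))"
    using lborel_integral_real_affine[of 1 "\<lambda>x. indicator {a+c<..<b+c} x *\<^sub>R f x" c]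
    unfolding e by (simp add: integral_lb_eq set_lebesgue_integral_def)
qed

lemma integrable_lb_combine:
  fixes f :: "real \<Rightarrow> real"
  assumes "integrable (lb a b) f" "integrable (lb b c) f" "a \<le> b" "b \<le> c"
  shows "integrable (lb a c) f"
proof -
  have [measurable]: "f \<in> borel_measurable borel" by (rule integrable_lb_measurable[OF assms(1)])
  have "integrable lborel (\<lambda>x. indicator {a<..<b} x *\<^sub>R f x + indicator {b<..<c} x *\<^sub>R f x)"
    using assms(1,2) by (simp add: integrable_lb_iff set_integrable_def)
  then have "integrable lborel (\<lambda>x. indicator {a<..<c} x *\<^sub>R f x)"
  proof (rule integrable_cong_AE_imp)
    show "AE x in lborel. indicat_real {a<..<b} x *\<^sub>R f x + indicat_real {b<..<c} x *\<^sub>R f x = indicat_real {a<..<c} x *\<^sub>R f x"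
      using AE_lborel_singleton[of b] by eventually_elim (use assms in \<open>auto simp: indicator_def\<close>)
  qed measurable
  then show ?thesis by (simp add: integrable_lb_iff set_integrable_def)
qed

lemma periodic_of_int:
  assumes "\<And>x::real. p (x + 1) = p x" shows "p (x + of_int n) = p x"
proof (induction n)
  case (nonneg n) show ?case
  proof (induction n)
    case (Suc n)
    then show ?case using assms[of "x + of_int (int n)"] by (simp add: add.assoc add.commute[of 1])
  qed simp
next
  case (neg n) show ?case
  proof (induction n)
    case 0 then show ?case using assms[of "x - 1"] by simp
  next
    case (Suc n)
    then show ?case using assms[of "x + of_int (- int (Suc (Suc n)))"] by (simp add: algebra_simps)
  qed
qed

lemma periodic_frac: 
  assumes "\<And>x::real. p (x + 1) = p x" shows "p (frac x) = p x"
  using periodic_of_int[where p=p, OF assms, of x "- \<lfloor>x\<rfloor>"] by (simp add: frac_def)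

lemma periodic_integrable:
  fixes p :: "real \<Rightarrow> real"
  assumes per: "\<And>x. p (x + 1) = p x" and i: "integrable (lb 0 1) p"
  shows "integrable (lb a b) p"
proof -
  have [measurable]: "p \<in> borel_measurable borel" by (rule integrable_lb_measurable[OF i])
  have sh: "(\<lambda>x. p (x + of_int n)) = p" for n using periodic_of_int[where p=p, OF per] by auto
  have unit: "integrable (lb (of_int n) (of_int n + 1)) p" for n
    using lb_shift(1)[of p 0 "of_int n" 1] i by (simp add: sh add.commute)
  have "integrable (lb (- real k) (real k)) p" for k
  proof (induction k)
    case 0
    have "AE x in lb 0 0. p x = 0" by (simp add: AE_lb)
    then have "integrable (lb 0 0) p" by (subst integrable_cong_AE[where g="\<lambda>_. 0"]) auto
    then show ?case by simp
  next
    case (Suc k)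
    have 1: "integrable (lb (- real (Suc k)) (- real k)) p" using unit[of "- int (Suc k)"] by simp
    have 2: "integrable (lb (real k) (real (Suc k))) p" using unit[of "int k"] by (simp add: add.commute)
    show ?case
      by (rule integrable_lb_combine[OF integrable_lb_combine[OF 1 Suc] 2]) auto
  qed
  moreover obtain k where "real k > max \<bar>a\<bar> \<bar>b\<bar>" using reals_Archimedean2 by blast
  ultimately show ?thesis by (intro integrable_lb_subset[of "- real k" "real k" p a b]) auto
qed

text \<open>The window of length one contains an integer after its left end; cut there and move the
  right piece back by one period.\<close>

lemma periodic_integral:
  fixes p :: "real \<Rightarrow> real"
  assumes per: "\<And>x. p (x + 1) = p x" and i: "integrable (lb 0 1) p"
  shows "integral\<^sup>L (lb z (z+1)) p = integral\<^sup>L (lb 0 1) p"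
proof -
  have [measurable]: "p \<in> borel_measurable borel" by (rule integrable_lb_measurable[OF i])
  have sh: "(\<lambda>x. p (x + of_int n)) = p" for n using periodic_of_int[where p=p, OF per] by auto
  define n where "n = \<lfloor>z\<rfloor>"
  have n: "of_int n \<le> z" "z < of_int n + 1" by (simp_all add: n_def)
  note I = periodic_integrable[OF per i]
  have "integral\<^sup>L (lb z (z+1)) p = integral\<^sup>L (lb z (of_int n + 1)) p + integral\<^sup>L (lb (of_int n + 1) (z + 1)) p"
    by (rule integral_lb_combine[OF I]) (use n in auto)
  also have "integral\<^sup>L (lb (of_int n + 1) (z + 1)) p = integral\<^sup>L (lb (of_int n) z) p"
    using lb_shift(2)[of p "of_int n" 1 z] by (simp add: per)
  also have "integral\<^sup>L (lb z (of_int n + 1)) p + integral\<^sup>L (lb (of_int n) z) p = integral\<^sup>L (lb (of_int n) (of_int n + 1)) p"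
    using integral_lb_combine[OF I, of "of_int n" z "of_int n + 1"] n by simp
  also have "\<dots> = integral\<^sup>L (lb 0 1) p"
    using lb_shift(2)[of p 0 "of_int n" 1] by (simp add: sh add.commute)
  finally show ?thesis .
qed

text \<open>Because \<open>p\<close> has mean zero, the integral from 0 to \<open>frac x\<close>
  does not jump at the integers: it is periodic and still a primitive of \<open>p\<close> on the
  whole line.\<close>

lemma periodic_primitive:
  fixes p :: "real \<Rightarrow> real"
  assumes per: "\<And>x. p (x + 1) = p x" and i: "integrable (lb 0 1) p" and z: "integral\<^sup>L (lb 0 1) p = 0" and "x \<le> y"
  shows "integral\<^sup>L (lb 0 (frac y)) p - integral\<^sup>L (lb 0 (frac x)) p = integral\<^sup>L (lb x y) p"
proof -
  have [measurable]: "p \<in> borel_measurable borel" by (rule integrable_lb_measurable[OF i])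
  note I = periodic_integrable[OF per i]
  have sh: "(\<lambda>x. p (x + of_int n)) = p" for n using periodic_of_int[where p=p, OF per] by auto
  have fr: "integral\<^sup>L (lb 0 (frac x)) p = integral\<^sup>L (lb (of_int \<lfloor>x\<rfloor>) x) p" for x
    using lb_shift(2)[of p 0 "of_int \<lfloor>x\<rfloor>" "frac x"] by (simp add: sh frac_def)
  have zero: "integral\<^sup>L (lb (of_int m) (of_int m + real k)) p = 0" for m k
  proof (induction k)
    case (Suc k)
    have "integral\<^sup>L (lb (of_int m) (of_int m + real (Suc k))) p
      = integral\<^sup>L (lb (of_int m) (of_int m + real k)) p + integral\<^sup>L (lb (of_int m + real k) ((of_int m + real k) + 1)) p"
      using integral_lb_combine[OF I, of "of_int m" "of_int m + real k" "of_int m + real (Suc k)"] by (simp add: add.assoc add.commute[of 1])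
    then show ?case using Suc periodic_integral[OF per i, of "of_int m + real k"] z by simp
  qed simp
  have "\<lfloor>x\<rfloor> \<le> \<lfloor>y\<rfloor>" using \<open>x \<le> y\<close> by (rule floor_mono)
  then obtain k where k: "\<lfloor>y\<rfloor> = \<lfloor>x\<rfloor> + int k" using zle_iff_zadd by blast
  have "integral\<^sup>L (lb (of_int \<lfloor>x\<rfloor>) y) p = integral\<^sup>L (lb (of_int \<lfloor>x\<rfloor>) (of_int \<lfloor>y\<rfloor>)) p + integral\<^sup>L (lb (of_int \<lfloor>y\<rfloor>) y) p"
    by (rule integral_lb_combine[OF I]) (use \<open>\<lfloor>x\<rfloor> \<le> \<lfloor>y\<rfloor>\<close> in auto)
  also have "integral\<^sup>L (lb (of_int \<lfloor>x\<rfloor>) (of_int \<lfloor>y\<rfloor>)) p = 0" unfolding k using zero[of "\<lfloor>x\<rfloor>" k] by simp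
  finally have "integral\<^sup>L (lb 0 (frac y)) p = integral\<^sup>L (lb (of_int \<lfloor>x\<rfloor>) y) p" by (simp add: fr)
  moreover have "integral\<^sup>L (lb (of_int \<lfloor>x\<rfloor>) y) p = integral\<^sup>L (lb (of_int \<lfloor>x\<rfloor>) x) p + integral\<^sup>L (lb x y) p"
    by (rule integral_lb_combine[OF I]) (use \<open>x \<le> y\<close> in auto)
  ultimately show ?thesis by (simp add: fr)
qed

lemma test_torus_d1: "test_torus e \<Longrightarrow> test_torus (d1 e)"
proof -
  assume e: "test_torus e"
  have "d1 e (x + 1) = d1 e x" for x
  proof -
    have "((\<lambda>x. e (x + 1)) has_real_derivative d1 e (x + 1)) (at x)"
      using e by (intro DERIV_shift[THEN iffD1] smooth_d1_works) (auto simp: test_torus_def)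
    moreover have "(\<lambda>x. e (x + 1)) = e" using e by (auto simp: test_torus_def)
    ultimately show ?thesis by (metis d1_eq)
  qed
  then show ?thesis using e smooth_d1 by (auto simp: test_torus_def)
qed

lemma test_torus_bounded: "test_torus e \<Longrightarrow> \<exists>K\<ge>0. \<forall>x. \<bar>e x\<bar> \<le> K"
proof -
  assume e: "test_torus e"
  have c: "continuous_on {0..1} e" using smooth_continuous e unfolding test_torus_def by (auto intro: continuous_on_subset)
  obtain B where B: "\<And>x. x \<in> {0..1} \<Longrightarrow> norm (e x) \<le> B"
    using compact_imp_bounded[OF compact_continuous_image[OF c compact_Icc]] unfolding bounded_iff by blast
  have "\<bar>e x\<bar> \<le> B" for x
    using B[of "frac x"] periodic_frac[of e x] e frac_lt_1[of x] by (auto simp: test_torus_def less_imp_le)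
  then show ?thesis by (intro exI[of _ "\<bar>B\<bar>"]) (auto intro: order_trans[OF _ abs_ge_self])
qed

lemma test_torus_measurable: "test_torus e \<Longrightarrow> e \<in> borel_measurable borel"
  by (auto simp: test_torus_def smooth_measurable)

lemma test_torus_const: "test_torus (\<lambda>x. c)"
  by (simp add: test_torus_def smooth_const)

text \<open>By periodicity of \<open>p\<close> the difference e(x+1) - e(x) is constant, and it
  equals the mean of \<open>p\<close>, which is zero.\<close>

lemma test_torus_primitive:
  assumes s: "smooth_fun p" and per: "\<And>x. p (x + 1) = p x" and z: "integral\<^sup>L (lb 0 1) p = 0"
  shows "\<exists>e. test_torus e \<and> d1 e = p \<and> e 0 = 0"
proof -
  obtain F where F: "\<And>x. (F has_real_derivative p x) (at x)"
    using ex_primitive[OF smooth_continuous[OF s]] by blast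
  define e where "e x = F x - F 0" for x
  have D: "(e has_real_derivative p x) (at x)" for x
    unfolding e_def[abs_def] by (auto intro!: derivative_eq_intros F)
  have se: "smooth_fun e" by (rule smooth_primitive[OF D s])
  have d: "d1 e = p" using d1_eq[OF D] by auto
  have 1: "e 1 = e 0" using smooth_integral(2)[OF se, of 0 1] z by (simp add: d)
  have "((\<lambda>x. e (x + 1) - e x) has_real_derivative 0) (at x)" for x
    using DERIV_shift[THEN iffD1, OF D[of "x+1"]] D[of x] per[of x] by (auto intro!: derivative_eq_intros)
  then have "e (x + 1) - e x = e (0 + 1) - e 0" for x
    by (intro DERIV_isconst_all[of "\<lambda>x. e (x + 1) - e x"]) auto
  with 1 se have "test_torus e" by (simp add: test_torus_def)
  then show ?thesis using d by (intro exI[of _ e]) (simp add: e_def)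
qed

section \<open>Weak spatial derivatives as primitives on time slices\<close>

lemma xbump_bounds: "\<bar>xbump n a b x\<bar> \<le> 1"
  using flatexp0_bounds by (simp add: xbump_def)

lemma ex_xbump_primitive:
  "\<exists>e. test_torus e \<and> d1 e = (\<lambda>x. xbump n a b x - integral\<^sup>L (lb 0 1) (xbump n a b)) \<and> e 0 = 0"
proof (rule test_torus_primitive)
  show "smooth_fun (\<lambda>x. xbump n a b x - integral\<^sup>L (lb 0 1) (xbump n a b))"
    by (intro smooth_diff smooth_xbump smooth_const)
  have "integrable (lb 0 1) (xbump n a b)"
    by (rule integrable_lb_bounded[where K=1]) (auto simp: xbump_bounds smooth_measurable smooth_xbump)
  then show "(\<integral>x. xbump n a b x - integral\<^sup>L (lb 0 1) (xbump n a b) \<partial>lb 0 1) = 0" by simp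
qed (simp add: xbump_periodic)

text \<open>For rational b these are countably many test functions, so a single null set of times
  serves them all. Their derivatives are the bumps on (0, b) up to an additive constant, the price
  of periodicity.\<close>

definition xprim :: "nat \<Rightarrow> real \<Rightarrow> real \<Rightarrow> real" where
  "xprim n b = (SOME e. test_torus e \<and> d1 e = (\<lambda>x. xbump n 0 b x - integral\<^sup>L (lb 0 1) (xbump n 0 b)) \<and> e 0 = 0)"

lemma xprim: "test_torus (xprim n b)" "d1 (xprim n b) = (\<lambda>x. xbump n 0 b x - integral\<^sup>L (lb 0 1) (xbump n 0 b))"
  using someI_ex[OF ex_xbump_primitive[of n 0 b]] by (auto simp: xprim_def)

text \<open>The additive constant is found by averaging both sides. The difference \<open>r\<close>
  of the two sides has mean zero and is orthogonal to the derivatives of \<open>xprim\<close>, hence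
  to the bumps themselves, since constants are harmless for a function of mean zero. Letting the
  bumps tend to indicators kills the primitive of \<open>r\<close> at rational points.\<close>

lemma slice_primitive:
  fixes f g :: "real \<Rightarrow> real"
  assumes f: "integrable (lb 0 1) f" and g: "integrable (lb 0 1) g" and g0: "integral\<^sup>L (lb 0 1) g = 0"
    and w: "\<And>n b. b \<in> \<rat> \<Longrightarrow> (\<integral>x. f x * d1 (xprim n b) x \<partial>lb 0 1) = - (\<integral>x. g x * xprim n b x \<partial>lb 0 1)"
  shows "AE x in lb 0 1. f x = (integral\<^sup>L (lb 0 1) f - (\<integral>y. integral\<^sup>L (lb 0 y) g \<partial>lb 0 1)) + integral\<^sup>L (lb 0 x) g"
proof -
  have [measurable]: "f \<in> borel_measurable borel" "g \<in> borel_measurable borel"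
    using f g by (auto intro: integrable_lb_measurable)
  define G where "G x = integral\<^sup>L (lb 0 x) g" for x
  have [measurable]: "G \<in> borel_measurable borel" unfolding G_def by measurable
  have iG: "integrable (lb 0 1) G"
    unfolding G_def by (rule integrable_lb_bounded[where K="\<integral>x. \<bar>g x\<bar> \<partial>lb 0 1"]) (auto intro!: abs_integral_lb_le[OF g])
  define m where "m = integral\<^sup>L (lb 0 1) f - integral\<^sup>L (lb 0 1) G"
  define r where "r x = f x - m - G x" for x
  have [measurable]: "r \<in> borel_measurable borel" unfolding r_def by measurable
  have ir: "integrable (lb 0 1) r" unfolding r_def using f iG by simp
  have r0: "integral\<^sup>L (lb 0 1) r = 0" unfolding r_def using f iG by (simp add: m_def)
  have rb: "(\<integral>x. r x * xbump n 0 b x \<partial>lb 0 1) = 0" if b: "b \<in> \<rat>" for n b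
  proof -
    let ?e = "xprim n b"
    have se: "smooth_fun ?e" using xprim(1) by (auto simp: test_torus_def)
    obtain K where K: "\<And>x. \<bar>?e x\<bar> \<le> K" using test_torus_bounded[OF xprim(1)] by blast
    obtain K' where K': "\<And>x. \<bar>d1 ?e x\<bar> \<le> K'" using test_torus_bounded[OF test_torus_d1[OF xprim(1)]] by blast
    have [measurable]: "?e \<in> borel_measurable borel" "d1 ?e \<in> borel_measurable borel"
      by (auto intro!: test_torus_measurable xprim test_torus_d1)
    have ie: "integrable (lb 0 1) (d1 ?e)" using smooth_integral(1)[OF se, of 0 1] by simp
    have rep: "?e 0 + integral\<^sup>L (lb 0 x) (d1 ?e) = ?e x" if "0 \<le> x" for x using smooth_integral(2)[OF se that] by simp
    note P = primitive_product(1)[OF g ie zero_le_one, of "?e 0"] primitive_product(2)[OF g ie zero_le_one, of 0] primitive_product(3)[OF g ie zero_le_one, of 0 "?e 0"]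
    have "(\<integral>x. g x * ?e x \<partial>lb 0 1) + (\<integral>x. G x * d1 ?e x \<partial>lb 0 1) =
       (\<integral>x. g x * (?e 0 + integral\<^sup>L (lb 0 x) (d1 ?e)) \<partial>lb 0 1) + (\<integral>x. (0 + integral\<^sup>L (lb 0 x) g) * d1 ?e x \<partial>lb 0 1)"
      by (intro arg_cong2[where f="(+)"] integral_cong_AE) (use rep in \<open>auto simp: AE_lb G_def\<close>)
    also have "\<dots> = 0" using P(3) g0 unfolding Bochner_Integration.integral_add[OF P(1,2)] by simp
    finally have 1: "(\<integral>x. G x * d1 ?e x \<partial>lb 0 1) = - (\<integral>x. g x * ?e x \<partial>lb 0 1)" by simp
    have if1: "integrable (lb 0 1) (\<lambda>x. f x * d1 ?e x)" by (rule integrable_mult_bounded[OF f, where K=K']) (use K' in auto)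
    have iG1: "integrable (lb 0 1) (\<lambda>x. G x * d1 ?e x)" by (rule integrable_mult_bounded[OF iG, where K=K']) (use K' in auto)
    have e1: "integral\<^sup>L (lb 0 1) (d1 ?e) = 0"
      using smooth_integral(2)[OF se, of 0 1] xprim(1)[of n b] by (auto simp: test_torus_def dest: spec[of _ 0])
    have "(\<integral>x. r x * d1 ?e x \<partial>lb 0 1) = (\<integral>x. f x * d1 ?e x - m * d1 ?e x - G x * d1 ?e x \<partial>lb 0 1)"
      by (simp add: r_def algebra_simps)
    also have "\<dots> = 0" using if1 iG1 ie e1 w[OF b, of n] 1 by simp
    finally have "(\<integral>x. r x * xbump n 0 b x - r x * integral\<^sup>L (lb 0 1) (xbump n 0 b) \<partial>lb 0 1) = 0"
      by (simp add: xprim(2) algebra_simps)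
    moreover have "integrable (lb 0 1) (\<lambda>x. r x * xbump n 0 b x)"
      by (rule integrable_mult_bounded[OF ir, where K=1]) (auto simp: xbump_bounds smooth_measurable smooth_xbump)
    ultimately show ?thesis using ir r0 by simp
  qed
  have rr: "integral\<^sup>L (lb 0 b) r = 0" if b: "b \<in> \<rat>" "0 < b" "b \<le> 1" for b
  proof -
    have [measurable]: "xbump n 0 b \<in> borel_measurable borel" for n by (rule smooth_measurable[OF smooth_xbump])
    have "(\<lambda>n. \<integral>t. r t * xbump n 0 b t \<partial>lb 0 1) \<longlonglongrightarrow> (\<integral>t. r t * indicator {0<..<b} t \<partial>lb 0 1)"
    proof (rule integral_dominated_convergence[where w="\<lambda>t. \<bar>r t\<bar>"])
      show "AE t in lb 0 1. (\<lambda>n. r t * xbump n 0 b t) \<longlonglongrightarrow> r t * indicator {0<..<b} t"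
        by (rule AE_lbI) (use xbump_limit[of 0 b] b in \<open>auto intro!: tendsto_intros\<close>)
      show "AE t in lb 0 1. norm (r t * xbump n 0 b t) \<le> \<bar>r t\<bar>" for n
        using xbump_bounds by (auto simp: abs_mult intro!: mult_left_le)
    qed (use ir in auto)
    then have "(\<integral>t. r t * indicator {0<..<b} t \<partial>lb 0 1) = 0" using rb[OF b(1)] by (simp add: LIMSEQ_const_iff)
    then show ?thesis using b by (subst integral_lb_restrict[where a=0 and b=1]) (auto simp: mult.commute)
  qed
  have cr: "continuous_on {0..1} (\<lambda>x. integral\<^sup>L (lb 0 x) r)" by (rule integral_lb_zero_continuous[OF ir])
  have "AE x in lb 0 1. r x = 0"
  proof (rule AE_zero_if_primitive_zero[OF ir])
    fix x :: real assume "0 \<le> x" "x \<le> 1"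
    then show "integral\<^sup>L (lb 0 x) r = 0"
      by - (rule continuous_zero_if_rat_zero[OF cr, of x], auto intro: rr)
  qed
  then show ?thesis by eventually_elim (simp add: r_def m_def G_def[abs_def])
qed

lemma integrable_mult_bounded':
  fixes f g :: "'a \<Rightarrow> real"
  assumes "integrable M f" "g \<in> borel_measurable M" "\<And>x. \<bar>g x\<bar> \<le> K"
  shows "integrable M (\<lambda>x. f x * g x)"
  using assms by (intro integrable_mult_bounded[where K=K]) auto

lemma tensor_fubini:
  fixes f :: "real \<times> real \<Rightarrow> real" and \<eta> e :: "real \<Rightarrow> real"
  assumes f: "integrable (lb a b \<Otimes>\<^sub>M lb c d) f"
    and [measurable]: "\<eta> \<in> borel_measurable borel" "e \<in> borel_measurable borel"
    and "\<And>x. \<bar>\<eta> x\<bar> \<le> K" "\<And>x. \<bar>e x\<bar> \<le> K'"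
  shows "integrable (lb a b) (\<lambda>t. \<integral>x. f (t, x) * e x \<partial>lb c d)"
    "integrable (lb a b \<Otimes>\<^sub>M lb c d) (\<lambda>z. f z * (\<eta> (fst z) * e (snd z)))"
    "integral\<^sup>L (lb a b \<Otimes>\<^sub>M lb c d) (\<lambda>z. f z * (\<eta> (fst z) * e (snd z))) = (\<integral>t. (\<integral>x. f (t, x) * e x \<partial>lb c d) * \<eta> t \<partial>lb a b)"
proof -
  have i1: "integrable (lb a b \<Otimes>\<^sub>M lb c d) (\<lambda>z. f z * e (snd z))"
    by (rule integrable_mult_bounded'[OF f, where K=K']) (use assms in auto)
  then show "integrable (lb a b) (\<lambda>t. \<integral>x. f (t, x) * e x \<partial>lb c d)"
    using lb2.integrable_fst'[OF i1] by simp
  have "integrable (lb a b \<Otimes>\<^sub>M lb c d) (\<lambda>z. f z * e (snd z) * \<eta> (fst z))"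
    by (rule integrable_mult_bounded'[OF i1, where K=K]) (use assms in auto)
  then show i2: "integrable (lb a b \<Otimes>\<^sub>M lb c d) (\<lambda>z. f z * (\<eta> (fst z) * e (snd z)))" by (simp add: ac_simps)
  show "integral\<^sup>L (lb a b \<Otimes>\<^sub>M lb c d) (\<lambda>z. f z * (\<eta> (fst z) * e (snd z))) = (\<integral>t. (\<integral>x. f (t, x) * e x \<partial>lb c d) * \<eta> t \<partial>lb a b)"
    unfolding lb2.integral_fst'[OF i2, symmetric]
    by (simp only: fst_conv snd_conv mult.commute[of "\<eta> _"] mult.assoc[symmetric] integral_mult_left_zero)
qed

text \<open>\<open>slice_primitive\<close> applies at almost every time. At times where the slice of
  \<open>g\<close> is not integrable or has nonzero mean both functions are set to 0, so that
  periodicity and the primitive relation hold at every time. The clause that \<open>G\<close> is 0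
  or a value of \<open>g\<close> lets pointwise bounds on \<open>g\<close> survive the
  modification.\<close>

lemma weak_dx_primitive:
  fixes f g :: "real \<times> real \<Rightarrow> real"
  assumes f: "integrable (cylm T) f" and g: "integrable (cylm T) g"
    and [measurable]: "f \<in> borel_measurable (borel \<Otimes>\<^sub>M borel)" "g \<in> borel_measurable (borel \<Otimes>\<^sub>M borel)"
    and w: "\<And>\<eta> e a b. smooth_fun \<eta> \<Longrightarrow> 0 < a \<Longrightarrow> b < T \<Longrightarrow> (\<And>t. t \<le> a \<or> b \<le> t \<Longrightarrow> \<eta> t = 0) \<Longrightarrow> test_torus e \<Longrightarrow>
       integral\<^sup>L (cylm T) (\<lambda>z. f z * (\<eta> (fst z) * d1 e (snd z))) = - integral\<^sup>L (cylm T) (\<lambda>z. g z * (\<eta> (fst z) * e (snd z)))"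
  shows "\<exists>F G. F \<in> borel_measurable (borel \<Otimes>\<^sub>M borel) \<and> G \<in> borel_measurable (borel \<Otimes>\<^sub>M borel) \<and>
    (\<forall>t x. F (t, x + 1) = F (t, x)) \<and> (\<forall>t x. G (t, x + 1) = G (t, x)) \<and>
    (AE z in cylm T. F z = f z) \<and> (AE z in cylm T. G z = g z) \<and>
    (\<forall>t x. G (t, x) = 0 \<or> G (t, x) = g (t, frac x)) \<and>
    (\<forall>t x y. integrable (lb x y) (\<lambda>x. G (t, x))) \<and>
    (\<forall>t x y. x \<le> y \<longrightarrow> F (t, y) - F (t, x) = (\<integral>x. G (t, x) \<partial>lb x y))"
proof -
  define good where "good t \<longleftrightarrow> integrable (lb 0 1) (\<lambda>x. g (t, x)) \<and> (\<integral>x. g (t, x) \<partial>lb 0 1) = 0" for t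
  have gi: "integrable (lb 0 1) (\<lambda>x. g (t, x)) \<longleftrightarrow> (\<integral>\<^sup>+x. ennreal \<bar>g (t, x)\<bar> \<partial>lb 0 1) < \<infinity>" for t
    unfolding integrable_iff_bounded by simp
  have [measurable]: "Measurable.pred borel good"
    unfolding good_def gi by measurable
  define G where "G = (\<lambda>(t, x). if good t then g (t, frac x) else 0)"
  define m where "m t = (\<integral>x. f (t, x) \<partial>lb 0 1) - (\<integral>y. (\<integral>x. g (t, x) \<partial>lb 0 y) \<partial>lb 0 1)" for t
  define F where "F = (\<lambda>(t, x). if good t then m t + (\<integral>x. g (t, x) \<partial>lb 0 (frac x)) else 0)"
  have [measurable]: "m \<in> borel_measurable borel" unfolding m_def by measurable
  have [measurable]: "(frac :: real \<Rightarrow> real) \<in> borel_measurable borel" unfolding frac_def[abs_def] by measurable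
  have mF: "F \<in> borel_measurable (borel \<Otimes>\<^sub>M borel)" unfolding F_def by measurable
  have mG: "G \<in> borel_measurable (borel \<Otimes>\<^sub>M borel)" unfolding G_def by measurable
  have e: "AE t in lb 0 T. (\<integral>x. f (t, x) * d1 e x \<partial>lb 0 1) = - (\<integral>x. g (t, x) * e x \<partial>lb 0 1)" if e: "test_torus e" for e
  proof -
    have [measurable]: "e \<in> borel_measurable borel" "d1 e \<in> borel_measurable borel"
      by (auto intro!: test_torus_measurable e test_torus_d1)
    obtain K where K: "\<And>x. \<bar>e x\<bar> \<le> K" using test_torus_bounded[OF e] by blast
    obtain K' where K': "\<And>x. \<bar>d1 e x\<bar> \<le> K'" using test_torus_bounded[OF test_torus_d1[OF e]] by blast
    note tf = tensor_fubini[OF f, of _ "d1 e" 1 K'] and tg = tensor_fubini[OF g, of _ e 1 K]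
    have z: "(\<lambda>x::real. 0::real) \<in> borel_measurable borel" by simp
    have i1: "integrable (lb 0 T) (\<lambda>t. \<integral>x. f (t, x) * d1 e x \<partial>lb 0 1)" by (rule tf(1)[OF z]) (use K' in auto)
    have i2: "integrable (lb 0 T) (\<lambda>t. \<integral>x. g (t, x) * e x \<partial>lb 0 1)" by (rule tg(1)[OF z]) (use K in auto)
    have "AE t in lb 0 T. (\<integral>x. f (t, x) * d1 e x \<partial>lb 0 1) + (\<integral>x. g (t, x) * e x \<partial>lb 0 1) = 0"
    proof (rule weak_zero)
      show "integrable (lb 0 T) (\<lambda>t. (\<integral>x. f (t, x) * d1 e x \<partial>lb 0 1) + (\<integral>x. g (t, x) * e x \<partial>lb 0 1))"
        using i1 i2 by simp
      fix n and a b :: real assume ab: "0 < a" "a < b" "b < T"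
      let ?\<eta> = "tbump n a b"
      have [measurable]: "?\<eta> \<in> borel_measurable borel" by (rule smooth_measurable[OF smooth_tbump])
      have \<eta>1: "\<bar>?\<eta> t\<bar> \<le> 1" for t using flatexp0_bounds by (simp add: tbump_def)
      have \<eta>0: "?\<eta> t = 0" if "t \<le> a \<or> b \<le> t" for t
        using that ab by (auto simp: tbump_def flatexp_def zero_less_mult_iff)
      have "integral\<^sup>L (cylm T) (\<lambda>z. f z * (?\<eta> (fst z) * d1 e (snd z))) = - integral\<^sup>L (cylm T) (\<lambda>z. g z * (?\<eta> (fst z) * e (snd z)))"
        by (rule w[OF smooth_tbump ab(1,3) \<eta>0 e])
      then have "(\<integral>t. (\<integral>x. f (t, x) * d1 e x \<partial>lb 0 1) * ?\<eta> t \<partial>lb 0 T) + (\<integral>t. (\<integral>x. g (t, x) * e x \<partial>lb 0 1) * ?\<eta> t \<partial>lb 0 T) = 0"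
        using tf(3)[of ?\<eta>] tg(3)[of ?\<eta>] K K' \<eta>1 by simp
      moreover have "integrable (lb 0 T) (\<lambda>t. (\<integral>x. f (t, x) * d1 e x \<partial>lb 0 1) * ?\<eta> t)"
        "integrable (lb 0 T) (\<lambda>t. (\<integral>x. g (t, x) * e x \<partial>lb 0 1) * ?\<eta> t)"
        using i1 i2 \<eta>1 by (auto intro!: integrable_mult_bounded'[where K=1])
      ultimately show "(\<integral>t. ((\<integral>x. f (t, x) * d1 e x \<partial>lb 0 1) + (\<integral>x. g (t, x) * e x \<partial>lb 0 1)) * ?\<eta> t \<partial>lb 0 T) = 0"
        by (simp add: distrib_right)
    qed
    then show ?thesis by eventually_elim simp
  qed
  \<comment> \<open>The constant test function yields the zero mean of the slices of
    \<open>g\<close>, without which their primitives would not be periodic.\<close>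
  have d1c: "d1 (\<lambda>x. 1) = (\<lambda>x. 0)" by (auto intro!: d1_eq)
  have 1: "AE t in lb 0 T. (\<integral>x. g (t, x) \<partial>lb 0 1) = 0"
    using e[OF test_torus_const[of 1]] by eventually_elim (simp add: d1c)
  have cnt: "countable (UNIV \<times> \<rat> :: (nat \<times> real) set)" by (intro countable_SIGMA countable_rat) auto
  have 2: "AE t in lb 0 T. \<forall>nb \<in> UNIV \<times> \<rat>. (\<integral>x. f (t, x) * d1 (xprim (fst nb) (snd nb)) x \<partial>lb 0 1) = - (\<integral>x. g (t, x) * xprim (fst nb) (snd nb) x \<partial>lb 0 1)"
    by (subst AE_ball_countable[OF cnt]) (auto intro!: e xprim)
  have slices: "AE t in lb 0 T. good t \<and> (AE x in lb 0 1. f (t, x) = m t + (\<integral>x. g (t, x) \<partial>lb 0 x))"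
    using lb2.AE_integrable_fst'[OF f] lb2.AE_integrable_fst'[OF g] 1 2
  proof eventually_elim
    case (elim t)
    then have "AE x in lb 0 1. f (t, x) = m t + (\<integral>x. g (t, x) \<partial>lb 0 x)"
      unfolding m_def by (intro slice_primitive) auto
    with elim show ?case by (simp add: good_def)
  qed
  have fr: "frac x = x" if "0 < x" "x < 1" for x :: real using that by (simp add: frac_eq)
  have aF: "AE z in cylm T. F z = f z"
  proof (rule lb2.AE_pair_measure)
    show "{z \<in> space (cylm T). F z = f z} \<in> sets (cylm T)" using mF by measurable
    show "AE t in lb 0 T. AE x in lb 0 1. F (t, x) = f (t, x)"
      using slices
    proof eventually_elim
      case (elim t)
      then have "AE x in lb 0 1. f (t, x) = m t + (\<integral>x. g (t, x) \<partial>lb 0 x)" by simp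
      with AE_lb_in show ?case by eventually_elim (use elim in \<open>auto simp: F_def fr\<close>)
    qed
  qed
  have aG: "AE z in cylm T. G z = g z"
  proof (rule lb2.AE_pair_measure)
    show "{z \<in> space (cylm T). G z = g z} \<in> sets (cylm T)" using mG by measurable
    show "AE t in lb 0 T. AE x in lb 0 1. G (t, x) = g (t, x)"
      using slices
    proof eventually_elim
      case (elim t)
      show ?case using AE_lb_in by eventually_elim (use elim in \<open>auto simp: G_def fr\<close>)
    qed
  qed
  have frac1: "frac (x + 1) = frac x" for x :: real by (simp add: frac_def)
  have Gper: "G (t, x + 1) = G (t, x)" for t x by (simp add: G_def frac1)
  have Gi01: "integrable (lb 0 1) (\<lambda>x. G (t, x))" for t
  proof (cases "good t")
    case True
    then have "integrable (lb 0 1) (\<lambda>x. g (t, x))" by (simp add: good_def)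
    then show ?thesis
      by (rule integrable_cong_AE_imp) (use True mG in \<open>auto simp: AE_lb G_def fr\<close>)
  qed (simp add: G_def)
  have G0: "(\<integral>x. G (t, x) \<partial>lb 0 1) = 0" for t
  proof (cases "good t")
    case True
    then have "(\<integral>x. G (t, x) \<partial>lb 0 1) = (\<integral>x. g (t, x) \<partial>lb 0 1)"
      by (intro integral_cong_AE) (use True mG in \<open>auto simp: AE_lb G_def fr\<close>)
    with True show ?thesis by (simp add: good_def)
  qed (simp add: G_def)
  have FG: "F (t, y) - F (t, x) = (\<integral>x. G (t, x) \<partial>lb x y)" if "x \<le> y" for t x y
  proof (cases "good t")
    case True
    have "(\<integral>x. G (t, x) \<partial>lb 0 (frac x)) = (\<integral>x. g (t, x) \<partial>lb 0 (frac x))" for x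
      by (intro integral_cong_AE) (use True mG frac_lt_1[of x] in \<open>auto simp: AE_lb G_def fr\<close>)
    then show ?thesis using True periodic_primitive[OF Gper[of t] Gi01[of t] G0[of t] that] by (simp add: F_def)
  qed (simp add: F_def G_def)
  show ?thesis
    by (intro exI[of _ F] exI[of _ G] conjI mF mG aF aG allI impI FG periodic_integrable[OF Gper Gi01])
       (auto simp: F_def G_def frac1)
qed

section \<open>The flow of the velocity field\<close>

text \<open>If the good set missed a subinterval, that subinterval, of positive length, would lie in
  a null set. Density lets inequalities between continuous functions pass from almost every to every
  time.\<close>

lemma AE_lb_closure:
  assumes "AE t in lb a b. P t" "a < b"
  shows "closure {t \<in> {a<..<b}. P t} = {a..b}"
proof -
  have ex: "\<exists>t. p < t \<and> t < q \<and> P t" if "a \<le> p" "q \<le> b" "p < q" for p q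
  proof (rule ccontr)
    assume "\<not> ?thesis"
    then have "AE t in lb p q. False"
      using AE_lb_mono[OF assms(1), of p q] that AE_lb_in[of p q] by (auto elim: AE_mp)
    then have "emeasure (lb p q) UNIV = 0" by (subst (asm) AE_iff_measurable[of UNIV]) auto
    then show False using that by simp
  qed
  have "{a<..<b} \<subseteq> closure {t \<in> {a<..<b}. P t}"
  proof
    fix t assume t: "t \<in> {a<..<b}"
    show "t \<in> closure {t \<in> {a<..<b}. P t}" unfolding closure_approachable
    proof (intro allI impI)
      fix e :: real assume "0 < e"
      with ex[of "max a (t - e)" t] t obtain s where "max a (t - e) < s" "s < t" "P s" by auto
      then show "\<exists>y\<in>{t \<in> {a<..<b}. P t}. dist y t < e"
        using t by (intro bexI[of _ s]) (auto simp: dist_real_def)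
    qed
  qed
  then have "closure {a<..<b} \<subseteq> closure {t \<in> {a<..<b}. P t}" by (rule closure_minimal) simp
  moreover have "closure {t \<in> {a<..<b}. P t} \<subseteq> closure {a<..<b}" by (rule closure_mono) auto
  ultimately show ?thesis using assms(2) by auto
qed

lemma AE_lb_continuous_le:
  fixes f :: "real \<Rightarrow> real"
  assumes "AE t in lb a b. f t \<le> C" "a < b" "continuous_on {a..b} f" "t \<in> {a..b}"
  shows "f t \<le> C"
proof (rule continuous_le_on_closure[where f=f and x=t and a=C and S="{t \<in> {a<..<b}. f t \<le> C}"])
  show "continuous_on (closure {t \<in> {a<..<b}. f t \<le> C}) f" "t \<in> closure {t \<in> {a<..<b}. f t \<le> C}"
    unfolding AE_lb_closure[OF assms(1,2)] using assms by auto
qed auto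

lemma AE_lb_continuous_eq:
  fixes f g :: "real \<Rightarrow> real"
  assumes "AE t in lb a b. f t = g t" "a < b" "continuous_on {a..b} f" "continuous_on {a..b} g" "t \<in> {a..b}"
  shows "f t = g t"
proof -
  have "f t - g t \<le> 0"
    by (rule AE_lb_continuous_le[where a=a and b=b and f="\<lambda>t. f t - g t"]) (use assms in \<open>auto intro!: continuous_intros elim: AE_mp\<close>)
  moreover have "g t - f t \<le> 0"
    by (rule AE_lb_continuous_le[where a=a and b=b and f="\<lambda>t. g t - f t"]) (use assms in \<open>auto intro!: continuous_intros elim: AE_mp\<close>)
  ultimately show ?thesis by simp
qed

lemma primitive_power_fact:
  fixes k :: "real \<Rightarrow> real"
  assumes k: "integrable (lb p t) k" and "p \<le> t"
  shows "integrable (lb p t) (\<lambda>s. k s * (integral\<^sup>L (lb p s) k ^ n / fact n))"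
    "(\<integral>s. k s * (integral\<^sup>L (lb p s) k ^ n / fact n) \<partial>lb p t) = integral\<^sup>L (lb p t) k ^ Suc n / fact (Suc n)"
proof -
  note P = primitive_power[OF k assms(2), of n]
  have eq: "k s * (integral\<^sup>L (lb p s) k ^ n / fact n) = (real (Suc n) * integral\<^sup>L (lb p s) k ^ n * k s) / fact (Suc n)" for s
    unfolding fact_Suc by (simp del: of_nat_Suc)
  show "integrable (lb p t) (\<lambda>s. k s * (integral\<^sup>L (lb p s) k ^ n / fact n))"
    unfolding eq using P by (intro integrable_divide_zero) auto
  show "(\<integral>s. k s * (integral\<^sup>L (lb p s) k ^ n / fact n) \<partial>lb p t) = integral\<^sup>L (lb p t) k ^ Suc n / fact (Suc n)"
    unfolding eq unfolding integral_divide_zero conjunct2[OF P, symmetric] ..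
qed

text \<open>All bounds and the primitive relation are demanded at every point because they are
  evaluated along trajectories, and a single trajectory is a null set of space-time.
  \<open>U\<close> makes trajectories Lipschitz in time and \<open>L\<close> makes the field
  Lipschitz in space; the square of \<open>L\<close> is what the energy estimate integrates.\<close>

locale velocity =
  fixes T :: real and u ux :: "real \<times> real \<Rightarrow> real" and L :: "real \<Rightarrow> real" and U :: real
  assumes T_pos: "0 < T"
    and u_meas [measurable]: "u \<in> borel_measurable (borel \<Otimes>\<^sub>M borel)"
    and ux_meas [measurable]: "ux \<in> borel_measurable (borel \<Otimes>\<^sub>M borel)"
    and u_per: "\<And>t x. u (t, x + 1) = u (t, x)"
    and ux_per: "\<And>t x. ux (t, x + 1) = ux (t, x)"
    and u_bd: "\<And>t x. \<bar>u (t, x)\<bar> \<le> U"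
    and ux_bd: "\<And>t x. \<bar>ux (t, x)\<bar> \<le> L t"
    and L_meas [measurable]: "L \<in> borel_measurable borel"
    and L2_int: "integrable (lb 0 T) (\<lambda>t. (L t)\<^sup>2)"
    and u_prim: "\<And>t x y. x \<le> y \<Longrightarrow> u (t, y) - u (t, x) = (\<integral>x. ux (t, x) \<partial>lb x y)"
begin

lemma L_nonneg: "0 \<le> L t"
  using ux_bd[of t 0] by linarith

lemma U_nonneg: "0 \<le> U"
  using u_bd[of 0 0] by linarith

lemma L_int: "integrable (lb 0 T) L"
proof (rule Bochner_Integration.integrable_bound)
  show "integrable (lb 0 T) (\<lambda>t. 1 + (L t)\<^sup>2)" using L2_int by simp
  have "L t \<le> 1 + (L t)\<^sup>2" for t
    using zero_le_power2[of "L t - 1"] L_nonneg[of t] by (simp add: power2_diff)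
  then show "AE t in lb 0 T. norm (L t) \<le> norm (1 + (L t)\<^sup>2)" using L_nonneg by auto
qed simp

lemma u_lip: "\<bar>u (t, y) - u (t, x)\<bar> \<le> L t * \<bar>y - x\<bar>"
proof (induction x y rule: linorder_wlog)
  case (le x y)
  then show ?case
    unfolding u_prim[OF le] using integral_lb_bound[OF le, of "\<lambda>x. ux (t, x)" "L t"] ux_bd by simp
next
  case (sym x y)
  then show ?case by (simp add: abs_minus_commute)
qed

lemma u_cont: "continuous_on UNIV (\<lambda>x. u (t, x))"
proof -
  have "(L t)-lipschitz_on UNIV (\<lambda>x. u (t, x))"
    using u_lip L_nonneg by (intro lipschitz_onI) (auto simp: dist_real_def abs_minus_commute)
  then show ?thesis by (rule lipschitz_on_continuous_on)
qed

definition solves :: "real \<Rightarrow> (real \<Rightarrow> real) \<Rightarrow> bool" where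
  "solves t0 Z \<longleftrightarrow> Z \<in> borel_measurable borel \<and> (\<forall>t. t0 \<le> t \<longrightarrow> t \<le> T \<longrightarrow> Z t = Z t0 + (\<integral>s. u (s, Z s) \<partial>lb t0 t))"

lemma solvesI:
  assumes "Z \<in> borel_measurable borel" "\<And>t. t0 \<le> t \<Longrightarrow> t \<le> T \<Longrightarrow> Z t = Z t0 + (\<integral>s. u (s, Z s) \<partial>lb t0 t)"
  shows "solves t0 Z"
  unfolding solves_def using assms by blast

lemma solvesD:
  assumes "solves t0 Z"
  shows "Z \<in> borel_measurable borel" "t0 \<le> t \<Longrightarrow> t \<le> T \<Longrightarrow> Z t = Z t0 + (\<integral>s. u (s, Z s) \<partial>lb t0 t)"
  using assms unfolding solves_def by blast+

lemma u_along_int: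
  assumes [measurable]: "Z \<in> borel_measurable borel"
  shows "integrable (lb a b) (\<lambda>s. u (s, Z s))"
  by (rule integrable_lb_bounded[where K=U]) (auto simp: u_bd)

lemma solves_diff:
  assumes Z: "solves t0 Z" and "t0 \<le> s" "s \<le> t" "t \<le> T"
  shows "Z t = Z s + (\<integral>s. u (s, Z s) \<partial>lb s t)"
proof -
  have [measurable]: "Z \<in> borel_measurable borel" by (rule solvesD(1)[OF Z])
  have "Z t = Z t0 + (\<integral>s. u (s, Z s) \<partial>lb t0 t)" "Z s = Z t0 + (\<integral>s. u (s, Z s) \<partial>lb t0 s)"
    by (rule solvesD(2)[OF Z]; use assms in simp)+
  moreover have "(\<integral>s. u (s, Z s) \<partial>lb t0 t) = (\<integral>s. u (s, Z s) \<partial>lb t0 s) + (\<integral>s. u (s, Z s) \<partial>lb s t)"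
    by (rule integral_lb_combine[OF u_along_int]) (use assms in auto)
  ultimately show ?thesis by simp
qed

lemma solves_restrict: "solves t0 Z \<Longrightarrow> t0 \<le> s \<Longrightarrow> solves s Z"
  by (rule solvesI, erule solvesD, erule solves_diff)

lemma solves_lip:
  assumes "solves t0 Z" "t0 \<le> s" "s \<le> t" "t \<le> T"
  shows "\<bar>Z t - Z s\<bar> \<le> U * (t - s)"
  using solves_diff[OF assms] integral_lb_bound[OF assms(3), of "\<lambda>s. u (s, Z s)" U] u_bd by simp

lemma solves_cont:
  assumes "solves t0 Z" shows "continuous_on {t0..T} Z"
proof -
  have "U-lipschitz_on {t0..T} Z"
  proof (rule lipschitz_onI)
    fix s t assume st: "s \<in> {t0..T}" "t \<in> {t0..T}"
    show "dist (Z s) (Z t) \<le> U * dist s t"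
      using solves_lip[OF assms, of s t] solves_lip[OF assms, of t s] st
      by (cases "s \<le> t") (auto simp: dist_real_def abs_minus_commute)
  qed (rule U_nonneg)
  then show ?thesis by (rule lipschitz_on_continuous_on)
qed

text \<open>At once uniqueness, Lipschitz dependence on the starting point, and the fact that
  trajectories which meet at some time stay together afterwards; the last use is why
  \<open>t0\<close> is arbitrary.\<close>

lemma solves_gronwall:
  assumes Z: "solves t0 Z" and W: "solves t0 W" and t0: "0 \<le> t0" and t: "t0 \<le> t" "t \<le> T"
  shows "\<bar>Z t - W t\<bar> \<le> \<bar>Z t0 - W t0\<bar> * exp (integral\<^sup>L (lb 0 T) L)"
proof (cases "t0 = T")
  case True
  then have "t = t0" using t by simp
  have "0 \<le> integral\<^sup>L (lb 0 T) L" using L_nonneg by (intro Bochner_Integration.integral_nonneg) auto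
  then show ?thesis using \<open>t = t0\<close> by (simp add: mult_le_cancel_left1)
next
  case False
  then have t0T: "t0 < T" using t by simp
  have [measurable]: "Z \<in> borel_measurable borel" "W \<in> borel_measurable borel" by (rule solvesD(1)[OF Z], rule solvesD(1)[OF W])
  \<comment> \<open>Extended by 0 before \<open>t0\<close>, the distance satisfies its integral
    inequality on all of (0, T), which is the form required by \<open>gronwall_AE\<close>.\<close>
  define f where "f t = (if t0 \<le> t then \<bar>Z t - W t\<bar> else 0)" for t
  define c where "c = \<bar>Z t0 - W t0\<bar>"
  have [measurable]: "f \<in> borel_measurable borel" unfolding f_def by measurable
  have fM: "f t \<le> c + 2 * U * T" if "t \<le> T" for t
  proof (cases "t0 \<le> t")
    case True
    have "\<bar>Z t - Z t0\<bar> \<le> U * (t - t0)" "\<bar>W t - W t0\<bar> \<le> U * (t - t0)"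
      using solves_lip[OF Z, of t0 t] solves_lip[OF W, of t0 t] True that by auto
    moreover have "U * (t - t0) \<le> U * T" using that t0 U_nonneg by (intro mult_left_mono) auto
    ultimately show ?thesis using True by (simp add: f_def c_def)
  next
    case False
    then show ?thesis using U_nonneg T_pos by (simp add: f_def c_def)
  qed
  have ineq: "f t \<le> c + (\<integral>s. L s * f s \<partial>lb 0 t)" if t: "0 < t" "t < T" for t
  proof (cases "t0 \<le> t")
    case True
    have iLf: "integrable (lb 0 t) (\<lambda>s. L s * f s)"
      by (rule integrable_mult_bounded[OF integrable_lb_subset[OF L_int], where K="c + 2 * U * T"])
         (use t fM in \<open>auto simp: AE_lb f_def\<close>)
    have e: "Z t - W t = (Z t0 - W t0) + (\<integral>s. u (s, Z s) - u (s, W s) \<partial>lb t0 t)"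
      using solvesD(2)[OF Z True] solvesD(2)[OF W True] t
      by (subst Bochner_Integration.integral_diff) (auto intro!: u_along_int)
    have "\<bar>\<integral>s. u (s, Z s) - u (s, W s) \<partial>lb t0 t\<bar> \<le> (\<integral>s. \<bar>u (s, Z s) - u (s, W s)\<bar> \<partial>lb t0 t)"
      by (rule integral_abs_bound)
    also have "\<dots> \<le> (\<integral>s. L s * f s \<partial>lb t0 t)"
    proof (rule integral_mono_AE)
      show "integrable (lb t0 t) (\<lambda>s. L s * f s)" by (rule integrable_lb_subset[OF iLf]) (use t0 in auto)
      show "AE s in lb t0 t. \<bar>u (s, Z s) - u (s, W s)\<bar> \<le> L s * f s"
        by (rule AE_lbI) (use u_lip in \<open>auto simp: f_def\<close>)
    qed (simp add: u_along_int)
    also have "\<dots> \<le> (\<integral>s. L s * f s \<partial>lb 0 t)"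
    proof -
      have "0 \<le> (\<integral>s. L s * f s \<partial>lb 0 t0)" using L_nonneg by (intro Bochner_Integration.integral_nonneg) (auto simp: f_def)
      then show ?thesis using integral_lb_combine[OF iLf t0 True] by simp
    qed
    finally show ?thesis using e True by (simp add: f_def c_def)
  next
    case False
    have "0 \<le> (\<integral>s. L s * f s \<partial>lb 0 t)" using L_nonneg by (intro Bochner_Integration.integral_nonneg) (auto simp: f_def)
    then show ?thesis using False by (simp add: f_def c_def)
  qed
  have "AE t in lb 0 T. f t \<le> c * exp (integral\<^sup>L (lb 0 T) L)"
    by (rule gronwall_AE[OF L_int L_nonneg, where M="c + 2 * U * T"])
      (use fM ineq in \<open>auto simp: AE_lb c_def f_def\<close>)
  then have "AE t in lb t0 T. f t \<le> c * exp (integral\<^sup>L (lb 0 T) L)" by (rule AE_lb_mono) (use t0 in auto)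
  then have "AE t in lb t0 T. \<bar>Z t - W t\<bar> \<le> c * exp (integral\<^sup>L (lb 0 T) L)"
    using AE_lb_in[of t0 T] by eventually_elim (auto simp: f_def)
  then show ?thesis unfolding c_def
    by (rule AE_lb_continuous_le[OF _ t0T]) (use t solves_cont[OF Z] solves_cont[OF W] in \<open>auto intro!: continuous_intros\<close>)
qed

section \<open>The flow by Picard iteration\<close>

fun picard :: "nat \<Rightarrow> real \<times> real \<Rightarrow> real" where
  "picard 0 z = snd z"
| "picard (Suc n) z = snd z + (\<integral>s. u (s, picard n (s, snd z)) \<partial>lb 0 (fst z))"

text \<open>As a limit of jointly measurable iterates, the flow is jointly measurable in time and
  label, which choosing a solution separately for each label would not give. Its values matter only
  for 0 \<le> t \<le> T.\<close>

definition X :: "real \<times> real \<Rightarrow> real" where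
  "X z = lim (\<lambda>n. picard n z)"

lemma picard_meas [measurable]: "picard n \<in> borel_measurable (borel \<Otimes>\<^sub>M borel)"
proof (induction n)
  case 0
  have "picard 0 = snd" by auto
  then show ?case by simp
next
  case (Suc n)
  note Suc[measurable]
  have "picard (Suc n) = (\<lambda>z. snd z + (\<integral>s. u (s, picard n (s, snd z)) \<partial>lb 0 (fst z)))" by auto
  then show ?case by simp
qed

lemma X_meas [measurable]: "X \<in> borel_measurable (borel \<Otimes>\<^sub>M borel)"
  unfolding X_def[abs_def] by measurable

text \<open>The first increment is at most U T, and each further step integrates once more against
  \<open>L\<close>; \<open>primitive_power_fact\<close> turns this into the terms of an exponential
  series.\<close>

lemma picard_diff:
  assumes "0 \<le> t" "t \<le> T"
  shows "\<bar>picard (Suc n) (t, a) - picard n (t, a)\<bar> \<le> U * T * (integral\<^sup>L (lb 0 t) L ^ n / fact n)"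
  using assms
proof (induction n arbitrary: t)
  case 0
  have "\<bar>\<integral>s. u (s, a) \<partial>lb 0 t\<bar> \<le> U * (t - 0)"
    by (rule integral_lb_bound) (use 0 u_bd in auto)
  also have "\<dots> \<le> U * T" using 0 U_nonneg by (auto intro: mult_left_mono)
  finally show ?case by simp
next
  case (Suc n)
  have Lt: "integrable (lb 0 t) L" by (rule integrable_lb_subset[OF L_int]) (use Suc.prems in auto)
  note P = primitive_power_fact[OF Lt Suc.prems(1), of n]
  have "\<bar>picard (Suc (Suc n)) (t, a) - picard (Suc n) (t, a)\<bar> = \<bar>\<integral>s. u (s, picard (Suc n) (s, a)) - u (s, picard n (s, a)) \<partial>lb 0 t\<bar>"
    by (subst Bochner_Integration.integral_diff) (auto simp del: picard.simps(2) simp: picard.simps(2)[of "Suc n"] picard.simps(2)[of n "(t, _)"] intro!: u_along_int)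
  also have "\<dots> \<le> (\<integral>s. \<bar>u (s, picard (Suc n) (s, a)) - u (s, picard n (s, a))\<bar> \<partial>lb 0 t)"
    by (rule integral_abs_bound)
  also have "\<dots> \<le> (\<integral>s. U * T * (L s * (integral\<^sup>L (lb 0 s) L ^ n / fact n)) \<partial>lb 0 t)"
  proof (rule integral_mono_AE)
    show "AE s in lb 0 t. \<bar>u (s, picard (Suc n) (s, a)) - u (s, picard n (s, a))\<bar> \<le> U * T * (L s * (integral\<^sup>L (lb 0 s) L ^ n / fact n))"
    proof (rule AE_lbI)
      fix s assume s: "0 < s" "s < t"
      have "\<bar>u (s, picard (Suc n) (s, a)) - u (s, picard n (s, a))\<bar> \<le> L s * \<bar>picard (Suc n) (s, a) - picard n (s, a)\<bar>"
        by (rule u_lip)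
      also have "\<dots> \<le> L s * (U * T * (integral\<^sup>L (lb 0 s) L ^ n / fact n))"
        by (rule mult_left_mono[OF Suc.IH L_nonneg]) (use s Suc.prems in auto)
      finally show "\<bar>u (s, picard (Suc n) (s, a)) - u (s, picard n (s, a))\<bar> \<le> U * T * (L s * (integral\<^sup>L (lb 0 s) L ^ n / fact n))"
        by (simp only: ac_simps)
    qed
    show "integrable (lb 0 t) (\<lambda>s. U * T * (L s * (integral\<^sup>L (lb 0 s) L ^ n / fact n)))"
      by (rule integrable_mult_right[OF P(1)])
    show "integrable (lb 0 t) (\<lambda>s. \<bar>u (s, picard (Suc n) (s, a)) - u (s, picard n (s, a))\<bar>)"
      by (intro integrable_abs Bochner_Integration.integrable_diff u_along_int) auto
  qed
  also have "\<dots> = U * T * (integral\<^sup>L (lb 0 t) L ^ Suc n / fact (Suc n))"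
    unfolding integral_mult_right_zero P(2) ..
  finally show ?case .
qed

lemma picard_tendsto:
  assumes "0 \<le> t" "t \<le> T" shows "(\<lambda>n. picard n (t, a)) \<longlonglongrightarrow> X (t, a)"
proof -
  let ?d = "\<lambda>n. picard (Suc n) (t, a) - picard n (t, a)"
  have "summable ?d"
  proof (rule summable_comparison_test')
    show "norm (?d n) \<le> U * T * (integral\<^sup>L (lb 0 t) L ^ n / fact n)" for n
      using picard_diff[OF assms] by simp
    show "summable (\<lambda>n. U * T * (integral\<^sup>L (lb 0 t) L ^ n / fact n))"
      using summable_exp[of "integral\<^sup>L (lb 0 t) L"] by (intro summable_mult) (simp add: divide_inverse mult.commute)
  qed
  then have "convergent (\<lambda>n. \<Sum>i<n. ?d i)" by (simp add: summable_iff_convergent)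
  then have "convergent (\<lambda>n. picard n (t, a) - picard 0 (t, a))"
    by (simp only: sum_lessThan_telescope[of "\<lambda>n. picard n (t, a)"])
  then obtain l where "(\<lambda>n. picard n (t, a) - picard 0 (t, a)) \<longlonglongrightarrow> l" by (auto simp: convergent_def)
  from tendsto_add[OF this tendsto_const[of "picard 0 (t, a)"]]
  have "convergent (\<lambda>n. picard n (t, a))" by (auto simp: convergent_def simp del: picard.simps)
  then show ?thesis unfolding X_def by (simp add: convergent_LIMSEQ_iff)
qed

lemma X_eq:
  assumes "0 \<le> t" "t \<le> T" shows "X (t, a) = a + (\<integral>s. u (s, X (s, a)) \<partial>lb 0 t)"
proof -
  have "(\<lambda>n. \<integral>s. u (s, picard n (s, a)) \<partial>lb 0 t) \<longlonglongrightarrow> (\<integral>s. u (s, X (s, a)) \<partial>lb 0 t)"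
  proof (rule integral_dominated_convergence[where w="\<lambda>s. U"])
    show "AE s in lb 0 t. (\<lambda>n. u (s, picard n (s, a))) \<longlonglongrightarrow> u (s, X (s, a))"
    proof (rule AE_lbI)
      fix s assume "0 < s" "s < t"
      then have "(\<lambda>n. picard n (s, a)) \<longlonglongrightarrow> X (s, a)" using assms by (intro picard_tendsto) auto
      then show "(\<lambda>n. u (s, picard n (s, a))) \<longlonglongrightarrow> u (s, X (s, a))"
        using continuous_on_tendsto_compose[OF u_cont] by auto
    qed
  qed (auto simp: u_bd)
  then have "(\<lambda>n. picard (Suc n) (t, a)) \<longlonglongrightarrow> a + (\<integral>s. u (s, X (s, a)) \<partial>lb 0 t)"
    by (auto intro!: tendsto_intros)
  moreover have "(\<lambda>n. picard (Suc n) (t, a)) \<longlonglongrightarrow> X (t, a)"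
    by (rule LIMSEQ_Suc[OF picard_tendsto[OF assms]])
  ultimately show ?thesis by (rule LIMSEQ_unique[symmetric])
qed

lemma X_0: "X (0, a) = a"
  using X_eq[of 0 a] T_pos by simp

lemma X_solves: "solves 0 (\<lambda>t. X (t, a))"
  by (rule solvesI) (measurable, unfold X_0, rule X_eq)

lemma X_lip: "0 \<le> t \<Longrightarrow> t \<le> T \<Longrightarrow> \<bar>X (t, a) - X (t, b)\<bar> \<le> \<bar>a - b\<bar> * exp (integral\<^sup>L (lb 0 T) L)"
  using solves_gronwall[OF X_solves[of a] X_solves[of b], of t] by (simp add: X_0)

lemma X_cont: "0 \<le> t \<Longrightarrow> t \<le> T \<Longrightarrow> continuous_on UNIV (\<lambda>a. X (t, a))"
proof -
  assume t: "0 \<le> t" "t \<le> T"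
  have "(exp (integral\<^sup>L (lb 0 T) L))-lipschitz_on UNIV (\<lambda>a. X (t, a))"
    using X_lip[OF t] by (intro lipschitz_onI) (auto simp: dist_real_def mult.commute)
  then show ?thesis by (rule lipschitz_on_continuous_on)
qed

text \<open>The trajectory shifted by one period solves the same equation, because \<open>u\<close>
  is periodic, and uniqueness identifies it.\<close>

lemma X_per: "0 \<le> t \<Longrightarrow> t \<le> T \<Longrightarrow> X (t, a + 1) = X (t, a) + 1"
proof -
  assume t: "0 \<le> t" "t \<le> T"
  have "solves 0 (\<lambda>t. X (t, a) + 1)"
  proof (rule solvesI)
    fix t assume "0 \<le> t" "t \<le> T"
    from X_eq[OF this, of a] show "X (t, a) + 1 = X (0, a) + 1 + (\<integral>s. u (s, X (s, a) + 1) \<partial>lb 0 t)"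
      by (simp add: X_0 u_per)
  qed measurable
  from solves_gronwall[OF X_solves[of "a+1"] this, of t] t show ?thesis by (simp add: X_0)
qed

text \<open>If the order were reversed at time t, the two trajectories would have met before, and
  uniqueness from the meeting time on would keep them equal.\<close>

lemma X_mono:
  assumes "a \<le> b" "0 \<le> t" "t \<le> T" shows "X (t, a) \<le> X (t, b)"
proof (rule ccontr)
  assume "\<not> ?thesis"
  then have neg: "X (t, b) - X (t, a) < 0" by simp
  have c: "continuous_on {0..t} (\<lambda>s. X (s, b) - X (s, a))"
    using solves_cont[OF X_solves[of a]] solves_cont[OF X_solves[of b]] assms
    by (auto intro!: continuous_intros elim!: continuous_on_subset)
  obtain s where s: "0 \<le> s" "s \<le> t" "X (s, b) - X (s, a) = 0"
    using IVT2'[of "\<lambda>s. X (s, b) - X (s, a)" t 0 0] neg assms c by (auto simp: X_0)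
  have "\<bar>X (t, b) - X (t, a)\<bar> \<le> \<bar>X (s, b) - X (s, a)\<bar> * exp (integral\<^sup>L (lb 0 T) L)"
    using s assms by (intro solves_gronwall[OF solves_restrict[OF X_solves] solves_restrict[OF X_solves]]) auto
  with s neg show False by simp
qed

end

section \<open>Fluxes along trajectories\<close>

text \<open>Continuity of \<open>K\<close> makes the increments o(t - s), so \<open>D\<close> has
  zero derivative everywhere. A chain rule can thus be verified on increments although its
  ingredients are only integrable in time.\<close>

lemma constant_if_superlinear:
  fixes D K :: "real \<Rightarrow> real"
  assumes "continuous_on {0..T} K"
    and D: "\<And>s t. 0 \<le> s \<Longrightarrow> s \<le> t \<Longrightarrow> t \<le> T \<Longrightarrow> \<bar>D t - D s\<bar> \<le> (t - s) * (C * (t - s) + (K t - K s))"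
    and t: "0 \<le> t" "t \<le> T"
  shows "D t = D 0"
proof -
  have "(D has_derivative (\<lambda>h. 0)) (at x within {0..T})" if x: "x \<in> {0..T}" for x
  proof -
    have "((\<lambda>y. C * \<bar>y - x\<bar> + \<bar>K y - K x\<bar>) \<longlongrightarrow> C * \<bar>x - x\<bar> + \<bar>K x - K x\<bar>) (at x within {0..T})"
      using assms(1) x by (intro tendsto_intros) (auto simp: continuous_on_def)
    then have lim: "((\<lambda>y. C * \<bar>y - x\<bar> + \<bar>K y - K x\<bar>) \<longlongrightarrow> 0) (at x within {0..T})" by simp
    have "((\<lambda>y. (D y - D x - 0) /\<^sub>R norm (y - x)) \<longlongrightarrow> 0) (at x within {0..T})"
    proof (rule Lim_null_comparison[OF _ lim])
      have "norm ((D y - D x - 0) /\<^sub>R norm (y - x)) \<le> C * \<bar>y - x\<bar> + \<bar>K y - K x\<bar>" if y: "y \<in> {0..T}" "y \<noteq> x" for y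
      proof -
        have "\<bar>D y - D x\<bar> \<le> \<bar>y - x\<bar> * (C * \<bar>y - x\<bar> + \<bar>K y - K x\<bar>)"
        proof (cases "x \<le> y")
          case True
          have "(y - x) * (C * (y - x) + (K y - K x)) \<le> (y - x) * (C * (y - x) + \<bar>K y - K x\<bar>)"
            using True by (intro mult_left_mono) auto
          then show ?thesis using D[of x y] True x y by (auto intro: order_trans)
        next
          case False
          have "(x - y) * (C * (x - y) + (K x - K y)) \<le> (x - y) * (C * (x - y) + \<bar>K x - K y\<bar>)"
            using False by (intro mult_left_mono) auto
          then show ?thesis using D[of y x] False x y by (auto simp: abs_minus_commute intro: order_trans)
        qed
        then show ?thesis using y by (simp add: field_simps)
      qed
      then show "\<forall>\<^sub>F y in at x within {0..T}. norm ((D y - D x - 0) /\<^sub>R norm (y - x)) \<le> C * \<bar>y - x\<bar> + \<bar>K y - K x\<bar>"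
        by (auto simp: eventually_at_filter)
    qed
    then show ?thesis by (simp add: has_derivative_within divide_inverse mult.commute)
  qed
  then obtain c where "\<forall>x\<in>{0..T}. D x = c"
    using has_derivative_zero_constant[of "{0..T}" D] by auto
  then show ?thesis using t by auto
qed

text \<open>\<open>H\<close> is absolutely continuous in time with derivative \<open>b\<close> and
  has spatial derivative \<open>A\<close>, while the curve \<open>Z\<close> moves with velocity
  \<open>w\<close>. Over a short interval, the increment of \<open>H\<close> along \<open>Z\<close>
  and the integral of the expected derivative differ by a quadratic Taylor error and by the errors
  of freezing the coefficients; all are o(t - s).\<close>

lemma chain_rule_along:
  fixes H A :: "real \<Rightarrow> real \<Rightarrow> real" and b d :: "real \<Rightarrow> real \<Rightarrow> real"
  assumes Hb: "\<And>t z. 0 \<le> t \<Longrightarrow> t \<le> T \<Longrightarrow> H t z = H 0 z + (\<integral>s. b s z \<partial>lb 0 t)"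
    and Ad: "\<And>t z. 0 \<le> t \<Longrightarrow> t \<le> T \<Longrightarrow> A t z = A 0 z + (\<integral>s. d s z \<partial>lb 0 t)"
    and b_meas [measurable]: "case_prod b \<in> borel_measurable (borel \<Otimes>\<^sub>M borel)"
    and d_meas [measurable]: "case_prod d \<in> borel_measurable (borel \<Otimes>\<^sub>M borel)"
    and A_meas [measurable]: "case_prod A \<in> borel_measurable (borel \<Otimes>\<^sub>M borel)"
    and k: "integrable (lb 0 T) k"
    and b_bd: "\<And>s z. \<bar>b s z\<bar> \<le> k s" and d_bd: "\<And>s z. \<bar>d s z\<bar> \<le> k s"
    and b_lip: "\<And>s z z'. \<bar>b s z - b s z'\<bar> \<le> k s * \<bar>z - z'\<bar>"
    and A_lip: "\<And>s z z'. 0 \<le> s \<Longrightarrow> s \<le> T \<Longrightarrow> \<bar>A s z - A s z'\<bar> \<le> C * \<bar>z - z'\<bar>"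
    and A_bd: "\<And>s z. 0 \<le> s \<Longrightarrow> s \<le> T \<Longrightarrow> \<bar>A s z\<bar> \<le> C"
    and taylor: "\<And>s z z'. 0 \<le> s \<Longrightarrow> s \<le> T \<Longrightarrow> \<bar>H s z' - H s z - A s z * (z' - z)\<bar> \<le> C * (z' - z)\<^sup>2"
    and [measurable]: "w \<in> borel_measurable borel" "Z \<in> borel_measurable borel" and w_bd: "\<And>s. \<bar>w s\<bar> \<le> U"
    and Zw: "\<And>s t. 0 \<le> s \<Longrightarrow> s \<le> t \<Longrightarrow> t \<le> T \<Longrightarrow> Z t = Z s + (\<integral>s. w s \<partial>lb s t)"
    and t: "0 \<le> t" "t \<le> T"
  shows "H t (Z t) = H 0 (Z 0) + (\<integral>s. b s (Z s) + A s (Z s) * w s \<partial>lb 0 t)"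
proof -
  have [measurable]: "k \<in> borel_measurable borel" by (rule integrable_lb_measurable[OF k])
  have k0: "0 \<le> k s" for s using b_bd[of s 0] by linarith
  have U0: "0 \<le> U" using w_bd[of 0] by linarith
  have kst: "integrable (lb s t) k" if "0 \<le> s" "t \<le> T" for s t
    using integrable_lb_subset[OF k that] .
  have ib: "integrable (lb s t) (\<lambda>r. b r (Y r))" if "0 \<le> s" "t \<le> T" and [measurable]: "Y \<in> borel_measurable borel" for s t Y
    by (rule Bochner_Integration.integrable_bound[OF kst[OF that(1,2)]]) (use b_bd in \<open>auto intro!: AE_I2 intro: order_trans[OF _ abs_ge_self]\<close>)
  have id: "integrable (lb s t) (\<lambda>r. d r z)" if "0 \<le> s" "t \<le> T" for s t z
    by (rule Bochner_Integration.integrable_bound[OF kst[OF that(1,2)]]) (use d_bd in \<open>auto intro!: AE_I2 intro: order_trans[OF _ abs_ge_self]\<close>)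
  have iw: "integrable (lb s t) w" for s t
    by (rule integrable_lb_bounded[where K=U]) (auto simp: w_bd)
  have iA: "integrable (lb s t) (\<lambda>r. A r (Z r) * w r)" if "0 \<le> s" "t \<le> T" for s t
    by (rule integrable_lb_bounded[where K="C * U"]) (use that w_bd A_bd U0 in \<open>auto simp: abs_mult intro!: mult_mono order_trans[OF abs_ge_zero A_bd]\<close>)
  define D where "D t = H t (Z t) - (\<integral>s. b s (Z s) + A s (Z s) * w s \<partial>lb 0 t)" for t
  \<comment> \<open>The factor 2 counts the variation of \<open>A\<close> in time and that of
    \<open>b\<close> in space, each worth U times the integral of k. The two terms C U^2 in the
    constant come from the Taylor error and from the Lipschitz bound on \<open>A\<close>.\<close>
  define K where "K t = 2 * U * integral\<^sup>L (lb 0 t) k" for t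
  have "D t = D 0"
  proof (rule constant_if_superlinear[where K=K and T=T and C="2 * C * U\<^sup>2", OF _ _ t])
    show "continuous_on {0..T} K" unfolding K_def
      by (intro continuous_intros integral_lb_zero_continuous[OF k])
    fix s t assume st: "0 \<le> s" "s \<le> t" "t \<le> T"
    define \<kappa> where "\<kappa> = integral\<^sup>L (lb s t) k"
    have Kst: "K t - K s = 2 * U * \<kappa>"
      using integral_lb_combine[OF kst[of 0 t] st(1,2)] st by (simp add: K_def \<kappa>_def algebra_simps)
    have \<kappa>0: "0 \<le> \<kappa>" unfolding \<kappa>_def using k0 by (intro Bochner_Integration.integral_nonneg) auto
    have C0: "0 \<le> C" using A_bd[of 0 0] t by (meson abs_ge_zero order_trans order_refl)
    have Zlip: "\<bar>Z r - Z s\<bar> \<le> U * (t - s)" if "s \<le> r" "r \<le> t" for r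
    proof -
      have "\<bar>Z r - Z s\<bar> \<le> U * (r - s)"
        using Zw[of s r] integral_lb_bound[OF that(1), of w U] w_bd that st by simp
      also have "\<dots> \<le> U * (t - s)" using that U0 by (intro mult_left_mono) auto
      finally show ?thesis .
    qed
    have Hst: "H t (Z s) - H s (Z s) = (\<integral>r. b r (Z s) \<partial>lb s t)"
      using Hb[of t "Z s"] Hb[of s "Z s"] integral_lb_combine[OF ib[of 0 t "\<lambda>_. Z s"] st(1,2)] st by simp
    have Adiff: "\<bar>A t (Z s) - A r (Z r)\<bar> \<le> \<kappa> + C * (U * (t - s))" if r: "s < r" "r < t" for r
    proof -
      have "A t (Z s) - A r (Z s) = (\<integral>p. d p (Z s) \<partial>lb r t)"
        using Ad[of t "Z s"] Ad[of r "Z s"] integral_lb_combine[OF id[of 0 t "Z s"], of r] st r by simp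
      also have "\<bar>\<dots>\<bar> \<le> (\<integral>p. \<bar>d p (Z s)\<bar> \<partial>lb r t)" by (rule integral_abs_bound)
      also have "\<dots> \<le> integral\<^sup>L (lb r t) k"
        by (rule integral_mono) (use st r d_bd in \<open>auto intro!: integrable_abs id kst\<close>)
      also have "\<dots> \<le> \<kappa>"
      proof -
        have "0 \<le> integral\<^sup>L (lb s r) k" using k0 by (intro Bochner_Integration.integral_nonneg) auto
        then show ?thesis unfolding \<kappa>_def using integral_lb_combine[OF kst[of s t], of r] st r by simp
      qed
      finally have 1: "\<bar>A t (Z s) - A r (Z s)\<bar> \<le> \<kappa>" .
      have "\<bar>A r (Z s) - A r (Z r)\<bar> \<le> C * \<bar>Z s - Z r\<bar>" using A_lip st r by auto
      also have "\<dots> \<le> C * (U * (t - s))" using Zlip[of r] r C0 by (intro mult_left_mono) (auto simp: abs_minus_commute)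
      finally show ?thesis using 1 by linarith
    qed
    \<comment> \<open>The error of freezing the point at \<open>Z s\<close> and the coefficient
      \<open>A\<close> at the final time t.\<close>
    define R where "R r = (A t (Z s) - A r (Z r)) * w r + (b r (Z s) - b r (Z r))" for r
    have iR: "integrable (lb s t) R" unfolding R_def left_diff_distrib
      using st by (intro Bochner_Integration.integrable_add Bochner_Integration.integrable_diff ib iA integrable_mult_right iw) auto
    have "\<bar>integral\<^sup>L (lb s t) R\<bar> \<le> (\<integral>r. \<bar>R r\<bar> \<partial>lb s t)" by (rule integral_abs_bound)
    also have "\<dots> \<le> (\<integral>r. (\<kappa> + C * (U * (t - s))) * U + k r * (U * (t - s)) \<partial>lb s t)"
    proof (rule integral_mono_AE)
      show "AE r in lb s t. \<bar>R r\<bar> \<le> (\<kappa> + C * (U * (t - s))) * U + k r * (U * (t - s))"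
      proof (rule AE_lbI)
        fix r assume r: "s < r" "r < t"
        have "\<bar>(A t (Z s) - A r (Z r)) * w r\<bar> \<le> (\<kappa> + C * (U * (t - s))) * U"
          unfolding abs_mult using Adiff[OF r] w_bd U0 C0 st \<kappa>0 by (intro mult_mono) auto
        moreover have "\<bar>b r (Z s) - b r (Z r)\<bar> \<le> k r * (U * (t - s))"
          using b_lip[of r "Z s" "Z r"] Zlip[of r] r k0[of r]
          by (meson abs_minus_commute le_less_linear mult_left_mono order.strict_implies_order order_trans abs_minus_commute[THEN eq_refl])
        ultimately show "\<bar>R r\<bar> \<le> (\<kappa> + C * (U * (t - s))) * U + k r * (U * (t - s))" unfolding R_def by linarith
      qed
    qed (use iR kst[of s t] st in auto)
    also have "\<dots> = (\<kappa> + C * (U * (t - s))) * U * (t - s) + \<kappa> * (U * (t - s))"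
      using kst[of s t] st by (simp add: \<kappa>_def)
    finally have Rb: "\<bar>integral\<^sup>L (lb s t) R\<bar> \<le> (\<kappa> + C * (U * (t - s))) * U * (t - s) + \<kappa> * (U * (t - s))" .
    have iRe: "integral\<^sup>L (lb s t) R = A t (Z s) * (Z t - Z s) + (H t (Z s) - H s (Z s)) - (\<integral>r. b r (Z r) + A r (Z r) * w r \<partial>lb s t)"
    proof -
      have "R = (\<lambda>r. (A t (Z s) * w r + b r (Z s)) - (b r (Z r) + A r (Z r) * w r))" by (auto simp: R_def algebra_simps)
      then have "integral\<^sup>L (lb s t) R = (\<integral>r. A t (Z s) * w r + b r (Z s) \<partial>lb s t) - (\<integral>r. b r (Z r) + A r (Z r) * w r \<partial>lb s t)"
        using st by (simp add: ib iA iw)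
      also have "(\<integral>r. A t (Z s) * w r + b r (Z s) \<partial>lb s t) = A t (Z s) * (Z t - Z s) + (H t (Z s) - H s (Z s))"
        using st Hst Zw[of s t] by (simp add: ib iw)
      finally show ?thesis .
    qed
    have "D t - D s = (H t (Z t) - H t (Z s) - A t (Z s) * (Z t - Z s)) + integral\<^sup>L (lb s t) R"
    proof -
      have "(\<integral>r. b r (Z r) + A r (Z r) * w r \<partial>lb 0 t) = (\<integral>r. b r (Z r) + A r (Z r) * w r \<partial>lb 0 s) + (\<integral>r. b r (Z r) + A r (Z r) * w r \<partial>lb s t)"
        using st by (intro integral_lb_combine Bochner_Integration.integrable_add ib iA) auto
      then show ?thesis unfolding D_def iRe by simp
    qed
    moreover have "\<bar>H t (Z t) - H t (Z s) - A t (Z s) * (Z t - Z s)\<bar> \<le> C * (U * (t - s))\<^sup>2"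
    proof -
      have "(Z t - Z s)\<^sup>2 \<le> (U * (t - s))\<^sup>2" using Zlip[of t] st by (intro abs_le_square_iff[THEN iffD1]) (auto intro: order_trans)
      then have "C * (Z t - Z s)\<^sup>2 \<le> C * (U * (t - s))\<^sup>2" using C0 by (intro mult_left_mono)
      then show ?thesis using taylor[of t "Z t" "Z s"] st by linarith
    qed
    ultimately have "\<bar>D t - D s\<bar> \<le> C * (U * (t - s))\<^sup>2 + ((\<kappa> + C * (U * (t - s))) * U * (t - s) + \<kappa> * (U * (t - s)))"
      using Rb by linarith
    also have "\<dots> = (t - s) * (2 * C * U\<^sup>2 * (t - s) + (K t - K s))"
      unfolding Kst by (simp add: algebra_simps power2_eq_square)
    finally show "\<bar>D t - D s\<bar> \<le> (t - s) * (2 * C * U\<^sup>2 * (t - s) + (K t - K s))" .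
  qed
  then show ?thesis by (simp add: D_def)
qed

section \<open>A weak conservation law tested along one trajectory\<close>

text \<open>The weak equation after elimination of the test function in time. The exceptional null
  set of times may depend on \<phi>, a restriction that the following lemmas remove.\<close>

definition weakW :: "real \<Rightarrow> (real \<times> real \<Rightarrow> real) \<Rightarrow> (real \<times> real \<Rightarrow> real) \<Rightarrow> (real \<Rightarrow> real) \<Rightarrow> bool" where
  "weakW T q F q0 \<longleftrightarrow> (\<forall>\<phi>. test_torus \<phi> \<longrightarrow> (AE t in lb 0 T.
     (\<integral>x. q (t, x) * \<phi> x \<partial>lb 0 1) = (\<integral>x. q0 x * \<phi> x \<partial>lb 0 1) + (\<integral>s. (\<integral>x. F (s, x) * d1 \<phi> x \<partial>lb 0 1) \<partial>lb 0 t)))"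

lemma test_torus_shift:
  assumes "test_torus \<phi>"
  shows "test_torus (\<lambda>x. \<phi> (x - z))" "d1 (\<lambda>x. \<phi> (x - z)) = (\<lambda>x. d1 \<phi> (x - z))"
proof -
  have s: "smooth_fun \<phi>" using assms by (simp add: test_torus_def)
  have per: "\<phi> (y + 1) = \<phi> y" for y using assms by (simp add: test_torus_def)
  show "test_torus (\<lambda>x. \<phi> (x - z))" unfolding test_torus_def
    using per[of "_ - z"] by (auto intro!: smooth_compose[OF s] smooth_diff smooth_ident smooth_const simp: algebra_simps)
  show "d1 (\<lambda>x. \<phi> (x - z)) = (\<lambda>x. d1 \<phi> (x - z))"
  proof
    fix x show "d1 (\<lambda>x. \<phi> (x - z)) x = d1 \<phi> (x - z)"
    proof (rule d1_eq)
      have "((\<lambda>x. x - z) has_real_derivative 1) (at x)" by (auto intro!: derivative_eq_intros)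
      from DERIV_chain2[OF smooth_d1_works[OF s] this]
      show "((\<lambda>x. \<phi> (x - z)) has_real_derivative d1 \<phi> (x - z)) (at x)" by simp
    qed
  qed
qed

lemma smooth_lip:
  assumes s: "smooth_fun \<phi>" and B: "\<And>x. \<bar>d1 \<phi> x\<bar> \<le> B"
  shows "\<bar>\<phi> y - \<phi> x\<bar> \<le> B * \<bar>y - x\<bar>"
proof (induction x y rule: linorder_wlog)
  case (le x y)
  show ?case
  proof (cases "x = y")
    case False
    with le have "x < y" by simp
    then obtain z where "\<phi> y - \<phi> x = (y - x) * d1 \<phi> z" using MVT2[of x y \<phi> "d1 \<phi>"] smooth_d1_works[OF s] by auto
    then show ?thesis using B[of z] by (simp add: abs_mult mult.commute[of "\<bar>y - x\<bar>"] mult_right_mono)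
  qed simp
next
  case (sym x y)
  then show ?case by (simp add: abs_minus_commute)
qed

lemma smooth_taylor:
  assumes s: "smooth_fun \<phi>" and B: "\<And>x. \<bar>d1 (d1 \<phi>) x\<bar> \<le> B"
  shows "\<bar>\<phi> y - \<phi> x - d1 \<phi> x * (y - x)\<bar> \<le> B * (y - x)\<^sup>2"
proof (cases "x = y")
  case False
  define f where "f z = \<phi> z - d1 \<phi> x * z" for z
  have sf: "smooth_fun f" unfolding f_def[abs_def] by (intro smooth_diff smooth_mult smooth_const smooth_ident s)
  have df: "d1 f z = d1 \<phi> z - d1 \<phi> x" for z unfolding f_def[abs_def]
    by (rule d1_eq) (auto intro!: derivative_eq_intros smooth_d1_works[OF s])
  have "\<exists>z. min x y < z \<and> z < max x y \<and> f (max x y) - f (min x y) = (max x y - min x y) * d1 f z"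
    using MVT2[of "min x y" "max x y" f "d1 f"] smooth_d1_works[OF sf] False by (auto simp: min_def max_def split: if_splits)
  then obtain z where z: "min x y < z" "z < max x y" "f (max x y) - f (min x y) = (max x y - min x y) * d1 f z" by blast
  have "\<bar>f y - f x\<bar> = \<bar>y - x\<bar> * \<bar>d1 f z\<bar>" using z(3) by (cases "x \<le> y") (auto simp: min_def max_def abs_mult abs_minus_commute)
  also have "\<dots> \<le> \<bar>y - x\<bar> * (B * \<bar>y - x\<bar>)"
  proof (rule mult_left_mono)
    have "\<bar>d1 f z\<bar> \<le> B * \<bar>z - x\<bar>" unfolding df by (rule smooth_lip[OF smooth_d1[OF s] B])
    also have "\<dots> \<le> B * \<bar>y - x\<bar>" using z B[of 0] by (intro mult_left_mono) (auto simp: min_def max_def split: if_splits)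
    finally show "\<bar>d1 f z\<bar> \<le> B * \<bar>y - x\<bar>" .
  qed simp
  finally show ?thesis by (simp add: f_def algebra_simps power2_eq_square abs_mult_self_eq flip: abs_mult)
qed simp

text \<open>The fields satisfy $\partial_t q + \partial_x (q u) = \partial_x s$ with initial value \<open>q0\<close>.\<close>
locale conserved = velocity +
  fixes q s :: "real \<times> real \<Rightarrow> real" and q0 :: "real \<Rightarrow> real" and Kq :: real and k :: "real \<Rightarrow> real"
  assumes q_meas [measurable]: "q \<in> borel_measurable (borel \<Otimes>\<^sub>M borel)"
    and q_per: "\<And>t x. q (t, x + 1) = q (t, x)"
    and q_bd: "\<And>t x. \<bar>q (t, x)\<bar> \<le> Kq"
    and s_meas [measurable]: "s \<in> borel_measurable (borel \<Otimes>\<^sub>M borel)"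
    and s_per: "\<And>t x. s (t, x + 1) = s (t, x)"
    and s_bd: "\<And>t x. \<bar>s (t, x)\<bar> \<le> k t"
    and s_cont: "\<And>t. continuous_on UNIV (\<lambda>x. s (t, x))"
    and k_int: "integrable (lb 0 T) k"
    and q0_int: "integrable (lb 0 1) q0"
    and weak: "weakW T q (\<lambda>z. q z * u z - s z) q0"
begin

definition F :: "real \<times> real \<Rightarrow> real" where "F z = q z * u z - s z"
definition kF :: "real \<Rightarrow> real" where "kF t = Kq * U + k t"

lemma F_meas [measurable]: "F \<in> borel_measurable (borel \<Otimes>\<^sub>M borel)"
  unfolding F_def[abs_def] by measurable

lemma q0_meas [measurable]: "q0 \<in> borel_measurable borel"
  by (rule integrable_lb_measurable[OF q0_int])

lemma k_meas [measurable]: "k \<in> borel_measurable borel"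
  by (rule integrable_lb_measurable[OF k_int])

lemma Kq_nonneg: "0 \<le> Kq"
  using q_bd[of 0 0] by linarith

lemma F_bd: "\<bar>F (t, x)\<bar> \<le> kF t"
proof -
  have "\<bar>q (t, x) * u (t, x)\<bar> \<le> Kq * U" unfolding abs_mult by (intro mult_mono q_bd u_bd Kq_nonneg) auto
  then show ?thesis using s_bd[of t x] unfolding F_def kF_def by (smt (verit))
qed

lemma kF_nonneg: "0 \<le> kF t" using F_bd[of t 0] by linarith

lemma kF_int: "integrable (lb 0 T) kF"
  unfolding kF_def[abs_def] using k_int by simp

text \<open>The right-hand side of the tested equation. Test function and derivative are separate
  arguments, so that differences and Taylor remainders of translated test functions can be inserted
  and estimated by the single constant \<open>N\<close>.\<close>

definition J :: "real \<Rightarrow> (real \<Rightarrow> real) \<Rightarrow> (real \<Rightarrow> real) \<Rightarrow> real" where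
  "J t p p' = (\<integral>x. q0 x * p x \<partial>lb 0 1) + (\<integral>r. (\<integral>x. F (r, x) * p' x \<partial>lb 0 1) \<partial>lb 0 t)"

definition N where "N = (\<integral>x. \<bar>q0 x\<bar> \<partial>lb 0 1) + integral\<^sup>L (lb 0 T) kF"

lemma J_integrable:
  assumes [measurable]: "p \<in> borel_measurable borel" and "\<And>x. \<bar>p x\<bar> \<le> B"
  shows "integrable (lb 0 1) (\<lambda>x. q0 x * p x)" "integrable (lb 0 1) (\<lambda>x. F (r, x) * p x)"
    "\<bar>\<integral>x. q0 x * p x \<partial>lb 0 1\<bar> \<le> B * (\<integral>x. \<bar>q0 x\<bar> \<partial>lb 0 1)"
    "\<bar>\<integral>x. F (r, x) * p x \<partial>lb 0 1\<bar> \<le> B * kF r"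
    "t \<le> T \<Longrightarrow> integrable (lb 0 t) (\<lambda>r. \<integral>x. F (r, x) * p x \<partial>lb 0 1)"
proof -
  have B0: "0 \<le> B" using assms(2)[of 0] by linarith
  show i: "integrable (lb 0 1) (\<lambda>x. q0 x * p x)"
    by (rule integrable_mult_bounded'[OF q0_int _ assms(2)]) simp
  have Fp: "\<bar>F (r, x) * p x\<bar> \<le> B * kF r" for r x
    unfolding abs_mult using mult_mono[OF F_bd assms(2) kF_nonneg] by (simp add: mult.commute)
  show "integrable (lb 0 1) (\<lambda>x. F (r, x) * p x)"
    by (rule integrable_lb_bounded[where K="B * kF r"]) (use Fp in auto)
  have "\<bar>\<integral>x. q0 x * p x \<partial>lb 0 1\<bar> \<le> (\<integral>x. \<bar>q0 x * p x\<bar> \<partial>lb 0 1)" by (rule integral_abs_bound)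
  also have "\<dots> \<le> (\<integral>x. B * \<bar>q0 x\<bar> \<partial>lb 0 1)"
  proof (rule integral_mono[OF integrable_abs[OF i]])
    show "integrable (lb 0 1) (\<lambda>x. B * \<bar>q0 x\<bar>)" using q0_int by simp
    show "\<bar>q0 x * p x\<bar> \<le> B * \<bar>q0 x\<bar>" for x
      unfolding abs_mult mult.commute[of B] by (rule mult_left_mono[OF assms(2)]) simp
  qed
  finally show "\<bar>\<integral>x. q0 x * p x \<partial>lb 0 1\<bar> \<le> B * (\<integral>x. \<bar>q0 x\<bar> \<partial>lb 0 1)" by simp
  show b: "\<bar>\<integral>x. F (r, x) * p x \<partial>lb 0 1\<bar> \<le> B * kF r" for r
    using integral_lb_bound[of 0 1 "\<lambda>x. F (r, x) * p x" "B * kF r"] Fp by simp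
  show "integrable (lb 0 t) (\<lambda>r. \<integral>x. F (r, x) * p x \<partial>lb 0 1)" if "t \<le> T"
  proof (rule Bochner_Integration.integrable_bound)
    show "integrable (lb 0 t) (\<lambda>r. B * kF r)" using integrable_lb_subset[OF kF_int, of 0 t] that by simp
    show "AE r in lb 0 t. norm (\<integral>x. F (r, x) * p x \<partial>lb 0 1) \<le> norm (B * kF r)"
      using b by (auto intro!: AE_I2 intro: order_trans[OF _ abs_ge_self])
  qed simp
qed

lemma J_bound:
  assumes [measurable]: "p \<in> borel_measurable borel" "p' \<in> borel_measurable borel"
    and b: "\<And>x. \<bar>p x\<bar> \<le> B" "\<And>x. \<bar>p' x\<bar> \<le> B" and t: "t \<le> T"
  shows "\<bar>J t p p'\<bar> \<le> B * N"
proof -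
  have B0: "0 \<le> B" using b(1)[of 0] by linarith
  have "\<bar>\<integral>r. (\<integral>x. F (r, x) * p' x \<partial>lb 0 1) \<partial>lb 0 t\<bar> \<le> (\<integral>r. \<bar>\<integral>x. F (r, x) * p' x \<partial>lb 0 1\<bar> \<partial>lb 0 t)"
    by (rule integral_abs_bound)
  also have "\<dots> \<le> (\<integral>r. B * kF r \<partial>lb 0 t)"
    by (rule integral_mono) (use J_integrable[of p' B] b t integrable_lb_subset[OF kF_int, of 0 t] in auto)
  also have "\<dots> = B * integral\<^sup>L (lb 0 t) kF" by simp
  also have "\<dots> \<le> B * integral\<^sup>L (lb 0 T) kF"
    using abs_integral_lb_le[OF kF_int t] kF_nonneg B0 by (intro mult_left_mono) auto
  finally show ?thesis unfolding J_def N_def using J_integrable(3)[OF assms(1) b(1)] by (simp add: algebra_simps)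
qed

lemma J_lin:
  assumes [measurable]: "p1 \<in> borel_measurable borel" "p1' \<in> borel_measurable borel" "p2 \<in> borel_measurable borel" "p2' \<in> borel_measurable borel"
    and b: "\<And>x. \<bar>p1 x\<bar> \<le> B" "\<And>x. \<bar>p1' x\<bar> \<le> B" "\<And>x. \<bar>p2 x\<bar> \<le> B" "\<And>x. \<bar>p2' x\<bar> \<le> B" and t: "t \<le> T"
  shows "J t (\<lambda>x. p1 x + c * p2 x) (\<lambda>x. p1' x + c * p2' x) = J t p1 p1' + c * J t p2 p2'"
proof -
  have 1: "(\<integral>x. q0 x * (p1 x + c * p2 x) \<partial>lb 0 1) = (\<integral>x. q0 x * p1 x \<partial>lb 0 1) + c * (\<integral>x. q0 x * p2 x \<partial>lb 0 1)"
    using J_integrable(1)[of p1 B] J_integrable(1)[of p2 B] b by (simp add: algebra_simps)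
  have 2: "(\<integral>x. F (r, x) * (p1' x + c * p2' x) \<partial>lb 0 1) = (\<integral>x. F (r, x) * p1' x \<partial>lb 0 1) + c * (\<integral>x. F (r, x) * p2' x \<partial>lb 0 1)" for r
    using J_integrable(2)[of p1' B r] J_integrable(2)[of p2' B r] b by (simp add: algebra_simps)
  show ?thesis unfolding J_def 1 2
    using J_integrable(5)[of p1' B t] J_integrable(5)[of p2' B t] b t by (simp add: algebra_simps)
qed

text \<open>The tested quantity as a function of the translate z. Being read off the right-hand side
  of the equation, it is defined at every time and absolutely continuous in it, whereas the integral
  of \<open>q\<close> against the test function is identified only at almost every time.\<close>

definition H :: "(real \<Rightarrow> real) \<Rightarrow> real \<Rightarrow> real \<Rightarrow> real" where
  "H \<phi> t z = J t (\<lambda>x. \<phi> (x - z)) (\<lambda>x. d1 \<phi> (x - z))"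

lemma H_lip:
  assumes \<phi>: "test_torus \<phi>" and B: "\<And>x. \<bar>\<phi> x\<bar> \<le> B" "\<And>x. \<bar>d1 \<phi> x\<bar> \<le> B" "\<And>x. \<bar>d1 (d1 \<phi>) x\<bar> \<le> B" and t: "t \<le> T"
  shows "\<bar>H \<phi> t z - H \<phi> t z'\<bar> \<le> (B * N) * \<bar>z - z'\<bar>" "\<bar>H \<phi> t z\<bar> \<le> B * N"
proof -
  have s: "smooth_fun \<phi>" using \<phi> by (simp add: test_torus_def)
  have [measurable]: "\<phi> \<in> borel_measurable borel" "d1 \<phi> \<in> borel_measurable borel"
    by (auto intro!: test_torus_measurable \<phi> test_torus_d1)
  have eq: "H \<phi> t z - H \<phi> t z' = J t (\<lambda>x. \<phi> (x - z) + (-1) * \<phi> (x - z')) (\<lambda>x. d1 \<phi> (x - z) + (-1) * d1 \<phi> (x - z'))"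
    unfolding H_def by (subst J_lin[where B=B]) (use B t in auto)
  have "\<bar>H \<phi> t z - H \<phi> t z'\<bar> \<le> (B * \<bar>z - z'\<bar>) * N"
    unfolding eq
  proof (rule J_bound[OF _ _ _ _ t])
    show "\<bar>\<phi> (x - z) + (-1) * \<phi> (x - z')\<bar> \<le> B * \<bar>z - z'\<bar>" for x
      using smooth_lip[OF s B(2), of "x - z" "x - z'"] by (simp add: abs_minus_commute)
    show "\<bar>d1 \<phi> (x - z) + (-1) * d1 \<phi> (x - z')\<bar> \<le> B * \<bar>z - z'\<bar>" for x
      using smooth_lip[OF smooth_d1[OF s] B(3), of "x - z" "x - z'"] by (simp add: abs_minus_commute)
  qed auto
  then show "\<bar>H \<phi> t z - H \<phi> t z'\<bar> \<le> (B * N) * \<bar>z - z'\<bar>" by (simp add: ac_simps)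
  show "\<bar>H \<phi> t z\<bar> \<le> B * N" unfolding H_def by (rule J_bound) (use B t in auto)
qed

text \<open>Rational translates share one null set of times, and both sides are Lipschitz in z. A
  common null set is indispensable here, since z is going to be replaced by a moving point.\<close>

lemma H_eq_AE:
  assumes \<phi>: "test_torus \<phi>"
  shows "AE t in lb 0 T. \<forall>z. (\<integral>x. q (t, x) * \<phi> (x - z) \<partial>lb 0 1) = H \<phi> t z"
proof -
  obtain B1 where B1: "\<And>x. \<bar>\<phi> x\<bar> \<le> B1" using test_torus_bounded[OF \<phi>] by blast
  obtain B2 where B2: "\<And>x. \<bar>d1 \<phi> x\<bar> \<le> B2" using test_torus_bounded[OF test_torus_d1[OF \<phi>]] by blast
  obtain B3 where B3: "\<And>x. \<bar>d1 (d1 \<phi>) x\<bar> \<le> B3" using test_torus_bounded[OF test_torus_d1[OF test_torus_d1[OF \<phi>]]] by blast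
  define B where "B = max B1 (max B2 B3)"
  have B: "\<bar>\<phi> x\<bar> \<le> B" "\<bar>d1 \<phi> x\<bar> \<le> B" "\<bar>d1 (d1 \<phi>) x\<bar> \<le> B" for x
    using B1[of x] B2[of x] B3[of x] unfolding B_def by auto
  have s: "smooth_fun \<phi>" using \<phi> by (simp add: test_torus_def)
  have B0: "0 \<le> B" using B(1)[of 0] by linarith
  have [measurable]: "\<phi> \<in> borel_measurable borel" by (rule test_torus_measurable[OF \<phi>])
  have "AE t in lb 0 T. \<forall>z\<in>\<rat>. (\<integral>x. q (t, x) * \<phi> (x - z) \<partial>lb 0 1) = H \<phi> t z"
  proof (subst AE_ball_countable[OF countable_rat], rule ballI)
    fix z :: real
    show "AE t in lb 0 T. (\<integral>x. q (t, x) * \<phi> (x - z) \<partial>lb 0 1) = H \<phi> t z"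
      using weak[unfolded weakW_def, rule_format, OF test_torus_shift(1)[OF \<phi>, of z]]
      unfolding H_def J_def F_def test_torus_shift(2)[OF \<phi>] .
  qed
  then show ?thesis using AE_lb_in[of 0 T]
  proof eventually_elim
    case (elim t)
    show ?case
    proof
      fix z
      let ?g = "\<lambda>z. (\<integral>x. q (t, x) * \<phi> (x - z) \<partial>lb 0 1) - H \<phi> t z"
      have iq: "integrable (lb 0 1) (\<lambda>x. q (t, x) * \<phi> (x - z))" for z
        by (rule integrable_lb_bounded[where K="Kq * B"]) (use q_bd B Kq_nonneg in \<open>auto simp: abs_mult intro!: mult_mono\<close>)
      have "((Kq * B + B * N))-lipschitz_on UNIV ?g"
      proof (rule lipschitz_onI)
        fix y z
        have "\<bar>\<integral>x. q (t, x) * \<phi> (x - y) - q (t, x) * \<phi> (x - z) \<partial>lb 0 1\<bar> \<le> (Kq * (B * \<bar>y - z\<bar>)) * (1 - 0)"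
        proof (rule integral_lb_bound)
          fix x
          have "\<bar>\<phi> (x - y) - \<phi> (x - z)\<bar> \<le> B * \<bar>y - z\<bar>" using smooth_lip[OF s B(2), of "x - y" "x - z"] by (simp add: abs_minus_commute)
          then show "\<bar>q (t, x) * \<phi> (x - y) - q (t, x) * \<phi> (x - z)\<bar> \<le> Kq * (B * \<bar>y - z\<bar>)"
            unfolding right_diff_distrib[symmetric] abs_mult using q_bd Kq_nonneg by (intro mult_mono) auto
        qed simp
        then have "\<bar>(\<integral>x. q (t, x) * \<phi> (x - y) \<partial>lb 0 1) - (\<integral>x. q (t, x) * \<phi> (x - z) \<partial>lb 0 1)\<bar> \<le> Kq * B * \<bar>y - z\<bar>"
          using iq by (simp add: ac_simps)
        moreover have "\<bar>H \<phi> t y - H \<phi> t z\<bar> \<le> (B * N) * \<bar>y - z\<bar>" using H_lip(1)[OF \<phi> B] elim by auto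
        ultimately show "dist (?g y) (?g z) \<le> (Kq * B + B * N) * dist y z"
          unfolding dist_real_def by (simp add: algebra_simps)
      next
        have "0 \<le> N" unfolding N_def using kF_nonneg by (intro add_nonneg_nonneg Bochner_Integration.integral_nonneg) auto
        then show "0 \<le> Kq * B + B * N" using Kq_nonneg B0 by simp
      qed
      then have "continuous_on UNIV ?g" by (rule lipschitz_on_continuous_on)
      then have "?g z = 0"
        by - (rule continuous_zero_if_rat_zero[where g="?g" and a="z - 1" and b="z + 1"], use elim in \<open>auto elim: continuous_on_subset\<close>)
      then show "(\<integral>x. q (t, x) * \<phi> (x - z) \<partial>lb 0 1) = H \<phi> t z" by simp
    qed
  qed
qed

text \<open>The chain rule for \<open>H\<close> along \<open>Z\<close>. A translate differentiated
  in z gives minus the translated derivative, so the coefficient \<open>A\<close> is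
  \<open>- H \<phi>'\<close>; expressing it through \<open>q\<close> subtracts u(Z) q from the flux
  and leaves the flux relative to the moving point.\<close>

lemma flux_test:
  assumes \<phi>: "test_torus \<phi>" and Z: "solves 0 Z"
  shows "AE t in lb 0 T. (\<integral>x. q (t, x) * \<phi> (x - Z t) \<partial>lb 0 1) = (\<integral>x. q0 x * \<phi> (x - Z 0) \<partial>lb 0 1)
    + (\<integral>r. (\<integral>x. (F (r, x) - u (r, Z r) * q (r, x)) * d1 \<phi> (x - Z r) \<partial>lb 0 1) \<partial>lb 0 t)"
proof -
  define \<phi>' where "\<phi>' = d1 \<phi>"
  have \<phi>': "test_torus \<phi>'" unfolding \<phi>'_def by (rule test_torus_d1[OF \<phi>])
  obtain B1 where B1: "\<And>x. \<bar>\<phi> x\<bar> \<le> B1" using test_torus_bounded[OF \<phi>] by blast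
  obtain B2 where B2: "\<And>x. \<bar>\<phi>' x\<bar> \<le> B2" using test_torus_bounded[OF \<phi>'] by blast
  obtain B3 where B3: "\<And>x. \<bar>d1 \<phi>' x\<bar> \<le> B3" using test_torus_bounded[OF test_torus_d1[OF \<phi>']] by blast
  obtain B4 where B4: "\<And>x. \<bar>d1 (d1 \<phi>') x\<bar> \<le> B4" using test_torus_bounded[OF test_torus_d1[OF test_torus_d1[OF \<phi>']]] by blast
  define B where "B = max (max B1 B2) (max B3 B4)"
  have B: "\<bar>\<phi> x\<bar> \<le> B" "\<bar>\<phi>' x\<bar> \<le> B" "\<bar>d1 \<phi>' x\<bar> \<le> B" "\<bar>d1 (d1 \<phi>') x\<bar> \<le> B" for x
    using B1[of x] B2[of x] B3[of x] B4[of x] unfolding B_def by auto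
  have s: "smooth_fun \<phi>" "smooth_fun \<phi>'" using \<phi> \<phi>' by (simp_all add: test_torus_def)
  have B0: "0 \<le> B" using B(1)[of 0] by linarith
  have [measurable]: "\<phi> \<in> borel_measurable borel" "\<phi>' \<in> borel_measurable borel" "d1 \<phi>' \<in> borel_measurable borel"
    by (auto intro!: test_torus_measurable \<phi> \<phi>' test_torus_d1)
  have [measurable]: "Z \<in> borel_measurable borel" by (rule solvesD(1)[OF Z])
  have Hrec: "H \<psi> t z = H \<psi> 0 z + (\<integral>r. (\<integral>x. F (r, x) * d1 \<psi> (x - z) \<partial>lb 0 1) \<partial>lb 0 t)" for \<psi> t z
    by (simp add: H_def J_def)
  have main: "H \<phi> t (Z t) = H \<phi> 0 (Z 0) + (\<integral>r. (\<integral>x. F (r, x) * d1 \<phi> (x - Z r) \<partial>lb 0 1) + (- H \<phi>' r (Z r)) * u (r, Z r) \<partial>lb 0 t)"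
    if t: "0 \<le> t" "t \<le> T" for t
  proof (rule chain_rule_along[where b="\<lambda>r z. \<integral>x. F (r, x) * d1 \<phi> (x - z) \<partial>lb 0 1" and A="\<lambda>r z. - H \<phi>' r z" and T=T
        and d="\<lambda>r z. - (\<integral>x. F (r, x) * d1 \<phi>' (x - z) \<partial>lb 0 1)" and k="\<lambda>r. B * kF r" and C="B * N" and w="\<lambda>r. u (r, Z r)" and U=U])
    show "H \<phi> t z = H \<phi> 0 z + (\<integral>r. (\<integral>x. F (r, x) * d1 \<phi> (x - z) \<partial>lb 0 1) \<partial>lb 0 t)" for t z by (rule Hrec)
    show "- H \<phi>' t z = - H \<phi>' 0 z + (\<integral>r. - (\<integral>x. F (r, x) * d1 \<phi>' (x - z) \<partial>lb 0 1) \<partial>lb 0 t)" for t z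
      by (subst Hrec) simp
    show "(\<lambda>(r, z). \<integral>x. F (r, x) * d1 \<phi> (x - z) \<partial>lb 0 1) \<in> borel_measurable (borel \<Otimes>\<^sub>M borel)"
      unfolding \<phi>'_def[symmetric] by measurable
    show "(\<lambda>(r, z). - (\<integral>x. F (r, x) * d1 \<phi>' (x - z) \<partial>lb 0 1)) \<in> borel_measurable (borel \<Otimes>\<^sub>M borel)"
      by measurable
    show "(\<lambda>(r, z). - H \<phi>' r z) \<in> borel_measurable (borel \<Otimes>\<^sub>M borel)"
      unfolding H_def J_def by measurable
    show "integrable (lb 0 T) (\<lambda>r. B * kF r)" using kF_int by simp
    show "\<bar>\<integral>x. F (r, x) * d1 \<phi> (x - z) \<partial>lb 0 1\<bar> \<le> B * kF r" for r z
      unfolding \<phi>'_def[symmetric] by (rule J_integrable(4)) (use B in auto)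
    show "\<bar>- (\<integral>x. F (r, x) * d1 \<phi>' (x - z) \<partial>lb 0 1)\<bar> \<le> B * kF r" for r z
      unfolding abs_minus_cancel by (rule J_integrable(4)) (use B in auto)
    show "\<bar>(\<integral>x. F (r, x) * d1 \<phi> (x - z) \<partial>lb 0 1) - (\<integral>x. F (r, x) * d1 \<phi> (x - z') \<partial>lb 0 1)\<bar> \<le> B * kF r * \<bar>z - z'\<bar>" for r z z'
    proof -
      have "(\<integral>x. F (r, x) * \<phi>' (x - z) \<partial>lb 0 1) - (\<integral>x. F (r, x) * \<phi>' (x - z') \<partial>lb 0 1) = (\<integral>x. F (r, x) * (\<phi>' (x - z) - \<phi>' (x - z')) \<partial>lb 0 1)"
        using J_integrable(2)[of "\<lambda>x. \<phi>' (x - z)" B r] J_integrable(2)[of "\<lambda>x. \<phi>' (x - z')" B r] B by (simp add: right_diff_distrib)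
      also have "\<bar>\<dots>\<bar> \<le> (B * \<bar>z - z'\<bar>) * kF r"
      proof (rule J_integrable(4))
        show "\<bar>\<phi>' (x - z) - \<phi>' (x - z')\<bar> \<le> B * \<bar>z - z'\<bar>" for x
          using smooth_lip[OF s(2) B(3), of "x - z" "x - z'"] by (simp add: abs_minus_commute)
      qed measurable
      finally show ?thesis by (simp add: \<phi>'_def ac_simps)
    qed
    show "\<bar>- H \<phi>' r z - - H \<phi>' r z'\<bar> \<le> B * N * \<bar>z - z'\<bar>" if "0 \<le> r" "r \<le> T" for r z z'
      using H_lip(1)[OF \<phi>' B(2-4) that(2), of z z'] by (simp add: abs_minus_commute)
    show "\<bar>- H \<phi>' r z\<bar> \<le> B * N" if "0 \<le> r" "r \<le> T" for r z
      using H_lip(2)[OF \<phi>' B(2-4) that(2), of z] by simp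
    show "\<bar>H \<phi> r z' - H \<phi> r z - - H \<phi>' r z * (z' - z)\<bar> \<le> B * N * (z' - z)\<^sup>2" if r: "0 \<le> r" "r \<le> T" for r z z'
    proof -
      have eq: "H \<phi> r z' - H \<phi> r z - - H \<phi>' r z * (z' - z) = J r (\<lambda>x. (\<phi> (x - z') + (-1) * \<phi> (x - z)) + (z' - z) * \<phi>' (x - z)) (\<lambda>x. (\<phi>' (x - z') + (-1) * \<phi>' (x - z)) + (z' - z) * d1 \<phi>' (x - z))"
      proof -
        have bd: "\<bar>\<psi> (x - z') + (-1) * \<psi> (x - z)\<bar> \<le> 2 * B" if "\<And>x. \<bar>\<psi> x\<bar> \<le> B" for \<psi> :: "real \<Rightarrow> real" and x
          using that[of "x - z'"] that[of "x - z"] by (simp add: abs_le_iff)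
        have bd': "\<bar>\<psi> x\<bar> \<le> 2 * B" if "\<And>x. \<bar>\<psi> x\<bar> \<le> B" for \<psi> :: "real \<Rightarrow> real" and x
          using that[of x] B0 by linarith
        have "J r (\<lambda>x. (\<phi> (x - z') + (-1) * \<phi> (x - z)) + (z' - z) * \<phi>' (x - z)) (\<lambda>x. (\<phi>' (x - z') + (-1) * \<phi>' (x - z)) + (z' - z) * d1 \<phi>' (x - z))
          = J r (\<lambda>x. \<phi> (x - z') + (-1) * \<phi> (x - z)) (\<lambda>x. \<phi>' (x - z') + (-1) * \<phi>' (x - z)) + (z' - z) * J r (\<lambda>x. \<phi>' (x - z)) (\<lambda>x. d1 \<phi>' (x - z))"
          by (rule J_lin[where B="2 * B"]; (rule r(2) bd[OF B(1)] bd[OF B(2)] bd'[OF B(2)] bd'[OF B(3)] | measurable))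
        also have "J r (\<lambda>x. \<phi> (x - z') + (-1) * \<phi> (x - z)) (\<lambda>x. \<phi>' (x - z') + (-1) * \<phi>' (x - z)) = J r (\<lambda>x. \<phi> (x - z')) (\<lambda>x. \<phi>' (x - z')) + (-1) * J r (\<lambda>x. \<phi> (x - z)) (\<lambda>x. \<phi>' (x - z))"
          by (rule J_lin[where B=B]; (rule r(2) B(1) B(2) | measurable))
        finally show ?thesis by (simp add: H_def \<phi>'_def algebra_simps)
      qed
      have "\<bar>H \<phi> r z' - H \<phi> r z - - H \<phi>' r z * (z' - z)\<bar> \<le> (B * (z' - z)\<^sup>2) * N"
        unfolding eq
      proof (rule J_bound[OF _ _ _ _ r(2)])
        show "\<bar>\<phi> (x - z') + - 1 * \<phi> (x - z) + (z' - z) * \<phi>' (x - z)\<bar> \<le> B * (z' - z)\<^sup>2" for x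
          using smooth_taylor[OF s(1), of B "x - z'" "x - z"] B(3)
          by (simp add: \<phi>'_def[symmetric] algebra_simps power2_commute[of z z'])
        show "\<bar>\<phi>' (x - z') + - 1 * \<phi>' (x - z) + (z' - z) * d1 \<phi>' (x - z)\<bar> \<le> B * (z' - z)\<^sup>2" for x
          using smooth_taylor[OF s(2), of B "x - z'" "x - z"] B(4)
          by (simp add: algebra_simps power2_commute[of z z'])
      qed auto
      then show ?thesis by (simp add: ac_simps)
    qed
    show "Z t = Z s + (\<integral>r. u (r, Z r) \<partial>lb s t)" if "0 \<le> s" "s \<le> t" "t \<le> T" for s t
      by (rule solves_diff[OF Z that])
  qed (use t u_bd in auto)
  have ae: "AE r in lb 0 T. (\<integral>x. F (r, x) * d1 \<phi> (x - Z r) \<partial>lb 0 1) + (- H \<phi>' r (Z r)) * u (r, Z r)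
     = (\<integral>x. (F (r, x) - u (r, Z r) * q (r, x)) * d1 \<phi> (x - Z r) \<partial>lb 0 1)"
    using H_eq_AE[OF \<phi>']
  proof eventually_elim
    case (elim r)
    have iq: "integrable (lb 0 1) (\<lambda>x. q (r, x) * \<phi>' (x - Z r))"
      by (rule integrable_lb_bounded[where K="Kq * B"]) (use q_bd B Kq_nonneg in \<open>auto simp: abs_mult intro!: mult_mono\<close>)
    have "(\<integral>x. (F (r, x) - u (r, Z r) * q (r, x)) * \<phi>' (x - Z r) \<partial>lb 0 1) = (\<integral>x. F (r, x) * \<phi>' (x - Z r) - u (r, Z r) * (q (r, x) * \<phi>' (x - Z r)) \<partial>lb 0 1)"
      by (simp add: algebra_simps)
    also have "\<dots> = (\<integral>x. F (r, x) * \<phi>' (x - Z r) \<partial>lb 0 1) - u (r, Z r) * H \<phi>' r (Z r)"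
      using iq J_integrable(2)[of "\<lambda>x. \<phi>' (x - Z r)" B r] B elim by simp
    finally show ?case by (simp add: \<phi>'_def)
  qed
  have [measurable]: "(\<lambda>r. H \<phi>' r (Z r)) \<in> borel_measurable borel" unfolding H_def J_def by measurable
  show ?thesis using H_eq_AE[OF \<phi>] AE_lb_in[of 0 T]
  proof eventually_elim
    case (elim t)
    have "(\<integral>x. q (t, x) * \<phi> (x - Z t) \<partial>lb 0 1) = H \<phi> 0 (Z 0) + (\<integral>r. (\<integral>x. F (r, x) * d1 \<phi> (x - Z r) \<partial>lb 0 1) + (- H \<phi>' r (Z r)) * u (r, Z r) \<partial>lb 0 t)"
      using elim main[of t] by simp
    also have "(\<integral>r. (\<integral>x. F (r, x) * d1 \<phi> (x - Z r) \<partial>lb 0 1) + (- H \<phi>' r (Z r)) * u (r, Z r) \<partial>lb 0 t)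
      = (\<integral>r. (\<integral>x. (F (r, x) - u (r, Z r) * q (r, x)) * d1 \<phi> (x - Z r) \<partial>lb 0 1) \<partial>lb 0 t)"
      using AE_lb_mono[OF ae, of 0 t] elim unfolding \<phi>'_def[symmetric] by (intro integral_cong_AE) auto
    finally show ?case by (simp add: H_def J_def)
  qed
qed

end

section \<open>One-sided approximate Dirac masses and sawtooth functions\<close>

definition del :: "nat \<Rightarrow> real" where "del n = 1 / (real n + 2)"
definition etac :: "nat \<Rightarrow> real" where "etac n = integral\<^sup>L (lb 0 1) (xbump 1 0 (del n))"
text \<open>Bumps of unit mass, positive modulo 1 exactly on (0, \<open>del n\<close>): Dirac masses
  approached from the right. The support shrinks with n, so the steepness of the bump can stay fixed
  at 1; the summand 2 in \<open>del\<close> keeps the support shorter than a period.\<close>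

definition eta :: "nat \<Rightarrow> real \<Rightarrow> real" where "eta n x = xbump 1 0 (del n) x * (1 / etac n)"

lemma del: "0 < del n" "del n < 1"
  by (simp_all add: del_def field_simps)

lemma del_tendsto: "del \<longlonglongrightarrow> 0"
proof -
  have "(\<lambda>n. 1 / real (n + 2)) \<longlonglongrightarrow> 0" using LIMSEQ_ignore_initial_segment[OF lim_1_over_n, of 2] .
  then show ?thesis unfolding del_def[abs_def] by (simp add: add.commute)
qed

lemma xbump_nonneg: "0 \<le> xbump n a b x"
  using flatexp0_bounds by (simp add: xbump_def)

lemma xbump_int: "integrable (lb c d) (xbump n a b)"
  by (rule integrable_lb_bounded[where K=1]) (auto simp: xbump_bounds smooth_measurable smooth_xbump)

lemma etac_pos: "0 < etac n"
proof -
  have "etac n \<noteq> 0"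
  proof
    assume "etac n = 0"
    then have "AE x in lb 0 1. xbump 1 0 (del n) x = 0"
      unfolding etac_def using integral_nonneg_eq_0_iff_AE[OF xbump_int] xbump_nonneg by auto
    then have "AE x in lb 0 (del n). xbump 1 0 (del n) x = 0" by (rule AE_lb_mono) (use del[of n] in auto)
    from AE_lb_closure[OF this del(1)] have "{t \<in> {0<..<del n}. xbump 1 0 (del n) t = 0} \<noteq> {}"
      using del(1)[of n] by (metis closure_empty atLeastatMost_empty_iff less_imp_le)
    then obtain t where t: "0 < t" "t < del n" "xbump 1 0 (del n) t = 0" by auto
    then show False
      using sin_prod_pos_iff[of 0 "del n" t] del[of n] by (auto simp: xbump_def flatexp_def)
  qed
  moreover have "0 \<le> etac n" unfolding etac_def using xbump_nonneg by (intro Bochner_Integration.integral_nonneg) auto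
  ultimately show ?thesis by simp
qed

lemma eta_nonneg: "0 \<le> eta n x"
  unfolding eta_def using xbump_nonneg etac_pos[of n] by (simp add: less_imp_le)

lemma eta_smooth: "smooth_fun (eta n)"
  unfolding eta_def[abs_def] by (intro smooth_mult smooth_xbump smooth_const)

lemma eta_meas [measurable]: "eta n \<in> borel_measurable borel"
  by (rule smooth_measurable[OF eta_smooth])

lemma eta_per: "eta n (x + 1) = eta n x"
  by (simp add: eta_def xbump_periodic)

lemma eta_bd: "\<bar>eta n x\<bar> \<le> 1 / etac n"
  unfolding eta_def abs_mult using xbump_bounds[of 1 0 "del n" x] etac_pos[of n] by (simp add: divide_right_mono)

lemma eta_int: "integrable (lb a b) (eta n)"
  by (rule integrable_lb_bounded[where K="1 / etac n"]) (auto simp: eta_bd)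

lemma eta_mass: "integral\<^sup>L (lb 0 1) (eta n) = 1"
  unfolding eta_def[abs_def] using etac_pos[of n] by (simp add: etac_def)

lemma eta_zero: "del n \<le> x \<Longrightarrow> x < 1 \<Longrightarrow> eta n x = 0"
  using sin_prod_pos_iff[of 0 "del n" x] del[of n] by (auto simp: eta_def xbump_def flatexp_def)

lemma eta_prim: "del n \<le> x \<Longrightarrow> x \<le> 1 \<Longrightarrow> integral\<^sup>L (lb 0 x) (eta n) = 1"
proof -
  assume x: "del n \<le> x" "x \<le> 1"
  have "integral\<^sup>L (lb 0 1) (eta n) = integral\<^sup>L (lb 0 x) (eta n) + integral\<^sup>L (lb x 1) (eta n)"
    by (rule integral_lb_combine[OF eta_int]) (use x del(1)[of n] in auto)
  moreover have "integral\<^sup>L (lb x 1) (eta n) = 0"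
    by (rule integral_eq_zero_AE) (use x eta_zero in \<open>auto simp: AE_lb\<close>)
  ultimately show ?thesis by (simp add: eta_mass)
qed

lemma ex_saw: "\<exists>e. test_torus e \<and> d1 e = (\<lambda>x. eta n x - 1) \<and> e 0 = 0"
  by (rule test_torus_primitive) (auto intro!: smooth_diff eta_smooth smooth_const simp: eta_per eta_int eta_mass)

text \<open>A smooth periodic approximation of the sawtooth: its derivative tends to the Dirac mass at the origin minus one, so that testing with its translates by a trajectory isolates the flux through the moving point.\<close>
definition saw :: "nat \<Rightarrow> real \<Rightarrow> real" where
  "saw n = (SOME e. test_torus e \<and> d1 e = (\<lambda>x. eta n x - 1) \<and> e 0 = 0)"

lemma saw: "test_torus (saw n)" "d1 (saw n) = (\<lambda>x. eta n x - 1)" "saw n 0 = 0"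
  using someI_ex[OF ex_saw[of n]] by (auto simp: saw_def)

lemma saw_per: "saw n (x + 1) = saw n x"
  using saw(1) by (simp add: test_torus_def)

lemma saw_meas [measurable]: "saw n \<in> borel_measurable borel"
  by (rule test_torus_measurable[OF saw(1)])

lemma saw_eq: "0 \<le> x \<Longrightarrow> saw n x = integral\<^sup>L (lb 0 x) (eta n) - x"
  using smooth_integral(2)[of "saw n" 0 x] saw[of n] eta_int[of 0 x n] by (simp add: test_torus_def)

lemma saw_bd: "\<bar>saw n x\<bar> \<le> 1"
proof -
  have "\<bar>saw n x\<bar> \<le> 1" if "0 \<le> x" "x < 1" for x
  proof -
    have "0 \<le> integral\<^sup>L (lb 0 x) (eta n)" using eta_nonneg by (intro Bochner_Integration.integral_nonneg) auto
    moreover have "integral\<^sup>L (lb 0 x) (eta n) \<le> 1"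
      using abs_integral_lb_le[OF eta_int, of x 1 0 n] that eta_nonneg eta_mass by simp
    ultimately show ?thesis using saw_eq[of x n] that by auto
  qed
  from this[of "frac x"] show ?thesis using periodic_frac[of "saw n" x] saw_per frac_lt_1[of x] by simp
qed

text \<open>As soon as \<open>del n\<close> is below x, the whole unit mass of \<open>eta n\<close>
  lies to the left of x and the sawtooth has its limit value.\<close>

lemma saw_tendsto:
  assumes "0 < x" "x < 1" shows "(\<lambda>n. saw n x) \<longlonglongrightarrow> 1 - x"
proof -
  have "\<forall>\<^sub>F n in sequentially. del n < x" using del_tendsto assms(1) by (rule order_tendstoD)
  then have "\<forall>\<^sub>F n in sequentially. 1 - x = saw n x"
    by eventually_elim (use assms saw_eq eta_prim in auto)
  then show ?thesis by (rule Lim_transform_eventually[OF tendsto_const])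
qed

text \<open>The two limiting sawteeth differ by z' - z to the right of z' and by z' - z - 1 between
  z and z'. Testing with the difference thus singles out the content of \<open>p\<close> between the
  two points, up to a multiple of its total content.\<close>

lemma saw_limit:
  fixes p :: "real \<Rightarrow> real"
  assumes p: "integrable (lb z (z+1)) p" and z': "z \<le> z'" "z' \<le> z + 1"
  shows "(\<lambda>n. \<integral>x. p x * (saw n (x - z') - saw n (x - z)) \<partial>lb z (z+1)) \<longlonglongrightarrow> (z' - z) * integral\<^sup>L (lb z (z+1)) p - integral\<^sup>L (lb z z') p"
proof -
  have [measurable]: "p \<in> borel_measurable borel" by (rule integrable_lb_measurable[OF p])
  have "(\<lambda>n. \<integral>x. p x * (saw n (x - z') - saw n (x - z)) \<partial>lb z (z+1)) \<longlonglongrightarrow> (\<integral>x. p x * ((z' - z) - indicator {z<..<z'} x) \<partial>lb z (z+1))"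
  proof (rule integral_dominated_convergence[where w="\<lambda>x. 2 * \<bar>p x\<bar>"])
    have "AE x in lborel. x \<noteq> z'" by (rule AE_lborel_singleton)
    then show "AE x in lb z (z+1). (\<lambda>n. p x * (saw n (x - z') - saw n (x - z))) \<longlonglongrightarrow> p x * ((z' - z) - indicator {z<..<z'} x)"
      unfolding AE_lb
    proof eventually_elim
      case (elim x)
      show ?case
      proof
        assume x: "z < x \<and> x < z + 1"
        have 1: "(\<lambda>n. saw n (x - z)) \<longlonglongrightarrow> 1 - (x - z)" using x by (intro saw_tendsto) auto
        have 2: "(\<lambda>n. saw n (x - z')) \<longlonglongrightarrow> 1 - (x - z') - indicator {z<..<z'} x"
        proof (cases "z' < x")
          case True
          then show ?thesis using saw_tendsto[of "x - z'"] x z' by simp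
        next
          case False
          with elim have "x < z'" by simp
          then show ?thesis using saw_tendsto[of "x - z' + 1"] x z' by (simp add: saw_per)
        qed
        show "(\<lambda>n. p x * (saw n (x - z') - saw n (x - z))) \<longlonglongrightarrow> p x * ((z' - z) - indicator {z<..<z'} x)"
          using tendsto_mult[OF tendsto_const[of "p x"] tendsto_diff[OF 2 1]] by (simp add: algebra_simps)
      qed
    qed
    show "AE x in lb z (z+1). norm (p x * (saw n (x - z') - saw n (x - z))) \<le> 2 * \<bar>p x\<bar>" for n
    proof (rule AE_I2)
      fix x
      have "\<bar>saw n (x - z') - saw n (x - z)\<bar> \<le> 2" using saw_bd[of n "x - z'"] saw_bd[of n "x - z"] by linarith
      then show "norm (p x * (saw n (x - z') - saw n (x - z))) \<le> 2 * \<bar>p x\<bar>"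
        unfolding real_norm_def abs_mult mult.commute[of 2] by (rule mult_left_mono) simp
    qed
  qed (use p in auto)
  also have "(\<integral>x. p x * ((z' - z) - indicator {z<..<z'} x) \<partial>lb z (z+1)) = (z' - z) * integral\<^sup>L (lb z (z+1)) p - integral\<^sup>L (lb z z') p"
  proof -
    have i: "integrable (lb z (z+1)) (\<lambda>x. indicator {z<..<z'} x * p x)"
      by (rule Bochner_Integration.integrable_bound[OF p]) (auto simp: indicator_def)
    have "(\<integral>x. p x * ((z' - z) - indicator {z<..<z'} x) \<partial>lb z (z+1)) = (\<integral>x. (z' - z) * p x - indicator {z<..<z'} x * p x \<partial>lb z (z+1))"
      by (simp add: algebra_simps)
    also have "\<dots> = (z' - z) * integral\<^sup>L (lb z (z+1)) p - (\<integral>x. indicator {z<..<z'} x * p x \<partial>lb z (z+1))"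
      using p i by simp
    also have "(\<integral>x. indicator {z<..<z'} x * p x \<partial>lb z (z+1)) = integral\<^sup>L (lb z z') p"
      using z' by (intro integral_lb_restrict[symmetric]) auto
    finally show ?thesis .
  qed
  finally show ?thesis .
qed

lemma eta_shift_mass: "(\<integral>x. eta n (x - z) \<partial>lb z (z+1)) = 1"
  using lb_shift(2)[of "\<lambda>x. eta n (x - z)" 0 z 1] eta_mass[of n] by (simp add: add.commute)

lemma eta_shift_int: "integrable (lb a b) (\<lambda>x. eta n (x - z))"
  by (rule integrable_lb_bounded[where K="1 / etac n"]) (auto simp: eta_bd)

lemma eta_mult_int:
  fixes G :: "real \<Rightarrow> real"
  assumes [measurable]: "G \<in> borel_measurable borel" and bd: "\<And>x. \<bar>G x\<bar> \<le> K"
  shows "integrable (lb a b) (\<lambda>x. G x * eta n (x - z))"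
  by (rule integrable_mult_bounded'[where K="1 / etac n"]) (auto simp: eta_bd intro!: integrable_lb_bounded[where K=K] bd)

text \<open>The mass of \<open>eta n\<close> sits strictly to the right of the origin, so only the
  right limit of \<open>G\<close> at z counts.\<close>

lemma kernel_limit:
  fixes G :: "real \<Rightarrow> real"
  assumes [measurable]: "G \<in> borel_measurable borel" and bd: "\<And>x. \<bar>G x\<bar> \<le> K" and lim: "(G \<longlongrightarrow> l) (at_right z)"
  shows "(\<lambda>n. \<integral>x. G x * eta n (x - z) \<partial>lb z (z+1)) \<longlonglongrightarrow> l"
proof (rule LIMSEQ_I)
  fix e :: real assume "0 < e"
  then have "\<forall>\<^sub>F x in at_right z. dist (G x) l < e / 2" by (intro tendstoD[OF lim]) auto
  then obtain d where d: "0 < d" "\<And>x. z < x \<Longrightarrow> x < z + d \<Longrightarrow> \<bar>G x - l\<bar> < e / 2"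
    unfolding eventually_at_right_field by (metis dist_real_def diff_gt_0_iff_gt add_diff_cancel_left' add.commute diff_add_cancel)
  have "\<forall>\<^sub>F n in sequentially. del n < d" using del_tendsto d(1) by (rule order_tendstoD)
  then obtain n0 where n0: "\<And>n. n0 \<le> n \<Longrightarrow> del n < d" by (auto simp: eventually_sequentially)
  have "norm ((\<integral>x. G x * eta n (x - z) \<partial>lb z (z+1)) - l) < e" if n: "n0 \<le> n" for n
  proof -
    have iG: "integrable (lb z (z+1)) (\<lambda>x. G x * eta n (x - z))"
      by (rule eta_mult_int[OF _ bd]) simp
    have "(\<integral>x. G x * eta n (x - z) \<partial>lb z (z+1)) - l = (\<integral>x. G x * eta n (x - z) \<partial>lb z (z+1)) - (\<integral>x. l * eta n (x - z) \<partial>lb z (z+1))"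
      by (simp add: eta_shift_mass)
    also have "\<dots> = (\<integral>x. (G x - l) * eta n (x - z) \<partial>lb z (z+1))"
      using iG eta_shift_int by (simp add: left_diff_distrib)
    finally have "\<bar>(\<integral>x. G x * eta n (x - z) \<partial>lb z (z+1)) - l\<bar> \<le> (\<integral>x. \<bar>(G x - l) * eta n (x - z)\<bar> \<partial>lb z (z+1))"
      by (simp add: integral_abs_bound)
    also have "\<dots> \<le> (\<integral>x. e / 2 * eta n (x - z) \<partial>lb z (z+1))"
    proof (rule integral_mono_AE)
      show "AE x in lb z (z+1). \<bar>(G x - l) * eta n (x - z)\<bar> \<le> e / 2 * eta n (x - z)"
      proof (rule AE_lbI)
        fix x assume x: "z < x" "x < z + 1"
        show "\<bar>(G x - l) * eta n (x - z)\<bar> \<le> e / 2 * eta n (x - z)"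
        proof (cases "x - z < del n")
          case True
          then have "\<bar>G x - l\<bar> \<le> e / 2" using d(2)[of x] n0[OF n] x by simp
          then show ?thesis unfolding abs_mult abs_of_nonneg[OF eta_nonneg] by (rule mult_right_mono[OF _ eta_nonneg])
        next
          case False
          then show ?thesis using eta_zero[of n "x - z"] x by simp
        qed
      qed
      show "integrable (lb z (z+1)) (\<lambda>x. \<bar>(G x - l) * eta n (x - z)\<bar>)"
        using iG eta_shift_int by (simp add: left_diff_distrib)
    qed (simp add: eta_shift_int)
    also have "\<dots> = e / 2" by (simp add: eta_shift_mass)
    finally show ?thesis using \<open>0 < e\<close> by simp
  qed
  then show "\<exists>no. \<forall>n\<ge>no. norm ((\<integral>x. G x * eta n (x - z) \<partial>lb z (z+1)) - l) < e" by blast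
qed

section \<open>The flux between two trajectories\<close>

context conserved
begin

lemma total_AE: "AE t in lb 0 T. (\<integral>x. q (t, x) \<partial>lb 0 1) = integral\<^sup>L (lb 0 1) q0"
proof -
  have "d1 (\<lambda>x. 1) = (\<lambda>x. 0)" by (auto intro!: d1_eq)
  then show ?thesis using weak[unfolded weakW_def, rule_format, OF test_torus_const[of 1]] by simp
qed

lemma q_slice_int: "integrable (lb a b) (\<lambda>x. q (t, x))"
  by (rule integrable_lb_bounded[where K=Kq]) (auto simp: q_bd)

text \<open>The time integrand produced by \<open>flux_test\<close> when the n-th sawtooth is
  carried by a point at position z; the factor \<open>eta n - 1\<close> is the sawtooth's
  derivative.\<close>

definition R :: "nat \<Rightarrow> real \<Rightarrow> real \<Rightarrow> real" where
  "R n r z = (\<integral>x. (F (r, x) - u (r, z) * q (r, x)) * (eta n (x - z) - 1) \<partial>lb 0 1)"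

lemma R_eq: "R n r z = (\<integral>x. (F (r, x) - u (r, z) * q (r, x)) * eta n (x - z) \<partial>lb z (z+1)) - (\<integral>x. F (r, x) \<partial>lb 0 1) + u (r, z) * (\<integral>x. q (r, x) \<partial>lb 0 1)"
proof -
  let ?G = "\<lambda>x. F (r, x) - u (r, z) * q (r, x)"
  have Gb: "\<bar>?G x\<bar> \<le> kF r + U * Kq" for x
  proof -
    have "\<bar>u (r, z) * q (r, x)\<bar> \<le> U * Kq" unfolding abs_mult by (intro mult_mono q_bd u_bd U_nonneg) auto
    then show ?thesis using F_bd[of r x] by linarith
  qed
  have iG: "integrable (lb 0 1) (\<lambda>x. ?G x * eta n (x - z))"
    by (rule eta_mult_int[OF _ Gb]) measurable
  have iF: "integrable (lb 0 1) (\<lambda>x. F (r, x))" by (rule integrable_lb_bounded[where K="kF r"]) (auto simp: F_bd)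
  have per: "?G (x + 1) * eta n ((x + 1) - z) = ?G x * eta n (x - z)" for x
    using eta_per[of n "x - z"] by (simp add: F_def q_per u_per s_per diff_add_eq)
  have "R n r z = (\<integral>x. ?G x * eta n (x - z) - F (r, x) + u (r, z) * q (r, x) \<partial>lb 0 1)"
    unfolding R_def by (intro Bochner_Integration.integral_cong) (auto simp: algebra_simps)
  also have "\<dots> = (\<integral>x. ?G x * eta n (x - z) \<partial>lb 0 1) - (\<integral>x. F (r, x) \<partial>lb 0 1) + u (r, z) * (\<integral>x. q (r, x) \<partial>lb 0 1)"
    using iG iF q_slice_int[of 0 1 r] by simp
  also have "(\<integral>x. ?G x * eta n (x - z) \<partial>lb 0 1) = (\<integral>x. ?G x * eta n (x - z) \<partial>lb z (z+1))"
    by (rule periodic_integral[symmetric, OF per iG])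
  finally show ?thesis .
qed

text \<open>Uniform in n because \<open>eta n\<close> has unit mass, although its maximum grows: the
  majorant for the passage to the limit under the time integral.\<close>

lemma R_bound: "\<bar>R n r z\<bar> \<le> 2 * kF r + 2 * (U * Kq)"
proof -
  let ?G = "\<lambda>x. F (r, x) - u (r, z) * q (r, x)"
  have Gb: "\<bar>?G x\<bar> \<le> kF r + U * Kq" for x
  proof -
    have "\<bar>u (r, z) * q (r, x)\<bar> \<le> U * Kq" unfolding abs_mult by (intro mult_mono q_bd u_bd U_nonneg) auto
    then show ?thesis using F_bd[of r x] by linarith
  qed
  have iG: "integrable (lb z (z+1)) (\<lambda>x. ?G x * eta n (x - z))"
    by (rule eta_mult_int[OF _ Gb]) measurable
  have "\<bar>\<integral>x. ?G x * eta n (x - z) \<partial>lb z (z+1)\<bar> \<le> (\<integral>x. \<bar>?G x * eta n (x - z)\<bar> \<partial>lb z (z+1))" by (rule integral_abs_bound)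
  also have "\<dots> \<le> (\<integral>x. (kF r + U * Kq) * eta n (x - z) \<partial>lb z (z+1))"
    by (rule integral_mono[OF integrable_abs[OF iG]])
       (use eta_shift_int eta_nonneg Gb in \<open>auto simp: abs_mult intro!: mult_right_mono\<close>)
  also have "\<dots> = kF r + U * Kq" by (simp add: eta_shift_mass)
  finally have 1: "\<bar>\<integral>x. ?G x * eta n (x - z) \<partial>lb z (z+1)\<bar> \<le> kF r + U * Kq" .
  have 2: "\<bar>\<integral>x. F (r, x) \<partial>lb 0 1\<bar> \<le> kF r" using integral_lb_bound[of 0 1 "\<lambda>x. F (r, x)" "kF r"] F_bd by simp
  have "\<bar>\<integral>x. q (r, x) \<partial>lb 0 1\<bar> \<le> Kq" using integral_lb_bound[of 0 1 "\<lambda>x. q (r, x)" Kq] q_bd by simp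
  then have "\<bar>u (r, z) * (\<integral>x. q (r, x) \<partial>lb 0 1)\<bar> \<le> U * Kq" unfolding abs_mult by (intro mult_mono u_bd U_nonneg) auto
  then show ?thesis unfolding R_eq using 1 2 by linarith
qed

text \<open>Near z the relative flux is q (u - u(z)) - s. Its first part tends to 0, as
  \<open>q\<close> is bounded and \<open>u\<close> continuous, so the discontinuous \<open>q\<close>
  need not have a trace at z.\<close>

lemma R_limit: "(\<lambda>n. R n r z) \<longlonglongrightarrow> - s (r, z) - (\<integral>x. F (r, x) \<partial>lb 0 1) + u (r, z) * (\<integral>x. q (r, x) \<partial>lb 0 1)"
proof -
  let ?G = "\<lambda>x. F (r, x) - u (r, z) * q (r, x)"
  have Gb: "\<bar>?G x\<bar> \<le> kF r + U * Kq" for x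
  proof -
    have "\<bar>u (r, z) * q (r, x)\<bar> \<le> U * Kq" unfolding abs_mult by (intro mult_mono q_bd u_bd U_nonneg) auto
    then show ?thesis using F_bd[of r x] by linarith
  qed
  have su: "((\<lambda>x. s (r, x)) \<longlongrightarrow> s (r, z)) (at_right z)" "((\<lambda>x. u (r, x)) \<longlongrightarrow> u (r, z)) (at_right z)"
    using s_cont[of r] u_cont[of r] by (auto simp: continuous_on_def intro: tendsto_within_subset)
  have "((\<lambda>x. q (r, x) * (u (r, x) - u (r, z))) \<longlongrightarrow> 0) (at_right z)"
  proof (rule Lim_null_comparison)
    show "((\<lambda>x. Kq * \<bar>u (r, x) - u (r, z)\<bar>) \<longlongrightarrow> 0) (at_right z)"
      by (rule tendsto_eq_intros su | simp)+
    show "\<forall>\<^sub>F x in at_right z. norm (q (r, x) * (u (r, x) - u (r, z))) \<le> Kq * \<bar>u (r, x) - u (r, z)\<bar>"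
      using q_bd by (intro always_eventually allI) (simp add: abs_mult mult_right_mono)
  qed
  from tendsto_diff[OF this su(1)] have "(?G \<longlongrightarrow> - s (r, z)) (at_right z)"
    by (simp add: F_def algebra_simps)
  then have "(\<lambda>n. \<integral>x. ?G x * eta n (x - z) \<partial>lb z (z+1)) \<longlonglongrightarrow> - s (r, z)"
    by (intro kernel_limit[where K="kF r + U * Kq"] Gb) measurable
  then show ?thesis unfolding R_eq by (intro tendsto_intros)
qed

text \<open>Subtract the sawtooth identities of the trajectories issued from 0 and from a. The mean
  fluxes cancel. The multiples of the total content \<open>Q0\<close>, which is constant in time,
  also cancel: they are z' - z at time t, a initially, and the difference of the displacements in
  between. What remains is the stress at the two moving ends.\<close>

lemma flux_identity:
  assumes a: "0 \<le> a" "a \<le> 1"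
  shows "AE t in lb 0 T. (\<integral>x. q (t, x) \<partial>lb (X (t, 0)) (X (t, a))) = integral\<^sup>L (lb 0 a) q0 + (\<integral>r. s (r, X (r, a)) - s (r, X (r, 0)) \<partial>lb 0 t)"
proof -
  let ?Z = "\<lambda>t. X (t, 0)" and ?W = "\<lambda>t. X (t, a)"
  define Q0 where "Q0 = integral\<^sup>L (lb 0 1) q0"
  have "AE t in lb 0 T. \<forall>n. (\<integral>x. q (t, x) * saw n (x - X (t, b)) \<partial>lb 0 1) = (\<integral>x. q0 x * saw n (x - b) \<partial>lb 0 1) + (\<integral>r. R n r (X (r, b)) \<partial>lb 0 t)" for b
    unfolding AE_all_countable R_def using flux_test[OF saw(1) X_solves[of b]] by (simp add: X_0 saw(2))
  note ft = this[of 0] this[of a]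
  show ?thesis using ft total_AE AE_lb_in[of 0 T]
  proof eventually_elim
    case (elim t)
    define z where "z = ?Z t" define z' where "z' = ?W t"
    have t: "0 \<le> t" "t \<le> T" using elim by auto
    have zz: "z \<le> z'" "z' \<le> z + 1"
      using X_mono[OF a(1) t] X_mono[OF a(2) t] X_per[OF t, of 0] by (simp_all add: z_def z'_def)
    have isaw: "integrable (lb 0 1) (\<lambda>x. q (t, x) * saw n (x - y))" for n y
      by (rule integrable_mult_bounded'[OF q_slice_int, where K=1]) (auto simp: saw_bd)
    have isaw0: "integrable (lb 0 1) (\<lambda>x. q0 x * saw n (x - y))" for n y
      by (rule integrable_mult_bounded'[OF q0_int, where K=1]) (auto simp: saw_bd)
    have [measurable]: "(\<lambda>r. R n r (X (r, b))) \<in> borel_measurable borel" for n b unfolding R_def by measurable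
    have ikF: "integrable (lb 0 t) (\<lambda>r. 2 * kF r + 2 * (U * Kq))"
      using integrable_lb_subset[OF kF_int, of 0 t] t by simp
    have iR: "integrable (lb 0 t) (\<lambda>r. R n r (X (r, b)))" for n b
      by (rule Bochner_Integration.integrable_bound[OF ikF]) (use R_bound in \<open>auto intro!: AE_I2 intro: order_trans[OF _ abs_ge_self]\<close>)
    have eq: "(\<integral>x. q (t, x) * (saw n (x - z') - saw n (x - z)) \<partial>lb z (z+1))
       = (\<integral>x. q0 x * (saw n (x - a) - saw n (x - 0)) \<partial>lb 0 (0+1)) + (\<integral>r. R n r (?W r) - R n r (?Z r) \<partial>lb 0 t)" for n
    proof -
      have "(\<integral>x. q (t, x) * (saw n (x - z') - saw n (x - z)) \<partial>lb z (z+1)) = (\<integral>x. q (t, x) * (saw n (x - z') - saw n (x - z)) \<partial>lb 0 1)"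
      proof (rule periodic_integral)
        show "q (t, x + 1) * (saw n (x + 1 - z') - saw n (x + 1 - z)) = q (t, x) * (saw n (x - z') - saw n (x - z))" for x
          using saw_per[of n "x - z'"] saw_per[of n "x - z"] by (simp add: q_per diff_add_eq)
        show "integrable (lb 0 1) (\<lambda>x. q (t, x) * (saw n (x - z') - saw n (x - z)))"
          using isaw[of n z'] isaw[of n z] by (simp add: right_diff_distrib)
      qed
      also have "\<dots> = (\<integral>x. q (t, x) * saw n (x - z') \<partial>lb 0 1) - (\<integral>x. q (t, x) * saw n (x - z) \<partial>lb 0 1)"
        using isaw[of n z'] isaw[of n z] by (simp add: right_diff_distrib)
      also have "\<dots> = ((\<integral>x. q0 x * saw n (x - a) \<partial>lb 0 1) - (\<integral>x. q0 x * saw n (x - 0) \<partial>lb 0 1)) + ((\<integral>r. R n r (?W r) \<partial>lb 0 t) - (\<integral>r. R n r (?Z r) \<partial>lb 0 t))"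
        using elim unfolding z_def z'_def by simp
      also have "\<dots> = (\<integral>x. q0 x * (saw n (x - a) - saw n (x - 0)) \<partial>lb 0 (0+1)) + (\<integral>r. R n r (?W r) - R n r (?Z r) \<partial>lb 0 t)"
        using isaw0[of n a] isaw0[of n 0] iR by (simp add: right_diff_distrib)
      finally show ?thesis .
    qed
    have lim1: "(\<lambda>n. \<integral>x. q (t, x) * (saw n (x - z') - saw n (x - z)) \<partial>lb z (z+1)) \<longlonglongrightarrow> (z' - z) * (\<integral>x. q (t, x) \<partial>lb z (z+1)) - (\<integral>x. q (t, x) \<partial>lb z z')"
      by (rule saw_limit[OF q_slice_int zz])
    have lim2: "(\<lambda>n. \<integral>x. q0 x * (saw n (x - a) - saw n (x - 0)) \<partial>lb 0 (0+1)) \<longlonglongrightarrow> (a - 0) * integral\<^sup>L (lb 0 (0+1)) q0 - integral\<^sup>L (lb 0 a) q0"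
      by (rule saw_limit) (use a q0_int in auto)
    let ?D = "\<lambda>r. - (s (r, ?W r) - s (r, ?Z r)) + Q0 * (u (r, ?W r) - u (r, ?Z r))"
    have lim3: "(\<lambda>n. \<integral>r. R n r (?W r) - R n r (?Z r) \<partial>lb 0 t) \<longlonglongrightarrow> (\<integral>r. ?D r \<partial>lb 0 t)"
    proof (rule integral_dominated_convergence[where w="\<lambda>r. 2 * (2 * kF r + 2 * (U * Kq))"])
      have "AE r in lb 0 t. (\<integral>x. q (r, x) \<partial>lb 0 1) = Q0" unfolding Q0_def by (rule AE_lb_mono[OF total_AE]) (use t in auto)
      then show "AE r in lb 0 t. (\<lambda>n. R n r (?W r) - R n r (?Z r)) \<longlonglongrightarrow> ?D r"
      proof eventually_elim
        case (elim r)
        show ?case using tendsto_diff[OF R_limit[of r "?W r"] R_limit[of r "?Z r"]] elim by (simp add: algebra_simps)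
      qed
      show "AE r in lb 0 t. norm (R n r (?W r) - R n r (?Z r)) \<le> 2 * (2 * kF r + 2 * (U * Kq))" for n
        by (rule AE_I2) (use R_bound[of n _ "?W _"] R_bound[of n _ "?Z _"] in \<open>smt (verit) real_norm_def\<close>)
      show "integrable (lb 0 t) (\<lambda>r. 2 * (2 * kF r + 2 * (U * Kq)))" by (rule integrable_mult_right[OF ikF])
    qed auto
    have "(z' - z) * (\<integral>x. q (t, x) \<partial>lb z (z+1)) - (\<integral>x. q (t, x) \<partial>lb z z') = ((a - 0) * integral\<^sup>L (lb 0 (0+1)) q0 - integral\<^sup>L (lb 0 a) q0) + (\<integral>r. ?D r \<partial>lb 0 t)"
      by (rule LIMSEQ_unique[OF lim1]) (use tendsto_add[OF lim2 lim3] in \<open>simp add: eq\<close>)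
    moreover have "(\<integral>x. q (t, x) \<partial>lb z (z+1)) = Q0"
      using periodic_integral[of "\<lambda>x. q (t, x)" z] q_per q_slice_int[of 0 1 t] elim by (simp add: Q0_def)
    moreover have "(\<integral>r. ?D r \<partial>lb 0 t) = - (\<integral>r. s (r, ?W r) - s (r, ?Z r) \<partial>lb 0 t) + Q0 * ((z' - a) - z)"
    proof -
      have isx: "integrable (lb 0 t) (\<lambda>r. s (r, X (r, b)))" for b
        by (rule Bochner_Integration.integrable_bound[OF integrable_lb_subset[OF k_int, of 0 t]])
           (use t s_bd in \<open>auto intro!: AE_I2 intro: order_trans[OF _ abs_ge_self]\<close>)
      have iu: "integrable (lb 0 t) (\<lambda>r. u (r, X (r, b)))" for b by (rule u_along_int) simp
      have "(\<integral>r. ?D r \<partial>lb 0 t) = - (\<integral>r. s (r, ?W r) - s (r, ?Z r) \<partial>lb 0 t) + Q0 * ((\<integral>r. u (r, ?W r) \<partial>lb 0 t) - (\<integral>r. u (r, ?Z r) \<partial>lb 0 t))"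
        using isx iu by simp
      then show ?thesis using X_eq[OF t, of a] X_eq[OF t, of 0] by (simp add: z_def z'_def)
    qed
    ultimately have "(\<integral>x. q (t, x) \<partial>lb z z') = integral\<^sup>L (lb 0 a) q0 + (\<integral>r. s (r, ?W r) - s (r, ?Z r) \<partial>lb 0 t)"
      by (simp add: Q0_def algebra_simps)
    then show ?case by (simp add: z_def z'_def)
  qed
qed

end

section \<open>Lagrangian coordinates\<close>

text \<open>The indicator of failure is periodic, so its integral over any window of length one is
  the same, namely zero.\<close>

lemma AE_periodic:
  assumes per: "\<And>x::real. P (x + 1) = P x" and [measurable]: "Measurable.pred borel P" and ae: "AE x in lb 0 1. P x"
  shows "AE x in lb z (z+1). P x"
proof -
  let ?f = "\<lambda>x. of_bool (\<not> P x) :: real"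
  have i: "integrable (lb a b) ?f" for a b by (rule integrable_lb_bounded[where K=1]) auto
  have "integral\<^sup>L (lb z (z+1)) ?f = integral\<^sup>L (lb 0 1) ?f" using per by (intro periodic_integral i) auto
  also have "\<dots> = 0" using ae by (intro integral_eq_zero_AE) auto
  finally have "AE x in lb z (z+1). ?f x = 0" using integral_nonneg_eq_0_iff_AE[OF i] by auto
  then show ?thesis by eventually_elim auto
qed

lemma emeasure_density_lb:
  assumes [measurable]: "r \<in> borel_measurable borel" "S \<in> sets borel" and r: "\<And>x. 0 \<le> r x" "\<And>x. r x \<le> K"
  shows "emeasure (density (lb a b) (\<lambda>x. ennreal (r x))) S = ennreal (\<integral>x. indicator S x * r x \<partial>lb a b)"
proof -
  have "integrable (lb a b) (\<lambda>x. indicator S x * r x)"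
    by (rule integrable_lb_bounded[where K=K]) (use r order_trans[OF r] in \<open>auto simp: indicator_def\<close>)
  then show ?thesis using r
    by (simp add: emeasure_density nn_integral_eq_integral[symmetric] ennreal_mult' ennreal_indicator mult.commute)
qed

locale lagrange = velocity +
  fixes rho :: "real \<times> real \<Rightarrow> real" and rl rh :: real and rho0 :: "real \<Rightarrow> real" and r0l r0h :: real
  assumes rho_meas [measurable]: "rho \<in> borel_measurable (borel \<Otimes>\<^sub>M borel)"
    and rho_per: "\<And>t x. rho (t, x + 1) = rho (t, x)"
    and rho_bd: "\<And>t x. rl \<le> rho (t, x)" "\<And>t x. rho (t, x) \<le> rh" and rl_pos: "0 < rl"
    and rho0_meas [measurable]: "rho0 \<in> borel_measurable borel"
    and rho0_bd: "\<And>x. r0l \<le> rho0 x" "\<And>x. rho0 x \<le> r0h" and r0l_pos: "0 < r0l"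
    and mass: "weakW T rho (\<lambda>z. rho z * u z) rho0"
begin

lemma rho_pos: "0 < rho z"
  using rho_bd(1)[of "fst z" "snd z"] rl_pos by simp

lemma rho0_pos: "0 < rho0 x"
  using rho0_bd(1)[of x] r0l_pos by simp

sublocale M: conserved T u ux L U rho "\<lambda>z. 0" rho0 rh "\<lambda>t. 0"
proof unfold_locales
  show "\<bar>rho (t, x)\<bar> \<le> rh" for t x using rho_bd[of t x] rl_pos by simp
  show "integrable (lb 0 1) rho0"
    by (rule integrable_lb_bounded[where K=r0h]) (use rho0_bd rho0_pos in \<open>auto simp: less_imp_le\<close>)
  show "weakW T rho (\<lambda>z. rho z * u z - 0) rho0" using mass by simp
qed (auto simp: rho_per)

text \<open>Times at which the mass between trajectories is conserved for all labels simultaneously.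
  Almost every time is good, and at each good time the change between label and position is
  legitimate.\<close>

definition good :: "real \<Rightarrow> bool" where
  "good t \<longleftrightarrow> 0 \<le> t \<and> t \<le> T \<and> (\<forall>a\<in>{0..1}. (\<integral>x. rho (t, x) \<partial>lb (X (t, 0)) (X (t, a))) = integral\<^sup>L (lb 0 a) rho0)"

lemma rho_slice_int: "integrable (lb a b) (\<lambda>x. rho (t, x))"
  by (rule M.q_slice_int)

lemma rho0_int: "integrable (lb a b) rho0"
  by (rule integrable_lb_bounded[where K=r0h]) (use rho0_bd rho0_pos in \<open>auto simp: less_imp_le\<close>)

lemma good_AE: "AE t in lb 0 T. good t"
proof -
  have "AE t in lb 0 T. \<forall>a\<in>\<rat> \<inter> {0..1}. (\<integral>x. rho (t, x) \<partial>lb (X (t, 0)) (X (t, a))) = integral\<^sup>L (lb 0 a) rho0"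
    using M.flux_identity by (subst AE_ball_countable) (auto intro: countable_subset[OF _ countable_rat])
  with AE_lb_in show ?thesis
  proof eventually_elim
    case (elim t)
    then have t: "0 \<le> t" "t \<le> T" by auto
    have "continuous_on {0..1} (\<lambda>a. (\<integral>x. rho (t, x) \<partial>lb (X (t, 0)) (X (t, a))) - integral\<^sup>L (lb 0 a) rho0)"
    proof (intro continuous_on_diff integral_lb_zero_continuous[OF rho0_int])
      show "continuous_on {0..1} (\<lambda>a. \<integral>x. rho (t, x) \<partial>lb (X (t, 0)) (X (t, a)))"
        by (rule continuous_on_compose2[OF integral_lb_zero_continuous[OF rho_slice_int, of "X (t, 0)" "X (t, 1)"] continuous_on_subset[OF X_cont[OF t]]])
           (auto intro!: X_mono t)
    qed
    then have "(\<integral>x. rho (t, x) \<partial>lb (X (t, 0)) (X (t, a))) - integral\<^sup>L (lb 0 a) rho0 = 0" if "a \<in> {0..1}" for a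
      using elim that by - (rule continuous_zero_if_rat_zero[where a=0 and b=1], auto)
    then show ?case using t by (simp add: good_def)
  qed
qed

text \<open>\<open>X_mono\<close> gives only the weak order; strictness comes from the mass between
  two labels, which is at least \<open>r0l\<close> times their distance and is still present at a
  good time.\<close>

lemma good_strict:
  assumes g: "good t" and a: "0 \<le> a" "a < b" "b \<le> 1"
  shows "X (t, a) < X (t, b)"
proof (rule ccontr)
  assume "\<not> ?thesis"
  moreover have "X (t, a) \<le> X (t, b)" using g a by (intro X_mono) (auto simp: good_def)
  ultimately have "X (t, a) = X (t, b)" by simp
  then have "integral\<^sup>L (lb 0 a) rho0 = integral\<^sup>L (lb 0 b) rho0" using g a unfolding good_def by (metis atLeastAtMost_iff less_imp_le order_trans)
  moreover have "integral\<^sup>L (lb 0 b) rho0 = integral\<^sup>L (lb 0 a) rho0 + integral\<^sup>L (lb a b) rho0"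
    by (rule integral_lb_combine[OF rho0_int]) (use a in auto)
  moreover have "(\<integral>x. r0l \<partial>lb a b) \<le> integral\<^sup>L (lb a b) rho0"
    by (rule integral_mono) (use rho0_int rho0_bd in auto)
  ultimately have "(b - a) * r0l \<le> 0" using a by simp
  moreover have "0 < (b - a) * r0l" using a r0l_pos by (intro mult_pos_pos) auto
  ultimately show False by linarith
qed

definition m :: "real measure" where "m = density (lb 0 1) (\<lambda>a. ennreal (rho0 a))"

lemma sets_m [simp, measurable_cong]: "sets m = sets borel" and space_m [simp]: "space m = UNIV"
  by (simp_all add: m_def)

lemma AE_m: "(AE a in m. P a) \<longleftrightarrow> (AE a in lb 0 1. P a)"
  unfolding m_def using rho0_pos by (subst AE_density) auto

lemma integral_m: "f \<in> borel_measurable borel \<Longrightarrow> integral\<^sup>L m f = (\<integral>a. rho0 a * f a \<partial>lb 0 1)"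
  for f :: "real \<Rightarrow> real"
  unfolding m_def using rho0_pos by (subst integral_density) (auto simp: less_imp_le)

lemma integrable_m: "f \<in> borel_measurable borel \<Longrightarrow> integrable m f \<longleftrightarrow> integrable (lb 0 1) (\<lambda>a. rho0 a * f a)"
  for f :: "real \<Rightarrow> real"
  unfolding m_def using rho0_pos by (subst integrable_density) (auto simp: less_imp_le)

lemma X_slice_meas [measurable]: "(\<lambda>a. X (t, a)) \<in> borel_measurable borel"
  by measurable

text \<open>The mass measure on labels is carried to the mass measure on one spatial period.
  Half-lines up to y suffice; for y inside the period the intermediate value theorem gives a label b
  with X(t, b) = y, and goodness of t is precisely equality of the masses up to b.\<close>

lemma push:
  assumes g: "good t"
  shows "distr m borel (\<lambda>a. X (t, a)) = density (lb (X (t, 0)) (X (t, 0) + 1)) (\<lambda>x. ennreal (rho (t, x)))" (is "?A = ?B")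
proof -
  have t: "0 \<le> t" "t \<le> T" and gm: "\<And>a. a \<in> {0..1} \<Longrightarrow> (\<integral>x. rho (t, x) \<partial>lb (X (t, 0)) (X (t, a))) = integral\<^sup>L (lb 0 a) rho0"
    using g by (auto simp: good_def)
  let ?z = "X (t, 0)"
  have X1: "X (t, 1) = ?z + 1" using X_per[OF t, of 0] by simp
  have eA: "emeasure ?A S = ennreal (\<integral>a. indicator S (X (t, a)) * rho0 a \<partial>lb 0 1)" if [measurable]: "S \<in> sets borel" for S
  proof -
    have "emeasure ?A S = emeasure m ((\<lambda>a. X (t, a)) -` S)" by (subst emeasure_distr) auto
    also have "\<dots> = ennreal (\<integral>a. indicator ((\<lambda>a. X (t, a)) -` S) a * rho0 a \<partial>lb 0 1)"
      unfolding m_def by (rule emeasure_density_lb[where K=r0h]) (auto simp: rho0_bd less_imp_le[OF rho0_pos] measurable_sets_borel[OF X_slice_meas that])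
    finally show ?thesis by (simp add: indicator_def)
  qed
  have eB: "emeasure ?B S = ennreal (\<integral>x. indicator S x * rho (t, x) \<partial>lb ?z (?z + 1))" if [measurable]: "S \<in> sets borel" for S
    by (rule emeasure_density_lb[where K=rh]) (auto simp: rho_bd less_imp_le[OF rho_pos])
  have key: "(\<integral>a. indicator {..y} (X (t, a)) * rho0 a \<partial>lb 0 1) = (\<integral>x. indicator {..y} x * rho (t, x) \<partial>lb ?z (?z + 1))" for y
  proof -
    consider "y < ?z" | "?z + 1 < y" | "?z \<le> y" "y \<le> ?z + 1" by linarith
    then show ?thesis
    proof cases
      case 1
      have "(\<integral>a. indicator {..y} (X (t, a)) * rho0 a \<partial>lb 0 1) = 0"
      proof (rule integral_eq_zero_AE, rule AE_lbI)
        fix a :: real assume "0 < a"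
        then have "?z \<le> X (t, a)" using t by (intro X_mono) auto
        then show "indicator {..y} (X (t, a)) * rho0 a = 0" using 1 by (simp add: indicator_def)
      qed
      moreover have "(\<integral>x. indicator {..y} x * rho (t, x) \<partial>lb ?z (?z + 1)) = 0"
        by (rule integral_eq_zero_AE) (use 1 in \<open>auto simp: AE_lb indicator_def\<close>)
      ultimately show ?thesis by simp
    next
      case 2
      have "(\<integral>a. indicator {..y} (X (t, a)) * rho0 a \<partial>lb 0 1) = integral\<^sup>L (lb 0 1) rho0"
      proof (rule integral_cong_AE)
        show "AE a in lb 0 1. indicator {..y} (X (t, a)) * rho0 a = rho0 a"
        proof (rule AE_lbI)
          fix a :: real assume "a < 1"
          then have "X (t, a) \<le> ?z + 1" using X_mono[of a 1, OF _ t] X1 by simp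
          then show "indicator {..y} (X (t, a)) * rho0 a = rho0 a" using 2 by (simp add: indicator_def)
        qed
      qed auto
      moreover have "(\<integral>x. indicator {..y} x * rho (t, x) \<partial>lb ?z (?z + 1)) = (\<integral>x. rho (t, x) \<partial>lb ?z (?z + 1))"
        by (rule integral_cong_AE) (use 2 in \<open>auto simp: AE_lb indicator_def\<close>)
      ultimately show ?thesis using gm[of 1] X1 by simp
    next
      case 3
      obtain b where b: "0 \<le> b" "b \<le> 1" "X (t, b) = y"
        using IVT'[of "\<lambda>a. X (t, a)" 0 y 1] 3 X1 continuous_on_subset[OF X_cont[OF t]] by auto
      have "(\<integral>a. indicator {..y} (X (t, a)) * rho0 a \<partial>lb 0 1) = (\<integral>a. indicator {0<..<b} a * rho0 a \<partial>lb 0 1)"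
      proof (rule integral_cong_AE)
        have iff: "X (t, a) \<le> y \<longleftrightarrow> a < b" if "0 < a" "a < 1" "a \<noteq> b" for a
          using good_strict[OF g, of a b] good_strict[OF g, of b a] b that by fastforce
        show "AE a in lb 0 1. indicator {..y} (X (t, a)) * rho0 a = indicator {0<..<b} a * rho0 a"
          unfolding AE_lb using AE_lborel_singleton[of b] by eventually_elim (use iff in \<open>auto simp: indicator_def\<close>)
      qed auto
      also have "\<dots> = integral\<^sup>L (lb 0 b) rho0" using b by (intro integral_lb_restrict[symmetric]) auto
      also have "\<dots> = (\<integral>x. rho (t, x) \<partial>lb ?z y)" using gm[of b] b by simp
      also have "\<dots> = (\<integral>x. indicator {?z<..<y} x * rho (t, x) \<partial>lb ?z (?z + 1))"
        using 3 by (intro integral_lb_restrict) auto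
      also have "\<dots> = (\<integral>x. indicator {..y} x * rho (t, x) \<partial>lb ?z (?z + 1))"
      proof (rule integral_cong_AE)
        show "AE x in lb ?z (?z + 1). indicator {?z<..<y} x * rho (t, x) = indicator {..y} x * rho (t, x)"
          unfolding AE_lb using AE_lborel_singleton[of y] by eventually_elim (auto simp: indicator_def)
      qed auto
      finally show ?thesis .
    qed
  qed
  show ?thesis
  proof (rule measure_eqI_generator_eq[where \<Omega>=UNIV and E="range atMost" and A="\<lambda>n. {..real n}"])
    show "Int_stable (range (atMost :: real \<Rightarrow> real set))" 
      by (auto simp: Int_stable_def min_def[symmetric])
    show "sets ?A = sigma_sets UNIV (range (atMost :: real \<Rightarrow> real set))"
      "sets ?B = sigma_sets UNIV (range (atMost :: real \<Rightarrow> real set))"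
      by (simp_all add: borel_eq_atMost)
    show "emeasure ?A S = emeasure ?B S" if S': "S \<in> range atMost" for S
    proof -
      obtain y where S: "S = {..y}" using S' by blast
      show ?thesis unfolding S using key[of y] eA[of "{..y}"] eB[of "{..y}"] by simp
    qed
    show "(\<Union>i. {..real i}) = UNIV" by (auto intro: real_arch_simple)
    show "emeasure ?A {..real i} \<noteq> \<infinity>" for i using eA by simp
  qed auto
qed

text \<open>Both mass densities are strictly positive, so null sets of labels and null sets of
  positions correspond in both directions.\<close>

lemma push_AE:
  assumes g: "good t" and [measurable]: "Measurable.pred borel P"
  shows "(AE x in lb (X (t, 0)) (X (t, 0) + 1). P x) \<longleftrightarrow> (AE a in lb 0 1. P (X (t, a)))"
proof -
  have "(AE a in lb 0 1. P (X (t, a))) \<longleftrightarrow> (AE x in distr m borel (\<lambda>a. X (t, a)). P x)"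
    unfolding AE_m[symmetric] by (rule AE_distr_iff[symmetric]) auto
  also have "\<dots> \<longleftrightarrow> (AE x in lb (X (t, 0)) (X (t, 0) + 1). P x)"
    unfolding push[OF g] using rho_pos by (subst AE_density) auto
  finally show ?thesis by simp
qed

lemma push_integral:
  fixes f :: "real \<Rightarrow> real"
  assumes g: "good t" and [measurable]: "f \<in> borel_measurable borel"
    and f: "integrable (lb (X (t, 0)) (X (t, 0) + 1)) f" and a: "0 \<le> a" "a \<le> 1"
  shows "integrable (lb 0 1) (\<lambda>a. rho0 a * (f (X (t, a)) / rho (t, X (t, a))))"
    "(\<integral>a. rho0 a * (f (X (t, a)) / rho (t, X (t, a))) \<partial>lb 0 a) = integral\<^sup>L (lb (X (t, 0)) (X (t, a))) f"
proof -
  let ?z = "X (t, 0)"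
  let ?N = "lb ?z (?z + 1)"
  have t: "0 \<le> t" "t \<le> T" using g by (auto simp: good_def)
  have X1: "X (t, 1) = ?z + 1" using X_per[OF t, of 0] by simp
  have cancel: "rho z * (y / rho z) = y" for z y using rho_pos[of z] by simp
  have P: "integrable m (\<lambda>a. h (X (t, a))) \<longleftrightarrow> integrable ?N (\<lambda>x. rho (t, x) * h x)"
    "integral\<^sup>L m (\<lambda>a. h (X (t, a))) = integral\<^sup>L ?N (\<lambda>x. rho (t, x) * h x)" if [measurable]: "h \<in> borel_measurable borel" for h :: "real \<Rightarrow> real"
  proof -
    have "integrable m (\<lambda>a. h (X (t, a))) \<longleftrightarrow> integrable (distr m borel (\<lambda>a. X (t, a))) h"
      by (rule integrable_distr_eq[symmetric]) auto
    also have "\<dots> \<longleftrightarrow> integrable ?N (\<lambda>x. rho (t, x) * h x)"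
      unfolding push[OF g] using rho_pos by (subst integrable_density) (auto simp: less_imp_le)
    finally show "integrable m (\<lambda>a. h (X (t, a))) \<longleftrightarrow> integrable ?N (\<lambda>x. rho (t, x) * h x)" .
    have "integral\<^sup>L m (\<lambda>a. h (X (t, a))) = integral\<^sup>L (distr m borel (\<lambda>a. X (t, a))) h"
      by (rule integral_distr[symmetric]) auto
    also have "\<dots> = integral\<^sup>L ?N (\<lambda>x. rho (t, x) * h x)"
      unfolding push[OF g] using rho_pos by (subst integral_density) (auto simp: less_imp_le)
    finally show "integral\<^sup>L m (\<lambda>a. h (X (t, a))) = integral\<^sup>L ?N (\<lambda>x. rho (t, x) * h x)" .
  qed
  have "integrable ?N (\<lambda>x. rho (t, x) * (f x / rho (t, x)))" using f by (simp only: cancel)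
  then have "integrable m (\<lambda>a. f (X (t, a)) / rho (t, X (t, a)))"
    by (subst P(1)[where h="\<lambda>x. f x / rho (t, x)"]) auto
  then show "integrable (lb 0 1) (\<lambda>a. rho0 a * (f (X (t, a)) / rho (t, X (t, a))))"
    by (subst (asm) integrable_m) auto
  let ?h = "\<lambda>x. indicator {?z<..<X (t, a)} x * (f x / rho (t, x))"
  have "(\<integral>a. rho0 a * (f (X (t, a)) / rho (t, X (t, a))) \<partial>lb 0 a) = (\<integral>b. indicator {0<..<a} b * (rho0 b * (f (X (t, b)) / rho (t, X (t, b)))) \<partial>lb 0 1)"
    using a by (intro integral_lb_restrict) auto
  also have "\<dots> = (\<integral>b. rho0 b * ?h (X (t, b)) \<partial>lb 0 1)"
  proof (rule integral_cong_AE)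
    have iff: "X (t, b) \<in> {?z<..<X (t, a)} \<longleftrightarrow> b < a" if "0 < b" "b < 1" "b \<noteq> a" for b
      using good_strict[OF g, of b a] good_strict[OF g, of a b] good_strict[OF g, of 0 b] a that by fastforce
    show "AE b in lb 0 1. indicator {0<..<a} b * (rho0 b * (f (X (t, b)) / rho (t, X (t, b)))) = rho0 b * ?h (X (t, b))"
      unfolding AE_lb using AE_lborel_singleton[of a] by eventually_elim (use iff in \<open>auto simp: indicator_def\<close>)
  qed auto
  also have "\<dots> = integral\<^sup>L m (\<lambda>b. ?h (X (t, b)))" by (rule integral_m[symmetric]) auto
  also have "\<dots> = integral\<^sup>L ?N (\<lambda>x. rho (t, x) * ?h x)" by (rule P(2)) auto
  also have "\<dots> = (\<integral>x. indicator {?z<..<X (t, a)} x * f x \<partial>?N)"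
    by (intro Bochner_Integration.integral_cong) (auto simp: indicator_def less_imp_neq[OF rho_pos, symmetric])
  also have "\<dots> = integral\<^sup>L (lb ?z (X (t, a))) f"
    using X_mono[OF a(2) t] X1 by (intro integral_lb_restrict[symmetric]) auto
  finally show "(\<integral>a. rho0 a * (f (X (t, a)) / rho (t, X (t, a))) \<partial>lb 0 a) = integral\<^sup>L (lb (X (t, 0)) (X (t, a))) f" .
qed

text \<open>Both directions serve: the constitutive law, valid almost everywhere in position, is
  moved to labels, and the final equality of the two solutions is moved back. Periodicity matches
  the unit interval with the period that starts at X(t, 0).\<close>

lemma AE_lagrange:
  assumes [measurable]: "Measurable.pred (borel \<Otimes>\<^sub>M borel) P" and per: "\<And>t x. P (t, x + 1) = P (t, x)"
  shows "(AE z in cylm T. P z) \<longleftrightarrow> (AE z in cylm T. P (fst z, X z))"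
proof -
  have sl: "(AE x in lb 0 1. P (t, x)) \<longleftrightarrow> (AE a in lb 0 1. P (t, X (t, a)))" if g: "good t" for t
  proof -
    have "(AE x in lb 0 1. P (t, x)) \<longleftrightarrow> (AE x in lb (X (t, 0)) (X (t, 0) + 1). P (t, x))"
    proof
      assume "AE x in lb 0 1. P (t, x)"
      then show "AE x in lb (X (t, 0)) (X (t, 0) + 1). P (t, x)" by (intro AE_periodic per) auto
    next
      assume *: "AE x in lb (X (t, 0)) (X (t, 0) + 1). P (t, x)"
      let ?f = "\<lambda>x. of_bool (\<not> P (t, x)) :: real"
      have i: "integrable (lb a b) ?f" for a b by (rule integrable_lb_bounded[where K=1]) auto
      have "integral\<^sup>L (lb 0 1) ?f = integral\<^sup>L (lb (X (t, 0)) (X (t, 0) + 1)) ?f" using per by (intro periodic_integral[symmetric] i) auto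
      also have "\<dots> = 0" using * by (intro integral_eq_zero_AE) auto
      finally have "AE x in lb 0 1. ?f x = 0" using integral_nonneg_eq_0_iff_AE[OF i] by auto
      then show "AE x in lb 0 1. P (t, x)" by eventually_elim auto
    qed
    also have "\<dots> \<longleftrightarrow> (AE a in lb 0 1. P (t, X (t, a)))" by (rule push_AE[OF g]) auto
    finally show ?thesis .
  qed
  have 1: "(AE z in cylm T. P z) \<longleftrightarrow> (AE t in lb 0 T. AE x in lb 0 1. P (t, x))"
  proof -
    have "{z \<in> space (cylm T). P (fst z, snd z)} \<in> sets (cylm T)" by measurable
    from lb2.AE_pair_iff[OF this] show ?thesis by simp
  qed
  have 2: "(AE z in cylm T. P (fst z, X z)) \<longleftrightarrow> (AE t in lb 0 T. AE x in lb 0 1. P (t, X (t, x)))"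
  proof -
    have "{z \<in> space (cylm T). P (fst z, X (fst z, snd z))} \<in> sets (cylm T)" by measurable
    from lb2.AE_pair_iff[OF this] show ?thesis by simp
  qed
  have "(AE t in lb 0 T. AE x in lb 0 1. P (t, x)) \<longleftrightarrow> (AE t in lb 0 T. AE x in lb 0 1. P (t, X (t, x)))"
  proof
    assume "AE t in lb 0 T. AE x in lb 0 1. P (t, x)"
    with good_AE show "AE t in lb 0 T. AE x in lb 0 1. P (t, X (t, x))" by eventually_elim (simp add: sl)
  next
    assume "AE t in lb 0 T. AE x in lb 0 1. P (t, X (t, x))"
    with good_AE show "AE t in lb 0 T. AE x in lb 0 1. P (t, x)" by eventually_elim (simp add: sl)
  qed
  then show ?thesis using 1 2 by simp
qed

end

lemma integrable_box_subset:
  fixes f :: "real \<times> real \<Rightarrow> real"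
  assumes f: "integrable (lb a b \<Otimes>\<^sub>M lb c d) f" and s: "a \<le> a'" "b' \<le> b" "c \<le> c'" "d' \<le> d"
  shows "integrable (lb a' b' \<Otimes>\<^sub>M lb c' d') f"
proof -
  have "f \<in> borel_measurable (lb a b \<Otimes>\<^sub>M lb c d)" using f by (rule borel_measurable_integrable)
  then have m: "f \<in> borel_measurable borel" unfolding cylm_density by simp
  have i: "integrable lborel (\<lambda>z. indicator ({a<..<b} \<times> {c<..<d}) z *\<^sub>R f z)"
    using f unfolding cylm_density by (subst (asm) integrable_density) (use m in auto)
  have "integrable lborel (\<lambda>z. indicator ({a'<..<b'} \<times> {c'<..<d'}) z *\<^sub>R f z)"
    by (rule Bochner_Integration.integrable_bound[OF i]) (use m s in \<open>auto simp: indicator_def intro!: AE_I2\<close>)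
  then show ?thesis unfolding cylm_density by (subst integrable_density) (use m in auto)
qed

section \<open>Conservation laws as ordinary differential equations along trajectories\<close>

context lagrange
begin

text \<open>In labels, the flux identity for \<open>rho * g\<close> says that rho0 times (g along
  the flow, minus g0, minus the time integral of sx / rho) has vanishing integral over (0, a), first
  for rational a and then for all. Its integrand therefore vanishes for almost every label, and
  \<open>rho0\<close>, being positive, divides out.\<close>

lemma transport:
  fixes g s sx :: "real \<times> real \<Rightarrow> real" and g0 :: "real \<Rightarrow> real"
  assumes C: "conserved T u ux L U (\<lambda>z. rho z * g z) s (\<lambda>a. rho0 a * g0 a) Kq k"
    and [measurable]: "g \<in> borel_measurable (borel \<Otimes>\<^sub>M borel)" "sx \<in> borel_measurable (borel \<Otimes>\<^sub>M borel)" "g0 \<in> borel_measurable borel"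
    and sx_per: "\<And>t x. sx (t, x + 1) = sx (t, x)"
    and sx_slice: "\<And>t a b. integrable (lb a b) (\<lambda>x. sx (t, x))"
    and s_prim: "\<And>t x y. x \<le> y \<Longrightarrow> s (t, y) - s (t, x) = (\<integral>x. sx (t, x) \<partial>lb x y)"
    and sx_int: "integrable (cylm T) sx"
  shows "integrable (cylm T) (\<lambda>z. sx (fst z, X z) / rho (fst z, X z))"
    "AE z in cylm T. g (fst z, X z) = g0 (snd z) + (\<integral>r. sx (r, X (r, snd z)) / rho (r, X (r, snd z)) \<partial>lb 0 (fst z))"
proof -
  interpret C: conserved T u ux L U "\<lambda>z. rho z * g z" s "\<lambda>a. rho0 a * g0 a" Kq k by (rule C)
  define w where "w z = sx (fst z, X z) / rho (fst z, X z)" for z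
  have [measurable]: "w \<in> borel_measurable (borel \<Otimes>\<^sub>M borel)" unfolding w_def[abs_def] by measurable
  have X1: "X (t, 1) = X (t, 0) + 1" if "good t" for t using X_per[of t 0] that by (auto simp: good_def)
  have slice: "integrable (lb 0 1) (\<lambda>a. w (t, a))" 
    and slice_abs: "(\<integral>a. \<bar>w (t, a)\<bar> \<partial>lb 0 1) \<le> (1 / r0l) * (\<integral>x. \<bar>sx (t, x)\<bar> \<partial>lb 0 1)" if g: "good t" for t
  proof -
    note P = push_integral[OF g, of "\<lambda>x. \<bar>sx (t, x)\<bar>" 1]
    have i1: "integrable (lb 0 1) (\<lambda>a. rho0 a * (\<bar>sx (t, X (t, a))\<bar> / rho (t, X (t, a))))"
      by (rule P(1)) (auto intro!: integrable_abs sx_slice)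
    have e: "rho0 a * (\<bar>sx (t, X (t, a))\<bar> / rho (t, X (t, a))) = rho0 a * \<bar>w (t, a)\<bar>" for a
      using rho_pos[of "(t, X (t, a))"] by (simp add: w_def)
    have le: "\<bar>w (t, a)\<bar> \<le> (1 / r0l) * (rho0 a * \<bar>w (t, a)\<bar>)" for a
      using mult_right_mono[OF rho0_bd(1)[of a], of "\<bar>w (t, a)\<bar>"] r0l_pos by (simp add: field_simps)
    have i2: "integrable (lb 0 1) (\<lambda>a. (1 / r0l) * (rho0 a * \<bar>w (t, a)\<bar>))"
      using i1 unfolding e by (rule integrable_mult_right)
    show i3: "integrable (lb 0 1) (\<lambda>a. w (t, a))"
      by (rule Bochner_Integration.integrable_bound[OF i2])
        (measurable, intro AE_I2, unfold real_norm_def, rule order_trans[OF le abs_ge_self])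
    have "(\<integral>a. \<bar>w (t, a)\<bar> \<partial>lb 0 1) \<le> (\<integral>a. (1 / r0l) * (rho0 a * \<bar>w (t, a)\<bar>) \<partial>lb 0 1)"
      by (rule integral_mono[OF integrable_abs[OF i3] i2 le])
    also have "\<dots> = (1 / r0l) * (\<integral>a. rho0 a * (\<bar>sx (t, X (t, a))\<bar> / rho (t, X (t, a))) \<partial>lb 0 1)"
      unfolding e by (rule integral_mult_right_zero)
    also have "(\<integral>a. rho0 a * (\<bar>sx (t, X (t, a))\<bar> / rho (t, X (t, a))) \<partial>lb 0 1) = (\<integral>x. \<bar>sx (t, x)\<bar> \<partial>lb (X (t, 0)) (X (t, 1)))"
      by (rule P(2)) (auto intro!: integrable_abs sx_slice)
    also have "\<dots> = (\<integral>x. \<bar>sx (t, x)\<bar> \<partial>lb 0 1)"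
      unfolding X1[OF g] by (rule periodic_integral) (auto simp: sx_per intro!: integrable_abs sx_slice)
    finally show "(\<integral>a. \<bar>w (t, a)\<bar> \<partial>lb 0 1) \<le> (1 / r0l) * (\<integral>x. \<bar>sx (t, x)\<bar> \<partial>lb 0 1)" .
  qed
  have iw: "integrable (cylm T) w"
  proof (rule lb2.Fubini_integrable)
    show "w \<in> borel_measurable (cylm T)" by measurable
    show "AE t in lb 0 T. integrable (lb 0 1) (\<lambda>a. w (t, a))"
      using good_AE by eventually_elim (rule slice)
    show "integrable (lb 0 T) (\<lambda>t. \<integral>a. norm (w (t, a)) \<partial>lb 0 1)"
    proof (rule Bochner_Integration.integrable_bound)
      show "integrable (lb 0 T) (\<lambda>t. (1 / r0l) * (\<integral>x. \<bar>sx (t, x)\<bar> \<partial>lb 0 1))"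
        using lb2.integrable_fst'[OF integrable_abs[OF sx_int]] by (intro integrable_mult_right) simp
      show "AE t in lb 0 T. norm (\<integral>a. norm (w (t, a)) \<partial>lb 0 1) \<le> norm ((1 / r0l) * (\<integral>x. \<bar>sx (t, x)\<bar> \<partial>lb 0 1))"
        using good_AE
      proof eventually_elim
        case (elim t)
        have "0 \<le> (\<integral>a. \<bar>w (t, a)\<bar> \<partial>lb 0 1)" by (intro Bochner_Integration.integral_nonneg) auto
        then show ?case using slice_abs[OF elim] r0l_pos by simp
      qed
    qed measurable
  qed
  then show "integrable (cylm T) (\<lambda>z. sx (fst z, X z) / rho (fst z, X z))" by (simp add: w_def[abs_def])
  have iw': "integrable (cylm T) (\<lambda>z. w z * rho0 (snd z))"
    by (rule integrable_mult_bounded'[OF iw, where K=r0h]) (use rho0_bd rho0_pos in \<open>auto simp: less_imp_le\<close>)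
  have A: "AE t in lb 0 T. (\<integral>b. rho0 b * g (t, X (t, b)) \<partial>lb 0 a) = (\<integral>b. rho0 b * g0 b \<partial>lb 0 a) + (\<integral>b. rho0 b * (\<integral>r. w (r, b) \<partial>lb 0 t) \<partial>lb 0 a)"
    if a: "0 \<le> a" "a \<le> 1" for a
    using C.flux_identity[OF a] good_AE AE_lb_in[of 0 T]
  proof eventually_elim
    case (elim t)
    have t: "0 \<le> t" "t \<le> T" using elim by auto
    have canc: "rho z * g z / rho z = g z" for z using rho_pos[of z] by simp
    have "(\<integral>b. rho0 b * (rho (t, X (t, b)) * g (t, X (t, b)) / rho (t, X (t, b))) \<partial>lb 0 a) = (\<integral>x. rho (t, x) * g (t, x) \<partial>lb (X (t, 0)) (X (t, a)))"
      by (rule push_integral(2)[OF elim(2) _ C.q_slice_int a, of t]) measurable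
    then have 1: "(\<integral>b. rho0 b * g (t, X (t, b)) \<partial>lb 0 a) = (\<integral>x. rho (t, x) * g (t, x) \<partial>lb (X (t, 0)) (X (t, a)))"
      by (simp only: canc)
    have "AE r in lb 0 t. s (r, X (r, a)) - s (r, X (r, 0)) = (\<integral>b. w (r, b) * rho0 b \<partial>lb 0 a)"
      using AE_lb_mono[OF good_AE, of 0 t, OF order_refl t(2)]
    proof eventually_elim
      case (elim r)
      have "s (r, X (r, a)) - s (r, X (r, 0)) = (\<integral>x. sx (r, x) \<partial>lb (X (r, 0)) (X (r, a)))"
        using elim a by (intro s_prim X_mono) (auto simp: good_def)
      also have "\<dots> = (\<integral>b. rho0 b * (sx (r, X (r, b)) / rho (r, X (r, b))) \<partial>lb 0 a)"
        by (rule push_integral(2)[symmetric, OF elim _ sx_slice a]) measurable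
      finally show ?case by (simp add: w_def mult.commute)
    qed
    then have "(\<integral>r. s (r, X (r, a)) - s (r, X (r, 0)) \<partial>lb 0 t) = (\<integral>r. (\<integral>b. w (r, b) * rho0 b \<partial>lb 0 a) \<partial>lb 0 t)"
      by (intro integral_cong_AE) auto
    also have "\<dots> = (\<integral>b. (\<integral>r. w (r, b) * rho0 b \<partial>lb 0 t) \<partial>lb 0 a)"
    proof -
      have "integrable (lb 0 t \<Otimes>\<^sub>M lb 0 a) (\<lambda>z. w z * rho0 (snd z))"
        by (rule integrable_box_subset[OF iw']) (use t a in auto)
      then have "integrable (lb 0 t \<Otimes>\<^sub>M lb 0 a) (\<lambda>(r, b). w (r, b) * rho0 b)" by (simp add: case_prod_unfold)
      from lb2.Fubini_integral[OF this] show ?thesis by simp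
    qed
    also have "\<dots> = (\<integral>b. rho0 b * (\<integral>r. w (r, b) \<partial>lb 0 t) \<partial>lb 0 a)" by (simp add: mult.commute)
    finally show ?case using elim(1) 1 by simp
  qed
  have "AE t in lb 0 T. \<forall>a\<in>\<rat> \<inter> {0..1}. (\<integral>b. rho0 b * g (t, X (t, b)) \<partial>lb 0 a) = (\<integral>b. rho0 b * g0 b \<partial>lb 0 a) + (\<integral>b. rho0 b * (\<integral>r. w (r, b) \<partial>lb 0 t) \<partial>lb 0 a)"
    by (subst AE_ball_countable) (auto intro!: A intro: countable_subset[OF _ countable_rat])
  then have slices: "AE t in lb 0 T. AE a in lb 0 1. g (t, X (t, a)) = g0 a + (\<integral>r. w (r, a) \<partial>lb 0 t)"
    using AE_lb_in[of 0 T] good_AE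
  proof eventually_elim
    case (elim t)
    define D where "D b = rho0 b * g (t, X (t, b)) - rho0 b * g0 b - rho0 b * (\<integral>r. w (r, b) \<partial>lb 0 t)" for b
    have canc: "rho z * g z / rho z = g z" for z using rho_pos[of z] by simp
    have i1: "integrable (lb 0 1) (\<lambda>b. rho0 b * g (t, X (t, b)))"
      using push_integral(1)[OF elim(3) _ C.q_slice_int[of _ _ t], of 0] by (simp add: canc)
    have i3: "integrable (lb 0 1) (\<lambda>b. rho0 b * (\<integral>r. w (r, b) \<partial>lb 0 t))"
    proof -
      have "integrable (lb 0 t \<Otimes>\<^sub>M lb 0 1) w" by (rule integrable_box_subset[OF iw]) (use elim in auto)
      then have "integrable (lb 0 t \<Otimes>\<^sub>M lb 0 1) (\<lambda>(r, b). w (r, b))" by simp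
      from lb2.integrable_snd[OF this] have "integrable (lb 0 1) (\<lambda>b. (\<integral>r. w (r, b) \<partial>lb 0 t) * rho0 b)"
        by (rule integrable_mult_bounded'[where K=r0h]) (use rho0_bd rho0_pos in \<open>auto simp: less_imp_le\<close>)
      then show ?thesis by (simp add: mult.commute)
    qed
    have iD: "integrable (lb 0 1) D" unfolding D_def[abs_def] using i1 i3 C.q0_int by simp
    have D0: "integral\<^sup>L (lb 0 a) D = 0" if "a \<in> \<rat>" "0 < a" "a < 1" for a
    proof -
      have "integral\<^sup>L (lb 0 a) D = (\<integral>b. rho0 b * g (t, X (t, b)) \<partial>lb 0 a) - (\<integral>b. rho0 b * g0 b \<partial>lb 0 a) - (\<integral>b. rho0 b * (\<integral>r. w (r, b) \<partial>lb 0 t) \<partial>lb 0 a)"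
        unfolding D_def using integrable_lb_subset[OF i1, of 0 a] integrable_lb_subset[OF i3, of 0 a] integrable_lb_subset[OF C.q0_int, of 0 a] that
        by simp
      then show ?thesis using elim(1) that by auto
    qed
    have "AE b in lb 0 1. D b = 0"
    proof (rule AE_zero_if_primitive_zero[OF iD])
      fix x :: real assume x: "0 \<le> x" "x \<le> 1"
      show "integral\<^sup>L (lb 0 x) D = 0"
        by (rule continuous_zero_if_rat_zero[OF integral_lb_zero_continuous[OF iD], of x]) (use x D0 in auto)
    qed
    then show ?case
    proof eventually_elim
      case (elim b)
      have "rho0 b * (g (t, X (t, b)) - g0 b - (\<integral>r. w (r, b) \<partial>lb 0 t)) = 0" using elim by (simp add: D_def algebra_simps)
      then show ?case using rho0_pos[of b] by simp
    qed
  qed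
  define V where "V z = (\<integral>r. w (r, snd z) \<partial>lb 0 (fst z))" for z
  have mV: "V \<in> borel_measurable (cylm T)"
    unfolding V_def[abs_def] by (rule measurable_integral_lb) measurable
  have "AE z in cylm T. g (fst z, X z) = g0 (snd z) + V z"
  proof (rule lb2.AE_pair_measure)
    have 1: "(\<lambda>z. g (fst z, X z)) \<in> borel_measurable (cylm T)" by measurable
    have 2: "(\<lambda>z. g0 (snd z) + V z) \<in> borel_measurable (cylm T)" using mV by measurable
    show "{z \<in> space (cylm T). g (fst z, X z) = g0 (snd z) + V z} \<in> sets (cylm T)"
      by (rule borel_measurable_eq[OF 1 2])
    show "AE t in lb 0 T. AE a in lb 0 1. g (fst (t, a), X (t, a)) = g0 (snd (t, a)) + V (t, a)"
      using slices by (simp add: V_def)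
  qed
  then show "AE z in cylm T. g (fst z, X z) = g0 (snd z) + (\<integral>r. sx (r, X (r, snd z)) / rho (r, X (r, snd z)) \<partial>lb 0 (fst z))"
    by (simp add: w_def V_def)
qed

end

section \<open>The energy estimate\<close>

lemma cauchy_schwarz_integral:
  fixes f g :: "'a \<Rightarrow> real"
  assumes f: "integrable M (\<lambda>x. (f x)\<^sup>2)" and g: "integrable M (\<lambda>x. (g x)\<^sup>2)" and fg: "integrable M (\<lambda>x. f x * g x)"
  shows "(\<integral>x. f x * g x \<partial>M)\<^sup>2 \<le> (\<integral>x. (f x)\<^sup>2 \<partial>M) * (\<integral>x. (g x)\<^sup>2 \<partial>M)"
proof -
  let ?A = "\<integral>x. (f x)\<^sup>2 \<partial>M" and ?B = "\<integral>x. f x * g x \<partial>M" and ?C = "\<integral>x. (g x)\<^sup>2 \<partial>M"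
  have q: "0 \<le> s\<^sup>2 * ?A - 2 * s * ?B + ?C" for s
  proof -
    have "0 \<le> (\<integral>x. (s * f x - g x)\<^sup>2 \<partial>M)" by (intro Bochner_Integration.integral_nonneg) auto
    also have "\<dots> = (\<integral>x. s\<^sup>2 * (f x)\<^sup>2 - 2 * s * (f x * g x) + (g x)\<^sup>2 \<partial>M)"
      by (intro Bochner_Integration.integral_cong) (auto simp: power2_eq_square algebra_simps)
    also have "\<dots> = s\<^sup>2 * ?A - 2 * s * ?B + ?C" using f g fg by simp
    finally show ?thesis .
  qed
  have A0: "0 \<le> ?A" "0 \<le> ?C" by (intro Bochner_Integration.integral_nonneg; simp)+
  show ?thesis
  proof (cases "?A = 0")
    case True
    have "?B = 0"
    proof (rule ccontr)
      assume B: "?B \<noteq> 0"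
      \<comment> \<open>When \<open>?A\<close> is zero the quadratic form is affine in s, and this
        value of s would make it equal to -1.\<close>
      have "2 * ((?C + 1) / (2 * ?B)) * ?B = ?C + 1" using B by simp
      then show False using q[of "(?C + 1) / (2 * ?B)"] True by simp
    qed
    then show ?thesis using A0 by simp
  next
    case False
    then have A: "0 < ?A" using A0(1) by (rule le_neq_trans[OF _ not_sym, rotated])
    have "0 \<le> ((?B / ?A)\<^sup>2 * ?A - 2 * (?B / ?A) * ?B + ?C) * ?A" using q[of "?B / ?A"] A by simp
    also have "\<dots> = ?A * ?C - ?B\<^sup>2" using A by (simp add: field_simps power2_eq_square)
    finally show ?thesis by simp
  qed
qed

lemma cylm_time_fubini:
  fixes f :: "real \<times> real \<Rightarrow> real"
  assumes f: "integrable (cylm T) f" and t: "t \<le> T"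
  shows "integrable (lb 0 1) (\<lambda>a. \<integral>r. f (r, a) \<partial>lb 0 t)" "integrable (lb 0 t) (\<lambda>r. \<integral>a. f (r, a) \<partial>lb 0 1)"
    "(\<integral>a. (\<integral>r. f (r, a) \<partial>lb 0 t) \<partial>lb 0 1) = (\<integral>r. (\<integral>a. f (r, a) \<partial>lb 0 1) \<partial>lb 0 t)"
proof -
  have i: "integrable (lb 0 t \<Otimes>\<^sub>M lb 0 1) f" by (rule integrable_box_subset[OF f]) (use t in auto)
  then have i': "integrable (lb 0 t \<Otimes>\<^sub>M lb 0 1) (\<lambda>(r, a). f (r, a))" by simp
  show "integrable (lb 0 1) (\<lambda>a. \<integral>r. f (r, a) \<partial>lb 0 t)" using lb2.integrable_snd[OF i'] .
  show "integrable (lb 0 t) (\<lambda>r. \<integral>a. f (r, a) \<partial>lb 0 1)" using lb2.integrable_fst'[OF i] .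
  show "(\<integral>a. (\<integral>r. f (r, a) \<partial>lb 0 t) \<partial>lb 0 1) = (\<integral>r. (\<integral>a. f (r, a) \<partial>lb 0 1) \<partial>lb 0 t)"
    using lb2.Fubini_integral[OF i'] by simp
qed

lemma AE_cylm_swap:
  assumes "{z \<in> space (cylm T). P z} \<in> sets (cylm T)" "AE z in cylm T. P z"
  shows "AE a in lb 0 1. AE t in lb 0 T. P (t, a)"
proof -
  have "{z \<in> space (cylm T). P (fst z, snd z)} \<in> sets (cylm T)" using assms(1) by simp
  from lb2.AE_commute[OF this] lb2.AE_pair[OF assms(2)] show ?thesis by simp
qed

lemma AE_cylm_snd:
  assumes "AE a in lb c d. P a" shows "AE z in lb e g \<Otimes>\<^sub>M lb c d. P (snd z)"
proof -
  obtain N where N: "{a \<in> space (lb c d). \<not> P a} \<subseteq> N" "N \<in> null_sets (lb c d)"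
    using assms by (auto simp: eventually_ae_filter)
  have [measurable]: "N \<in> sets borel" using N(2) by (auto simp: null_sets_def)
  have "AE z in lb e g \<Otimes>\<^sub>M lb c d. snd z \<notin> N"
  proof (rule lb2.AE_pair_measure)
    show "AE x in lb e g. AE y in lb c d. snd (x, y) \<notin> N" using AE_not_in[OF N(2)] by simp
  qed measurable
  then show ?thesis by eventually_elim (use N(1) in auto)
qed

text \<open>The comparison in abstract form, over time and label: v is the specific volume, h the
  temperature, w the rate of change of v, s the stress, r the acceleration and \<open>wt\<close> the
  mass per label. Multiplication by the volume makes the constitutive law \<open>s_eq\<close> linear
  in w and h, with coefficients depending on the label alone. One weight \<open>L\<close> dominates
  all rates and stresses; L \<ge> 1 lets it absorb bounded quantities as well.\<close>

lemma lagrangian_uniqueness: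
  fixes v1 v2 h1 h2 w1 w2 s1 s2 u1 u2 r1 r2 :: "real \<times> real \<Rightarrow> real"
    and mu ga cv wt v0 h0 u0 L :: "real \<Rightarrow> real"
  assumes T: "0 < T"
    and meas[measurable]: "v1 \<in> borel_measurable (borel \<Otimes>\<^sub>M borel)" "v2 \<in> borel_measurable (borel \<Otimes>\<^sub>M borel)"
      "h1 \<in> borel_measurable (borel \<Otimes>\<^sub>M borel)" "h2 \<in> borel_measurable (borel \<Otimes>\<^sub>M borel)"
      "w1 \<in> borel_measurable (borel \<Otimes>\<^sub>M borel)" "w2 \<in> borel_measurable (borel \<Otimes>\<^sub>M borel)"
      "s1 \<in> borel_measurable (borel \<Otimes>\<^sub>M borel)" "s2 \<in> borel_measurable (borel \<Otimes>\<^sub>M borel)"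
      "u1 \<in> borel_measurable (borel \<Otimes>\<^sub>M borel)" "u2 \<in> borel_measurable (borel \<Otimes>\<^sub>M borel)"
      "r1 \<in> borel_measurable (borel \<Otimes>\<^sub>M borel)" "r2 \<in> borel_measurable (borel \<Otimes>\<^sub>M borel)"
      "wt \<in> borel_measurable borel"
    and L: "L \<in> borel_measurable borel" "\<And>t. 1 \<le> L t" "integrable (lb 0 T) (\<lambda>t. (L t)\<^sup>2)"
    and wt: "\<And>a. wl \<le> wt a" "\<And>a. wt a \<le> wh" "0 < wl"
    and v: "\<And>z. vl \<le> v1 z" "\<And>z. v1 z \<le> vh" "\<And>z. vl \<le> v2 z" "\<And>z. v2 z \<le> vh" "0 < vl"
    and h: "\<And>z. \<bar>h1 z\<bar> \<le> hh" "\<And>z. \<bar>h2 z\<bar> \<le> hh"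
    and w: "\<And>t a. \<bar>w1 (t, a)\<bar> \<le> L t" "\<And>t a. \<bar>w2 (t, a)\<bar> \<le> L t"
    and s: "\<And>t a. \<bar>s1 (t, a)\<bar> \<le> L t" "\<And>t a. \<bar>s2 (t, a)\<bar> \<le> L t"
    and u: "\<And>z. \<bar>u1 z\<bar> \<le> U" "\<And>z. \<bar>u2 z\<bar> \<le> U"
    and r: "integrable (cylm T) r1" "integrable (cylm T) r2"
    and mu: "\<And>a. ml \<le> mu a" "\<And>a. mu a \<le> mh" "0 < ml" and ga: "\<And>a. 0 \<le> ga a" "\<And>a. ga a \<le> gh"
    and cv: "\<And>a. cl \<le> cv a" "0 < cl"
    and v_eq: "AE z in cylm T. v1 z = v0 (snd z) + (\<integral>r. w1 (r, snd z) \<partial>lb 0 (fst z))"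
      "AE z in cylm T. v2 z = v0 (snd z) + (\<integral>r. w2 (r, snd z) \<partial>lb 0 (fst z))"
    and h_eq: "AE z in cylm T. cv (snd z) * (h1 z - h0 (snd z)) = (\<integral>r. s1 (r, snd z) * w1 (r, snd z) \<partial>lb 0 (fst z))"
      "AE z in cylm T. cv (snd z) * (h2 z - h0 (snd z)) = (\<integral>r. s2 (r, snd z) * w2 (r, snd z) \<partial>lb 0 (fst z))"
    and u_eq: "AE z in cylm T. u1 z = u0 (snd z) + (\<integral>r. r1 (r, snd z) \<partial>lb 0 (fst z))"
      "AE z in cylm T. u2 z = u0 (snd z) + (\<integral>r. r2 (r, snd z) \<partial>lb 0 (fst z))"
    and s_eq: "AE z in cylm T. s1 z * v1 z = mu (snd z) * w1 z - ga (snd z) * h1 z"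
      "AE z in cylm T. s2 z * v2 z = mu (snd z) * w2 z - ga (snd z) * h2 z"
    and parts: "AE t in lb 0 T. (\<integral>a. wt a * ((u1 (t, a) - u2 (t, a)) * (r1 (t, a) - r2 (t, a))) \<partial>lb 0 1)
        = - (\<integral>a. wt a * ((w1 (t, a) - w2 (t, a)) * (s1 (t, a) - s2 (t, a))) \<partial>lb 0 1)"
  shows "AE z in cylm T. v1 z = v2 z \<and> h1 z = h2 z \<and> u1 z = u2 z"
proof -
  note [measurable] = L(1)
  define dw where "dw z = w1 z - w2 z" for z
  define dv where "dv z = v1 z - v2 z" for z
  define dh where "dh z = h1 z - h2 z" for z
  define ds where "ds z = s1 z - s2 z" for z
  define du where "du z = u1 z - u2 z" for z
  define dr where "dr z = r1 z - r2 z" for z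
  have dm [measurable]: "dw \<in> borel_measurable (borel \<Otimes>\<^sub>M borel)" "dv \<in> borel_measurable (borel \<Otimes>\<^sub>M borel)" "dh \<in> borel_measurable (borel \<Otimes>\<^sub>M borel)"
    "ds \<in> borel_measurable (borel \<Otimes>\<^sub>M borel)" "du \<in> borel_measurable (borel \<Otimes>\<^sub>M borel)" "dr \<in> borel_measurable (borel \<Otimes>\<^sub>M borel)"
    unfolding dw_def dv_def dh_def ds_def du_def dr_def by measurable
  have L0: "0 \<le> L t" for t using L(2)[of t] by linarith
  have dwb: "\<bar>dw (t, a)\<bar> \<le> 2 * L t" for t a using w(1)[of t a] w(2)[of t a] unfolding dw_def by linarith
  have dsb: "\<bar>ds (t, a)\<bar> \<le> 2 * L t" for t a using s(1)[of t a] s(2)[of t a] unfolding ds_def by linarith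
  have dvb: "\<bar>dv z\<bar> \<le> 2 * vh" for z using v(1)[of z] v(2)[of z] v(3)[of z] v(4)[of z] v(5) unfolding dv_def by linarith
  have dhb: "\<bar>dh z\<bar> \<le> 2 * hh" for z using h(1)[of z] h(2)[of z] unfolding dh_def by linarith
  have dub: "\<bar>du z\<bar> \<le> 2 * U" for z using u(1)[of z] u(2)[of z] unfolding du_def by linarith
  have iL: "integrable (cylm T) (\<lambda>z. (L (fst z))\<^sup>2)"
    using integrable_pair_mult[OF L(3), of 0 1 "\<lambda>_. 1"] by (simp add: case_prod_unfold)
  have ibd: "integrable (cylm T) f" if [measurable]: "f \<in> borel_measurable (borel \<Otimes>\<^sub>M borel)" and b: "\<And>t a. \<bar>f (t, a)\<bar> \<le> K * (L t)\<^sup>2" for f :: "real \<times> real \<Rightarrow> real" and K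
    by (rule Bochner_Integration.integrable_bound[OF integrable_mult_right[OF iL, of K]])
       (measurable, use b in \<open>auto intro!: AE_I2 intro: order_trans[OF _ abs_ge_self] simp: case_prod_unfold\<close>)
  have L1: "1 \<le> (L t)\<^sup>2" for t using L(2)[of t] by (simp add: one_le_power)
  \<comment> \<open>The Gronwall quantity contains only volume and temperature differences. The
    velocity difference acts at first through the nonnegativity of its kinetic energy.\<close>
  define y where "y z = (dv z)\<^sup>2 + (dh z)\<^sup>2" for z
  define P where "P t = (\<integral>a. wt a * y (t, a) \<partial>lb 0 1)" for t
  define e where "e t = (\<integral>a. wt a * (dw (t, a))\<^sup>2 \<partial>lb 0 1)" for t
  have [measurable]: "y \<in> borel_measurable (borel \<Otimes>\<^sub>M borel)" "P \<in> borel_measurable borel" "e \<in> borel_measurable borel"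
    unfolding y_def[abs_def] P_def[abs_def] e_def[abs_def] by measurable
  have wt0: "0 < wt a" for a using wt(1)[of a] wt(3) by linarith
  have wh0: "0 < wh" using wt0[of 0] wt(2)[of 0] by linarith
  define Y where "Y = 4 * vh\<^sup>2 + 4 * hh\<^sup>2"
  have sq_le: "x\<^sup>2 \<le> b\<^sup>2" if "\<bar>x\<bar> \<le> b" for x b :: real using that abs_le_square_iff[of x b] by (auto simp: abs_le_iff) 
  have y0: "0 \<le> y z" for z by (simp add: y_def)
  have yb: "y z \<le> Y" for z
    using sq_le[OF dvb[of z]] sq_le[OF dhb[of z]] unfolding y_def Y_def by (simp add: power_mult_distrib)
  have dwsq: "(dw (t, a))\<^sup>2 \<le> 4 * (L t)\<^sup>2" for t a using sq_le[OF dwb[of t a]] by (simp add: power_mult_distrib)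
  have bw: "\<bar>wt a * x\<bar> \<le> (wh * B) * (L t)\<^sup>2" if "\<bar>x\<bar> \<le> B * (L t)\<^sup>2" for a x B t
  proof -
    have "\<bar>wt a\<bar> * \<bar>x\<bar> \<le> wh * (B * (L t)\<^sup>2)" using that wt(2)[of a] wt0[of a] wh0 by (intro mult_mono) auto
    then show ?thesis by (simp add: abs_mult)
  qed
  have i_dw: "integrable (cylm T) (\<lambda>z. wt (snd z) * (dw z)\<^sup>2)"
    by (rule ibd[where K="wh * 4"]) (measurable, use dwsq in \<open>auto intro!: bw\<close>)
  have Ly: "\<bar>(L t)\<^sup>2 * y (t, a)\<bar> \<le> Y * (L t)\<^sup>2" for t a
    using y0[of "(t, a)"] yb[of "(t, a)"] by (simp add: mult.commute mult_right_mono)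
  have i_Ly: "integrable (cylm T) (\<lambda>z. wt (snd z) * ((L (fst z))\<^sup>2 * y z))"
    by (rule ibd[where K="wh * Y"]) (measurable, use Ly in \<open>auto intro!: bw\<close>)
  have i_dwds: "integrable (cylm T) (\<lambda>z. wt (snd z) * (dw z * ds z))"
  proof (rule ibd[where K="wh * 4"])
    fix t a
    have "\<bar>dw (t, a) * ds (t, a)\<bar> \<le> (2 * L t) * (2 * L t)" unfolding abs_mult by (intro mult_mono dwb dsb) (auto simp: L0)
    then show "\<bar>wt (snd (t, a)) * (dw (t, a) * ds (t, a))\<bar> \<le> wh * 4 * (L t)\<^sup>2"
      by (intro bw) (simp add: power2_eq_square)
  qed measurable
  have i_dr: "integrable (cylm T) dr" unfolding dr_def[abs_def] using r by simp
  have i_drdu: "integrable (cylm T) (\<lambda>z. wt (snd z) * (du z * dr z))"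
  proof -
    have "integrable (cylm T) (\<lambda>z. dr z * (wt (snd z) * du z))"
    proof (rule integrable_mult_bounded'[OF i_dr, where K="wh * (2 * U)"])
      fix z show "\<bar>wt (snd z) * du z\<bar> \<le> wh * (2 * U)"
        unfolding abs_mult using dub wt(2)[of "snd z"] wt0[of "snd z"] wh0 by (intro mult_mono) auto
    qed measurable
    then show ?thesis by (simp add: ac_simps)
  qed

  have ia: "AE a in lb 0 1. integrable (lb 0 T) (\<lambda>t. r1 (t, a))" "AE a in lb 0 1. integrable (lb 0 T) (\<lambda>t. r2 (t, a))"
    using lb2.AE_integrable_snd[of 0 T 0 1 "\<lambda>t a. r1 (t, a)"] lb2.AE_integrable_snd[of 0 T 0 1 "\<lambda>t a. r2 (t, a)"] r by (simp_all add: case_prod_unfold)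
  \<comment> \<open>The version of the velocity difference that is absolutely continuous in time and
    vanishes initially; its energy identity holds at every time, not just almost every one.\<close>
  define V where "V z = (\<integral>r. dr (r, snd z) \<partial>lb 0 (fst z))" for z
  have mV: "V \<in> borel_measurable (cylm T)" unfolding V_def[abs_def]
    by (intro measurable_integral_lb) measurable
  have box: "AE z in cylm T. z \<in> {0<..<T} \<times> {0<..<1}" unfolding AE_cylm by simp
  have duV: "AE z in cylm T. du z = V z"
    using u_eq AE_cylm_snd[OF ia(1), of 0 T] AE_cylm_snd[OF ia(2), of 0 T] box
  proof eventually_elim
    case (elim z)
    have "fst z \<le> T" using elim by auto
    then have "integrable (lb 0 (fst z)) (\<lambda>t. r1 (t, snd z))" "integrable (lb 0 (fst z)) (\<lambda>t. r2 (t, snd z))"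
      using integrable_lb_subset[OF elim(3), of 0 "fst z"] integrable_lb_subset[OF elim(4), of 0 "fst z"] by auto
    then show ?case using elim(1,2) by (simp add: V_def dr_def du_def)
  qed
  have all_t: "AE a in lb 0 1. integrable (lb 0 T) (\<lambda>t. dr (t, a)) \<and> (AE t in lb 0 T. du (t, a) = (\<integral>r. dr (r, a) \<partial>lb 0 t))"
  proof -
    have "AE a in lb 0 1. AE t in lb 0 T. du (t, a) = V (t, a)"
      by (rule AE_cylm_swap[OF borel_measurable_eq[OF _ mV] duV]) measurable
    then show ?thesis using ia by eventually_elim (simp add: dr_def V_def)
  qed
  \<comment> \<open>For a fixed label, the square of a primitive is twice the integral of the
    primitive times its density; exchanging the integrals and using \<open>parts\<close> turns
    acceleration against velocity into minus stress against rate.\<close>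
  have en: "(\<integral>a. wt a * (\<integral>r. dr (r, a) \<partial>lb 0 t)\<^sup>2 \<partial>lb 0 1) = - 2 * (\<integral>r. (\<integral>a. wt a * (dw (r, a) * ds (r, a)) \<partial>lb 0 1) \<partial>lb 0 t)"
    if t: "0 \<le> t" "t \<le> T" for t
  proof -
    have "AE a in lb 0 1. wt a * (\<integral>r. dr (r, a) \<partial>lb 0 t)\<^sup>2 = 2 * (\<integral>r. wt a * (du (r, a) * dr (r, a)) \<partial>lb 0 t)"
      using all_t
    proof eventually_elim
      case (elim a)
      have it: "integrable (lb 0 t) (\<lambda>r. dr (r, a))" using integrable_lb_subset[of 0 T] elim t by blast
      note P = primitive_product(1)[OF it it t(1), of 0] primitive_product(2)[OF it it t(1), of 0] primitive_product(3)[OF it it t(1), of 0 0]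
      have ae: "AE r in lb 0 t. du (r, a) = (\<integral>r. dr (r, a) \<partial>lb 0 r)" using elim t by (auto intro: AE_lb_mono)
      have "(\<integral>r. dr (r, a) \<partial>lb 0 t)\<^sup>2 = (\<integral>s. dr (s, a) * (0 + (\<integral>r. dr (r, a) \<partial>lb 0 s)) + (0 + (\<integral>r. dr (r, a) \<partial>lb 0 s)) * dr (s, a) \<partial>lb 0 t)"
        using P(3) by (simp add: power2_eq_square)
      also have "\<dots> = (\<integral>s. 2 * (du (s, a) * dr (s, a)) \<partial>lb 0 t)"
      proof (rule integral_cong_AE)
        show "AE s in lb 0 t. dr (s, a) * (0 + (\<integral>r. dr (r, a) \<partial>lb 0 s)) + (0 + (\<integral>r. dr (r, a) \<partial>lb 0 s)) * dr (s, a) = 2 * (du (s, a) * dr (s, a))"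
          using ae by eventually_elim simp
        show "(\<lambda>s. dr (s, a) * (0 + (\<integral>r. dr (r, a) \<partial>lb 0 s)) + (0 + (\<integral>r. dr (r, a) \<partial>lb 0 s)) * dr (s, a)) \<in> borel_measurable (lb 0 t)"
          using borel_measurable_integrable[OF Bochner_Integration.integrable_add[OF P(1,2)]] .
      qed measurable
      finally show ?case by simp
    qed
    then have "(\<integral>a. wt a * (\<integral>r. dr (r, a) \<partial>lb 0 t)\<^sup>2 \<partial>lb 0 1) = (\<integral>a. 2 * (\<integral>r. wt a * (du (r, a) * dr (r, a)) \<partial>lb 0 t) \<partial>lb 0 1)"
      by (intro integral_cong_AE) measurable
    also have "\<dots> = 2 * (\<integral>r. (\<integral>a. wt a * (du (r, a) * dr (r, a)) \<partial>lb 0 1) \<partial>lb 0 t)"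
      using cylm_time_fubini(3)[OF i_drdu t(2)] by simp
    also have "(\<integral>r. (\<integral>a. wt a * (du (r, a) * dr (r, a)) \<partial>lb 0 1) \<partial>lb 0 t) = (\<integral>r. - (\<integral>a. wt a * (dw (r, a) * ds (r, a)) \<partial>lb 0 1) \<partial>lb 0 t)"
      by (rule integral_cong_AE) (measurable, rule AE_lb_mono[where a=0 and b=T], use parts t in \<open>auto simp: dw_def ds_def du_def dr_def\<close>)
    finally show ?thesis by simp
  qed

  \<comment> \<open>Half of the viscosity \<open>ml\<close> is spent in Young's inequality. The
    factors 1/vh and 1/vl come from dividing by \<open>v1\<close>, which lies between
    \<open>vl\<close> and \<open>vh\<close>; each constant takes the unfavourable end.\<close>
  define \<kappa> where "\<kappa> = ml / (2 * vh)"
  define K where "K = (gh\<^sup>2 + 1) / (ml * vl)"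
  have vh0: "0 < vh" using v(1)[of "(0,0)"] v(2)[of "(0,0)"] v(5) by linarith
  have gh0: "0 \<le> gh" using ga(1)[of 0] ga(2)[of 0] by linarith
  have pt: "AE z in cylm T. \<kappa> * (dw z)\<^sup>2 - K * ((L (fst z))\<^sup>2 * y z) \<le> dw z * ds z \<and> vl * \<bar>ds z\<bar> \<le> mh * \<bar>dw z\<bar> + gh * \<bar>dh z\<bar> + L (fst z) * \<bar>dv z\<bar>"
    using s_eq
  proof eventually_elim
    case (elim z)
    obtain t a where z: "z = (t, a)" by (cases z)
    \<comment> \<open>Splitting s1 v1 - s2 v2 as v1 ds + s2 dv puts the stress difference next to a
      factor bounded away from zero.\<close>
    have key: "v1 z * ds z = mu a * dw z - ga a * dh z - s2 z * dv z"
      using elim unfolding dw_def ds_def dh_def dv_def z by (simp add: algebra_simps)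
    have s2: "\<bar>s2 z\<bar> \<le> L t" using s(2) z by simp
    have b1: "\<bar>ga a * dh z\<bar> \<le> gh * \<bar>dh z\<bar>" unfolding abs_mult using ga by (intro mult_right_mono) auto
    have b2: "\<bar>s2 z * dv z\<bar> \<le> L t * \<bar>dv z\<bar>" unfolding abs_mult using s2 by (intro mult_right_mono) auto
    have mua: "0 < mu a" using mu(1)[of a] mu(3) by linarith
    have b3: "\<bar>mu a * dw z\<bar> \<le> mh * \<bar>dw z\<bar>" unfolding abs_mult using mu(2)[of a] mua by (intro mult_right_mono) auto
    have v10: "0 < v1 z" using v(1)[of z] v(5) by linarith
    have "vl * \<bar>ds z\<bar> \<le> v1 z * \<bar>ds z\<bar>" using v(1) by (intro mult_right_mono) auto
    also have "\<dots> = \<bar>v1 z * ds z\<bar>" using v10 by (simp add: abs_mult)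
    also have "\<dots> \<le> mh * \<bar>dw z\<bar> + gh * \<bar>dh z\<bar> + L t * \<bar>dv z\<bar>" unfolding key using b1 b2 b3 by linarith
    finally have second: "vl * \<bar>ds z\<bar> \<le> mh * \<bar>dw z\<bar> + gh * \<bar>dh z\<bar> + L t * \<bar>dv z\<bar>" .
    define B where "B = gh * \<bar>dh z\<bar> + L t * \<bar>dv z\<bar>"
    have B2: "B\<^sup>2 \<le> 2 * (gh\<^sup>2 + 1) * ((L t)\<^sup>2 * y z)"
    proof -
      have "B\<^sup>2 \<le> 2 * (gh * \<bar>dh z\<bar>)\<^sup>2 + 2 * (L t * \<bar>dv z\<bar>)\<^sup>2"
        unfolding B_def using zero_le_power2[of "gh * \<bar>dh z\<bar> - L t * \<bar>dv z\<bar>"] by (simp add: power2_sum power2_diff)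
      also have "\<dots> = 2 * (gh\<^sup>2 * (dh z)\<^sup>2 + (L t)\<^sup>2 * (dv z)\<^sup>2)" by (simp add: power_mult_distrib)
      also have "\<dots> \<le> 2 * ((gh\<^sup>2 + 1) * ((L t)\<^sup>2 * (dh z)\<^sup>2) + (gh\<^sup>2 + 1) * ((L t)\<^sup>2 * (dv z)\<^sup>2))"
      proof -
        have m1: "gh\<^sup>2 * (dh z)\<^sup>2 \<le> (gh\<^sup>2 + 1) * ((L t)\<^sup>2 * (dh z)\<^sup>2)"
          using L1[of t] by (intro mult_mono) (auto simp: mult_le_cancel_right1 intro: order_trans[OF zero_le_power2])
        have m2: "(L t)\<^sup>2 * (dv z)\<^sup>2 \<le> (gh\<^sup>2 + 1) * ((L t)\<^sup>2 * (dv z)\<^sup>2)"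
          by (simp add: distrib_right)
        show ?thesis by (rule mult_left_mono[OF add_mono[OF m1 m2]]) simp
      qed
      finally show ?thesis by (simp add: y_def algebra_simps)
    qed
    have "mu a * (dw z)\<^sup>2 - \<bar>dw z\<bar> * B \<le> dw z * (v1 z * ds z)"
    proof -
      have "\<bar>dw z * (ga a * dh z + s2 z * dv z)\<bar> \<le> \<bar>dw z\<bar> * B"
        unfolding abs_mult B_def using b1 b2 by (intro mult_left_mono) auto
      then show ?thesis unfolding key by (simp add: algebra_simps power2_eq_square abs_le_iff)
    qed
    \<comment> \<open>Young's inequality, weighted so that half of the viscous term survives;
      squaring \<open>B\<close> is what produces L^2.\<close>
    moreover have "\<bar>dw z\<bar> * B \<le> ml / 2 * (dw z)\<^sup>2 + B\<^sup>2 / (2 * ml)"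
    proof -
      have "0 \<le> (ml * \<bar>dw z\<bar> - B)\<^sup>2" by simp
      then have "2 * (ml * (\<bar>dw z\<bar> * B)) \<le> ml\<^sup>2 * (dw z)\<^sup>2 + B\<^sup>2" by (simp add: power2_diff power_mult_distrib algebra_simps)
      then show ?thesis using mu(3) by (simp add: field_simps power2_eq_square)
    qed
    moreover have "ml * (dw z)\<^sup>2 \<le> mu a * (dw z)\<^sup>2" using mu(1) by (intro mult_right_mono) auto
    moreover define Q where "Q = (gh\<^sup>2 + 1) / ml * ((L t)\<^sup>2 * y z)"
    moreover have "B\<^sup>2 / (2 * ml) \<le> Q"
      using B2 mu(3) by (simp add: field_simps Q_def)
    moreover have "v1 z * (dw z * ds z) = dw z * (v1 z * ds z)" by simp
    ultimately have "ml / 2 * (dw z)\<^sup>2 - Q \<le> v1 z * (dw z * ds z)" by linarith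
    then have c: "ml / 2 * (dw z)\<^sup>2 - (gh\<^sup>2 + 1) / ml * ((L t)\<^sup>2 * y z) \<le> v1 z * (dw z * ds z)"
      by (simp only: Q_def)
    have "\<kappa> * (dw z)\<^sup>2 - K * ((L t)\<^sup>2 * y z) \<le> dw z * ds z"
    proof -
      have "v1 z * (\<kappa> * (dw z)\<^sup>2) \<le> vh * (\<kappa> * (dw z)\<^sup>2)"
        using v(2)[of z] mu(3) vh0 by (intro mult_right_mono) (auto simp: \<kappa>_def)
      then have 1: "v1 z * (\<kappa> * (dw z)\<^sup>2) \<le> ml / 2 * (dw z)\<^sup>2" using vh0 by (simp add: \<kappa>_def)
      have "vl * (K * ((L t)\<^sup>2 * y z)) \<le> v1 z * (K * ((L t)\<^sup>2 * y z))"
        using v(1)[of z] mu(3) v(5) y0 by (intro mult_right_mono) (auto simp: K_def)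
      then have 2: "(gh\<^sup>2 + 1) / ml * ((L t)\<^sup>2 * y z) \<le> v1 z * (K * ((L t)\<^sup>2 * y z))" using v(5) by (simp add: K_def)
      have "v1 z * (\<kappa> * (dw z)\<^sup>2 - K * ((L t)\<^sup>2 * y z)) \<le> v1 z * (dw z * ds z)"
        using 1 2 c by (simp add: right_diff_distrib)
      then show ?thesis using v10 by simp
    qed
    then show ?case using second z by simp
  qed
  define A where "A = (\<integral>t. (L t)\<^sup>2 \<partial>lb 0 T)"
  \<comment> \<open>\<open>K1\<close> bounds |ds| + |dw| by |dw| + L |dh| + L |dv|: the quotient
    comes from the pointwise bound on ds, the 1 from dw itself. In \<open>C2\<close>,
    \<open>A\<close> is the factor left by Cauchy-Schwarz, 3 comes from squaring a sum of three
    terms, and cl^2 from dividing by the heat capacity.\<close>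
  define K1 where "K1 = (mh + gh + 1) / vl + 1"
  define C2 where "C2 = 3 * K1\<^sup>2 * A / cl\<^sup>2"
  define f where "f z = (dw z)\<^sup>2 + (L (fst z))\<^sup>2 * y z" for z
  have [measurable]: "f \<in> borel_measurable (borel \<Otimes>\<^sub>M borel)" unfolding f_def[abs_def] by measurable
  have f0: "0 \<le> f z" for z unfolding f_def using y0 by simp
  have fb: "\<bar>f (t, a)\<bar> \<le> (4 + Y) * (L t)\<^sup>2" for t a
    using dwsq[of t a] Ly[of t a] f0[of "(t, a)"] y0[of "(t, a)"] by (simp add: f_def distrib_right)
  have L2t: "integrable (lb 0 t) (\<lambda>r. (L r)\<^sup>2)" if "t \<le> T" for t by (rule integrable_lb_subset[OF L(3)]) (use that in auto)
  have if1: "integrable (lb 0 t) (\<lambda>r. f (r, a))" if "t \<le> T" for t a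
    by (rule Bochner_Integration.integrable_bound[OF integrable_mult_right[OF L2t[OF that], of "4 + Y"]])
       (measurable, intro AE_I2, unfold real_norm_def, rule order_trans[OF fb abs_ge_self])
  have A0: "0 \<le> A" unfolding A_def by (intro Bochner_Integration.integral_nonneg) auto
  have mh0: "0 < mh" using mu(1)[of 0] mu(2)[of 0] mu(3) by linarith
  have K10: "0 \<le> K1" unfolding K1_def using mh0 gh0 v(5) by simp
  have bL: "integrable (lb 0 t) g" if "t \<le> T" and [measurable]: "g \<in> borel_measurable borel" and b: "\<And>r. \<bar>g r\<bar> \<le> B * (L r)\<^sup>2" for t g B
    by (rule Bochner_Integration.integrable_bound[OF integrable_mult_right[OF L2t[OF that(1)], of B]])
       (measurable, intro AE_I2, unfold real_norm_def, rule order_trans[OF b abs_ge_self])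
  have Lsq: "L r \<le> (L r)\<^sup>2" for r using L(2)[of r] by (simp add: power2_eq_square)
  have L2sq: "x \<le> 2 * (L r)\<^sup>2" if "x \<le> 2 * L r" for x r using that Lsq[of r] by linarith
  have i_w: "integrable (lb 0 t) (\<lambda>r. w1 (r, a))" "integrable (lb 0 t) (\<lambda>r. w2 (r, a))" "integrable (lb 0 t) (\<lambda>r. dw (r, a))" if t: "t \<le> T" for t a
  proof -
    show "integrable (lb 0 t) (\<lambda>r. w1 (r, a))" by (rule bL[OF t, where B=2]) (measurable, intro L2sq, use w(1) L0 in \<open>auto intro: order_trans[OF w(1)]\<close>)
    show "integrable (lb 0 t) (\<lambda>r. w2 (r, a))" by (rule bL[OF t, where B=2]) (measurable, intro L2sq, use w(2) L0 in \<open>auto intro: order_trans[OF w(2)]\<close>)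
    show "integrable (lb 0 t) (\<lambda>r. dw (r, a))" by (rule bL[OF t, where B=2]) (measurable, intro L2sq dwb)
  qed
  have i_sw: "integrable (lb 0 t) (\<lambda>r. s1 (r, a) * w1 (r, a))" "integrable (lb 0 t) (\<lambda>r. s2 (r, a) * w2 (r, a))" if "t \<le> T" for t a
    using that by (auto intro!: bL[where B=1] mult_mono s w L0 simp: abs_mult power2_eq_square)
  \<comment> \<open>Volume and temperature differences have no initial part, so each is a time
    integral. Cauchy-Schwarz bounds the first by the factor T; for the second, the integrand s1 w1 -
    s2 w2 = ds w1 + s2 dw is at most L times a quantity whose square is controlled by
    \<open>f\<close>.\<close>
  have main: "AE z in cylm T. y z \<le> (T + C2) * (\<integral>r. f (r, snd z) \<partial>lb 0 (fst z))"
  proof -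
    have "AE a in lb 0 1. AE t in lb 0 T. vl * \<bar>ds (t, a)\<bar> \<le> mh * \<bar>dw (t, a)\<bar> + gh * \<bar>dh (t, a)\<bar> + L t * \<bar>dv (t, a)\<bar>"
    proof -
      have "AE z in cylm T. vl * \<bar>ds z\<bar> \<le> mh * \<bar>dw z\<bar> + gh * \<bar>dh z\<bar> + L (fst z) * \<bar>dv z\<bar>" using pt by eventually_elim simp
      moreover have "{z \<in> space (cylm T). vl * \<bar>ds z\<bar> \<le> mh * \<bar>dw z\<bar> + gh * \<bar>dh z\<bar> + L (fst z) * \<bar>dv z\<bar>} \<in> sets (cylm T)" by measurable
      ultimately show ?thesis using AE_cylm_swap[of T "\<lambda>z. vl * \<bar>ds z\<bar> \<le> mh * \<bar>dw z\<bar> + gh * \<bar>dh z\<bar> + L (fst z) * \<bar>dv z\<bar>"] by simp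
    qed
    from AE_cylm_snd[OF this] have snd_AE: "AE z in cylm T. AE t in lb 0 T. vl * \<bar>ds (t, snd z)\<bar> \<le> mh * \<bar>dw (t, snd z)\<bar> + gh * \<bar>dh (t, snd z)\<bar> + L t * \<bar>dv (t, snd z)\<bar>" .
    have box: "AE z in cylm T. z \<in> {0<..<T} \<times> {0<..<1}" unfolding AE_cylm by simp
    show ?thesis using v_eq h_eq snd_AE box
    proof eventually_elim
      case (elim z)
      obtain t a where z: "z = (t, a)" by (cases z)
      have t: "0 < t" "t < T" using elim z by auto
      have tT: "t \<le> T" using t by simp
      define I where "I = (\<integral>r. f (r, a) \<partial>lb 0 t)"
      have dwI: "(\<integral>r. (dw (r, a))\<^sup>2 \<partial>lb 0 t) \<le> I" unfolding I_def
        by (rule integral_mono[OF bL[where B=4] if1]) (use tT dwsq y0 in \<open>auto simp: f_def\<close>)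
      have "dv z = (\<integral>r. 1 * dw (r, a) \<partial>lb 0 t)"
        using elim(1,2) i_w[OF tT] unfolding z dv_def dw_def by simp
      then have "(dv z)\<^sup>2 = (\<integral>r. 1 * dw (r, a) \<partial>lb 0 t)\<^sup>2" by simp
      also have "\<dots> \<le> (\<integral>r. 1\<^sup>2 \<partial>lb 0 t) * (\<integral>r. (dw (r, a))\<^sup>2 \<partial>lb 0 t)"
        by (rule cauchy_schwarz_integral) (use i_w(3)[OF tT] dwsq tT in \<open>auto intro!: bL[where B=4]\<close>)
      also have "\<dots> \<le> T * I" using t dwI by (auto intro!: mult_mono Bochner_Integration.integral_nonneg)
      finally have dvI: "(dv z)\<^sup>2 \<le> T * I" .
      define g where "g r = K1 * (\<bar>dw (r, a)\<bar> + L r * \<bar>dh (r, a)\<bar> + L r * \<bar>dv (r, a)\<bar>)" for r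
      have [measurable]: "g \<in> borel_measurable borel" unfolding g_def[abs_def] by measurable
      have g0: "0 \<le> g r" for r unfolding g_def using K10 L0 by simp
      have gsq: "(g r)\<^sup>2 \<le> 3 * K1\<^sup>2 * f (r, a)" for r
      proof -
        have three: "(p + q + s)\<^sup>2 \<le> 3 * (p\<^sup>2 + q\<^sup>2 + s\<^sup>2)" for p q s :: real
          using zero_le_power2[of "p - q"] zero_le_power2[of "q - s"] zero_le_power2[of "p - s"]
          by (simp add: power2_eq_square algebra_simps)
        have "(g r)\<^sup>2 \<le> K1\<^sup>2 * (3 * (\<bar>dw (r, a)\<bar>\<^sup>2 + (L r * \<bar>dh (r, a)\<bar>)\<^sup>2 + (L r * \<bar>dv (r, a)\<bar>)\<^sup>2))"
          unfolding g_def power_mult_distrib[of K1] by (rule mult_left_mono[OF three]) simp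
        also have "\<dots> = 3 * K1\<^sup>2 * f (r, a)" by (simp add: f_def y_def power_mult_distrib algebra_simps)
        finally show ?thesis .
      qed
      have i_gsq: "integrable (lb 0 t) (\<lambda>r. (g r)\<^sup>2)"
        by (rule Bochner_Integration.integrable_bound[OF integrable_mult_right[OF if1[OF tT], of "3 * K1\<^sup>2" a]])
           (measurable, intro AE_I2, use gsq in \<open>auto intro: order_trans[OF _ abs_ge_self]\<close>)
      have i_Lg: "integrable (lb 0 t) (\<lambda>r. L r * g r)"
      proof (rule Bochner_Integration.integrable_bound[OF Bochner_Integration.integrable_add[OF L2t[OF tT] i_gsq]])
        show "AE r in lb 0 t. norm (L r * g r) \<le> norm ((L r)\<^sup>2 + (g r)\<^sup>2)"
        proof (rule AE_I2)
          fix r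
          have "L r * g r \<le> (L r)\<^sup>2 + (g r)\<^sup>2"
          proof -
            have "0 \<le> L r * g r" by (rule mult_nonneg_nonneg[OF L0 g0])
            moreover have "2 * (L r * g r) \<le> (L r)\<^sup>2 + (g r)\<^sup>2" using zero_le_power2[of "L r - g r"] by (simp add: power2_diff)
            ultimately show ?thesis by linarith
          qed
          then show "norm (L r * g r) \<le> norm ((L r)\<^sup>2 + (g r)\<^sup>2)" using L0[of r] g0[of r] by simp
        qed
      qed measurable
      have cvdh: "cv a * dh z = (\<integral>r. s1 (r, a) * w1 (r, a) - s2 (r, a) * w2 (r, a) \<partial>lb 0 t)"
        using elim(3,4) i_sw[OF tT] unfolding z dh_def by (simp add: algebra_simps)
      have "\<bar>cv a * dh z\<bar> \<le> (\<integral>r. \<bar>s1 (r, a) * w1 (r, a) - s2 (r, a) * w2 (r, a)\<bar> \<partial>lb 0 t)"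
        unfolding cvdh by (rule integral_abs_bound)
      also have "\<dots> \<le> (\<integral>r. L r * g r \<partial>lb 0 t)"
      proof (rule integral_mono_AE[OF integrable_abs[OF Bochner_Integration.integrable_diff[OF i_sw[OF tT]]] i_Lg])
        have "AE r in lb 0 t. vl * \<bar>ds (r, a)\<bar> \<le> mh * \<bar>dw (r, a)\<bar> + gh * \<bar>dh (r, a)\<bar> + L r * \<bar>dv (r, a)\<bar>"
          using elim(5) unfolding z by (auto intro: AE_lb_mono[OF _ _ tT])
        then show "AE r in lb 0 t. \<bar>s1 (r, a) * w1 (r, a) - s2 (r, a) * w2 (r, a)\<bar> \<le> L r * g r"
        proof eventually_elim
          case (elim r)
          have "s1 (r, a) * w1 (r, a) - s2 (r, a) * w2 (r, a) = ds (r, a) * w1 (r, a) + s2 (r, a) * dw (r, a)"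
            by (simp add: ds_def dw_def algebra_simps)
          also have "\<bar>\<dots>\<bar> \<le> \<bar>ds (r, a)\<bar> * L r + L r * \<bar>dw (r, a)\<bar>"
            by (rule order_trans[OF abs_triangle_ineq]) (auto simp: abs_mult intro!: add_mono mult_mono w s L0)
          finally have 1: "\<bar>s1 (r, a) * w1 (r, a) - s2 (r, a) * w2 (r, a)\<bar> \<le> L r * (\<bar>ds (r, a)\<bar> + \<bar>dw (r, a)\<bar>)"
            by (simp add: algebra_simps)
          define S where "S = \<bar>dw (r, a)\<bar> + L r * \<bar>dh (r, a)\<bar> + L r * \<bar>dv (r, a)\<bar>"
          have S: "\<bar>dw (r, a)\<bar> \<le> S" "\<bar>dh (r, a)\<bar> \<le> S" "L r * \<bar>dv (r, a)\<bar> \<le> S"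
            using L0[of r] L(2)[of r] mult_right_mono[OF L(2)[of r], of "\<bar>dh (r, a)\<bar>"] unfolding S_def
            by (auto intro: add_nonneg_nonneg add_increasing add_increasing2)
          have "vl * \<bar>ds (r, a)\<bar> \<le> (mh + gh + 1) * S"
          proof -
            have "mh * \<bar>dw (r, a)\<bar> \<le> mh * S" using S(1) mh0 by (intro mult_left_mono) auto
            moreover have "gh * \<bar>dh (r, a)\<bar> \<le> gh * S" using S(2) gh0 by (intro mult_left_mono) auto
            moreover have "(mh + gh + 1) * S = mh * S + gh * S + S" by (simp add: distrib_right)
            ultimately show ?thesis using elim S(3) by linarith
          qed
          then have "\<bar>ds (r, a)\<bar> \<le> (mh + gh + 1) / vl * S" using v(5) by (simp add: field_simps)
          then have "\<bar>ds (r, a)\<bar> + \<bar>dw (r, a)\<bar> \<le> K1 * S" using S(1) by (simp add: K1_def distrib_right)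
          then have "L r * (\<bar>ds (r, a)\<bar> + \<bar>dw (r, a)\<bar>) \<le> L r * g r" unfolding g_def S_def[symmetric] by (rule mult_left_mono[OF _ L0])
          with 1 show ?case by linarith
        qed
      qed
      finally have "(cv a * dh z)\<^sup>2 \<le> (\<integral>r. L r * g r \<partial>lb 0 t)\<^sup>2" by (rule sq_le)
      also have "\<dots> \<le> (\<integral>r. (L r)\<^sup>2 \<partial>lb 0 t) * (\<integral>r. (g r)\<^sup>2 \<partial>lb 0 t)"
        by (rule cauchy_schwarz_integral[OF L2t[OF tT] i_gsq i_Lg])
      also have "\<dots> \<le> A * (3 * K1\<^sup>2 * I)"
      proof (rule mult_mono)
        show "(\<integral>r. (L r)\<^sup>2 \<partial>lb 0 t) \<le> A" unfolding A_def using abs_integral_lb_le[OF L(3) tT] by simp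
        have "(\<integral>r. (g r)\<^sup>2 \<partial>lb 0 t) \<le> (\<integral>r. 3 * K1\<^sup>2 * f (r, a) \<partial>lb 0 t)"
          by (rule integral_mono[OF i_gsq integrable_mult_right[OF if1[OF tT]] gsq])
        then show "(\<integral>r. (g r)\<^sup>2 \<partial>lb 0 t) \<le> 3 * K1\<^sup>2 * I" by (simp add: I_def)
      qed (auto simp: A0 intro!: Bochner_Integration.integral_nonneg)
      finally have "(cv a)\<^sup>2 * (dh z)\<^sup>2 \<le> A * (3 * K1\<^sup>2 * I)" by (simp add: power_mult_distrib)
      moreover have "cl\<^sup>2 * (dh z)\<^sup>2 \<le> (cv a)\<^sup>2 * (dh z)\<^sup>2"
        using cv(1)[of a] cv(2) by (intro mult_right_mono power_mono) auto
      ultimately have "cl\<^sup>2 * (dh z)\<^sup>2 \<le> A * (3 * K1\<^sup>2 * I)" by linarith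
      then have "(dh z)\<^sup>2 \<le> C2 * I" unfolding C2_def using cv(2) by (simp add: field_simps)
      with dvI show ?case unfolding y_def[of z] by (simp add: z I_def distrib_right)
    qed
  qed

  have e0: "0 \<le> e t" for t unfolding e_def using wt0 by (intro Bochner_Integration.integral_nonneg) (simp add: less_imp_le)
  have P0: "0 \<le> P t" for t unfolding P_def using wt0 y0 by (intro Bochner_Integration.integral_nonneg) (simp add: less_imp_le)
  have PM: "P t \<le> wh * Y" for t
  proof -
    have "\<bar>wt a * y (t, a)\<bar> \<le> wh * Y" for a
      unfolding abs_mult using wt(2)[of a] wt0[of a] yb[of "(t, a)"] y0[of "(t, a)"] wh0 by (intro mult_mono) auto
    from integral_lb_bound[of 0 1 "\<lambda>a. wt a * y (t, a)", OF _ this] show ?thesis by (simp add: P_def)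
  qed
  have LP: "(\<integral>a. wt a * ((L r)\<^sup>2 * y (r, a)) \<partial>lb 0 1) = (L r)\<^sup>2 * P r" for r
  proof -
    have "(\<integral>a. wt a * ((L r)\<^sup>2 * y (r, a)) \<partial>lb 0 1) = (\<integral>a. (L r)\<^sup>2 * (wt a * y (r, a)) \<partial>lb 0 1)" by (simp add: ac_simps)
    then show ?thesis by (simp add: P_def)
  qed
  have ie: "integrable (lb 0 t) e" if "t \<le> T" for t
    using cylm_time_fubini(2)[OF i_dw that] by (simp add: e_def[abs_def])
  have iLP: "integrable (lb 0 t) (\<lambda>r. (L r)\<^sup>2 * P r)" if "t \<le> T" for t
    using cylm_time_fubini(2)[OF i_Ly that] by (simp add: LP)
  have \<kappa>0: "0 < \<kappa>" unfolding \<kappa>_def using mu(3) vh0 by simp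
  have K0: "0 \<le> K" unfolding K_def using mu(3) v(5) by simp
  \<comment> \<open>By \<open>en\<close> the accumulated product of dw and ds is nonpositive, being
    minus half a kinetic energy. The pointwise lower bound \<open>pt\<close> on that product then
    limits the dissipation by the Gronwall quantity.\<close>
  have dissip: "\<kappa> * integral\<^sup>L (lb 0 t) e \<le> K * (\<integral>r. (L r)\<^sup>2 * P r \<partial>lb 0 t)" if t: "0 \<le> t" "t \<le> T" for t
  proof -
    have "0 \<le> (\<integral>a. wt a * (\<integral>r. dr (r, a) \<partial>lb 0 t)\<^sup>2 \<partial>lb 0 1)"
      using wt0 by (intro Bochner_Integration.integral_nonneg) (simp add: less_imp_le)
    then have neg: "(\<integral>r. (\<integral>a. wt a * (dw (r, a) * ds (r, a)) \<partial>lb 0 1) \<partial>lb 0 t) \<le> 0" using en[OF t] by simp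
    have "(\<integral>r. \<kappa> * e r - K * ((L r)\<^sup>2 * P r) \<partial>lb 0 t) \<le> (\<integral>r. (\<integral>a. wt a * (dw (r, a) * ds (r, a)) \<partial>lb 0 1) \<partial>lb 0 t)"
    proof (rule integral_mono_AE)
      have "AE r in lb 0 T. \<kappa> * e r - K * ((L r)\<^sup>2 * P r) \<le> (\<integral>a. wt a * (dw (r, a) * ds (r, a)) \<partial>lb 0 1)"
        using lb2.AE_pair[OF pt] lb2.AE_integrable_fst'[OF i_dw] lb2.AE_integrable_fst'[OF i_Ly] lb2.AE_integrable_fst'[OF i_dwds]
      proof eventually_elim
        case (elim r)
        have "\<kappa> * e r - K * ((L r)\<^sup>2 * P r) = (\<integral>a. \<kappa> * (wt a * (dw (r, a))\<^sup>2) - K * (wt a * ((L r)\<^sup>2 * y (r, a))) \<partial>lb 0 1)"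
          using elim(2,3) by (simp add: e_def LP)
        also have "\<dots> \<le> (\<integral>a. wt a * (dw (r, a) * ds (r, a)) \<partial>lb 0 1)"
        proof (rule integral_mono_AE)
          show "integrable (lb 0 1) (\<lambda>a. \<kappa> * (wt a * (dw (r, a))\<^sup>2) - K * (wt a * ((L r)\<^sup>2 * y (r, a))))" using elim(2,3) by simp
          show "integrable (lb 0 1) (\<lambda>a. wt a * (dw (r, a) * ds (r, a)))" using elim(4) by simp
          show "AE a in lb 0 1. \<kappa> * (wt a * (dw (r, a))\<^sup>2) - K * (wt a * ((L r)\<^sup>2 * y (r, a))) \<le> wt a * (dw (r, a) * ds (r, a))"
            using elim(1)
          proof eventually_elim
            case (elim a)
            then have "wt a * (\<kappa> * (dw (r, a))\<^sup>2 - K * ((L r)\<^sup>2 * y (r, a))) \<le> wt a * (dw (r, a) * ds (r, a))"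
              using wt0[of a] by (intro mult_left_mono) auto
            then show ?case by (simp add: algebra_simps)
          qed
        qed
        finally show ?case .
      qed
      then show "AE r in lb 0 t. \<kappa> * e r - K * ((L r)\<^sup>2 * P r) \<le> (\<integral>a. wt a * (dw (r, a) * ds (r, a)) \<partial>lb 0 1)"
        by (rule AE_lb_mono) (use t in auto)
      show "integrable (lb 0 t) (\<lambda>r. \<kappa> * e r - K * ((L r)\<^sup>2 * P r))" using ie[OF t(2)] iLP[OF t(2)] by simp
      show "integrable (lb 0 t) (\<lambda>r. \<integral>a. wt a * (dw (r, a) * ds (r, a)) \<partial>lb 0 1)" using cylm_time_fubini(2)[OF i_dwds t(2)] by simp
    qed
    with neg have "(\<integral>r. \<kappa> * e r - K * ((L r)\<^sup>2 * P r) \<partial>lb 0 t) \<le> 0" by linarith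
    then show ?thesis using ie[OF t(2)] iLP[OF t(2)] by simp
  qed
  have i_f: "integrable (cylm T) (\<lambda>z. wt (snd z) * f z)"
    by (rule ibd[where K="wh * (4 + Y)"]) (measurable, use fb in \<open>auto intro!: bw\<close>)
  have C20: "0 \<le> T + C2" unfolding C2_def using T A0 by simp
  \<comment> \<open>K / \<kappa> is the cost of replacing the dissipation by L^2 P, and the 1
    accounts for the L^2 P already present in \<open>f\<close>.\<close>
  define C3 where "C3 = (T + C2) * (K / \<kappa> + 1)"
  have Pineq: "AE t in lb 0 T. P t \<le> 0 + (\<integral>r. C3 * (L r)\<^sup>2 * P r \<partial>lb 0 t)"
    using lb2.AE_pair[OF main] AE_lb_in[of 0 T]
  proof eventually_elim
    case (elim t)
    have t: "0 \<le> t" "t \<le> T" using elim by auto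
    have iy: "integrable (lb 0 1) (\<lambda>a. wt a * y (t, a))"
      by (rule integrable_lb_bounded[where K="wh * Y"]) (use wt(2) wt0 yb y0 wh0 in \<open>auto simp: abs_mult less_imp_le intro!: mult_mono\<close>)
    have "P t \<le> (\<integral>a. (T + C2) * (\<integral>r. wt a * f (r, a) \<partial>lb 0 t) \<partial>lb 0 1)"
      unfolding P_def
    proof (rule integral_mono_AE[OF iy])
      show "integrable (lb 0 1) (\<lambda>a. (T + C2) * (\<integral>r. wt a * f (r, a) \<partial>lb 0 t))" 
        using cylm_time_fubini(1)[OF i_f t(2)] by simp
      show "AE a in lb 0 1. wt a * y (t, a) \<le> (T + C2) * (\<integral>r. wt a * f (r, a) \<partial>lb 0 t)"
        using elim(1)
      proof eventually_elim
        case (elim a)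
        then have "wt a * y (t, a) \<le> wt a * ((T + C2) * (\<integral>r. f (r, a) \<partial>lb 0 t))" using wt0[of a] by (intro mult_left_mono) auto
        then show ?case by (simp add: ac_simps)
      qed
    qed
    also have "\<dots> = (T + C2) * (\<integral>r. (\<integral>a. wt a * f (r, a) \<partial>lb 0 1) \<partial>lb 0 t)"
      using cylm_time_fubini(3)[OF i_f t(2)] by simp
    also have "(\<integral>r. (\<integral>a. wt a * f (r, a) \<partial>lb 0 1) \<partial>lb 0 t) = (\<integral>r. e r + (L r)\<^sup>2 * P r \<partial>lb 0 t)"
    proof (rule integral_cong_AE)
      have "AE r in lb 0 T. (\<integral>a. wt a * f (r, a) \<partial>lb 0 1) = e r + (L r)\<^sup>2 * P r"
        using lb2.AE_integrable_fst'[OF i_dw] lb2.AE_integrable_fst'[OF i_Ly]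
      proof eventually_elim
        case (elim r)
        have "(\<integral>a. wt a * f (r, a) \<partial>lb 0 1) = (\<integral>a. wt a * (dw (r, a))\<^sup>2 + wt a * ((L r)\<^sup>2 * y (r, a)) \<partial>lb 0 1)"
          by (simp add: f_def distrib_left)
        also have "\<dots> = e r + (L r)\<^sup>2 * P r" using elim by (simp add: e_def LP)
        finally show ?case .
      qed
      then show "AE r in lb 0 t. (\<integral>a. wt a * f (r, a) \<partial>lb 0 1) = e r + (L r)\<^sup>2 * P r" by (rule AE_lb_mono) (use t in auto)
    qed measurable
    also have "\<dots> = integral\<^sup>L (lb 0 t) e + (\<integral>r. (L r)\<^sup>2 * P r \<partial>lb 0 t)" using ie[OF t(2)] iLP[OF t(2)] by simp
    also have "(T + C2) * (integral\<^sup>L (lb 0 t) e + (\<integral>r. (L r)\<^sup>2 * P r \<partial>lb 0 t)) \<le> (T + C2) * ((K / \<kappa> + 1) * (\<integral>r. (L r)\<^sup>2 * P r \<partial>lb 0 t))"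
    proof (rule mult_left_mono[OF _ C20])
      have "integral\<^sup>L (lb 0 t) e \<le> K / \<kappa> * (\<integral>r. (L r)\<^sup>2 * P r \<partial>lb 0 t)"
        using dissip[OF t] \<kappa>0 by (simp add: field_simps)
      then show "integral\<^sup>L (lb 0 t) e + (\<integral>r. (L r)\<^sup>2 * P r \<partial>lb 0 t) \<le> (K / \<kappa> + 1) * (\<integral>r. (L r)\<^sup>2 * P r \<partial>lb 0 t)"
        by (simp add: distrib_right)
    qed
    also have "\<dots> = (\<integral>r. C3 * (L r)\<^sup>2 * P r \<partial>lb 0 t)" by (simp add: C3_def mult.assoc)
    finally show ?case by simp
  qed
  have C30: "0 \<le> C3" unfolding C3_def using C20 K0 \<kappa>0 by simp
  \<comment> \<open>The constant in Gronwall's lemma is 0 because the two solutions share their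
    initial data.\<close>
  have Pz: "AE t in lb 0 T. P t \<le> 0 * exp (\<integral>t. C3 * (L t)\<^sup>2 \<partial>lb 0 T)"
    by (rule gronwall_AE[OF _ _ _ _ _ _ Pineq, where M="wh * Y"]) (use L(3) C30 P0 PM in auto)
  then have Pz: "AE t in lb 0 T. P t = 0" by eventually_elim (use P0 in \<open>auto intro: antisym\<close>)
  have yz: "AE z in cylm T. y z = 0"
  proof (rule lb2.AE_pair_measure)
    show "AE t in lb 0 T. AE a in lb 0 1. y (t, a) = 0" using Pz
    proof eventually_elim
      case (elim t)
      have iy: "integrable (lb 0 1) (\<lambda>a. wt a * y (t, a))"
        by (rule integrable_lb_bounded[where K="wh * Y"]) (use wt(2) wt0 yb y0 wh0 in \<open>auto simp: abs_mult less_imp_le intro!: mult_mono\<close>)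
      have "AE a in lb 0 1. wt a * y (t, a) = 0"
        using elim integral_nonneg_eq_0_iff_AE[OF iy] wt0 y0 by (simp add: P_def less_imp_le)
      then show ?case by eventually_elim (use wt0 in \<open>simp add: less_imp_neq[symmetric]\<close>)
    qed
  qed measurable
  \<comment> \<open>With P = 0 the dissipation estimate makes the rates equal; the energy identity,
    read once more, then leaves no kinetic energy in the velocity difference.\<close>
  have ez: "AE t in lb 0 T. e t = 0"
  proof -
    have "(\<integral>r. (L r)\<^sup>2 * P r \<partial>lb 0 T) = 0" by (rule integral_eq_zero_AE) (use Pz in \<open>eventually_elim, simp\<close>)
    then have "integral\<^sup>L (lb 0 T) e \<le> 0" using dissip[of T] T \<kappa>0 by (simp add: mult_le_0_iff)
    moreover have "0 \<le> integral\<^sup>L (lb 0 T) e" using e0 by (intro Bochner_Integration.integral_nonneg) auto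
    ultimately have "integral\<^sup>L (lb 0 T) e = 0" by linarith
    then show ?thesis using integral_nonneg_eq_0_iff_AE[OF ie[OF order_refl]] e0 by simp
  qed
  have wz: "AE t in lb 0 T. (\<integral>a. wt a * (dw (t, a) * ds (t, a)) \<partial>lb 0 1) = 0"
    using ez lb2.AE_integrable_fst'[OF i_dw]
  proof eventually_elim
    case (elim t)
    have "AE a in lb 0 1. wt a * (dw (t, a))\<^sup>2 = 0"
      using elim integral_nonneg_eq_0_iff_AE[of "lb 0 1" "\<lambda>a. wt a * (dw (t, a))\<^sup>2"] wt0 by (simp add: e_def less_imp_le)
    then have "AE a in lb 0 1. wt a * (dw (t, a) * ds (t, a)) = 0" by eventually_elim auto
    then show ?case by (rule integral_eq_zero_AE)
  qed
  have duz: "AE z in cylm T. du z = 0"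
  proof (rule lb2.AE_pair_measure)
    show "AE t in lb 0 T. AE a in lb 0 1. du (t, a) = 0"
      using lb2.AE_pair[OF duV[unfolded V_def]] AE_lb_in[of 0 T]
    proof eventually_elim
      case (elim t)
      have t: "0 \<le> t" "t \<le> T" using elim by auto
      have "(\<integral>r. (\<integral>a. wt a * (dw (r, a) * ds (r, a)) \<partial>lb 0 1) \<partial>lb 0 t) = 0"
        by (rule integral_eq_zero_AE, rule AE_lb_mono[OF wz]) (use t in auto)
      then have "(\<integral>a. wt a * (\<integral>r. dr (r, a) \<partial>lb 0 t)\<^sup>2 \<partial>lb 0 1) = 0" using en[OF t] by simp
      moreover have "(\<integral>a. wt a * (du (t, a))\<^sup>2 \<partial>lb 0 1) = (\<integral>a. wt a * (\<integral>r. dr (r, a) \<partial>lb 0 t)\<^sup>2 \<partial>lb 0 1)"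
      proof (rule integral_cong_AE)
        show "AE a in lb 0 1. wt a * (du (t, a))\<^sup>2 = wt a * (\<integral>r. dr (r, a) \<partial>lb 0 t)\<^sup>2" using elim(1) by eventually_elim simp
      qed measurable
      moreover have "integrable (lb 0 1) (\<lambda>a. wt a * (du (t, a))\<^sup>2)"
      proof (rule integrable_lb_bounded[where K="wh * (2 * U)\<^sup>2"])
        show "\<bar>wt a * (du (t, a))\<^sup>2\<bar> \<le> wh * (2 * U)\<^sup>2" for a
          unfolding abs_mult using sq_le[OF dub[of "(t, a)"]] wt(2)[of a] wt0[of a] wh0 by (intro mult_mono) auto
      qed measurable
      ultimately have "AE a in lb 0 1. wt a * (du (t, a))\<^sup>2 = 0"
        using integral_nonneg_eq_0_iff_AE[of "lb 0 1" "\<lambda>a. wt a * (du (t, a))\<^sup>2"] wt0 by (simp add: less_imp_le)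
      then show ?case by eventually_elim (use wt0 in \<open>simp add: less_imp_neq[symmetric]\<close>)
    qed
  qed measurable
  show ?thesis using yz duz
    by eventually_elim (auto simp: y_def dv_def dh_def du_def sum_power2_eq_zero_iff)
qed

section \<open>Regular representatives of solutions\<close>

lemma primitive_continuous:
  fixes f g :: "real \<Rightarrow> real"
  assumes g: "\<And>a b. integrable (lb a b) g" and f: "\<And>x y. x \<le> y \<Longrightarrow> f y - f x = integral\<^sup>L (lb x y) g"
  shows "continuous_on UNIV f"
proof -
  have "isCont f x" for x
  proof -
    have "continuous_on {x-1..x+1} (\<lambda>y. f (x-1) + integral\<^sup>L (lb (x-1) y) g)"
      by (intro continuous_intros integral_lb_zero_continuous g)
    moreover have "f (x-1) + integral\<^sup>L (lb (x-1) y) g = f y" if "y \<in> {x-1..x+1}" for y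
      using f[of "x-1" y] that by simp
    ultimately have "continuous_on {x-1..x+1} f" by (subst continuous_on_cong[OF refl, symmetric]) auto
    then show ?thesis by (rule continuous_on_interior) simp
  qed
  then show ?thesis by (simp add: continuous_on_eq_continuous_at)
qed

lemma mix_bounds: "0 \<le> c \<Longrightarrow> c \<le> 1 \<Longrightarrow> min ap am \<le> mix ap am c" "0 \<le> c \<Longrightarrow> c \<le> 1 \<Longrightarrow> mix ap am c \<le> max ap am"
proof -
  assume c: "0 \<le> c" "c \<le> 1"
  have e: "min ap am = c * min ap am + (1 - c) * min ap am" "max ap am = c * max ap am + (1 - c) * max ap am" by (simp_all add: algebra_simps)
  show "min ap am \<le> mix ap am c" unfolding mix_def by (subst e, intro add_mono mult_left_mono) (use c in auto)
  show "mix ap am c \<le> max ap am" unfolding mix_def by (subst e, intro add_mono mult_left_mono) (use c in auto)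
qed

text \<open>Meant for the concentration of a solution, which is given only as a bounded function; it
  inherits the range of \<open>c0\<close> later, by transport along trajectories.\<close>

lemma mix_abs_bound: "\<bar>c\<bar> \<le> B \<Longrightarrow> \<bar>mix ap am c\<bar> \<le> B * \<bar>ap\<bar> + (1 + B) * \<bar>am\<bar>"
proof -
  assume c: "\<bar>c\<bar> \<le> B"
  have "\<bar>mix ap am c\<bar> \<le> \<bar>c\<bar> * \<bar>ap\<bar> + \<bar>1 - c\<bar> * \<bar>am\<bar>"
    unfolding mix_def by (rule order_trans[OF abs_triangle_ineq]) (simp add: abs_mult)
  also have "\<dots> \<le> B * \<bar>ap\<bar> + (1 + B) * \<bar>am\<bar>"
    using c by (intro add_mono mult_right_mono) auto
  finally show ?thesis .
qed

lemma integrable_cylm_one: "integrable (cylm T) (\<lambda>z. (c::real))"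
  using integrable_pair_mult[of 0 T "\<lambda>_. c" 0 1 "\<lambda>_. 1"] by (simp add: case_prod_unfold)

text \<open>At a good time a spatial primitive becomes absolutely continuous in the label, with
  equal values at the labels 0 and 1: just what integration by parts over one period of labels
  requires.\<close>

lemma (in lagrange) lagrangian_primitive:
  fixes s sx :: "real \<times> real \<Rightarrow> real"
  assumes g: "good t" and [measurable]: "sx \<in> borel_measurable (borel \<Otimes>\<^sub>M borel)"
    and s_per: "\<And>t x. s (t, x + 1) = s (t, x)"
    and sx_slice: "\<And>t a b. integrable (lb a b) (\<lambda>x. sx (t, x))"
    and s_prim: "\<And>t x y. x \<le> y \<Longrightarrow> s (t, y) - s (t, x) = (\<integral>x. sx (t, x) \<partial>lb x y)"
  shows "integrable (lb 0 1) (\<lambda>a. rho0 a * (sx (t, X (t, a)) / rho (t, X (t, a))))"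
    "0 \<le> a \<Longrightarrow> a \<le> 1 \<Longrightarrow> s (t, X (t, a)) = s (t, X (t, 0)) + (\<integral>a. rho0 a * (sx (t, X (t, a)) / rho (t, X (t, a))) \<partial>lb 0 a)"
    "s (t, X (t, 1)) = s (t, X (t, 0))"
proof -
  have t: "0 \<le> t" "t \<le> T" using g by (auto simp: good_def)
  show "integrable (lb 0 1) (\<lambda>a. rho0 a * (sx (t, X (t, a)) / rho (t, X (t, a))))"
    by (rule push_integral(1)[OF g _ sx_slice, of _ 0]) auto
  show "s (t, X (t, a)) = s (t, X (t, 0)) + (\<integral>a. rho0 a * (sx (t, X (t, a)) / rho (t, X (t, a))) \<partial>lb 0 a)" if a: "0 \<le> a" "a \<le> 1"
  proof -
    have "(\<integral>a. rho0 a * (sx (t, X (t, a)) / rho (t, X (t, a))) \<partial>lb 0 a) = (\<integral>x. sx (t, x) \<partial>lb (X (t, 0)) (X (t, a)))"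
      by (rule push_integral(2)[OF g _ sx_slice a]) auto
    then show ?thesis using s_prim[OF X_mono[OF a(1) t], of t] by simp
  qed
  show "s (t, X (t, 1)) = s (t, X (t, 0))" using X_per[OF t, of 0] s_per[of t "X (t, 0)"] by simp
qed

section \<open>Regular solutions and their equations along trajectories\<close>

text \<open>\<open>sigma\<close> is a field of its own, continuous in space as the primitive of
  \<open>sx\<close>. The constitutive law ties it to the other fields almost everywhere only, since
  those are discontinuous, while its values at trajectories need the continuous representative. The
  bound S (1 + L) has the shape that the constitutive formula yields.\<close>

locale clean = lagrange T u ux L U rho rl rh rho0 r0l r0h
  for T :: real and u ux :: "real \<times> real \<Rightarrow> real" and L :: "real \<Rightarrow> real" and U :: real
    and rho :: "real \<times> real \<Rightarrow> real" and rl rh :: real and rho0 :: "real \<Rightarrow> real" and r0l r0h :: real +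
  fixes c theta sigma sx :: "real \<times> real \<Rightarrow> real" and c0 theta0 u0 :: "real \<Rightarrow> real"
    and mup mum gp gm cvp cvm cM tl th S :: real
  assumes c_meas [measurable]: "c \<in> borel_measurable (borel \<Otimes>\<^sub>M borel)"
    and c_per: "\<And>t x. c (t, x + 1) = c (t, x)"
    and c_bd: "\<And>t x. \<bar>c (t, x)\<bar> \<le> cM"
    and theta_meas [measurable]: "theta \<in> borel_measurable (borel \<Otimes>\<^sub>M borel)"
    and theta_per: "\<And>t x. theta (t, x + 1) = theta (t, x)"
    and theta_bd: "\<And>t x. tl \<le> theta (t, x)" "\<And>t x. theta (t, x) \<le> th" and tl_pos: "0 < tl"
    and sigma_meas [measurable]: "sigma \<in> borel_measurable (borel \<Otimes>\<^sub>M borel)"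
    and sigma_per: "\<And>t x. sigma (t, x + 1) = sigma (t, x)"
    and sigma_bd: "\<And>t x. \<bar>sigma (t, x)\<bar> \<le> S * (1 + L t)"
    and sx_meas [measurable]: "sx \<in> borel_measurable (borel \<Otimes>\<^sub>M borel)"
    and sx_per: "\<And>t x. sx (t, x + 1) = sx (t, x)"
    and sx_slice: "\<And>t a b. integrable (lb a b) (\<lambda>x. sx (t, x))"
    and sigma_prim: "\<And>t x y. x \<le> y \<Longrightarrow> sigma (t, y) - sigma (t, x) = (\<integral>x. sx (t, x) \<partial>lb x y)"
    and sx_int: "integrable (cylm T) sx"
    and sigma_eq: "AE z in cylm T. sigma z = mix mup mum (c z) * ux z - (mix gp gm (c z) - 1) * rho z * theta z"
    and c0_meas [measurable]: "c0 \<in> borel_measurable borel"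
    and theta0_meas [measurable]: "theta0 \<in> borel_measurable borel"
    and u0_meas [measurable]: "u0 \<in> borel_measurable borel"
    and momentum0_int: "integrable (lb 0 1) (\<lambda>x. rho0 x * u0 x)"
    and species0_int: "integrable (lb 0 1) (\<lambda>x. rho0 x * c0 x)"
    and energy0_int: "integrable (lb 0 1) (\<lambda>x. rho0 x * ((u0 x)\<^sup>2 / 2 + mix cvp cvm (c0 x) * theta0 x))"
    and species: "weakW T (\<lambda>z. rho z * c z) (\<lambda>z. rho z * c z * u z) (\<lambda>x. rho0 x * c0 x)"
    and momentum: "weakW T (\<lambda>z. rho z * u z) (\<lambda>z. rho z * (u z)\<^sup>2 - sigma z) (\<lambda>x. rho0 x * u0 x)"
    and energy: "weakW T (\<lambda>z. rho z * ((u z)\<^sup>2 / 2 + mix cvp cvm (c z) * theta z))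
        (\<lambda>z. rho z * ((u z)\<^sup>2 / 2 + mix cvp cvm (c z) * theta z) * u z - sigma z * u z)
        (\<lambda>x. rho0 x * ((u0 x)\<^sup>2 / 2 + mix cvp cvm (c0 x) * theta0 x))"
begin

lemma mix_meas [measurable]: "mix p q \<in> borel_measurable borel"
  unfolding mix_def[abs_def] by measurable

lemma rh_pos: "0 < rh" using rho_bd[of 0 0] rl_pos by linarith

lemma rho_abs: "\<bar>rho (t, x)\<bar> \<le> rh" using rho_bd[of t x] rl_pos by simp

lemma S_nonneg: "0 \<le> S"
  using order_trans[OF abs_ge_zero sigma_bd[of 0 0]] L_nonneg[of 0] by (simp add: zero_le_mult_iff)

lemma L_int': "integrable (lb 0 T) (\<lambda>t. S * (1 + L t))"
  using L_int by simp

lemma ux_slice: "integrable (lb a b) (\<lambda>x. ux (t, x))"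
  by (rule integrable_lb_bounded[where K="L t"]) (auto simp: ux_bd)

lemma L_cylm: "integrable (cylm T) (\<lambda>z. L (fst z))" "integrable (cylm T) (\<lambda>z. (L (fst z))\<^sup>2)"
  using integrable_pair_mult[OF L_int, of 0 1 "\<lambda>_. 1"] integrable_pair_mult[OF L2_int, of 0 1 "\<lambda>_. 1"] by (simp_all add: case_prod_unfold)

lemma ux_int: "integrable (cylm T) ux"
  by (rule Bochner_Integration.integrable_bound[OF L_cylm(1)])
     (use ux_bd in \<open>auto intro!: AE_I2 intro: order_trans[OF _ abs_ge_self]\<close>)

lemma sigma_cont: "continuous_on UNIV (\<lambda>x. sigma (t, x))"
  by (rule primitive_continuous[OF sx_slice sigma_prim])

lemma lag_c: "AE z in cylm T. c (fst z, X z) = c0 (snd z)"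
proof -
  have "conserved T u ux L U (\<lambda>z. rho z * c z) (\<lambda>z. 0) (\<lambda>a. rho0 a * c0 a) (rh * cM) (\<lambda>t. 0)"
  proof unfold_locales
    show "\<bar>rho (t, x) * c (t, x)\<bar> \<le> rh * cM" for t x
      unfolding abs_mult using rho_abs c_bd rh_pos by (intro mult_mono) auto
    show "weakW T (\<lambda>z. rho z * c z) (\<lambda>z. rho z * c z * u z - 0) (\<lambda>a. rho0 a * c0 a)" using species by simp
  qed (auto simp: rho_per c_per species0_int)
  from transport(2)[OF this, of "\<lambda>z. 0"] show ?thesis by simp
qed

text \<open>The constant 1 = rho (1 / rho) satisfies the trivial law d_t 1 + d_x (1 u) = d_x u. Thus
  \<open>transport\<close>, with 1 / rho as the carried quantity and u in place of the stress,
  yields the equation of the specific volume.\<close>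

lemma lag_v: "integrable (cylm T) (\<lambda>z. ux (fst z, X z) / rho (fst z, X z))"
  "AE z in cylm T. 1 / rho (fst z, X z) = 1 / rho0 (snd z) + (\<integral>r. ux (r, X (r, snd z)) / rho (r, X (r, snd z)) \<partial>lb 0 (fst z))"
proof -
  have one: "rho z * (1 / rho z) = 1" "rho0 x * (1 / rho0 x) = 1" for z x using rho_pos[of z] rho0_pos[of x] by simp_all
  have C: "conserved T u ux L U (\<lambda>z. rho z * (1 / rho z)) u (\<lambda>a. rho0 a * (1 / rho0 a)) 1 (\<lambda>t. U)"
    unfolding one
  proof unfold_locales
    show "weakW T (\<lambda>z. 1) (\<lambda>z. 1 * u z - u z) (\<lambda>x. 1)" by (simp add: weakW_def)
  qed (auto simp: u_per u_bd u_cont)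
  show "integrable (cylm T) (\<lambda>z. ux (fst z, X z) / rho (fst z, X z))"
    by (rule transport(1)[OF C]) (auto intro!: ux_slice u_prim ux_int simp: ux_per)
  show "AE z in cylm T. 1 / rho (fst z, X z) = 1 / rho0 (snd z) + (\<integral>r. ux (r, X (r, snd z)) / rho (r, X (r, snd z)) \<partial>lb 0 (fst z))"
    by (rule transport(2)[OF C]) (auto intro!: ux_slice u_prim ux_int simp: ux_per)
qed

lemma lag_u: "integrable (cylm T) (\<lambda>z. sx (fst z, X z) / rho (fst z, X z))"
  "AE z in cylm T. u (fst z, X z) = u0 (snd z) + (\<integral>r. sx (r, X (r, snd z)) / rho (r, X (r, snd z)) \<partial>lb 0 (fst z))"
proof -
  have C: "conserved T u ux L U (\<lambda>z. rho z * u z) sigma (\<lambda>a. rho0 a * u0 a) (rh * U) (\<lambda>t. S * (1 + L t))"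
  proof unfold_locales
    show "\<bar>rho (t, x) * u (t, x)\<bar> \<le> rh * U" for t x
      unfolding abs_mult using rho_abs u_bd rh_pos by (intro mult_mono) auto
    show "weakW T (\<lambda>z. rho z * u z) (\<lambda>z. rho z * u z * u z - sigma z) (\<lambda>a. rho0 a * u0 a)"
      using momentum by (simp add: power2_eq_square mult.assoc)
    show "integrable (lb 0 T) (\<lambda>t. S * (1 + L t))" by (rule L_int')
  qed (auto simp: rho_per u_per momentum0_int sigma_per sigma_bd sigma_cont)
  show "integrable (cylm T) (\<lambda>z. sx (fst z, X z) / rho (fst z, X z))"
    by (rule transport(1)[OF C]) (auto intro!: sx_slice sigma_prim sx_int simp: sx_per)
  show "AE z in cylm T. u (fst z, X z) = u0 (snd z) + (\<integral>r. sx (r, X (r, snd z)) / rho (r, X (r, snd z)) \<partial>lb 0 (fst z))"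
    by (rule transport(2)[OF C]) (auto intro!: sx_slice sigma_prim sx_int simp: sx_per)
qed

text \<open>The flux is sigma u, a product of two spatial primitives;
  \<open>primitive_product\<close> supplies its derivative sx u + sigma ux.\<close>

lemma lag_E: "AE z in cylm T. (u (fst z, X z))\<^sup>2 / 2 + mix cvp cvm (c (fst z, X z)) * theta (fst z, X z)
    = ((u0 (snd z))\<^sup>2 / 2 + mix cvp cvm (c0 (snd z)) * theta0 (snd z))
      + (\<integral>r. (sx (r, X (r, snd z)) * u (r, X (r, snd z)) + sigma (r, X (r, snd z)) * ux (r, X (r, snd z))) / rho (r, X (r, snd z)) \<partial>lb 0 (fst z))"
proof -
  define E where "E z = (u z)\<^sup>2 / 2 + mix cvp cvm (c z) * theta z" for z
  define E0 where "E0 x = (u0 x)\<^sup>2 / 2 + mix cvp cvm (c0 x) * theta0 x" for x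
  define px where "px z = sx z * u z + sigma z * ux z" for z
  define KE where "KE = U\<^sup>2 / 2 + (cM * \<bar>cvp\<bar> + (1 + cM) * \<bar>cvm\<bar>) * th"
  have [measurable]: "E \<in> borel_measurable (borel \<Otimes>\<^sub>M borel)" "px \<in> borel_measurable (borel \<Otimes>\<^sub>M borel)" "E0 \<in> borel_measurable borel"
    unfolding E_def[abs_def] E0_def[abs_def] px_def[abs_def] by measurable
  have Eb: "\<bar>E (t, x)\<bar> \<le> KE" for t x
  proof -
    have "(u (t, x))\<^sup>2 \<le> U\<^sup>2" using u_bd[of t x] U_nonneg by (simp add: abs_le_square_iff[symmetric])
    moreover have "\<bar>mix cvp cvm (c (t, x)) * theta (t, x)\<bar> \<le> (cM * \<bar>cvp\<bar> + (1 + cM) * \<bar>cvm\<bar>) * th"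
      unfolding abs_mult using mix_abs_bound[OF c_bd, of cvp cvm t x] theta_bd[of t x] tl_pos by (intro mult_mono) auto
    ultimately show ?thesis unfolding E_def KE_def by (intro order_trans[OF abs_triangle_ineq] add_mono) auto
  qed
  have KE0: "0 \<le> KE" using Eb[of 0 0] by linarith
  have slice_sxu: "integrable (lb a b) (\<lambda>x. sx (t, x) * u (t, x))" for t a b
    by (rule integrable_mult_bounded'[OF sx_slice, where K=U]) (auto simp: u_bd)
  have slice_sux: "integrable (lb a b) (\<lambda>x. sigma (t, x) * ux (t, x))" for t a b
    by (rule integrable_lb_bounded[where K="S * (1 + L t) * L t"])
       (use sigma_bd ux_bd L_nonneg S_nonneg in \<open>auto simp: abs_mult intro!: mult_mono order_trans[OF abs_ge_zero sigma_bd]\<close>)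
  have slice: "integrable (lb a b) (\<lambda>x. px (t, x))" for t a b
    unfolding px_def by (intro Bochner_Integration.integrable_add slice_sxu slice_sux)
  have prim: "sigma (t, y) * u (t, y) - sigma (t, x) * u (t, x) = (\<integral>x. px (t, x) \<partial>lb x y)" if xy: "x \<le> y" for t x y
  proof -
    note P = primitive_product(3)[OF sx_slice[of x y t] ux_slice[of x y t] xy, of "sigma (t, x)" "u (t, x)"]
    have "(\<integral>z. sx (t, z) * (u (t, x) + (\<integral>w. ux (t, w) \<partial>lb x z)) + (sigma (t, x) + (\<integral>w. sx (t, w) \<partial>lb x z)) * ux (t, z) \<partial>lb x y) = (\<integral>x. px (t, x) \<partial>lb x y)"
    proof (rule integral_cong_AE)
      show "AE z in lb x y. sx (t, z) * (u (t, x) + (\<integral>w. ux (t, w) \<partial>lb x z)) + (sigma (t, x) + (\<integral>w. sx (t, w) \<partial>lb x z)) * ux (t, z) = px (t, z)"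
        by (rule AE_lbI) (simp add: px_def u_prim[symmetric] sigma_prim[symmetric])
    qed measurable
    then show ?thesis using P xy by (simp add: u_prim[symmetric] sigma_prim[symmetric])
  qed
  have px_int: "integrable (cylm T) px"
  proof -
    have 1: "integrable (cylm T) (\<lambda>z. sx z * u z)"
      by (rule integrable_mult_bounded'[OF sx_int, where K=U]) (use u_bd in auto)
    have 2: "integrable (cylm T) (\<lambda>z. sigma z * ux z)"
    proof (rule Bochner_Integration.integrable_bound)
      show "integrable (cylm T) (\<lambda>z. S * (L (fst z) + (L (fst z))\<^sup>2))" using L_cylm by simp
      show "AE z in cylm T. norm (sigma z * ux z) \<le> norm (S * (L (fst z) + (L (fst z))\<^sup>2))"
      proof (rule AE_I2)
        fix z :: "real \<times> real"
        have "\<bar>sigma z\<bar> * \<bar>ux z\<bar> \<le> (S * (1 + L (fst z))) * L (fst z)"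
          using sigma_bd[of "fst z" "snd z"] ux_bd[of "fst z" "snd z"] order_trans[OF abs_ge_zero sigma_bd[of "fst z" "snd z"]] by (intro mult_mono) auto
        also have "\<dots> = S * (L (fst z) + (L (fst z))\<^sup>2)" by (simp add: algebra_simps power2_eq_square)
        finally have "\<bar>sigma z * ux z\<bar> \<le> S * (L (fst z) + (L (fst z))\<^sup>2)" by (simp add: abs_mult)
        then show "norm (sigma z * ux z) \<le> norm (S * (L (fst z) + (L (fst z))\<^sup>2))"
          unfolding real_norm_def by (rule order_trans[OF _ abs_ge_self])
      qed
    qed measurable
    show ?thesis unfolding px_def[abs_def] using 1 2 by simp
  qed
  have px_per: "px (t, x + 1) = px (t, x)" for t x by (simp add: px_def sx_per u_per sigma_per ux_per)
  have C: "conserved T u ux L U (\<lambda>z. rho z * E z) (\<lambda>z. sigma z * u z) (\<lambda>a. rho0 a * E0 a) (rh * KE) (\<lambda>t. S * (1 + L t) * U)"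
  proof unfold_locales
    show "\<bar>rho (t, x) * E (t, x)\<bar> \<le> rh * KE" for t x
      unfolding abs_mult using rho_abs Eb rh_pos by (intro mult_mono) auto
    show "weakW T (\<lambda>z. rho z * E z) (\<lambda>z. rho z * E z * u z - sigma z * u z) (\<lambda>a. rho0 a * E0 a)"
      unfolding E_def E0_def by (rule energy)
    show "\<bar>sigma (t, x) * u (t, x)\<bar> \<le> S * (1 + L t) * U" for t x
      unfolding abs_mult using sigma_bd u_bd order_trans[OF abs_ge_zero sigma_bd[of t x]] by (intro mult_mono) auto
    show "continuous_on UNIV (\<lambda>x. sigma (t, x) * u (t, x))" for t by (intro continuous_intros sigma_cont u_cont)
    show "integrable (lb 0 T) (\<lambda>t. S * (1 + L t) * U)" by (rule integrable_mult_left[OF L_int'])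
    show "integrable (lb 0 1) (\<lambda>a. rho0 a * E0 a)" unfolding E0_def by (rule energy0_int)
  qed (auto simp: rho_per u_per sigma_per E_def c_per theta_per)
  have "AE z in cylm T. E (fst z, X z) = E0 (snd z) + (\<integral>r. px (r, X (r, snd z)) / rho (r, X (r, snd z)) \<partial>lb 0 (fst z))"
    by (rule transport(2)[OF C]) (auto intro!: slice prim px_int px_per)
  then show ?thesis unfolding E_def E0_def px_def .
qed

text \<open>Subtract the kinetic energy. By \<open>lag_u\<close> and
  \<open>primitive_product\<close> it grows at the rate acceleration times velocity, which is the
  term sx u / rho of the total energy; only the work sigma ux / rho is left to heat the fluid. The
  heat capacity stays constant along a trajectory because \<open>c\<close> does.\<close>

lemma lag_theta: "AE z in cylm T. mix cvp cvm (c0 (snd z)) * (theta (fst z, X z) - theta0 (snd z))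
    = (\<integral>r. sigma (r, X (r, snd z)) * (ux (r, X (r, snd z)) / rho (r, X (r, snd z))) \<partial>lb 0 (fst z))"
proof -
  define r where "r z = sx (fst z, X z) / rho (fst z, X z)" for z
  define v where "v z = u (fst z, X z)" for z
  define p where "p z = sigma (fst z, X z) * (ux (fst z, X z) / rho (fst z, X z))" for z
  have [measurable]: "r \<in> borel_measurable (borel \<Otimes>\<^sub>M borel)" "v \<in> borel_measurable (borel \<Otimes>\<^sub>M borel)" "p \<in> borel_measurable (borel \<Otimes>\<^sub>M borel)"
    unfolding r_def[abs_def] v_def[abs_def] p_def[abs_def] by measurable
  have r_int: "integrable (cylm T) r" unfolding r_def[abs_def] by (rule lag_u(1))
  have ra: "AE a in lb 0 1. integrable (lb 0 T) (\<lambda>t. r (t, a))"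
    using lb2.AE_integrable_snd[of 0 T 0 1 "\<lambda>t a. r (t, a)"] r_int by (simp add: case_prod_unfold)
  define V where "V z = u0 (snd z) + (\<integral>s. r (s, snd z) \<partial>lb 0 (fst z))" for z
  have mV: "V \<in> borel_measurable (cylm T)" unfolding V_def[abs_def]
    by (intro borel_measurable_add measurable_integral_lb) measurable
  have vV: "AE z in cylm T. v z = V z" using lag_u(2) by (simp add: v_def V_def r_def)
  have swap: "AE a in lb 0 1. AE t in lb 0 T. v (t, a) = V (t, a)"
    by (rule AE_cylm_swap[OF borel_measurable_eq[OF _ mV] vV]) measurable
  have pb: "\<bar>p (t, a)\<bar> \<le> (S * (1 + L t)) * (L t / rl)" for t a
  proof -
    have "\<bar>ux (t, X (t, a)) / rho (t, X (t, a))\<bar> \<le> L t / rl"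
      unfolding abs_divide using ux_bd rho_bd rl_pos rho_pos[of "(t, X (t, a))"] L_nonneg by (intro frac_le) auto
    then show ?thesis unfolding p_def abs_mult fst_conv using sigma_bd[of t "X (t, a)"] order_trans[OF abs_ge_zero sigma_bd[of t "X (t, a)"]] by (intro mult_mono) auto
  qed
  have i_p: "integrable (lb 0 t) (\<lambda>s. p (s, a))" if "t \<le> T" for t a
  proof (rule Bochner_Integration.integrable_bound)
    show "integrable (lb 0 t) (\<lambda>s. (S / rl) * (L s + (L s)\<^sup>2))"
      using integrable_lb_subset[OF L_int, of 0 t] integrable_lb_subset[OF L2_int, of 0 t] that by simp
    have "(S * (1 + L s)) * (L s / rl) = (S / rl) * (L s + (L s)\<^sup>2)" for s using rl_pos by (simp add: field_simps power2_eq_square)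
    then show "AE s in lb 0 t. norm (p (s, a)) \<le> norm ((S / rl) * (L s + (L s)\<^sup>2))"
      using pb by (intro AE_I2) (metis abs_ge_self order_trans real_norm_def)
  qed measurable
  have box: "AE z in cylm T. z \<in> {0<..<T} \<times> {0<..<1}" unfolding AE_cylm by simp
  show ?thesis using lag_E lag_c vV AE_cylm_snd[OF ra, of 0 T] AE_cylm_snd[OF swap, of 0 T] box
  proof eventually_elim
    case (elim z)
    obtain t a where z: "z = (t, a)" by (cases z)
    have t: "0 \<le> t" "t \<le> T" using elim z by auto
    have ir: "integrable (lb 0 t) (\<lambda>s. r (s, a))" using integrable_lb_subset[OF elim(4), of 0 t] t z by simp
    have ae: "AE s in lb 0 t. v (s, a) = u0 a + (\<integral>s. r (s, a) \<partial>lb 0 s)"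
      using elim(5) t unfolding z V_def by (auto intro: AE_lb_mono)
    have irv: "integrable (lb 0 t) (\<lambda>s. r (s, a) * v (s, a))"
      by (rule integrable_mult_bounded'[OF ir, where K=U]) (auto simp: v_def u_bd)
    note P = primitive_product(3)[OF ir ir t(1), of "u0 a" "u0 a"]
    have "(v (t, a))\<^sup>2 = (u0 a)\<^sup>2 + (\<integral>s. r (s, a) * (u0 a + (\<integral>s. r (s, a) \<partial>lb 0 s)) + (u0 a + (\<integral>s. r (s, a) \<partial>lb 0 s)) * r (s, a) \<partial>lb 0 t)"
      using P elim(3) by (simp add: z V_def power2_eq_square)
    also have "(\<integral>s. r (s, a) * (u0 a + (\<integral>s. r (s, a) \<partial>lb 0 s)) + (u0 a + (\<integral>s. r (s, a) \<partial>lb 0 s)) * r (s, a) \<partial>lb 0 t) = (\<integral>s. 2 * (r (s, a) * v (s, a)) \<partial>lb 0 t)"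
    proof (rule integral_cong_AE)
      show "AE s in lb 0 t. r (s, a) * (u0 a + (\<integral>s. r (s, a) \<partial>lb 0 s)) + (u0 a + (\<integral>s. r (s, a) \<partial>lb 0 s)) * r (s, a) = 2 * (r (s, a) * v (s, a))"
        using ae by eventually_elim simp
    qed measurable
    finally have sq: "(v (t, a))\<^sup>2 = (u0 a)\<^sup>2 + 2 * (\<integral>s. r (s, a) * v (s, a) \<partial>lb 0 t)" by simp
    have "(\<integral>s. (sx (s, X (s, a)) * u (s, X (s, a)) + sigma (s, X (s, a)) * ux (s, X (s, a))) / rho (s, X (s, a)) \<partial>lb 0 t) = (\<integral>s. r (s, a) * v (s, a) + p (s, a) \<partial>lb 0 t)"
      by (intro Bochner_Integration.integral_cong) (auto simp: r_def v_def p_def add_divide_distrib)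
    also have "\<dots> = (\<integral>s. r (s, a) * v (s, a) \<partial>lb 0 t) + (\<integral>s. p (s, a) \<partial>lb 0 t)" using irv i_p[OF t(2)] by simp
    finally have "(v (t, a))\<^sup>2 / 2 + mix cvp cvm (c0 a) * theta (t, X (t, a)) = ((u0 a)\<^sup>2 / 2 + mix cvp cvm (c0 a) * theta0 a) + ((\<integral>s. r (s, a) * v (s, a) \<partial>lb 0 t) + (\<integral>s. p (s, a) \<partial>lb 0 t))"
      using elim(1,2) by (simp add: z v_def)
    then have "mix cvp cvm (c0 a) * theta (t, X (t, a)) = mix cvp cvm (c0 a) * theta0 a + (\<integral>s. p (s, a) \<partial>lb 0 t)"
      using sq by linarith
    then show ?case by (simp add: z p_def right_diff_distrib)
  qed
qed

text \<open>\<open>AE_lagrange\<close> carries the constitutive law to labels, where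
  \<open>c\<close> equals \<open>c0\<close>; division by the density gives it the linear form used
  in the comparison.\<close>

lemma lag_sigma: "AE z in cylm T. sigma (fst z, X z) * (1 / rho (fst z, X z))
    = mix mup mum (c0 (snd z)) * (ux (fst z, X z) / rho (fst z, X z)) - (mix gp gm (c0 (snd z)) - 1) * theta (fst z, X z)"
proof -
  let ?P = "\<lambda>z. sigma z = mix mup mum (c z) * ux z - (mix gp gm (c z) - 1) * rho z * theta z"
  have "Measurable.pred (borel \<Otimes>\<^sub>M borel) ?P" by measurable
  from AE_lagrange[OF this] sigma_eq have "AE z in cylm T. ?P (fst z, X z)"
    by (simp add: sigma_per c_per ux_per rho_per theta_per)
  with lag_c show ?thesis
  proof eventually_elim
    case (elim z)
    then show ?case using rho_pos[of "(fst z, X z)"] by (simp add: diff_divide_distrib)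
  qed
qed

end

section \<open>Comparison of two regular solutions\<close>

theorem clean_unique:
  fixes tl tl' :: real and sigma sigma' :: "real \<times> real \<Rightarrow> real"
  assumes S1: "clean T u ux L U rho rl rh rho0 r0l r0h c theta sigma sx c0 theta0 u0 mup mum gp gm cvp cvm cM tl th S"
    and S2: "clean T u' ux' L' U' rho' rl' rh' rho0 r0l r0h c' theta' sigma' sx' c0 theta0 u0 mup mum gp gm cvp cvm cM' tl' th' S'"
    and par: "0 < mup" "0 < mum" "1 < gp" "1 < gm" "0 < cvp" "0 < cvm"
    and c0_bd: "\<And>x. 0 \<le> c0 x" "\<And>x. c0 x \<le> 1"
  shows "AE z in cylm T. c z = c' z \<and> rho z = rho' z \<and> theta z = theta' z \<and> u z = u' z"
proof -
  interpret A: clean T u ux L U rho rl rh rho0 r0l r0h c theta sigma sx c0 theta0 u0 mup mum gp gm cvp cvm cM tl th S by (rule S1)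
  interpret B: clean T u' ux' L' U' rho' rl' rh' rho0 r0l r0h c' theta' sigma' sx' c0 theta0 u0 mup mum gp gm cvp cvm cM' tl' th' S' by (rule S2)
  define X where "X = A.X"
  define Y where "Y = B.X"
  have [measurable]: "X \<in> borel_measurable (borel \<Otimes>\<^sub>M borel)" "Y \<in> borel_measurable (borel \<Otimes>\<^sub>M borel)"
    unfolding X_def Y_def by measurable
  define v1 where "v1 z = 1 / rho (fst z, X z)" for z
  define v2 where "v2 z = 1 / rho' (fst z, Y z)" for z
  define h1 where "h1 z = theta (fst z, X z)" for z
  define h2 where "h2 z = theta' (fst z, Y z)" for z
  define w1 where "w1 z = ux (fst z, X z) / rho (fst z, X z)" for z
  define w2 where "w2 z = ux' (fst z, Y z) / rho' (fst z, Y z)" for z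
  define s1 where "s1 z = sigma (fst z, X z)" for z
  define s2 where "s2 z = sigma' (fst z, Y z)" for z
  define u1 where "u1 z = u (fst z, X z)" for z
  define u2 where "u2 z = u' (fst z, Y z)" for z
  define r1 where "r1 z = sx (fst z, X z) / rho (fst z, X z)" for z
  define r2 where "r2 z = sx' (fst z, Y z) / rho' (fst z, Y z)" for z
  have m [measurable]: "v1 \<in> borel_measurable (borel \<Otimes>\<^sub>M borel)" "v2 \<in> borel_measurable (borel \<Otimes>\<^sub>M borel)"
      "h1 \<in> borel_measurable (borel \<Otimes>\<^sub>M borel)" "h2 \<in> borel_measurable (borel \<Otimes>\<^sub>M borel)"
      "w1 \<in> borel_measurable (borel \<Otimes>\<^sub>M borel)" "w2 \<in> borel_measurable (borel \<Otimes>\<^sub>M borel)"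
      "s1 \<in> borel_measurable (borel \<Otimes>\<^sub>M borel)" "s2 \<in> borel_measurable (borel \<Otimes>\<^sub>M borel)"
      "u1 \<in> borel_measurable (borel \<Otimes>\<^sub>M borel)" "u2 \<in> borel_measurable (borel \<Otimes>\<^sub>M borel)"
      "r1 \<in> borel_measurable (borel \<Otimes>\<^sub>M borel)" "r2 \<in> borel_measurable (borel \<Otimes>\<^sub>M borel)"
    unfolding v1_def[abs_def] v2_def[abs_def] h1_def[abs_def] h2_def[abs_def] w1_def[abs_def] w2_def[abs_def]
      s1_def[abs_def] s2_def[abs_def] u1_def[abs_def] u2_def[abs_def] r1_def[abs_def] r2_def[abs_def] by measurable
  \<comment> \<open>One weight has to serve both solutions: \<open>KL\<close> dominates the
    reciprocals of the lower density bounds and the stress constants, and the summand 1 in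
    \<open>Lc\<close> makes the weight at least 1.\<close>
  define KL where "KL = 1 / rl + 1 / rl' + S + S'"
  define Lc where "Lc t = 1 + KL * (1 + L t + L' t)" for t
  have KL: "1 / rl \<le> KL" "1 / rl' \<le> KL" "S \<le> KL" "S' \<le> KL" "0 \<le> KL"
    unfolding KL_def using A.rl_pos B.rl_pos A.S_nonneg B.S_nonneg by auto
  have Lc_ge: "KL * (1 + L t) \<le> Lc t" "KL * (1 + L' t) \<le> Lc t" for t
  proof -
    have "0 \<le> KL * L t" "0 \<le> KL * L' t" using KL(5) A.L_nonneg B.L_nonneg by simp_all
    then show "KL * (1 + L t) \<le> Lc t" "KL * (1 + L' t) \<le> Lc t" unfolding Lc_def by (simp_all add: distrib_left)
  qed
  have quot: "\<bar>p / d\<bar> \<le> KL * (1 + l)" if "\<bar>p\<bar> \<le> l" "e \<le> d" "0 < e" "1 / e \<le> KL" for p d l e :: real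
  proof -
    have "\<bar>p / d\<bar> \<le> l / e" unfolding abs_divide using that by (intro frac_le) auto
    also have "\<dots> = 1 / e * l" by simp
    also have "\<dots> \<le> KL * (1 + l)" using that KL by (intro mult_mono) auto
    finally show ?thesis .
  qed
  have main: "AE z in cylm T. v1 z = v2 z \<and> h1 z = h2 z \<and> u1 z = u2 z"
  proof (rule lagrangian_uniqueness[where ?w1.0=w1 and ?w2.0=w2 and ?s1.0=s1 and ?s2.0=s2 and ?r1.0=r1 and ?r2.0=r2 and L=Lc and wt=rho0 and wl=r0l and wh=r0h
        and vl="min (1 / rh) (1 / rh')" and vh="max (1 / rl) (1 / rl')" and hh="max th th'" and U="max U U'" and mu="\<lambda>a. mix mup mum (c0 a)" and ml="min mup mum" and mh="max mup mum"
        and ga="\<lambda>a. mix gp gm (c0 a) - 1" and gh="max gp gm - 1" and cv="\<lambda>a. mix cvp cvm (c0 a)" and cl="min cvp cvm"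
        and ?v0.0="\<lambda>a. 1 / rho0 a" and ?h0.0=theta0 and ?u0.0=u0])
    show "0 < T" by (rule A.T_pos)
    show "Lc \<in> borel_measurable borel" unfolding Lc_def[abs_def] by measurable
    show "1 \<le> Lc t" for t unfolding Lc_def using KL(5) A.L_nonneg[of t] B.L_nonneg[of t] by simp
    show "integrable (lb 0 T) (\<lambda>t. (Lc t)\<^sup>2)"
    proof (rule Bochner_Integration.integrable_bound)
      show "integrable (lb 0 T) (\<lambda>t. 2 + 6 * KL\<^sup>2 * (1 + (L t)\<^sup>2 + (L' t)\<^sup>2))" using A.L2_int B.L2_int by simp
      show "AE t in lb 0 T. norm ((Lc t)\<^sup>2) \<le> norm (2 + 6 * KL\<^sup>2 * (1 + (L t)\<^sup>2 + (L' t)\<^sup>2))"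
      proof (rule AE_I2)
        fix t
        have three: "(p + q + s)\<^sup>2 \<le> 3 * (p\<^sup>2 + q\<^sup>2 + s\<^sup>2)" for p q s :: real
          using zero_le_power2[of "p - q"] zero_le_power2[of "q - s"] zero_le_power2[of "p - s"]
          by (simp add: power2_eq_square algebra_simps)
        have two: "(1 + q)\<^sup>2 \<le> 2 + 2 * q\<^sup>2" for q :: real
          using zero_le_power2[of "1 - q"] by (simp add: power2_eq_square algebra_simps)
        have "(Lc t)\<^sup>2 \<le> 2 + 2 * (KL * (1 + L t + L' t))\<^sup>2" unfolding Lc_def by (rule two)
        also have "\<dots> = 2 + 2 * (KL\<^sup>2 * (1 + L t + L' t)\<^sup>2)" by (simp add: power_mult_distrib)
        also have "\<dots> \<le> 2 + 2 * (KL\<^sup>2 * (3 * (1\<^sup>2 + (L t)\<^sup>2 + (L' t)\<^sup>2)))"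
          by (intro add_left_mono mult_left_mono three) auto
        finally have "(Lc t)\<^sup>2 \<le> 2 + 6 * KL\<^sup>2 * (1 + (L t)\<^sup>2 + (L' t)\<^sup>2)" by (simp add: algebra_simps)
        then show "norm ((Lc t)\<^sup>2) \<le> norm (2 + 6 * KL\<^sup>2 * (1 + (L t)\<^sup>2 + (L' t)\<^sup>2))" by simp
      qed
    qed (unfold Lc_def[abs_def], measurable)
    show "r0l \<le> rho0 a" "rho0 a \<le> r0h" for a using A.rho0_bd by auto
    show "0 < r0l" by (rule A.r0l_pos)
    show "min (1 / rh) (1 / rh') \<le> v1 z" "v1 z \<le> max (1 / rl) (1 / rl')" for z
      using frac_le[of 1 1 "rho (fst z, X z)" rh] frac_le[of 1 1 rl "rho (fst z, X z)"] A.rho_bd[of "fst z" "X z"] A.rl_pos A.rho_pos[of "(fst z, X z)"]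
      by (auto simp: v1_def)
    show "min (1 / rh) (1 / rh') \<le> v2 z" "v2 z \<le> max (1 / rl) (1 / rl')" for z
      using frac_le[of 1 1 "rho' (fst z, Y z)" rh'] frac_le[of 1 1 rl' "rho' (fst z, Y z)"] B.rho_bd[of "fst z" "Y z"] B.rl_pos B.rho_pos[of "(fst z, Y z)"]
      by (auto simp: v2_def)
    show "0 < min (1 / rh) (1 / rh')" using A.rh_pos B.rh_pos by simp
    show "\<bar>h1 z\<bar> \<le> max th th'" for z using A.theta_bd[of "fst z" "X z"] A.tl_pos by (auto simp: h1_def)
    show "\<bar>h2 z\<bar> \<le> max th th'" for z using B.theta_bd[of "fst z" "Y z"] B.tl_pos by (auto simp: h2_def)
    show "\<bar>w1 (t, a)\<bar> \<le> Lc t" for t a unfolding w1_def fst_conv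
      by (rule order_trans[OF quot[OF A.ux_bd A.rho_bd(1) A.rl_pos KL(1)] Lc_ge(1)])
    show "\<bar>w2 (t, a)\<bar> \<le> Lc t" for t a unfolding w2_def fst_conv
      by (rule order_trans[OF quot[OF B.ux_bd B.rho_bd(1) B.rl_pos KL(2)] Lc_ge(2)])
    show "\<bar>s1 (t, a)\<bar> \<le> Lc t" for t a unfolding s1_def fst_conv
    proof (rule order_trans[OF A.sigma_bd order_trans[OF _ Lc_ge(1)]])
      show "S * (1 + L t) \<le> KL * (1 + L t)" using KL(3) A.L_nonneg[of t] by (intro mult_right_mono) auto
    qed
    show "\<bar>s2 (t, a)\<bar> \<le> Lc t" for t a unfolding s2_def fst_conv
    proof (rule order_trans[OF B.sigma_bd order_trans[OF _ Lc_ge(2)]])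
      show "S' * (1 + L' t) \<le> KL * (1 + L' t)" using KL(4) B.L_nonneg[of t] by (intro mult_right_mono) auto
    qed
    show "\<bar>u1 z\<bar> \<le> max U U'" for z using A.u_bd[of "fst z" "X z"] by (simp add: u1_def)
    show "\<bar>u2 z\<bar> \<le> max U U'" for z using B.u_bd[of "fst z" "Y z"] by (simp add: u2_def)
    show "integrable (cylm T) r1" unfolding r1_def[abs_def] X_def by (rule A.lag_u(1))
    show "integrable (cylm T) r2" unfolding r2_def[abs_def] Y_def by (rule B.lag_u(1))
    show "min mup mum \<le> mix mup mum (c0 a)" "mix mup mum (c0 a) \<le> max mup mum" "min cvp cvm \<le> mix cvp cvm (c0 a)" for a
      using mix_bounds[OF c0_bd] by auto
    show "0 < min mup mum" "0 < min cvp cvm" using par by auto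
    show "0 \<le> mix gp gm (c0 a) - 1" "mix gp gm (c0 a) - 1 \<le> max gp gm - 1" for a
      using mix_bounds[OF c0_bd, of gp gm a] par by auto
    show "AE z in cylm T. v1 z = 1 / rho0 (snd z) + (\<integral>r. w1 (r, snd z) \<partial>lb 0 (fst z))"
      using A.lag_v(2) by (simp add: v1_def w1_def X_def)
    show "AE z in cylm T. v2 z = 1 / rho0 (snd z) + (\<integral>r. w2 (r, snd z) \<partial>lb 0 (fst z))"
      using B.lag_v(2) by (simp add: v2_def w2_def Y_def)
    show "AE z in cylm T. mix cvp cvm (c0 (snd z)) * (h1 z - theta0 (snd z)) = (\<integral>r. s1 (r, snd z) * w1 (r, snd z) \<partial>lb 0 (fst z))"
      using A.lag_theta by (simp add: h1_def s1_def w1_def X_def)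
    show "AE z in cylm T. mix cvp cvm (c0 (snd z)) * (h2 z - theta0 (snd z)) = (\<integral>r. s2 (r, snd z) * w2 (r, snd z) \<partial>lb 0 (fst z))"
      using B.lag_theta by (simp add: h2_def s2_def w2_def Y_def)
    show "AE z in cylm T. u1 z = u0 (snd z) + (\<integral>r. r1 (r, snd z) \<partial>lb 0 (fst z))"
      using A.lag_u(2) by (simp add: u1_def r1_def X_def)
    show "AE z in cylm T. u2 z = u0 (snd z) + (\<integral>r. r2 (r, snd z) \<partial>lb 0 (fst z))"
      using B.lag_u(2) by (simp add: u2_def r2_def Y_def)
    show "AE z in cylm T. s1 z * v1 z = mix mup mum (c0 (snd z)) * w1 z - (mix gp gm (c0 (snd z)) - 1) * h1 z"
      using A.lag_sigma by (simp add: s1_def v1_def w1_def h1_def X_def)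
    show "AE z in cylm T. s2 z * v2 z = mix mup mum (c0 (snd z)) * w2 z - (mix gp gm (c0 (snd z)) - 1) * h2 z"
      using B.lag_sigma by (simp add: s2_def v2_def w2_def h2_def Y_def)
    \<comment> \<open>Integration by parts in the label: the differences of velocity and stress are
      both absolutely continuous and take equal values at labels 0 and 1, so the boundary terms of
      their product cancel. The common \<open>rho0\<close> makes the two label variables the
      same.\<close>
    show "AE t in lb 0 T. (\<integral>a. rho0 a * ((u1 (t, a) - u2 (t, a)) * (r1 (t, a) - r2 (t, a))) \<partial>lb 0 1)
        = - (\<integral>a. rho0 a * ((w1 (t, a) - w2 (t, a)) * (s1 (t, a) - s2 (t, a))) \<partial>lb 0 1)"
      using A.good_AE B.good_AE
    proof eventually_elim
      case (elim t)
      have Au: "integrable (lb 0 1) (\<lambda>a. rho0 a * w1 (t, a))" "\<And>a. 0 \<le> a \<Longrightarrow> a \<le> 1 \<Longrightarrow> u1 (t, a) = u1 (t, 0) + (\<integral>a. rho0 a * w1 (t, a) \<partial>lb 0 a)" "u1 (t, 1) = u1 (t, 0)"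
        unfolding w1_def u1_def X_def fst_conv by (rule A.lagrangian_primitive[OF elim(1) A.ux_meas A.u_per A.ux_slice A.u_prim]; assumption)+
      have As: "integrable (lb 0 1) (\<lambda>a. rho0 a * r1 (t, a))" "\<And>a. 0 \<le> a \<Longrightarrow> a \<le> 1 \<Longrightarrow> s1 (t, a) = s1 (t, 0) + (\<integral>a. rho0 a * r1 (t, a) \<partial>lb 0 a)" "s1 (t, 1) = s1 (t, 0)"
        unfolding r1_def s1_def X_def fst_conv by (rule A.lagrangian_primitive[OF elim(1) A.sx_meas A.sigma_per A.sx_slice A.sigma_prim]; assumption)+
      have Bu: "integrable (lb 0 1) (\<lambda>a. rho0 a * w2 (t, a))" "\<And>a. 0 \<le> a \<Longrightarrow> a \<le> 1 \<Longrightarrow> u2 (t, a) = u2 (t, 0) + (\<integral>a. rho0 a * w2 (t, a) \<partial>lb 0 a)" "u2 (t, 1) = u2 (t, 0)"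
        unfolding w2_def u2_def Y_def fst_conv by (rule B.lagrangian_primitive[OF elim(2) B.ux_meas B.u_per B.ux_slice B.u_prim]; assumption)+
      have Bs: "integrable (lb 0 1) (\<lambda>a. rho0 a * r2 (t, a))" "\<And>a. 0 \<le> a \<Longrightarrow> a \<le> 1 \<Longrightarrow> s2 (t, a) = s2 (t, 0) + (\<integral>a. rho0 a * r2 (t, a) \<partial>lb 0 a)" "s2 (t, 1) = s2 (t, 0)"
        unfolding r2_def s2_def Y_def fst_conv by (rule B.lagrangian_primitive[OF elim(2) B.sx_meas B.sigma_per B.sx_slice B.sigma_prim]; assumption)+
      define f where "f a = u1 (t, a) - u2 (t, a)" for a
      define g where "g a = s1 (t, a) - s2 (t, a)" for a
      define fa where "fa a = rho0 a * (w1 (t, a) - w2 (t, a))" for a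
      define ga where "ga a = rho0 a * (r1 (t, a) - r2 (t, a))" for a
      have ifa: "integrable (lb 0 1) fa"
        using Au(1) Bu(1) by (simp add: fa_def[abs_def] right_diff_distrib)
      have iga: "integrable (lb 0 1) ga"
        using As(1) Bs(1) by (simp add: ga_def[abs_def] right_diff_distrib)
      have fp: "f a = f 0 + integral\<^sup>L (lb 0 a) fa" if a: "0 \<le> a" "a \<le> 1" for a
        using Au(2)[OF a] Bu(2)[OF a] integrable_lb_subset[OF Au(1), of 0 a] integrable_lb_subset[OF Bu(1), of 0 a] a
        by (simp add: f_def fa_def[abs_def] right_diff_distrib)
      have gp: "g a = g 0 + integral\<^sup>L (lb 0 a) ga" if a: "0 \<le> a" "a \<le> 1" for a
        using As(2)[OF a] Bs(2)[OF a] integrable_lb_subset[OF As(1), of 0 a] integrable_lb_subset[OF Bs(1), of 0 a] a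
        by (simp add: g_def ga_def[abs_def] right_diff_distrib)
      have per: "f 1 = f 0" "g 1 = g 0" using Au(3) Bu(3) As(3) Bs(3) by (simp_all add: f_def g_def)
      note P = primitive_product(1)[OF ifa iga zero_le_one, of "g 0"] primitive_product(2)[OF ifa iga zero_le_one, of "f 0"] primitive_product(3)[OF ifa iga zero_le_one, of "f 0" "g 0"]
      have "(\<integral>a. fa a * (g 0 + integral\<^sup>L (lb 0 a) ga) \<partial>lb 0 1) + (\<integral>a. (f 0 + integral\<^sup>L (lb 0 a) fa) * ga a \<partial>lb 0 1) = 0"
        using P(3) per fp[of 1] gp[of 1] unfolding Bochner_Integration.integral_add[OF P(1,2)] by simp
      moreover have "(\<integral>a. fa a * (g 0 + integral\<^sup>L (lb 0 a) ga) \<partial>lb 0 1) = (\<integral>a. rho0 a * ((w1 (t, a) - w2 (t, a)) * (s1 (t, a) - s2 (t, a))) \<partial>lb 0 1)"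
      proof (rule integral_cong_AE, rule borel_measurable_integrable[OF P(1)])
        show "AE a in lb 0 1. fa a * (g 0 + integral\<^sup>L (lb 0 a) ga) = rho0 a * ((w1 (t, a) - w2 (t, a)) * (s1 (t, a) - s2 (t, a)))"
        proof (rule AE_lbI)
          fix a :: real assume a: "0 < a" "a < 1"
          show "fa a * (g 0 + integral\<^sup>L (lb 0 a) ga) = rho0 a * ((w1 (t, a) - w2 (t, a)) * (s1 (t, a) - s2 (t, a)))"
            unfolding gp[OF less_imp_le[OF a(1)] less_imp_le[OF a(2)], symmetric] by (simp add: fa_def g_def)
        qed
      qed measurable
      moreover have "(\<integral>a. (f 0 + integral\<^sup>L (lb 0 a) fa) * ga a \<partial>lb 0 1) = (\<integral>a. rho0 a * ((u1 (t, a) - u2 (t, a)) * (r1 (t, a) - r2 (t, a))) \<partial>lb 0 1)"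
      proof (rule integral_cong_AE, rule borel_measurable_integrable[OF P(2)])
        show "AE a in lb 0 1. (f 0 + integral\<^sup>L (lb 0 a) fa) * ga a = rho0 a * ((u1 (t, a) - u2 (t, a)) * (r1 (t, a) - r2 (t, a)))"
        proof (rule AE_lbI)
          fix a :: real assume a: "0 < a" "a < 1"
          show "(f 0 + integral\<^sup>L (lb 0 a) fa) * ga a = rho0 a * ((u1 (t, a) - u2 (t, a)) * (r1 (t, a) - r2 (t, a)))"
            unfolding fp[OF less_imp_le[OF a(1)] less_imp_le[OF a(2)], symmetric] by (simp add: ga_def f_def)
        qed
      qed measurable
      ultimately show ?case by linarith
    qed
  qed measurable
  \<comment> \<open>The velocity enters through its time integral, so equality at almost every time
    suffices; almost every label is treated first, and continuity of both flows gives the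
    others.\<close>
  have XY: "X (t, a) = Y (t, a)" if t: "0 \<le> t" "t \<le> T" and a: "a \<in> {0..1}" for t a
  proof -
    have "AE z in cylm T. u1 z = u2 z" using main by eventually_elim simp
    moreover have "{z \<in> space (cylm T). u1 z = u2 z} \<in> sets (cylm T)" by measurable
    ultimately have "AE a in lb 0 1. AE t in lb 0 T. u1 (t, a) = u2 (t, a)" by (intro AE_cylm_swap)
    then have "AE a in lb 0 1. X (t, a) = Y (t, a)"
    proof eventually_elim
      case (elim a)
      have "(\<integral>s. u1 (s, a) \<partial>lb 0 t) = (\<integral>s. u2 (s, a) \<partial>lb 0 t)"
        by (rule integral_cong_AE) (use AE_lb_mono[OF elim, of 0 t] t in auto)
      then show ?case using A.X_eq[OF t, of a] B.X_eq[OF t, of a] by (simp add: X_def Y_def u1_def u2_def)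
    qed
    then show ?thesis
      by (rule AE_lb_continuous_eq) (use a A.X_cont[OF t] B.X_cont[OF t] in \<open>auto simp: X_def Y_def elim: continuous_on_subset\<close>)
  qed
  let ?P = "\<lambda>z. c z = c' z \<and> rho z = rho' z \<and> theta z = theta' z \<and> u z = u' z"
  have mP: "Measurable.pred (borel \<Otimes>\<^sub>M borel) ?P" by measurable
  have perP: "?P (t, x + 1) = ?P (t, x)" for t x
    by (simp add: A.c_per B.c_per A.rho_per B.rho_per A.theta_per B.theta_per A.u_per B.u_per)
  have box: "AE z in cylm T. z \<in> {0<..<T} \<times> {0<..<1}" unfolding AE_cylm by simp
  have "AE z in cylm T. ?P (fst z, A.X z)"
    using main A.lag_c B.lag_c box
  proof eventually_elim
    case (elim z)
    have eq: "A.X z = B.X z" using XY[of "fst z" "snd z"] elim(4) by (auto simp: X_def Y_def)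
    have "rho (fst z, A.X z) = rho' (fst z, A.X z)" using elim(1) eq by (simp add: v1_def v2_def X_def Y_def)
    then show ?case using elim(1,2,3) eq by (simp add: h1_def h2_def u1_def u2_def X_def Y_def)
  qed
  then show ?thesis using A.AE_lagrange[OF mP perP] by simp
qed

section \<open>Passage from weak solutions to regular representatives\<close>

lemma data_rep:
  assumes "f \<in> borel_measurable (lebesgue_on torus)"
  shows "\<exists>g::real\<Rightarrow>real. g \<in> borel_measurable borel \<and> (AE x in lb 0 1. f x = g x)"
proof -
  have "(\<lambda>x. if x \<in> torus then f x else 0) \<in> borel_measurable lebesgue"
    using assms by (intro borel_measurable_if_I) (auto simp: torus_def)
  from completion_ex_borel_measurable_real[OF this] obtain g where
    g: "g \<in> borel_measurable lborel" "AE x in lborel. (if x \<in> torus then f x else 0) = g x" by auto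
  have "AE x in lb 0 1. f x = g x" unfolding AE_lb using g(2) by eventually_elim (auto simp: torus_def split: if_splits)
  then show ?thesis using g(1) by auto
qed

lemma frac_meas [measurable]: "(frac :: real \<Rightarrow> real) \<in> borel_measurable borel"
  unfolding frac_def[abs_def] by measurable

text \<open>Composing with \<open>frac\<close> extends a Borel version periodically from [0, 1) and
  keeps it Borel.\<close>

lemma cyl_rep:
  assumes "set_borel_measurable lebesgue (cyl T) f"
  shows "\<exists>g::real\<times>real\<Rightarrow>real. g \<in> borel_measurable (borel \<Otimes>\<^sub>M borel) \<and> (\<forall>t x. g (t, x + 1) = g (t, x)) \<and> (AE z in cylm T. f z = g z)"
proof -
  from completion_ex_borel_measurable_real[OF assms[unfolded set_borel_measurable_def]] obtain g where
    g: "g \<in> borel_measurable lborel" "AE z in lborel. indicator (cyl T) z *\<^sub>R f z = g z" by auto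
  have m [measurable]: "g \<in> borel_measurable (borel \<Otimes>\<^sub>M borel)" using g(1) by (simp add: borel_prod)
  define h where "h z = g (fst z, frac (snd z))" for z :: "real \<times> real"
  have "h \<in> borel_measurable (borel \<Otimes>\<^sub>M borel)" unfolding h_def[abs_def] by measurable
  moreover have "h (t, x + 1) = h (t, x)" for t x by (simp add: h_def frac_def)
  moreover have "AE z in cylm T. f z = h z" unfolding AE_cylm using g(2)
    by eventually_elim (auto simp: h_def cyl_def torus_def frac_eq)
  ultimately show ?thesis by blast
qed

lemma set_integrable_measurable: "set_integrable M A f \<Longrightarrow> set_borel_measurable M A (f :: _ \<Rightarrow> real)"
  unfolding set_integrable_def set_borel_measurable_def by (rule borel_measurable_integrable)

lemma test_int_tensor:
  assumes "smooth_fun \<eta>" "0 < a" "b < T" "\<And>t. t \<le> a \<or> b \<le> t \<Longrightarrow> \<eta> t = 0" "test_torus e"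
  shows "test_int T (\<lambda>z. \<eta> (fst z) * e (snd z))"
  unfolding test_int_def using assms tensor_smooth[OF assms(1)] by (auto simp: test_torus_def)

lemma weak_dx_transfer:
  assumes w: "weak_dx T f g" and [measurable]: "f' \<in> borel_measurable (borel \<Otimes>\<^sub>M borel)" "g' \<in> borel_measurable (borel \<Otimes>\<^sub>M borel)"
    and ae: "AE z in cylm T. f z = f' z" "AE z in cylm T. g z = g' z"
    and \<eta>: "smooth_fun \<eta>" "0 < a" "b < T" "\<And>t. t \<le> a \<or> b \<le> t \<Longrightarrow> \<eta> t = 0" and e: "test_torus e"
  shows "integral\<^sup>L (cylm T) (\<lambda>z. f' z * (\<eta> (fst z) * d1 e (snd z))) = - integral\<^sup>L (cylm T) (\<lambda>z. g' z * (\<eta> (fst z) * e (snd z)))"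
proof -
  let ?\<phi> = "\<lambda>z::real\<times>real. \<eta> (fst z) * e (snd z)"
  have se: "smooth_fun e" using e by (simp add: test_torus_def)
  have [measurable]: "\<eta> \<in> borel_measurable borel" "e \<in> borel_measurable borel" "d1 e \<in> borel_measurable borel"
    by (auto intro!: smooth_measurable smooth_d1 \<eta>(1) se)
  note W = w[unfolded weak_dx_def, rule_format, OF test_int_tensor[OF \<eta> e]]
  have i1: "set_integrable lebesgue (cyl T) (\<lambda>z. f z * (\<eta> (fst z) * d1 e (snd z)))"
    and i2: "set_integrable lebesgue (cyl T) (\<lambda>z. g z * (\<eta> (fst z) * e (snd z)))"
    and eq: "(LINT z:cyl T|lebesgue. f z * (\<eta> (fst z) * d1 e (snd z))) = - (LINT z:cyl T|lebesgue. g z * (\<eta> (fst z) * e (snd z)))"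
    using W by (simp_all add: tensor_derivs[OF \<eta>(1) se])
  have "(LINT z:cyl T|lebesgue. f z * (\<eta> (fst z) * d1 e (snd z))) = integral\<^sup>L (cylm T) (\<lambda>z. f' z * (\<eta> (fst z) * d1 e (snd z)))"
    by (rule cyl_transfer(2)[OF i1]) (measurable, use ae(1) in \<open>eventually_elim, simp\<close>)
  moreover have "(LINT z:cyl T|lebesgue. g z * (\<eta> (fst z) * e (snd z))) = integral\<^sup>L (cylm T) (\<lambda>z. g' z * (\<eta> (fst z) * e (snd z)))"
    by (rule cyl_transfer(2)[OF i2]) (measurable, use ae(2) in \<open>eventually_elim, simp\<close>)
  ultimately show ?thesis using eq by simp
qed

lemma test_init_tensor:
  assumes "smooth_fun \<eta>" "T' < T" "\<And>t. T' \<le> t \<Longrightarrow> \<eta> t = 0" "test_torus e"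
  shows "test_init T (\<lambda>z. \<eta> (fst z) * e (snd z))"
  unfolding test_init_def using assms tensor_smooth[OF assms(1)] by (auto simp: test_torus_def)

text \<open>The weak formulation contains the integrability of \<open>q0\<close> times the initial
  trace of the test function. A test function that depends on time alone, vanishes after T / 2 and
  not at 0, releases it.\<close>

lemma weak_cons_init_integrable:
  assumes w: "weak_cons T q F q0" and T: "0 < T" and [measurable]: "q0' \<in> borel_measurable borel"
    and ae: "AE x in lb 0 1. q0 x = q0' x"
  shows "integrable (lb 0 1) q0'"
proof -
  define \<eta> where "\<eta> t = flatexp 0 (T / 2 - t)" for t
  have "smooth_fun \<eta>" unfolding \<eta>_def[abs_def]
    by (intro smooth_compose[OF smooth_flatexp] smooth_diff smooth_const smooth_ident)
  moreover have "\<eta> t = 0" if "T / 2 \<le> t" for t using that by (simp add: \<eta>_def flatexp_def)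
  ultimately have "test_init T (\<lambda>z. \<eta> (fst z) * 1)"
    using T by (intro test_init_tensor[where T'="T/2"] test_torus_const) auto
  from w[unfolded weak_cons_def, rule_format, OF this]
  have i: "set_integrable lebesgue torus (\<lambda>x. q0 x * (\<eta> 0 * 1))" by simp
  have "integrable (lb 0 1) (\<lambda>x. q0' x * (\<eta> 0 * 1))"
    by (rule torus_transfer(1)[OF i]) (measurable, use ae in \<open>eventually_elim, simp\<close>)
  moreover have "\<eta> 0 \<noteq> 0" using T by (simp add: \<eta>_def flatexp_def)
  ultimately show ?thesis by simp
qed

text \<open>The fluxes are compared only after multiplication by \<open>d1 e\<close>. For constant
  \<open>e\<close> this product is 0 and \<open>F'\<close> may be taken as 0: total momentum is
  conserved before the flux is known to be integrable, hence before the velocity is known to be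
  bounded.\<close>

lemma weak_cons_ode:
  assumes w: "weak_cons T q F q0" and T: "0 < T"
    and [measurable]: "q' \<in> borel_measurable (borel \<Otimes>\<^sub>M borel)" "F' \<in> borel_measurable (borel \<Otimes>\<^sub>M borel)" "q0' \<in> borel_measurable borel"
    and qi: "integrable (cylm T) q'" and Fi: "integrable (cylm T) F'"
    and ae: "AE z in cylm T. q z = q' z" "AE z in cylm T. F z * d1 e (snd z) = F' z * d1 e (snd z)" "AE x in lb 0 1. q0 x = q0' x"
    and e: "test_torus e"
  shows "AE t in lb 0 T. (\<integral>x. q' (t, x) * e x \<partial>lb 0 1) = (\<integral>x. q0' x * e x \<partial>lb 0 1) + (\<integral>s. (\<integral>x. F' (s, x) * d1 e x \<partial>lb 0 1) \<partial>lb 0 t)"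
proof (rule weak_ode)
  have se: "smooth_fun e" using e by (simp add: test_torus_def)
  have [measurable]: "e \<in> borel_measurable borel" "d1 e \<in> borel_measurable borel"
    by (auto intro!: smooth_measurable smooth_d1 se)
  obtain K where K: "\<And>x. \<bar>e x\<bar> \<le> K" using test_torus_bounded[OF e] by blast
  obtain K' where K': "\<And>x. \<bar>d1 e x\<bar> \<le> K'" using test_torus_bounded[OF test_torus_d1[OF e]] by blast
  have i1: "integrable (cylm T) (\<lambda>z. q' z * e (snd z))" by (rule integrable_mult_bounded'[OF qi, where K=K]) (use K in auto)
  have i2: "integrable (cylm T) (\<lambda>z. F' z * d1 e (snd z))" by (rule integrable_mult_bounded'[OF Fi, where K=K']) (use K' in auto)
  show iA: "integrable (lb 0 T) (\<lambda>t. \<integral>x. q' (t, x) * e x \<partial>lb 0 1)" using lb2.integrable_fst'[OF i1] by simp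
  show iB: "integrable (lb 0 T) (\<lambda>t. \<integral>x. F' (t, x) * d1 e x \<partial>lb 0 1)" using lb2.integrable_fst'[OF i2] by simp
  fix \<eta> T' assume \<eta>: "smooth_fun \<eta>" "T' < T" "\<And>t. T' \<le> t \<Longrightarrow> \<eta> t = 0"
  have [measurable]: "\<eta> \<in> borel_measurable borel" "d1 \<eta> \<in> borel_measurable borel"
    by (auto intro!: smooth_measurable smooth_d1 \<eta>)
  \<comment> \<open>\<eta> may be unbounded for negative times; cut off to (0, T) it satisfies the
    global bounds demanded by \<open>tensor_fubini\<close>, and the integrals do not change.\<close>
  have bd: "\<exists>K. \<forall>t. \<bar>indicator {0<..<T} t * g t\<bar> \<le> K" if "continuous_on UNIV g" for g :: "real \<Rightarrow> real"
  proof -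
    have c: "continuous_on {0..T} g" using that by (rule continuous_on_subset) auto
    obtain B where B: "\<And>x. x \<in> {0..T} \<Longrightarrow> norm (g x) \<le> B"
      using compact_imp_bounded[OF compact_continuous_image[OF c compact_Icc]] unfolding bounded_iff by blast
    then show ?thesis by (intro exI[of _ "\<bar>B\<bar>"]) (auto simp: indicator_def intro: order_trans[OF _ abs_ge_self])
  qed
  obtain N where N: "\<And>t. \<bar>indicator {0<..<T} t * \<eta> t\<bar> \<le> N" using bd[OF smooth_continuous[OF \<eta>(1)]] by blast
  obtain N' where N': "\<And>t. \<bar>indicator {0<..<T} t * d1 \<eta> t\<bar> \<le> N'" using bd[OF smooth_continuous[OF smooth_d1[OF \<eta>(1)]]] by blast
  note W = w[unfolded weak_cons_def, rule_format, OF test_init_tensor[OF \<eta> e]]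
  have i: "set_integrable lebesgue (cyl T) (\<lambda>z. q z * (d1 \<eta> (fst z) * e (snd z)) + F z * (\<eta> (fst z) * d1 e (snd z)))"
    and i0: "set_integrable lebesgue torus (\<lambda>x. q0 x * (\<eta> 0 * e x))"
    and eq: "(LINT z:cyl T|lebesgue. q z * (d1 \<eta> (fst z) * e (snd z)) + F z * (\<eta> (fst z) * d1 e (snd z))) + (LINT x:torus|lebesgue. q0 x * (\<eta> 0 * e x)) = 0"
    using W by (simp_all add: tensor_derivs[OF \<eta>(1) se])
  let ?i = "\<lambda>z. indicator {0<..<T} (fst z) :: real"
  let ?G = "\<lambda>z. q' z * ((?i z * d1 \<eta> (fst z)) * e (snd z)) + F' z * ((?i z * \<eta> (fst z)) * d1 e (snd z))"
  have box: "AE z in cylm T. z \<in> {0<..<T} \<times> {0<..<1}" unfolding AE_cylm by simp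
  have 1: "(LINT z:cyl T|lebesgue. q z * (d1 \<eta> (fst z) * e (snd z)) + F z * (\<eta> (fst z) * d1 e (snd z))) = integral\<^sup>L (cylm T) ?G"
  proof (rule cyl_transfer(2)[OF i])
    show "AE z in cylm T. q z * (d1 \<eta> (fst z) * e (snd z)) + F z * (\<eta> (fst z) * d1 e (snd z)) = ?G z"
      using ae(1,2) box
    proof eventually_elim
      case (elim z)
      have "F z * (\<eta> (fst z) * d1 e (snd z)) = \<eta> (fst z) * (F z * d1 e (snd z))" by simp
      then show ?case using elim by auto
    qed
  qed measurable
  have 2: "(LINT x:torus|lebesgue. q0 x * (\<eta> 0 * e x)) = (\<integral>x. q0' x * (\<eta> 0 * e x) \<partial>lb 0 1)"
    by (rule torus_transfer(2)[OF i0]) (measurable, use ae(3) in \<open>eventually_elim, simp\<close>)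
  have m: "(\<lambda>t. indicator {0<..<T} t * d1 \<eta> t) \<in> borel_measurable borel" "(\<lambda>t. indicator {0<..<T} t * \<eta> t) \<in> borel_measurable borel" by measurable
  have me: "e \<in> borel_measurable borel" "d1 e \<in> borel_measurable borel" by measurable
  note tq = tensor_fubini[OF qi m(1) me(1) N' K] and tF = tensor_fubini[OF Fi m(2) me(2) N K']
  have ia: "integrable (lb 0 T) (\<lambda>t. (\<integral>x. q' (t, x) * e x \<partial>lb 0 1) * (indicator {0<..<T} t * d1 \<eta> t))"
    by (rule integrable_mult_bounded'[OF iA _ N']) measurable
  have ib: "integrable (lb 0 T) (\<lambda>t. (\<integral>x. F' (t, x) * d1 e x \<partial>lb 0 1) * (indicator {0<..<T} t * \<eta> t))"
    by (rule integrable_mult_bounded'[OF iB _ N]) measurable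
  have "integral\<^sup>L (cylm T) ?G = (\<integral>t. (\<integral>x. q' (t, x) * e x \<partial>lb 0 1) * (indicator {0<..<T} t * d1 \<eta> t) \<partial>lb 0 T)
      + (\<integral>t. (\<integral>x. F' (t, x) * d1 e x \<partial>lb 0 1) * (indicator {0<..<T} t * \<eta> t) \<partial>lb 0 T)"
    unfolding Bochner_Integration.integral_add[OF tq(2) tF(2)] tq(3) tF(3) ..
  also have "\<dots> = (\<integral>t. (\<integral>x. q' (t, x) * e x \<partial>lb 0 1) * (indicator {0<..<T} t * d1 \<eta> t) + (\<integral>x. F' (t, x) * d1 e x \<partial>lb 0 1) * (indicator {0<..<T} t * \<eta> t) \<partial>lb 0 T)"
    by (rule Bochner_Integration.integral_add[symmetric, OF ia ib])
  also have "\<dots> = (\<integral>t. (\<integral>x. q' (t, x) * e x \<partial>lb 0 1) * d1 \<eta> t + (\<integral>x. F' (t, x) * d1 e x \<partial>lb 0 1) * \<eta> t \<partial>lb 0 T)"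
    by (rule integral_cong_AE) (auto simp: AE_lb)
  finally have 3: "integral\<^sup>L (cylm T) ?G = (\<integral>t. (\<integral>x. q' (t, x) * e x \<partial>lb 0 1) * d1 \<eta> t + (\<integral>x. F' (t, x) * d1 e x \<partial>lb 0 1) * \<eta> t \<partial>lb 0 T)" .
  have 4: "(\<integral>x. q0' x * (\<eta> 0 * e x) \<partial>lb 0 1) = (\<integral>x. q0' x * e x \<partial>lb 0 1) * \<eta> 0"
    by (simp add: mult.commute[of "\<eta> 0"] mult.assoc[symmetric])
  show "(\<integral>t. (\<integral>x. q' (t, x) * e x \<partial>lb 0 1) * d1 \<eta> t + (\<integral>x. F' (t, x) * d1 e x \<partial>lb 0 1) * \<eta> t \<partial>lb 0 T) + (\<integral>x. q0' x * e x \<partial>lb 0 1) * \<eta> 0 = 0"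
    using eq unfolding 1 2 3 4 .
qed

lemma weak_cons_weakW:
  assumes "weak_cons T q F q0" "0 < T"
    and "q' \<in> borel_measurable (borel \<Otimes>\<^sub>M borel)" "F' \<in> borel_measurable (borel \<Otimes>\<^sub>M borel)" "q0' \<in> borel_measurable borel"
    and "integrable (cylm T) q'" "integrable (cylm T) F'"
    and ae: "AE z in cylm T. q z = q' z" "AE z in cylm T. F z = F' z" "AE x in lb 0 1. q0 x = q0' x"
  shows "weakW T q' F' q0'"
  unfolding weakW_def
proof (intro allI impI)
  fix \<phi> assume "test_torus \<phi>"
  moreover have "AE z in cylm T. F z * d1 \<phi> (snd z) = F' z * d1 \<phi> (snd z)" using ae(2) by eventually_elim simp
  ultimately show "AE t in lb 0 T. (\<integral>x. q' (t, x) * \<phi> x \<partial>lb 0 1) = (\<integral>x. q0' x * \<phi> x \<partial>lb 0 1) + (\<integral>s. (\<integral>x. F' (s, x) * d1 \<phi> x \<partial>lb 0 1) \<partial>lb 0 t)"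
    by (intro weak_cons_ode[OF assms(1-7) ae(1) _ ae(3)])
qed

section \<open>Bounds and measurability contained in the definition of a Hoff solution\<close>

text \<open>For a Borel representative the slice-wise essential supremum is measurable in time,
  because l(t) \<le> c says that a parameter integral vanishes. At the times where it is infinite, a
  null set in view of \<open>C\<close>, \<open>enn2real\<close> returns 0.\<close>

lemma slice_sup_bound:
  assumes [measurable]: "g \<in> borel_measurable (borel \<Otimes>\<^sub>M borel)" and ae: "AE z in cylm T. f z = g z"
    and C: "(\<integral>\<^sup>+t \<in> {0<..<T}. (Linf_norm_slice f t)\<^sup>2 \<partial>lebesgue) \<le> ennreal C"
  shows "\<exists>L. L \<in> borel_measurable borel \<and> (\<forall>t. 0 \<le> L t) \<and> integrable (lb 0 T) (\<lambda>t. (L t)\<^sup>2) \<and> (AE z in cylm T. \<bar>g z\<bar> \<le> L (fst z))"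
proof -
  define l where "l t = esssup (lb 0 1) (\<lambda>x. ennreal \<bar>g (t, x)\<bar>)" for t
  define L where "L t = enn2real (l t)" for t
  have le_iff: "l t \<le> c \<longleftrightarrow> (\<integral>\<^sup>+x. indicator {x. c < ennreal \<bar>g (t, x)\<bar>} x \<partial>lb 0 1) = 0" for t c
  proof -
    have "l t \<le> c \<longleftrightarrow> (AE x in lb 0 1. ennreal \<bar>g (t, x)\<bar> \<le> c)"
    proof
      assume c: "l t \<le> c"
      have "AE x in lb 0 1. ennreal \<bar>g (t, x)\<bar> \<le> l t" unfolding l_def by (rule esssup_AE)
      then show "AE x in lb 0 1. ennreal \<bar>g (t, x)\<bar> \<le> c" by eventually_elim (rule order_trans[OF _ c])
    qed (auto simp: l_def intro!: esssup_I)
    also have "\<dots> \<longleftrightarrow> (AE x in lb 0 1. (indicator {x. c < ennreal \<bar>g (t, x)\<bar>} x :: ennreal) = 0)"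
      by (intro AE_cong) (auto simp: indicator_def not_less)
    also have "\<dots> \<longleftrightarrow> (\<integral>\<^sup>+x. indicator {x. c < ennreal \<bar>g (t, x)\<bar>} x \<partial>lb 0 1) = 0"
      by (subst nn_integral_0_iff_AE) auto
    finally show ?thesis .
  qed
  have [measurable]: "l \<in> borel_measurable borel"
  proof (rule borel_measurableI_le)
    fix c
    have "Measurable.pred borel (\<lambda>t. (\<integral>\<^sup>+x. (if c < ennreal \<bar>g (t, x)\<bar> then 1 else 0 :: ennreal) \<partial>lb 0 1) = 0)" by measurable
    moreover have "(\<lambda>x. indicator {x. c < ennreal \<bar>g (t, x)\<bar>} x) = (\<lambda>x. if c < ennreal \<bar>g (t, x)\<bar> then 1 else 0 :: ennreal)" for t
      by (auto simp: indicator_def)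
    ultimately show "{t \<in> space borel. l t \<le> c} \<in> sets borel" unfolding le_iff pred_def by simp
  qed
  have [measurable]: "L \<in> borel_measurable borel" unfolding L_def[abs_def] by measurable
  have l_le: "AE t in lb 0 T. l t \<le> Linf_norm_slice f t"
    using lb2.AE_pair[OF ae]
  proof eventually_elim
    case (elim t)
    have "AE x in lebesgue_on torus. ennreal \<bar>f (t, x)\<bar> \<le> Linf_norm_slice f t"
      unfolding Linf_norm_slice_def by (rule esssup_AE)
    then have "AE x in lebesgue. x \<in> torus \<longrightarrow> ennreal \<bar>f (t, x)\<bar> \<le> Linf_norm_slice f t"
      by (subst (asm) AE_restrict_space_iff) (auto simp: torus_def)
    then have "AE x in lb 0 1. ennreal \<bar>f (t, x)\<bar> \<le> Linf_norm_slice f t" unfolding AE_torus_iff .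
    with elim have "AE x in lb 0 1. ennreal \<bar>g (t, x)\<bar> \<le> Linf_norm_slice f t" by eventually_elim simp
    then show ?case unfolding l_def by (intro esssup_I) auto
  qed
  have "(\<integral>\<^sup>+t. (l t)\<^sup>2 \<partial>lb 0 T) = (\<integral>\<^sup>+t. (l t)\<^sup>2 * indicator {0<..<T} t \<partial>lborel)"
    unfolding lb_def by (subst nn_integral_density) (auto simp: ennreal_indicator mult.commute)
  also have "\<dots> \<le> (\<integral>\<^sup>+t. (Linf_norm_slice f t)\<^sup>2 * indicator {0<..<T} t \<partial>lborel)"
    by (rule nn_integral_mono_AE) (use l_le in \<open>auto simp: AE_lb indicator_def intro!: power_mono elim!: AE_mp intro: AE_I2\<close>)
  also have "\<dots> \<le> ennreal C" using C by (simp add: nn_integral_completion)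
  finally have fin: "(\<integral>\<^sup>+t. (l t)\<^sup>2 \<partial>lb 0 T) < \<infinity>" by (simp add: le_less_trans)
  then have "AE t in lb 0 T. (l t)\<^sup>2 \<noteq> \<infinity>" by (intro nn_integral_PInf_AE) auto
  then have lf: "AE t in lb 0 T. l t = ennreal (L t)"
    by eventually_elim (auto simp: L_def power2_eq_square ennreal_mult_eq_top_iff less_top)
  have L0: "0 \<le> L t" for t by (simp add: L_def)
  have "integrable (lb 0 T) (\<lambda>t. (L t)\<^sup>2)"
  proof (rule integrableI_bounded)
    have "(\<integral>\<^sup>+t. ennreal (norm ((L t)\<^sup>2)) \<partial>lb 0 T) = (\<integral>\<^sup>+t. (l t)\<^sup>2 \<partial>lb 0 T)"
      by (rule nn_integral_cong_AE) (use lf in \<open>eventually_elim, simp add: ennreal_power L0\<close>)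
    then show "(\<integral>\<^sup>+t. ennreal (norm ((L t)\<^sup>2)) \<partial>lb 0 T) < \<infinity>" using fin by simp
  qed measurable
  moreover have "AE z in cylm T. \<bar>g z\<bar> \<le> L (fst z)"
  proof (rule lb2.AE_pair_measure)
    show "AE t in lb 0 T. AE x in lb 0 1. \<bar>g (t, x)\<bar> \<le> L (fst (t, x))"
      using lf
    proof eventually_elim
      case (elim t)
      have "AE x in lb 0 1. ennreal \<bar>g (t, x)\<bar> \<le> l t" unfolding l_def by (rule esssup_AE)
      then show ?case by eventually_elim (simp add: elim ennreal_le_iff L0)
    qed
  qed measurable
  ultimately show ?thesis using L0 by (intro exI[of _ L]) auto
qed

text \<open>\<open>weak_dx\<close> provides integrability, hence measurability, of \<open>g\<close>
  times every test function. Test functions of time alone that tend to 1 on the cylinder recover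
  \<open>g\<close> as a pointwise limit.\<close>

lemma weak_dx_derivative_measurable:
  assumes w: "weak_dx T f g" and T: "0 < T"
  shows "set_borel_measurable lebesgue (cyl T) g"
proof -
  define \<eta> where "\<eta> n = tbump n (T / (real n + 3)) (T - T / (real n + 3))" for n
  have d: "0 < T / (real n + 3)" "T / (real n + 3) < T - T / (real n + 3)" for n
    using T by (auto simp: field_simps intro!: add_pos_nonneg)
  have i: "set_integrable lebesgue (cyl T) (\<lambda>z. g z * (\<eta> n (fst z) * 1))" for n
  proof -
    have "test_int T (\<lambda>z. \<eta> n (fst z) * 1)"
    proof (rule test_int_tensor[where a="T / (real n + 3)" and b="T - T / (real n + 3)"])
      show "smooth_fun (\<eta> n)" unfolding \<eta>_def by (rule smooth_tbump)
      show "T - T / (real n + 3) < T" using d(1)[of n] by simp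
      show "\<eta> n t = 0" if "t \<le> T / (real n + 3) \<or> T - T / (real n + 3) \<le> t" for t
        using that d(2)[of n] by (auto simp: \<eta>_def tbump_def flatexp_def zero_less_mult_iff)
    qed (use d test_torus_const in auto)
    from w[unfolded weak_dx_def, rule_format, OF this] show ?thesis by simp
  qed
  have lim: "(\<lambda>n. \<eta> n t) \<longlonglongrightarrow> 1" if t: "0 < t" "t < T" for t
  proof -
    have l0: "(\<lambda>n. T / (real n + 3)) \<longlonglongrightarrow> 0"
    proof -
      have "(\<lambda>n. T * (1 / real (n + 3))) \<longlonglongrightarrow> T * 0"
        by (intro tendsto_mult tendsto_const LIMSEQ_ignore_initial_segment[OF lim_1_over_n, of 3])
      then show ?thesis by (simp add: add.commute)
    qed
    \<comment> \<open>Once the margin T / (n + 3) is below m, both factors inside the bump are at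
      least m; its argument is then at least n m^2 and tends to infinity, although interval and
      steepness change together.\<close>
    define m where "m = min t (T - t) / 2"
    have m: "0 < m" using t by (simp add: m_def)
    have ev: "\<forall>\<^sub>F n in sequentially. T / (real n + 3) < m" using l0 m by (rule order_tendstoD)
    have lower: "flatexp 0 (real n * m\<^sup>2) \<le> \<eta> n t" if n: "T / (real n + 3) < m" for n
    proof -
      have "m \<le> t - T / (real n + 3)" "m \<le> T - T / (real n + 3) - t" using n t by (auto simp: m_def min_def split: if_splits)
      then have "m\<^sup>2 \<le> (t - T / (real n + 3)) * (T - T / (real n + 3) - t)"
        unfolding power2_eq_square using m by (intro mult_mono) auto
      then have le: "real n * m\<^sup>2 \<le> real n * ((t - T / (real n + 3)) * (T - T / (real n + 3) - t))" by (rule mult_left_mono) simp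
      have mono: "flatexp 0 x \<le> flatexp 0 y" if "x \<le> y" for x y
        using that by (auto simp: flatexp_def intro!: divide_left_mono frac_le)
      show ?thesis unfolding \<eta>_def tbump_def by (rule mono[OF le])
    qed
    show ?thesis
    proof (rule tendsto_sandwich)
      show "\<forall>\<^sub>F n in sequentially. flatexp 0 (real n * m\<^sup>2) \<le> \<eta> n t" using ev by eventually_elim (rule lower)
      show "\<forall>\<^sub>F n in sequentially. \<eta> n t \<le> 1" using flatexp0_bounds by (simp add: \<eta>_def tbump_def)
      show "(\<lambda>n. flatexp 0 (real n * m\<^sup>2)) \<longlonglongrightarrow> 1" using flatexp0_limit[of "m\<^sup>2"] m by simp
    qed simp
  qed
  show ?thesis unfolding set_borel_measurable_def
  proof (rule borel_measurable_LIMSEQ_real)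
    show "(\<lambda>n. indicator (cyl T) z *\<^sub>R (g z * (\<eta> n (fst z) * 1))) \<longlonglongrightarrow> indicator (cyl T) z *\<^sub>R g z" for z
    proof (cases "z \<in> cyl T")
      case True
      then have "(\<lambda>n. \<eta> n (fst z)) \<longlonglongrightarrow> 1" by (intro lim) (auto simp: cyl_def)
      from tendsto_mult[OF tendsto_const[of "g z"] this] True show ?thesis by simp
    qed simp
    show "(\<lambda>z. indicator (cyl T) z *\<^sub>R (g z * (\<eta> n (fst z) * 1))) \<in> borel_measurable lebesgue" for n
      using i[of n] unfolding set_integrable_def by (rule borel_measurable_integrable)
  qed
qed

lemma AE_lb_nonempty:
  assumes "AE t in lb a b. P t" "a < b"
  shows "\<exists>t. a < t \<and> t < b \<and> P t"
proof (rule ccontr)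
  assume "\<not> ?thesis"
  then have e: "{t \<in> {a<..<b}. P t} = {}" by auto
  have "closure {} = {a..b}" using AE_lb_closure[OF assms] unfolding e .
  then show False using assms(2) by simp
qed

text \<open>The bound is available at almost every t < T but not at T itself. An admissible time
  exists between T - T / (n + 2) and T for every n, and monotone convergence fills the
  cylinder.\<close>

lemma nn_integral_box_le:
  fixes f g :: "real \<times> real \<Rightarrow> real"
  assumes T: "0 < T" and [measurable]: "g \<in> borel_measurable (borel \<Otimes>\<^sub>M borel)" and ae: "AE z in cylm T. f z = g z"
    and C: "AE t in lebesgue. t \<in> {0<..<T} \<longrightarrow> (\<integral>\<^sup>+z \<in> {0<..<t} \<times> torus. ennreal ((f z)\<^sup>2) \<partial>lebesgue) \<le> ennreal C"
  shows "integrable (cylm T) (\<lambda>z. (g z)\<^sup>2)"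
proof (rule integrableI_bounded)
  have gm: "g \<in> borel_measurable borel" using assms(2) by (simp add: borel_prod)
  have C': "AE t in lb 0 T. (\<integral>\<^sup>+z \<in> {0<..<t} \<times> torus. ennreal ((f z)\<^sup>2) \<partial>lebesgue) \<le> ennreal C" using C unfolding AE_time_iff .
  let ?h = "\<lambda>n z. ennreal ((g z)\<^sup>2) * indicator {..<T - T / (real n + 2)} (fst z)"
  have d: "0 < T / (real n + 2)" "T / (real n + 2) < T" for n using T by (auto simp: field_simps intro!: add_pos_nonneg)
  have le: "(\<integral>\<^sup>+z. ?h n z \<partial>cylm T) \<le> ennreal C" for n
  proof -
    have "AE t in lb (T - T / (real n + 2)) T. (\<integral>\<^sup>+z \<in> {0<..<t} \<times> torus. ennreal ((f z)\<^sup>2) \<partial>lebesgue) \<le> ennreal C"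
      by (rule AE_lb_mono[OF C']) (use d(2)[of n] in auto)
    then have "\<exists>t. T - T / (real n + 2) < t \<and> t < T \<and> (\<integral>\<^sup>+z \<in> {0<..<t} \<times> torus. ennreal ((f z)\<^sup>2) \<partial>lebesgue) \<le> ennreal C"
      by (rule AE_lb_nonempty) (use d(1)[of n] in simp)
    then obtain t where t: "T - T / (real n + 2) < t" "t < T" "(\<integral>\<^sup>+z \<in> {0<..<t} \<times> torus. ennreal ((f z)\<^sup>2) \<partial>lebesgue) \<le> ennreal C" by blast
    have "(\<integral>\<^sup>+z. ?h n z \<partial>cylm T) = (\<integral>\<^sup>+z. indicator ({0<..<T} \<times> {0<..<1}) z * ?h n z \<partial>lborel)"
      unfolding cylm_density by (subst nn_integral_density) (use gm in \<open>auto simp: ennreal_indicator borel_prod[symmetric]\<close>)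
    also have "\<dots> \<le> (\<integral>\<^sup>+z. ennreal ((f z)\<^sup>2) * indicator ({0<..<t} \<times> torus) z \<partial>lborel)"
    proof (rule nn_integral_mono_AE)
      show "AE z in lborel. indicator ({0<..<T} \<times> {0<..<1}) z * ?h n z \<le> ennreal ((f z)\<^sup>2) * indicator ({0<..<t} \<times> torus) z"
        using ae unfolding AE_cylm by eventually_elim (use t in \<open>auto simp: indicator_def torus_def\<close>)
    qed
    also have "\<dots> \<le> ennreal C" using t(3) by (simp add: nn_integral_completion)
    finally show ?thesis .
  qed
  have "(\<integral>\<^sup>+z. ennreal (norm ((g z)\<^sup>2)) \<partial>cylm T) = (\<integral>\<^sup>+z. (SUP n. ?h n z) \<partial>cylm T)"
  proof (rule nn_integral_cong_AE)
    have box: "AE z in cylm T. z \<in> {0<..<T} \<times> {0<..<1}" unfolding AE_cylm by simp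
    then show "AE z in cylm T. ennreal (norm ((g z)\<^sup>2)) = (SUP n. ?h n z)"
    proof eventually_elim
      case (elim z)
      have l0: "(\<lambda>n. T / (real n + 2)) \<longlonglongrightarrow> 0"
      proof -
        have "(\<lambda>n. T * (1 / real (n + 2))) \<longlonglongrightarrow> T * 0"
          by (intro tendsto_mult tendsto_const LIMSEQ_ignore_initial_segment[OF lim_1_over_n, of 2])
        then show ?thesis by (simp add: add.commute)
      qed
      have "\<forall>\<^sub>F n in sequentially. T / (real n + 2) < T - fst z" using l0 by (rule order_tendstoD) (use elim in auto)
      then obtain n where n: "T / (real n + 2) < T - fst z" by (auto simp: eventually_sequentially)
      show ?case
      proof (rule antisym)
        show "ennreal (norm ((g z)\<^sup>2)) \<le> (SUP n. ?h n z)"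
          by (rule SUP_upper2[of n]) (use n in \<open>auto simp: indicator_def\<close>)
        show "(SUP n. ?h n z) \<le> ennreal (norm ((g z)\<^sup>2))" by (rule SUP_least) (auto simp: indicator_def)
      qed
    qed
  qed
  also have "\<dots> = (SUP n. \<integral>\<^sup>+z. ?h n z \<partial>cylm T)"
  proof (rule nn_integral_monotone_convergence_SUP)
    show "incseq ?h"
    proof (rule incseq_SucI, rule le_funI)
      fix n z
      have "T / (real (Suc n) + 2) \<le> T / (real n + 2)" using T by (intro divide_left_mono) auto
      then show "?h n z \<le> ?h (Suc n) z" by (auto simp: indicator_def)
    qed
  qed measurable
  also have "\<dots> \<le> ennreal C" by (rule SUP_least) (rule le)
  finally show "(\<integral>\<^sup>+z. ennreal (norm ((g z)\<^sup>2)) \<partial>cylm T) < \<infinity>" by (simp add: le_less_trans)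
qed measurable

definition spatial_primitive :: "(real \<times> real \<Rightarrow> real) \<Rightarrow> (real \<times> real \<Rightarrow> real) \<Rightarrow> bool" where
  "spatial_primitive F G \<longleftrightarrow> F \<in> borel_measurable (borel \<Otimes>\<^sub>M borel) \<and> G \<in> borel_measurable (borel \<Otimes>\<^sub>M borel) \<and>
    (\<forall>t x. F (t, x + 1) = F (t, x)) \<and> (\<forall>t x. G (t, x + 1) = G (t, x)) \<and>
    (\<forall>t x y. integrable (lb x y) (\<lambda>x. G (t, x))) \<and>
    (\<forall>t x y. x \<le> y \<longrightarrow> F (t, y) - F (t, x) = (\<integral>x. G (t, x) \<partial>lb x y))"

lemma spatial_primitiveD:
  assumes "spatial_primitive F G"
  shows "F \<in> borel_measurable (borel \<Otimes>\<^sub>M borel)" "G \<in> borel_measurable (borel \<Otimes>\<^sub>M borel)"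
    "F (t, x + 1) = F (t, x)" "G (t, x + 1) = G (t, x)" "integrable (lb x y) (\<lambda>x. G (t, x))"
    "x \<le> y \<Longrightarrow> F (t, y) - F (t, x) = (\<integral>x. G (t, x) \<partial>lb x y)"
  using assms unfolding spatial_primitive_def by blast+

lemma weak_dx_spatial_primitive:
  assumes w: "weak_dx T f g"
    and m: "f' \<in> borel_measurable (borel \<Otimes>\<^sub>M borel)" "g' \<in> borel_measurable (borel \<Otimes>\<^sub>M borel)"
    and i: "integrable (cylm T) f'" "integrable (cylm T) g'"
    and ae: "AE z in cylm T. f z = f' z" "AE z in cylm T. g z = g' z"
  shows "\<exists>F G. spatial_primitive F G \<and> (AE z in cylm T. F z = f' z) \<and> (AE z in cylm T. G z = g' z) \<and>
    (\<forall>t x. G (t, x) = 0 \<or> G (t, x) = g' (t, frac x))"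
proof -
  have "\<exists>F G. F \<in> borel_measurable (borel \<Otimes>\<^sub>M borel) \<and> G \<in> borel_measurable (borel \<Otimes>\<^sub>M borel) \<and>
    (\<forall>t x. F (t, x + 1) = F (t, x)) \<and> (\<forall>t x. G (t, x + 1) = G (t, x)) \<and>
    (AE z in cylm T. F z = f' z) \<and> (AE z in cylm T. G z = g' z) \<and>
    (\<forall>t x. G (t, x) = 0 \<or> G (t, x) = g' (t, frac x)) \<and>
    (\<forall>t x y. integrable (lb x y) (\<lambda>x. G (t, x))) \<and>
    (\<forall>t x y. x \<le> y \<longrightarrow> F (t, y) - F (t, x) = (\<integral>x. G (t, x) \<partial>lb x y))"
  proof (rule weak_dx_primitive[OF i m])
    fix \<eta> e :: "real \<Rightarrow> real" and a b :: real
    assume A: "smooth_fun \<eta>" "0 < a" "b < T" "\<And>t. t \<le> a \<or> b \<le> t \<Longrightarrow> \<eta> t = 0" "test_torus e"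
    show "integral\<^sup>L (cylm T) (\<lambda>z. f' z * (\<eta> (fst z) * d1 e (snd z))) = - integral\<^sup>L (cylm T) (\<lambda>z. g' z * (\<eta> (fst z) * e (snd z)))"
      by (rule weak_dx_transfer[OF w m ae A])
  qed
  then show ?thesis
    unfolding spatial_primitive_def
    apply (elim exE conjE)
    subgoal for F G by (intro exI[of _ F] exI[of _ G] conjI)
    done
qed

text \<open>Setting both functions to 0 on a measurable set of bad times keeps the primitive
  relation at every time; it turns bounds valid at almost every time into bounds valid
  always.\<close>

lemma spatial_primitive_restrict:
  assumes sp: "spatial_primitive F G" and [measurable]: "Measurable.pred borel P"
  shows "spatial_primitive (\<lambda>z. if P (fst z) then F z else 0) (\<lambda>z. if P (fst z) then G z else 0)"
proof -
  note [measurable] = spatial_primitiveD(1,2)[OF sp]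
  have "integrable (lb x y) (\<lambda>x. if P t then G (t, x) else 0)" for t x y
    using spatial_primitiveD(5)[OF sp] by (cases "P t") auto
  moreover have "(if P t then F (t, y) else 0) - (if P t then F (t, x) else 0) = (\<integral>x. (if P t then G (t, x) else 0) \<partial>lb x y)"
    if "x \<le> y" for t x y using spatial_primitiveD(6)[OF sp that] by (cases "P t") auto
  ultimately show ?thesis
    unfolding spatial_primitive_def using spatial_primitiveD(3,4)[OF sp] by auto
qed

lemma AE_cylm_fst:
  assumes [measurable]: "Measurable.pred borel P" and "AE t in lb 0 T. P t"
  shows "AE z in cylm T. P (fst z)"
proof (rule lb2.AE_pair_measure)
  show "AE t in lb 0 T. AE x in lb 0 1. P (fst (t, x))" using assms(2) by eventually_elim simp
qed measurable

lemma spatial_primitive_continuous: "spatial_primitive F G \<Longrightarrow> continuous_on UNIV (\<lambda>x. F (t, x))"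
  by (rule primitive_continuous[where g="\<lambda>x. G (t, x)"]) (rule spatial_primitiveD(5,6), assumption+)+

lemma spatial_primitive_oscillation:
  assumes sp: "spatial_primitive F G" and x: "0 \<le> x" "x \<le> 1" and y: "0 \<le> y" "y \<le> 1"
  shows "\<bar>F (t, y) - F (t, x)\<bar> \<le> 2 * (\<integral>x. \<bar>G (t, x)\<bar> \<partial>lb 0 1)"
proof -
  have b: "\<bar>F (t, z) - F (t, 0)\<bar> \<le> (\<integral>x. \<bar>G (t, x)\<bar> \<partial>lb 0 1)" if "0 \<le> z" "z \<le> 1" for z
    unfolding spatial_primitiveD(6)[OF sp that(1)]
    by (rule abs_integral_lb_le[OF spatial_primitiveD(5)[OF sp] that(2)])
  show ?thesis using b[OF x] b[OF y] by linarith
qed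

text \<open>Decompose rho F as rho (F - F(y)) + rho F(y) and integrate: the weighted mean is
  prescribed as \<open>A\<close>, the oscillation is at most 2 K, and the total weight of rho lies
  between \<open>rl\<close> and \<open>rh\<close>.\<close>

lemma spatial_primitive_mean_bound:
  assumes sp: "spatial_primitive F G" and [measurable]: "rho \<in> borel_measurable (borel \<Otimes>\<^sub>M borel)"
    and rho: "\<And>t x. rl \<le> rho (t, x)" "\<And>t x. rho (t, x) \<le> rh" "0 < rl"
    and A: "(\<integral>x. rho (t, x) * F (t, x) \<partial>lb 0 1) = A" and K: "(\<integral>x. \<bar>G (t, x)\<bar> \<partial>lb 0 1) \<le> K"
  shows "\<bar>F (t, x)\<bar> \<le> (\<bar>A\<bar> + 2 * K * rh) / rl"
proof -
  note [measurable] = spatial_primitiveD(1,2)[OF sp]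
  define y where "y = frac x"
  have y: "0 \<le> y" "y \<le> 1" unfolding y_def using frac_lt_1[of x] by auto
  have Fy: "F (t, x) = F (t, y)" unfolding y_def
    using periodic_frac[of "\<lambda>x. F (t, x)" x] spatial_primitiveD(3)[OF sp] by simp
  have osc: "\<bar>F (t, z) - F (t, y)\<bar> \<le> 2 * K" if "0 < z" "z < 1" for z
    using spatial_primitive_oscillation[OF sp y, of z t] that K by simp
  have K0: "0 \<le> 2 * K" using osc[of "1/2"] by linarith
  have rho0: "0 < rho (t, z)" for z using rho(1)[of t z] rho(3) by linarith
  have i1: "integrable (lb 0 1) (\<lambda>z. rho (t, z))"
    by (rule integrable_lb_bounded[where K=rh]) (use rho rho0 in \<open>auto simp: less_imp_le\<close>)
  have d: "\<bar>rho (t, z) * (F (t, z) - F (t, y))\<bar> \<le> rh * (2 * K)" if "0 < z" "z < 1" for z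
    unfolding abs_mult using osc[OF that] rho0[of z] rho(2)[of t z] K0 by (intro mult_mono) auto
  have i2: "integrable (lb 0 1) (\<lambda>z. rho (t, z) * (F (t, z) - F (t, y)))"
    by (rule integrable_lb_bounded[OF _ d]) auto
  have "A = (\<integral>z. rho (t, z) * (F (t, z) - F (t, y)) + rho (t, z) * F (t, y) \<partial>lb 0 1)"
    unfolding A[symmetric] by (simp add: algebra_simps)
  also have "\<dots> = (\<integral>z. rho (t, z) * (F (t, z) - F (t, y)) \<partial>lb 0 1) + (\<integral>z. rho (t, z) \<partial>lb 0 1) * F (t, y)"
    using i1 i2 by (subst Bochner_Integration.integral_add) auto
  finally have eq: "A = (\<integral>z. rho (t, z) * (F (t, z) - F (t, y)) \<partial>lb 0 1) + (\<integral>z. rho (t, z) \<partial>lb 0 1) * F (t, y)" .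
  have le: "\<bar>\<integral>z. rho (t, z) * (F (t, z) - F (t, y)) \<partial>lb 0 1\<bar> \<le> rh * (2 * K)"
    using integral_lb_bound[of 0 1 "\<lambda>z. rho (t, z) * (F (t, z) - F (t, y))", OF _ d] by simp
  have R: "rl \<le> (\<integral>z. rho (t, z) \<partial>lb 0 1)"
    using integral_mono[of "lb 0 1" "\<lambda>z. rl" "\<lambda>z. rho (t, z)"] i1 rho(1) by simp
  have "rl * \<bar>F (t, y)\<bar> \<le> (\<integral>z. rho (t, z) \<partial>lb 0 1) * \<bar>F (t, y)\<bar>" using R by (rule mult_right_mono) simp
  also have "\<dots> = \<bar>(\<integral>z. rho (t, z) \<partial>lb 0 1) * F (t, y)\<bar>" using R rho(3) by (simp add: abs_mult)
  also have "\<dots> \<le> \<bar>A\<bar> + rh * (2 * K)" using eq le by linarith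
  finally show ?thesis unfolding Fy using rho(3) by (simp add: field_simps)
qed

text \<open>From |a| \<le> 1 + a^2 on an interval of length one; this trades the bound on the square
  for one on the oscillation of a primitive.\<close>

lemma slice_abs_bound:
  fixes f g :: "real \<times> real \<Rightarrow> real"
  assumes gm [measurable]: "g \<in> borel_measurable (borel \<Otimes>\<^sub>M borel)" and gi: "\<And>t. integrable (lb 0 1) (\<lambda>x. g (t, x))"
    and ae: "AE z in cylm T. f z = g z" and C0: "0 \<le> C"
    and C: "AE t in lebesgue. t \<in> {0<..<T} \<longrightarrow> (\<integral>\<^sup>+x \<in> torus. ennreal ((f (t, x))\<^sup>2) \<partial>lebesgue) \<le> ennreal C"
  shows "AE t in lb 0 T. (\<integral>x. \<bar>g (t, x)\<bar> \<partial>lb 0 1) \<le> 1 + C"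
  using lb2.AE_pair[OF ae] C[unfolded AE_time_iff]
proof eventually_elim
  case (elim t)
  have "(\<integral>\<^sup>+x. ennreal ((g (t, x))\<^sup>2) \<partial>lb 0 1) = (\<integral>\<^sup>+x. indicator {0<..<1} x * ennreal ((g (t, x))\<^sup>2) \<partial>lborel)"
    unfolding lb_def by (subst nn_integral_density) (auto simp: ennreal_indicator)
  also have "\<dots> \<le> (\<integral>\<^sup>+x. ennreal ((f (t, x))\<^sup>2) * indicator torus x \<partial>lborel)"
  proof (rule nn_integral_mono_AE)
    show "AE x in lborel. indicator {0<..<1} x * ennreal ((g (t, x))\<^sup>2) \<le> ennreal ((f (t, x))\<^sup>2) * indicator torus x"
      using elim(1) unfolding AE_lb by eventually_elim (auto simp: indicator_def torus_def)
  qed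
  also have "\<dots> \<le> ennreal C" using elim(2) by (simp add: nn_integral_completion)
  finally have sq: "(\<integral>\<^sup>+x. ennreal ((g (t, x))\<^sup>2) \<partial>lb 0 1) \<le> ennreal C" .
  have ab: "\<bar>a\<bar> \<le> 1 + a\<^sup>2" for a :: real
    using zero_le_power2[of "\<bar>a\<bar> - 1"] by (simp add: power2_diff)
  have "ennreal (\<integral>x. \<bar>g (t, x)\<bar> \<partial>lb 0 1) = (\<integral>\<^sup>+x. ennreal \<bar>g (t, x)\<bar> \<partial>lb 0 1)"
    using gi[of t] by (intro nn_integral_eq_integral[symmetric]) auto
  also have "\<dots> \<le> (\<integral>\<^sup>+x. 1 + ennreal ((g (t, x))\<^sup>2) \<partial>lb 0 1)"
    by (rule nn_integral_mono) (use ab in \<open>simp flip: ennreal_1 ennreal_plus\<close>)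
  also have "\<dots> = 1 + (\<integral>\<^sup>+x. ennreal ((g (t, x))\<^sup>2) \<partial>lb 0 1)"
    by (subst nn_integral_add) (auto simp: emeasure_lb_UNIV)
  also have "\<dots> \<le> 1 + ennreal C" by (rule add_left_mono[OF sq])
  also have "\<dots> = ennreal (1 + C)" using C0 by (simp flip: ennreal_1 ennreal_plus)
  finally show ?case using C0 by (subst (asm) ennreal_le_iff) auto
qed

lemma integrable_cylm_bounded:
  fixes f :: "real \<times> real \<Rightarrow> real"
  assumes "f \<in> borel_measurable (borel \<Otimes>\<^sub>M borel)" "\<And>t x. \<bar>f (t, x)\<bar> \<le> K"
  shows "integrable (cylm T) f"
proof (rule Bochner_Integration.integrable_bound[OF integrable_cylm_one[of T K]])
  show "AE z in cylm T. norm (f z) \<le> norm K"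
    by (rule AE_I2) (use assms(2) in \<open>auto intro: order_trans[OF _ abs_ge_self]\<close>)
qed (use assms(1) in simp)

text \<open>The upper bound \<open>max a b\<close> keeps the clipping interval nonempty without
  having to derive a \<le> b from a bound that holds almost everywhere.\<close>

lemma clip_rep:
  fixes f :: "real \<times> real \<Rightarrow> real"
  assumes m: "set_borel_measurable lebesgue (cyl T) f" and bd: "AE z in lebesgue. z \<in> cyl T \<longrightarrow> a \<le> f z \<and> f z \<le> b"
  shows "\<exists>g. g \<in> borel_measurable (borel \<Otimes>\<^sub>M borel) \<and> (\<forall>t x. g (t, x + 1) = g (t, x)) \<and>
    (\<forall>t x. a \<le> g (t, x) \<and> g (t, x) \<le> max a b) \<and> (AE z in cylm T. f z = g z)"
proof -
  obtain g where g [measurable]: "g \<in> borel_measurable (borel \<Otimes>\<^sub>M borel)" and p: "\<And>t x. g (t, x + 1) = g (t, x)"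
    and ae: "AE z in cylm T. f z = g z" using cyl_rep[OF m] by blast
  define h where "h z = max a (min (max a b) (g z))" for z
  have "AE z in cylm T. f z = h z" using ae bd[unfolded AE_cyl_iff] by eventually_elim (auto simp: h_def)
  moreover have "h \<in> borel_measurable (borel \<Otimes>\<^sub>M borel)" unfolding h_def[abs_def] by measurable
  ultimately show ?thesis using p by (intro exI[of _ h]) (auto simp: h_def)
qed

lemma velocity_rep:
  assumes T: "0 < T" and W: "L1_W11 T u ux" and C8: "0 \<le> C8"
    "AE t in lebesgue. t \<in> {0<..<T} \<longrightarrow> (\<integral>\<^sup>+x \<in> torus. ennreal ((ux (t, x))\<^sup>2) \<partial>lebesgue) \<le> ennreal C8"
    and C9: "(\<integral>\<^sup>+t \<in> {0<..<T}. (Linf_norm_slice ux t)\<^sup>2 \<partial>lebesgue) \<le> ennreal C9"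
  shows "\<exists>v vx L. spatial_primitive v vx \<and> (AE z in cylm T. u z = v z) \<and> (AE z in cylm T. ux z = vx z) \<and>
    integrable (cylm T) v \<and> L \<in> borel_measurable borel \<and> integrable (lb 0 T) (\<lambda>t. (L t)\<^sup>2) \<and>
    (\<forall>t x. \<bar>vx (t, x)\<bar> \<le> L t) \<and> (AE t in lb 0 T. (\<integral>x. \<bar>vx (t, x)\<bar> \<partial>lb 0 1) \<le> 1 + C8)"
proof -
  have ui: "set_integrable lebesgue (cyl T) u" and uxi: "set_integrable lebesgue (cyl T) ux" and wd: "weak_dx T u ux"
    using W by (auto simp: L1_W11_def)
  obtain u1 where u1m [measurable]: "u1 \<in> borel_measurable (borel \<Otimes>\<^sub>M borel)" and u1: "AE z in cylm T. u z = u1 z"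
    using cyl_rep[OF set_integrable_measurable[OF ui]] by blast
  obtain g where [measurable]: "g \<in> borel_measurable (borel \<Otimes>\<^sub>M borel)" and g: "AE z in cylm T. ux z = g z"
    using cyl_rep[OF set_integrable_measurable[OF uxi]] by blast
  obtain L where L [measurable]: "L \<in> borel_measurable borel" and L0: "\<And>t. 0 \<le> L t" and L2: "integrable (lb 0 T) (\<lambda>t. (L t)\<^sup>2)"
    and gL: "AE z in cylm T. \<bar>g z\<bar> \<le> L (fst z)" using slice_sup_bound[OF _ g C9] by auto
  \<comment> \<open>The derivative is truncated before the primitive is built, so that its bound by
    \<open>L\<close> holds at every point and passes to \<open>vx\<close> through the alternative in
    \<open>vh\<close>.\<close>
  define h where "h z = (if \<bar>g z\<bar> \<le> L (fst z) then g z else 0)" for z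
  have hm [measurable]: "h \<in> borel_measurable (borel \<Otimes>\<^sub>M borel)" unfolding h_def[abs_def] by measurable
  have h: "AE z in cylm T. ux z = h z" using g gL by eventually_elim (simp add: h_def)
  have hb: "\<bar>h z\<bar> \<le> L (fst z)" for z using L0 by (simp add: h_def)
  obtain v vx where sp: "spatial_primitive v vx" and v: "AE z in cylm T. v z = u1 z" and vx: "AE z in cylm T. vx z = h z"
    and vh: "\<And>t x. vx (t, x) = 0 \<or> vx (t, x) = h (t, frac x)"
    using weak_dx_spatial_primitive[OF wd u1m hm cyl_transfer(1)[OF ui u1m u1] cyl_transfer(1)[OF uxi hm h] u1 h] by blast
  note [measurable] = spatial_primitiveD(1,2)[OF sp]
  have uv: "AE z in cylm T. u z = v z" using u1 v by eventually_elim simp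
  have uxv: "AE z in cylm T. ux z = vx z" using h vx by eventually_elim simp
  have "\<bar>vx (t, x)\<bar> \<le> L t" for t x using vh[of t x] hb[of "(t, frac x)"] L0[of t] by auto
  moreover have "AE t in lb 0 T. (\<integral>x. \<bar>vx (t, x)\<bar> \<partial>lb 0 1) \<le> 1 + C8"
    by (rule slice_abs_bound[OF spatial_primitiveD(2,5)[OF sp] uxv C8])
  moreover have "integrable (cylm T) v" by (rule cyl_transfer(1)[OF ui _ uv]) measurable
  ultimately show ?thesis using sp uv uxv L L2 by blast
qed

text \<open>Square integrability makes the derivative integrable, so the stress has a representative
  that is continuous in space. Its bound, first known for almost every point of a slice, holds on
  the whole slice by continuity; the exceptional times are set to 0.\<close>

lemma stress_rep:
  fixes s sx :: "real \<times> real \<Rightarrow> real"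
  assumes T: "0 < T" and wd: "weak_dx T s sx"
    and C5: "AE t in lebesgue. t \<in> {0<..<T} \<longrightarrow> (\<integral>\<^sup>+z \<in> {0<..<t} \<times> torus. ennreal ((sx z)\<^sup>2) \<partial>lebesgue) \<le> ennreal C5"
    and [measurable]: "s1 \<in> borel_measurable (borel \<Otimes>\<^sub>M borel)" and s1: "AE z in cylm T. s z = s1 z"
    and s1i: "integrable (cylm T) s1"
    and [measurable]: "B \<in> borel_measurable borel" and B0: "\<And>t. 0 \<le> B t" and B: "\<And>t x. \<bar>s1 (t, x)\<bar> \<le> B t"
  shows "\<exists>s2 sx2. spatial_primitive s2 sx2 \<and> (AE z in cylm T. s z = s2 z) \<and> integrable (cylm T) sx2 \<and> (\<forall>t x. \<bar>s2 (t, x)\<bar> \<le> B t)"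
proof -
  obtain g where gm [measurable]: "g \<in> borel_measurable (borel \<Otimes>\<^sub>M borel)" and g: "AE z in cylm T. sx z = g z"
    using cyl_rep[OF weak_dx_derivative_measurable[OF wd T]] by blast
  have "integrable (cylm T) (\<lambda>z. (g z)\<^sup>2)" by (rule nn_integral_box_le[OF T gm g C5])
  then have g2: "integrable (cylm T) (\<lambda>z. 1 + (g z)\<^sup>2)" using integrable_cylm_one[of T 1] by (intro Bochner_Integration.integrable_add)
  have ab: "\<bar>a\<bar> \<le> 1 + a\<^sup>2" for a :: real
    using zero_le_power2[of "\<bar>a\<bar> - 1"] by (simp add: power2_diff)
  have gi: "integrable (cylm T) g"
    by (rule Bochner_Integration.integrable_bound[OF g2]) (use ab in auto)
  obtain F G where sp: "spatial_primitive F G" and F: "AE z in cylm T. F z = s1 z" and G: "AE z in cylm T. G z = g z"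
    using weak_dx_spatial_primitive[OF wd assms(4) gm s1i gi s1 g] by blast
  note [measurable] = spatial_primitiveD(1,2)[OF sp]
  \<comment> \<open>Encoding the almost-everywhere bound as a vanishing integral makes the condition
    measurable in t.\<close>
  define P where "P t \<longleftrightarrow> (\<integral>\<^sup>+x. (if \<bar>F (t, x)\<bar> \<le> B t then 0 else 1 :: ennreal) \<partial>lb 0 1) = 0" for t
  have P_iff: "P t \<longleftrightarrow> (AE x in lb 0 1. \<bar>F (t, x)\<bar> \<le> B t)" for t
    unfolding P_def by (subst nn_integral_0_iff_AE) (auto intro!: AE_cong)
  have [measurable]: "Measurable.pred borel P" unfolding P_def[abs_def] by measurable
  have PT: "AE t in lb 0 T. P t" using lb2.AE_pair[OF F]
  proof eventually_elim
    case (elim t)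
    then show ?case unfolding P_iff by eventually_elim (simp add: B)
  qed
  define s2 where "s2 z = (if P (fst z) then F z else 0)" for z
  define sx2 where "sx2 z = (if P (fst z) then G z else 0)" for z
  have sp2: "spatial_primitive s2 sx2" unfolding s2_def[abs_def] sx2_def[abs_def]
    by (rule spatial_primitive_restrict[OF sp]) measurable
  note [measurable] = spatial_primitiveD(1,2)[OF sp2]
  have Pz: "AE z in cylm T. P (fst z)" by (rule AE_cylm_fst[OF _ PT]) measurable
  have "AE z in cylm T. s z = s2 z" using Pz F s1 by eventually_elim (simp add: s2_def)
  moreover have "AE z in cylm T. g z = sx2 z" using Pz G by eventually_elim (simp add: sx2_def)
  then have "integrable (cylm T) sx2" using integrable_cong_AE_imp[OF gi, of sx2] by simp
  moreover have "\<bar>s2 (t, x)\<bar> \<le> B t" for t x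
  proof (cases "P t")
    case True
    have "\<bar>F (t, frac x)\<bar> \<le> B t"
    proof (rule AE_lb_continuous_le[where a=0 and b=1 and f="\<lambda>x. \<bar>F (t, x)\<bar>"])
      show "AE x in lb 0 1. \<bar>F (t, x)\<bar> \<le> B t" using True unfolding P_iff .
      show "continuous_on {0..1} (\<lambda>x. \<bar>F (t, x)\<bar>)"
        by (intro continuous_intros continuous_on_subset[OF spatial_primitive_continuous[OF sp]]) auto
      show "frac x \<in> {0..1}" using frac_lt_1[of x] by simp
    qed simp
    moreover have "F (t, frac x) = F (t, x)"
      using periodic_frac[of "\<lambda>x. F (t, x)" x] spatial_primitiveD(3)[OF sp] by simp
    ultimately show ?thesis using True by (simp add: s2_def)
  qed (simp add: s2_def B0)
  ultimately show ?thesis using sp2 by blast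
qed

section \<open>From a Hoff solution to a regular representative, and uniqueness\<close>

theorem hoff_clean:
  assumes T: "0 < T" and hoff: "hoff_solution mup mum gp gm cvp cvm T c0 rho0 theta0 u0 c rho theta u"
    and m0 [measurable]: "d0 \<in> borel_measurable borel" "r0 \<in> borel_measurable borel" "h0 \<in> borel_measurable borel" "v0 \<in> borel_measurable borel"
    and ae0: "AE x in lb 0 1. c0 x = d0 x" "AE x in lb 0 1. rho0 x = r0 x" "AE x in lb 0 1. theta0 x = h0 x" "AE x in lb 0 1. u0 x = v0 x"
    and r0: "0 < r0l" "\<And>x. r0l \<le> r0 x" "\<And>x. r0 x \<le> r0h"
  shows "\<exists>v vx L U r rl rh d h s sx cM tl th S.
    clean T v vx L U r rl rh r0 r0l r0h d h s sx d0 h0 v0 mup mum gp gm cvp cvm cM tl th S \<and>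
    (AE z in cylm T. c z = d z \<and> rho z = r z \<and> theta z = h z \<and> u z = v z)"
proof -
  obtain ux where ws: "weak_solution_ux mup mum gp gm cvp cvm T c0 rho0 theta0 u0 c rho theta u ux"
    and ex: "let sigma = (\<lambda>z. mix mup mum (c z) * ux z - (mix gp gm (c z) - 1) * rho z * theta z)
        in \<exists>rl rh tl th C5 C6 C8 C9 C11 :: real. \<exists>sx sd.
          0 < rl \<and> 0 < rh \<and> 0 < tl \<and> 0 < th \<and> 0 < C5 \<and> 0 < C6 \<and> 0 < C8 \<and> 0 < C9 \<and> 0 < C11 \<and>
          (AE z in lebesgue. z \<in> cyl T \<longrightarrow> rl \<le> rho z \<and> rho z \<le> rh) \<and>
          (AE z in lebesgue. z \<in> cyl T \<longrightarrow> tl \<le> theta z \<and> theta z \<le> th) \<and>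
          weak_dx T sigma sx \<and>
          weak_dt T sigma (\<lambda>z. sd z - u z * sx z) \<and>
          (AE t in lebesgue. t \<in> {0<..<T} \<longrightarrow>
             (\<integral>\<^sup>+x \<in> torus. ennreal ((sigma (t, x))\<^sup>2) \<partial>lebesgue)
             + (\<integral>\<^sup>+z \<in> {0<..<t} \<times> torus. ennreal ((sx z)\<^sup>2) \<partial>lebesgue) \<le> ennreal C5) \<and>
          (AE t in lebesgue. t \<in> {0<..<T} \<longrightarrow>
             (\<integral>\<^sup>+x \<in> torus. ennreal ((ux (t, x))\<^sup>2) \<partial>lebesgue) \<le> ennreal C8) \<and>
          (\<integral>\<^sup>+t \<in> {0<..<T}. (Linf_norm_slice sigma t)\<^sup>2 \<partial>lebesgue) \<le> ennreal C6 \<and>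
          (\<integral>\<^sup>+t \<in> {0<..<T}. (Linf_norm_slice ux t)\<^sup>2 \<partial>lebesgue) \<le> ennreal C9 \<and>
          (AE t in lebesgue. t \<in> {0<..<T} \<longrightarrow>
             ennreal (min 1 t) * (\<integral>\<^sup>+x \<in> torus. ennreal ((sx (t, x))\<^sup>2) \<partial>lebesgue)
             + (\<integral>\<^sup>+z \<in> {0<..<t} \<times> torus. ennreal (min 1 (fst z) * (sd z)\<^sup>2) \<partial>lebesgue)
             \<le> ennreal C11)"
    using hoff unfolding hoff_solution_def by (elim exE conjE)
  define sg where "sg z = mix mup mum (c z) * ux z - (mix gp gm (c z) - 1) * rho z * theta z" for z
  obtain rl rh tl th C5 C8 C9 sx where pos: "0 < rl" "0 < tl" "0 < C8"
    and rho_ae: "AE z in lebesgue. z \<in> cyl T \<longrightarrow> rl \<le> rho z \<and> rho z \<le> rh"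
    and theta_ae: "AE z in lebesgue. z \<in> cyl T \<longrightarrow> tl \<le> theta z \<and> theta z \<le> th"
    and sg_dx: "weak_dx T sg sx"
    and C5: "AE t in lebesgue. t \<in> {0<..<T} \<longrightarrow> (\<integral>\<^sup>+x \<in> torus. ennreal ((sg (t, x))\<^sup>2) \<partial>lebesgue)
             + (\<integral>\<^sup>+z \<in> {0<..<t} \<times> torus. ennreal ((sx z)\<^sup>2) \<partial>lebesgue) \<le> ennreal C5"
    and C8: "AE t in lebesgue. t \<in> {0<..<T} \<longrightarrow> (\<integral>\<^sup>+x \<in> torus. ennreal ((ux (t, x))\<^sup>2) \<partial>lebesgue) \<le> ennreal C8"
    and C9: "(\<integral>\<^sup>+t \<in> {0<..<T}. (Linf_norm_slice ux t)\<^sup>2 \<partial>lebesgue) \<le> ennreal C9"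
    using ex unfolding Let_def sg_def[abs_def, symmetric] by (elim exE conjE)
  have C5': "AE t in lebesgue. t \<in> {0<..<T} \<longrightarrow> (\<integral>\<^sup>+z \<in> {0<..<t} \<times> torus. ennreal ((sx z)\<^sup>2) \<partial>lebesgue) \<le> ennreal C5"
    using C5 by eventually_elim (auto intro: order_trans[rotated])
  note W = ws[unfolded weak_solution_ux_def Let_def, folded sg_def]
  obtain cM where cM: "AE z in lebesgue. z \<in> cyl T \<longrightarrow> - cM \<le> c z \<and> c z \<le> cM"
  proof -
    from W obtain M where M: "AE z in lebesgue. z \<in> cyl T \<longrightarrow> \<bar>c z\<bar> \<le> M" unfolding Linf_Linf_def by blast
    then have "AE z in lebesgue. z \<in> cyl T \<longrightarrow> - M \<le> c z \<and> c z \<le> M" by eventually_elim auto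
    then show ?thesis by (rule that)
  qed
  have cm: "set_borel_measurable lebesgue (cyl T) c" "set_borel_measurable lebesgue (cyl T) rho" "set_borel_measurable lebesgue (cyl T) theta"
    using W unfolding Linf_Linf_def Linf_L1_def by blast+
  obtain d where d_m [measurable]: "d \<in> borel_measurable (borel \<Otimes>\<^sub>M borel)" and d_per: "\<And>t x. d (t, x + 1) = d (t, x)"
    and d_bd: "\<And>t x. - cM \<le> d (t, x) \<and> d (t, x) \<le> max (- cM) cM" and d: "AE z in cylm T. c z = d z"
    using clip_rep[OF cm(1) cM] by blast
  obtain r where r_m [measurable]: "r \<in> borel_measurable (borel \<Otimes>\<^sub>M borel)" and r_per: "\<And>t x. r (t, x + 1) = r (t, x)"
    and r_bd: "\<And>t x. rl \<le> r (t, x) \<and> r (t, x) \<le> max rl rh" and r: "AE z in cylm T. rho z = r z"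
    using clip_rep[OF cm(2) rho_ae] by blast
  obtain h where h_m [measurable]: "h \<in> borel_measurable (borel \<Otimes>\<^sub>M borel)" and h_per: "\<And>t x. h (t, x + 1) = h (t, x)"
    and h_bd: "\<And>t x. tl \<le> h (t, x) \<and> h (t, x) \<le> max tl th" and h: "AE z in cylm T. theta z = h z"
    using clip_rep[OF cm(3) theta_ae] by blast
  define D where "D = max (- cM) cM"
  define R where "R = max rl rh"
  define H where "H = max tl th"
  have d_abs: "\<bar>d (t, x)\<bar> \<le> D" for t x using d_bd[of t x] by (auto simp: D_def)
  have r_abs: "\<bar>r (t, x)\<bar> \<le> R" for t x using r_bd[of t x] pos by (auto simp: R_def)
  have h_abs: "\<bar>h (t, x)\<bar> \<le> H" for t x using h_bd[of t x] pos by (auto simp: H_def)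
  have D0: "0 \<le> D" "0 \<le> R" "0 \<le> H" using d_abs r_abs h_abs by (meson abs_ge_zero order_trans)+
  have mixm [measurable]: "mix p q \<in> borel_measurable borel" for p q
    unfolding mix_def[abs_def] by measurable
  have mix_d: "\<bar>mix p q (d (t, x))\<bar> \<le> D * \<bar>p\<bar> + (1 + D) * \<bar>q\<bar>" for p q t x by (rule mix_abs_bound[OF d_abs])

  obtain w wx L where sp: "spatial_primitive w wx" and uw: "AE z in cylm T. u z = w z" and uxw: "AE z in cylm T. ux z = wx z"
    and wi: "integrable (cylm T) w" and Lm [measurable]: "L \<in> borel_measurable borel" and L2: "integrable (lb 0 T) (\<lambda>t. (L t)\<^sup>2)"
    and wxL: "\<And>t x. \<bar>wx (t, x)\<bar> \<le> L t" and wxK: "AE t in lb 0 T. (\<integral>x. \<bar>wx (t, x)\<bar> \<partial>lb 0 1) \<le> 1 + C8"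
    using velocity_rep[OF T _ less_imp_le[OF pos(3)] C8 C9, of u] W by blast
  note [measurable] = spatial_primitiveD(1,2)[OF sp]
  have L0: "0 \<le> L t" for t using wxL[of t 0] by linarith
  define A0 where "A0 = (\<integral>x. r0 x * v0 x \<partial>lb 0 1)"
  \<comment> \<open>At this point \<open>u\<close> is only integrable and the flux, which contains
    its square, has no integrable representative at hand; the constant test function never meets
    it.\<close>
  have mom: "AE t in lb 0 T. (\<integral>x. r (t, x) * w (t, x) \<partial>lb 0 1) = A0"
  proof -
    have d1c: "d1 (\<lambda>x. 1) = (\<lambda>x. 0)" by (auto intro!: d1_eq)
    have "AE t in lb 0 T. (\<integral>x. r (t, x) * w (t, x) * 1 \<partial>lb 0 1) = (\<integral>x. r0 x * v0 x * 1 \<partial>lb 0 1) + (\<integral>s. (\<integral>x. 0 * d1 (\<lambda>x. 1) x \<partial>lb 0 1) \<partial>lb 0 t)"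
    proof (rule weak_cons_ode[where q="\<lambda>z. rho z * u z" and F="\<lambda>z. rho z * (u z)\<^sup>2 - sg z" and ?q0.0="\<lambda>x. rho0 x * u0 x" and F'="\<lambda>z. 0" and q'="\<lambda>z. r z * w z" and q0'="\<lambda>x. r0 x * v0 x"])
      show "weak_cons T (\<lambda>z. rho z * u z) (\<lambda>z. rho z * (u z)\<^sup>2 - sg z) (\<lambda>x. rho0 x * u0 x)" using W by blast
      have "integrable (cylm T) (\<lambda>z. w z * r z)" by (rule integrable_mult_bounded'[OF wi, where K=R]) (use r_abs in auto)
      then show "integrable (cylm T) (\<lambda>z. r z * w z)" by (simp add: mult.commute)
      show "AE z in cylm T. rho z * u z = r z * w z" using r uw by eventually_elim simp
      show "AE x in lb 0 1. rho0 x * u0 x = r0 x * v0 x" using ae0(2,4) by eventually_elim simp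
    qed (auto simp: d1c T test_torus_const)
    then show ?thesis by (simp add: A0_def)
  qed
  \<comment> \<open>The times at which the momentum has its initial value and the spatial derivative
    of the velocity a controlled integral. Discarding the others makes \<open>U\<close> a bound at
    every point.\<close>
  define P where "P t \<longleftrightarrow> (\<integral>x. r (t, x) * w (t, x) \<partial>lb 0 1) = A0 \<and> (\<integral>x. \<bar>wx (t, x)\<bar> \<partial>lb 0 1) \<le> 1 + C8" for t
  have Pm [measurable]: "Measurable.pred borel P" unfolding P_def[abs_def] by measurable
  have PT: "AE t in lb 0 T. P t" using mom wxK by eventually_elim (simp add: P_def)
  have Pz: "AE z in cylm T. P (fst z)" by (rule AE_cylm_fst[OF Pm PT])
  define v where "v z = (if P (fst z) then w z else 0)" for z
  define vx where "vx z = (if P (fst z) then wx z else 0)" for z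
  have spv: "spatial_primitive v vx" unfolding v_def[abs_def] vx_def[abs_def]
    by (rule spatial_primitive_restrict[OF sp Pm])
  note [measurable] = spatial_primitiveD(1,2)[OF spv]
  have uv: "AE z in cylm T. u z = v z" using uw Pz by eventually_elim (simp add: v_def)
  have uxv: "AE z in cylm T. ux z = vx z" using uxw Pz by eventually_elim (simp add: vx_def)
  have vxL: "\<bar>vx (t, x)\<bar> \<le> L t" for t x using wxL[of t x] L0[of t] by (simp add: vx_def)
  define U where "U = (\<bar>A0\<bar> + 2 * (1 + C8) * R) / rl"
  have U0: "0 \<le> U" using pos D0 by (auto simp: U_def intro!: divide_nonneg_pos add_nonneg_nonneg)
  have vU: "\<bar>v (t, x)\<bar> \<le> U" for t x
  proof (cases "P t")
    case True
    then have "\<bar>w (t, x)\<bar> \<le> U" unfolding U_def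
      by (intro spatial_primitive_mean_bound[OF sp r_m _ _ pos(1)]) (use r_bd in \<open>auto simp: P_def R_def\<close>)
    then show ?thesis using True by (simp add: v_def)
  qed (simp add: v_def U0)
  \<comment> \<open>The constitutive formula on bounded representatives. It obeys its bound
    everywhere but need not be continuous; \<open>stress_rep\<close> exchanges it for a continuous
    version with the same bound.\<close>
  define s1 where "s1 z = mix mup mum (d z) * vx z - (mix gp gm (d z) - 1) * r z * h z" for z
  have s1m: "s1 \<in> borel_measurable (borel \<Otimes>\<^sub>M borel)" unfolding s1_def[abs_def] by measurable
  define Mm where "Mm = D * \<bar>mup\<bar> + (1 + D) * \<bar>mum\<bar>"
  define Mg where "Mg = D * \<bar>gp\<bar> + (1 + D) * \<bar>gm\<bar> + 1"
  define S where "S = Mm + Mg * R * H"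
  have M0: "0 \<le> Mm" "0 \<le> Mg" "0 \<le> S" using D0 by (auto simp: Mm_def Mg_def S_def)
  have s1S: "\<bar>s1 (t, x)\<bar> \<le> S * (1 + L t)" for t x
  proof -
    have g: "\<bar>mix gp gm (d (t, x)) - 1\<bar> \<le> Mg" using mix_d[of gp gm t x] unfolding Mg_def by linarith
    have 1: "\<bar>mix mup mum (d (t, x)) * vx (t, x)\<bar> \<le> Mm * L t"
      unfolding abs_mult Mm_def using mix_d vxL M0(1)[unfolded Mm_def] by (intro mult_mono) auto
    have 2: "\<bar>(mix gp gm (d (t, x)) - 1) * r (t, x) * h (t, x)\<bar> \<le> Mg * R * H"
      unfolding abs_mult using g r_abs h_abs M0 D0 by (intro mult_mono) auto
    have "0 \<le> Mm" "0 \<le> Mg * R * H * L t" using M0 D0 L0[of t] by auto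
    with 1 2 show ?thesis unfolding s1_def S_def distrib_left distrib_right mult_1_right by linarith
  qed
  have Lc: "integrable (cylm T) (\<lambda>z. S * (1 + L (fst z)))"
  proof -
    have ab: "L t \<le> 1 + (L t)\<^sup>2" for t
      using zero_le_power2[of "L t - 1"] L0[of t] by (simp add: power2_diff)
    have "integrable (lb 0 T) (\<lambda>t. 1 + (L t)\<^sup>2)" using L2 by simp
    then have "integrable (lb 0 T) L"
      by (rule Bochner_Integration.integrable_bound) (use ab L0 in auto)
    then have "integrable (lb 0 T) (\<lambda>t. S * (1 + L t))" by simp
    from integrable_pair_mult[OF this, of 0 1 "\<lambda>_. 1"] show ?thesis by (simp add: case_prod_unfold)
  qed
  have bounded_int: "integrable (cylm T) f" if "f \<in> borel_measurable (borel \<Otimes>\<^sub>M borel)" "\<And>t x. \<bar>f (t, x)\<bar> \<le> S * (1 + L t)" for f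
    by (rule Bochner_Integration.integrable_bound[OF Lc]) (use that in \<open>auto intro!: AE_I2 intro: order_trans[OF _ abs_ge_self]\<close>)
  have s1ae: "AE z in cylm T. sg z = s1 z" using d r h uxv by eventually_elim (simp add: sg_def s1_def)
  obtain s sy where sps: "spatial_primitive s sy" and ss: "AE z in cylm T. sg z = s z" and syi: "integrable (cylm T) sy"
    and sS: "\<And>t x. \<bar>s (t, x)\<bar> \<le> S * (1 + L t)"
  proof -
    have "(\<lambda>t. S * (1 + L t)) \<in> borel_measurable borel" by measurable
    moreover have "0 \<le> S * (1 + L t)" for t using M0 L0[of t] by simp
    ultimately show ?thesis
      using stress_rep[OF T sg_dx C5' s1m s1ae bounded_int[OF s1m s1S] _ _ s1S] that by blast
  qed
  note [measurable] = spatial_primitiveD(1,2)[OF sps]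
  have si: "integrable (cylm T) s" by (rule bounded_int[OF _ sS]) measurable
  define E where "E z = (v z)\<^sup>2 / 2 + mix cvp cvm (d z) * h z" for z
  have Em [measurable]: "E \<in> borel_measurable (borel \<Otimes>\<^sub>M borel)" unfolding E_def[abs_def] by measurable
  define EM where "EM = U\<^sup>2 + (D * \<bar>cvp\<bar> + (1 + D) * \<bar>cvm\<bar>) * H"
  have E_abs: "\<bar>E (t, x)\<bar> \<le> EM" for t x
  proof -
    have "\<bar>mix cvp cvm (d (t, x)) * h (t, x)\<bar> \<le> (D * \<bar>cvp\<bar> + (1 + D) * \<bar>cvm\<bar>) * H"
      unfolding abs_mult using mix_d h_abs D0 by (intro mult_mono) auto
    moreover have "(v (t, x))\<^sup>2 \<le> U\<^sup>2" using vU[of t x] by (rule abs_le_square_iff[THEN iffD1, OF order_trans[OF _ abs_ge_self]])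
    moreover have "0 \<le> (v (t, x))\<^sup>2" by simp
    ultimately show ?thesis unfolding E_def EM_def by linarith
  qed
  have bi: "integrable (cylm T) f" if "f \<in> borel_measurable (borel \<Otimes>\<^sub>M borel)" "\<And>z. \<bar>f z\<bar> \<le> K" for f :: "real \<times> real \<Rightarrow> real" and K
    by (rule integrable_cylm_bounded[of _ K]) (use that in auto)
  have b2: "\<bar>f z * g z\<bar> \<le> K * K'" if "\<And>z. \<bar>f z\<bar> \<le> K" "\<And>z. \<bar>g z\<bar> \<le> K'"
    for f g :: "real \<times> real \<Rightarrow> real" and K K' z
    unfolding abs_mult using that(1)[of z] that(2)[of z] by (intro mult_mono) auto
  have r_z: "\<bar>r z\<bar> \<le> R" and v_z: "\<bar>v z\<bar> \<le> U" and d_z: "\<bar>d z\<bar> \<le> D" and E_z: "\<bar>E z\<bar> \<le> EM" for z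
    using r_abs[of "fst z" "snd z"] vU[of "fst z" "snd z"] d_abs[of "fst z" "snd z"] E_abs[of "fst z" "snd z"] by simp_all
  have rv_int: "integrable (cylm T) (\<lambda>z. r z * v z)" by (rule bi[OF _ b2[OF r_z v_z]]) measurable
  have rd_int: "integrable (cylm T) (\<lambda>z. r z * d z)" by (rule bi[OF _ b2[OF r_z d_z]]) measurable
  have rdv_int: "integrable (cylm T) (\<lambda>z. r z * d z * v z)" by (rule bi[OF _ b2[OF b2[OF r_z d_z] v_z]]) measurable
  have rvv_int: "integrable (cylm T) (\<lambda>z. r z * (v z)\<^sup>2)"
    unfolding power2_eq_square by (rule bi[OF _ b2[OF r_z b2[OF v_z v_z]]]) measurable
  have rE_int: "integrable (cylm T) (\<lambda>z. r z * E z)" by (rule bi[OF _ b2[OF r_z E_z]]) measurable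
  have rEv_int: "integrable (cylm T) (\<lambda>z. r z * E z * v z)" by (rule bi[OF _ b2[OF b2[OF r_z E_z] v_z]]) measurable
  have sv_int: "integrable (cylm T) (\<lambda>z. s z * v z)"
    by (rule integrable_mult_bounded'[OF si, where K=U]) (use v_z in auto)
  have r_int: "integrable (cylm T) r" by (rule bi[OF r_m r_z])
  let ?Ein = "\<lambda>x. (u0 x)\<^sup>2 / 2 + mix cvp cvm (c0 x) * theta0 x" and ?Fin = "\<lambda>x. (v0 x)\<^sup>2 / 2 + mix cvp cvm (d0 x) * h0 x"
  let ?E = "\<lambda>z. (u z)\<^sup>2 / 2 + mix cvp cvm (c z) * theta z"
  have W1: "weak_cons T rho (\<lambda>z. rho z * u z) rho0"
    and W2: "weak_cons T (\<lambda>z. rho z * c z) (\<lambda>z. rho z * c z * u z) (\<lambda>x. rho0 x * c0 x)"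
    and W3: "weak_cons T (\<lambda>z. rho z * u z) (\<lambda>z. rho z * (u z)\<^sup>2 - sg z) (\<lambda>x. rho0 x * u0 x)"
    and W4: "weak_cons T (\<lambda>z. rho z * ?E z) (\<lambda>z. rho z * ?E z * u z - sg z * u z) (\<lambda>x. rho0 x * ?Ein x)"
    using W by blast+
  have all: "AE z in cylm T. rho z = r z \<and> c z = d z \<and> theta z = h z \<and> u z = v z \<and> sg z = s z"
    using d r h uv ss by eventually_elim simp
  have all0: "AE x in lb 0 1. rho0 x = r0 x \<and> c0 x = d0 x \<and> theta0 x = h0 x \<and> u0 x = v0 x"
    using ae0 by eventually_elim simp
  have ae2: "AE z in cylm T. rho z * c z = r z * d z" "AE z in cylm T. rho z * c z * u z = r z * d z * v z"
    "AE z in cylm T. rho z * u z = r z * v z" "AE z in cylm T. rho z * (u z)\<^sup>2 - sg z = r z * (v z)\<^sup>2 - s z"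
    "AE z in cylm T. rho z * ?E z = r z * E z" "AE z in cylm T. rho z * ?E z * u z - sg z * u z = r z * E z * v z - s z * v z"
    using all by (eventually_elim, simp add: E_def)+
  have ae3: "AE x in lb 0 1. rho0 x * c0 x = r0 x * d0 x" "AE x in lb 0 1. rho0 x * u0 x = r0 x * v0 x" "AE x in lb 0 1. rho0 x * ?Ein x = r0 x * ?Fin x"
    using all0 by (eventually_elim, simp)+
  have "clean T v vx L U r rl R r0 r0l r0h d h s sy d0 h0 v0 mup mum gp gm cvp cvm D tl H S"
  proof unfold_locales
    show "AE z in cylm T. s z = mix mup mum (d z) * vx z - (mix gp gm (d z) - 1) * r z * h z"
      using ss s1ae by eventually_elim (simp add: s1_def)
    show "integrable (lb 0 1) (\<lambda>x. r0 x * v0 x)" by (rule weak_cons_init_integrable[OF W3 T _ ae3(2)]) measurable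
    show "integrable (lb 0 1) (\<lambda>x. r0 x * d0 x)" by (rule weak_cons_init_integrable[OF W2 T _ ae3(1)]) measurable
    show "integrable (lb 0 1) (\<lambda>x. r0 x * ?Fin x)" by (rule weak_cons_init_integrable[OF W4 T _ ae3(3)]) measurable
    show "weakW T r (\<lambda>z. r z * v z) r0"
      by (rule weak_cons_weakW[OF W1 T _ _ _ r_int rv_int r ae2(3) ae0(2)]) measurable
    show "weakW T (\<lambda>z. r z * d z) (\<lambda>z. r z * d z * v z) (\<lambda>x. r0 x * d0 x)"
      by (rule weak_cons_weakW[OF W2 T _ _ _ rd_int rdv_int ae2(1,2) ae3(1)]) measurable
    show "weakW T (\<lambda>z. r z * v z) (\<lambda>z. r z * (v z)\<^sup>2 - s z) (\<lambda>x. r0 x * v0 x)"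
      by (rule weak_cons_weakW[OF W3 T _ _ _ rv_int Bochner_Integration.integrable_diff[OF rvv_int si] ae2(3,4) ae3(2)]) measurable
    show "weakW T (\<lambda>z. r z * ((v z)\<^sup>2 / 2 + mix cvp cvm (d z) * h z))
        (\<lambda>z. r z * ((v z)\<^sup>2 / 2 + mix cvp cvm (d z) * h z) * v z - s z * v z) (\<lambda>x. r0 x * ?Fin x)"
      unfolding E_def[symmetric]
      by (rule weak_cons_weakW[OF W4 T _ _ _ rE_int Bochner_Integration.integrable_diff[OF rEv_int sv_int] ae2(5,6) ae3(3)]) measurable
    show "v (t, y) - v (t, x) = (\<integral>x. vx (t, x) \<partial>lb x y)" if "x \<le> y" for t x y by (rule spatial_primitiveD(6)[OF spv that])
    show "s (t, y) - s (t, x) = (\<integral>x. sy (t, x) \<partial>lb x y)" if "x \<le> y" for t x y by (rule spatial_primitiveD(6)[OF sps that])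
    show "r (t, x) \<le> R" "rl \<le> r (t, x)" for t x using r_bd[of t x] by (auto simp: R_def)
    show "h (t, x) \<le> H" "tl \<le> h (t, x)" for t x using h_bd[of t x] by (auto simp: H_def)
  qed (use T vU vxL L2 sS syi pos r0 d_abs in \<open>auto simp: d_per r_per h_per intro: spatial_primitiveD(1-5)[OF spv] spatial_primitiveD(1-5)[OF sps]\<close>)
  moreover have "AE z in cylm T. c z = d z \<and> rho z = r z \<and> theta z = h z \<and> u z = v z" using all by eventually_elim simp
  ultimately show ?thesis by blast
qed

theorem mainTheorem3:
  fixes mup mum gp gm cvp cvm T :: real
    and c0 rho0 theta0 u0 :: "real \<Rightarrow> real"
    and c rho theta u c' rho' theta' u' :: "real \<times> real \<Rightarrow> real"
  assumes "0 < mup" "0 < mum" "1 < gp" "1 < gm" "0 < cvp" "0 < cvm"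
    and "c0 \<in> borel_measurable (lebesgue_on torus)"
    and "rho0 \<in> borel_measurable (lebesgue_on torus)"
    and "theta0 \<in> borel_measurable (lebesgue_on torus)"
    and "H1_torus u0"
    and "\<exists>rl rh tl th :: real. 0 < rl \<and> 0 < rh \<and> 0 < tl \<and> 0 < th \<and>
           (AE x in lebesgue. x \<in> torus \<longrightarrow>
              rl \<le> rho0 x \<and> rho0 x \<le> rh \<and> tl \<le> theta0 x \<and> theta0 x \<le> th \<and>
              0 \<le> c0 x \<and> c0 x \<le> 1)"
    and "0 < T"
    and "hoff_solution mup mum gp gm cvp cvm T c0 rho0 theta0 u0 c rho theta u"
    and "hoff_solution mup mum gp gm cvp cvm T c0 rho0 theta0 u0 c' rho' theta' u'"
  shows "AE z in lebesgue. z \<in> cyl T \<longrightarrow>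
           c z = c' z \<and> rho z = rho' z \<and> theta z = theta' z \<and> u z = u' z"
proof -
  obtain r0l r0h :: real where r0l: "0 < r0l" and bd: "AE x in lb 0 1. r0l \<le> rho0 x \<and> rho0 x \<le> r0h \<and> 0 \<le> c0 x \<and> c0 x \<le> 1"
    using assms(11) unfolding AE_torus_iff by (elim exE conjE) (auto elim!: AE_mp)
  obtain d where [measurable]: "d \<in> borel_measurable borel" and d: "AE x in lb 0 1. c0 x = d x" using data_rep[OF assms(7)] by blast
  obtain r where [measurable]: "r \<in> borel_measurable borel" and r: "AE x in lb 0 1. rho0 x = r x" using data_rep[OF assms(8)] by blast
  obtain h0 where hm: "h0 \<in> borel_measurable borel" and h0: "AE x in lb 0 1. theta0 x = h0 x" using data_rep[OF assms(9)] by blast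
  have "u0 \<in> borel_measurable (lebesgue_on torus)" using assms(10) by (simp add: H1_torus_def)
  then obtain v0 where vm: "v0 \<in> borel_measurable borel" and v0: "AE x in lb 0 1. u0 x = v0 x" using data_rep by blast
  \<comment> \<open>The initial representatives are fixed and clipped before either solution is
    regularised: the comparison requires both solutions to have literally the same data, with bounds
    at every point.\<close>
  define d0 where "d0 x = max 0 (min 1 (d x))" for x
  define r0 where "r0 x = max r0l (min (max r0l r0h) (r x))" for x
  have dm: "d0 \<in> borel_measurable borel" and rm: "r0 \<in> borel_measurable borel"
    unfolding d0_def[abs_def] r0_def[abs_def] by measurable
  have d0: "AE x in lb 0 1. c0 x = d0 x" using d bd by eventually_elim (auto simp: d0_def)
  have r0: "AE x in lb 0 1. rho0 x = r0 x" using r bd by eventually_elim (auto simp: r0_def)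
  have r0b: "r0l \<le> r0 x" "r0 x \<le> max r0l r0h" for x by (auto simp: r0_def)
  obtain v vx L U q rl rh b h s sx cM tl th S
    where C: "clean T v vx L U q rl rh r0 r0l (max r0l r0h) b h s sx d0 h0 v0 mup mum gp gm cvp cvm cM tl th S"
      and e: "AE z in cylm T. c z = b z \<and> rho z = q z \<and> theta z = h z \<and> u z = v z"
    using hoff_clean[OF assms(12,13) dm rm hm vm d0 r0 h0 v0 r0l r0b] by blast
  obtain v' vx' L' U' q' rl' rh' b' h' s' sx' cM' tl' th' S'
    where C': "clean T v' vx' L' U' q' rl' rh' r0 r0l (max r0l r0h) b' h' s' sx' d0 h0 v0 mup mum gp gm cvp cvm cM' tl' th' S'"
      and e': "AE z in cylm T. c' z = b' z \<and> rho' z = q' z \<and> theta' z = h' z \<and> u' z = v' z"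
    using hoff_clean[OF assms(12,14) dm rm hm vm d0 r0 h0 v0 r0l r0b] by blast
  have "AE z in cylm T. b z = b' z \<and> q z = q' z \<and> h z = h' z \<and> v z = v' z"
    by (rule clean_unique[OF C C' assms(1-6)]) (auto simp: d0_def)
  with e e' show ?thesis unfolding AE_cyl_iff by eventually_elim simp
qed

end
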